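(* Let $S=k[x,y,z]$ with the standard grading, where $k$ is an infinite field, let $\mathfrak m=(x,y,z)$, and consider the ideal $$I = (x^2y+y^3-yz^2-z^3,\ xy^2-xz^2,\ x^3z-xyz^2,\ y^2z^2-z^4,\ x^6,\ z^6,\ xz^5).$$ Then $I$ is an $\mathfrak m$-primary ideal with minimal homogeneous free resolution of the form $$0\to S(-8)\oplus S(-9)^2\to S(-5)^3\oplus S(-7)^5\oplus S(-8)\to S(-3)^2\oplus S(-4)^2\oplus S(-6)^3\to I\to 0,$$ the Hilbert function of $S/I$ is $(1,3,6,8,7,6,2)$, and $I$ is homogeneously licci, but not minimally homogeneously licci.
   Context: The Hilbert function of a finite length standard graded algebra $A$ is written as the finite sequence $(\dim_k A_0,\dim_k A_1,\dots)$ with the trailing zeros omitted. Two proper ideals $I,J$ of height $c$ in a commutative Noetherian ring are directly linked if there is a regular sequence $f_1,\dots,f_c$ such that $(f_1,\dots,f_c):I=J$ and $(f_1,\dots,f_c):J=I$. A complete intersection is an ideal generated by a regular sequence. A homogeneous ideal in a standard graded polynomial ring is homogeneously licci if it can be linked to a complete intersection in finitely many direct links using only homogeneous regular sequences at each step. A homogeneous ideal $I$ of height $c$ is directly minimally homogeneously linked to $J$ if $J=L:I$ and $I=L:J$, where $L$ is generated by a homogeneous regular sequence of length $c$ in $I$ of smallest possible degrees (that is, its degrees $d_1\le\dots\le d_c$ satisfy $d_i\le e_i$ for all $i$ whenever $e_1\le\dots\le e_c$ are the degrees of a homogeneous regular sequence of length $c$ in $I$). This relation is not necessarily symmetric. The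 ideal $I$ is minimally homogeneously licci if it is homogeneously licci and there is a finite sequence $I=I_0,I_1,\dots,I_n$ with $I_n$ a complete intersection and each $I_j$ directly minimally homogeneously linked to $I_{j+1}$. *)

theory Defs
  imports
    "HOL-Library.Poly_Mapping"
    "HOL-Library.Numeral_Type"
    "HOL-Library.Extended_Nat"
    "Jordan_Normal_Form.Matrix_Kernel"
begin

section \<open>Ideals of a commutative ring\<close>

definition is_ideal :: "'a::comm_ring_1 set \<Rightarrow> bool" where
  "is_ideal I \<longleftrightarrow> Modules.module.subspace (*) I"

definition ideal_gen :: "'a::comm_ring_1 set \<Rightarrow> 'a set" where
  "ideal_gen B = Modules.module.span (*) B"

definition prime_ideal :: "'a::comm_ring_1 set \<Rightarrow> bool" where
  "prime_ideal P \<longleftrightarrow>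
     is_ideal P \<and> P \<noteq> UNIV \<and> (\<forall>a b. a * b \<in> P \<longrightarrow> a \<in> P \<or> b \<in> P)"

definition primary_ideal :: "'a::comm_ring_1 set \<Rightarrow> bool" where
  "primary_ideal Q \<longleftrightarrow>
     is_ideal Q \<and> Q \<noteq> UNIV \<and> (\<forall>a b. a * b \<in> Q \<longrightarrow> a \<in> Q \<or> (\<exists>n. b ^ n \<in> Q))"

definition radical :: "'a::comm_ring_1 set \<Rightarrow> 'a set" where
  "radical I = {a. \<exists>n. a ^ n \<in> I}"

definition primary_to :: "'a::comm_ring_1 set \<Rightarrow> 'a set \<Rightarrow> bool" where
  "primary_to P Q \<longleftrightarrow> primary_ideal Q \<and> radical Q = P"

definition ideal_colon :: "'a::comm_ring_1 set \<Rightarrow> 'a set \<Rightarrow> 'a set" where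
  "ideal_colon L I = {f. \<forall>g\<in>I. f * g \<in> L}"

definition prime_height :: "'a::comm_ring_1 set \<Rightarrow> enat" where
  "prime_height P = Sup {enat n |n. \<exists>Q :: nat \<Rightarrow> 'a set.
     (\<forall>i\<le>n. prime_ideal (Q i)) \<and> (\<forall>i<n. Q i \<subset> Q (Suc i)) \<and> Q n = P}"

text \<open>The unit ideal has height \<open>\<infinity>\<close>, so an ideal of finite height is proper.\<close>

definition ideal_height :: "'a::comm_ring_1 set \<Rightarrow> enat" where
  "ideal_height I = Inf {prime_height P |P. prime_ideal P \<and> I \<subseteq> P}"

definition regular_sequence :: "'a::comm_ring_1 list \<Rightarrow> bool" where
  "regular_sequence fs \<longleftrightarrow>
     (\<forall>i<length fs. \<forall>g. fs ! i * g \<in> ideal_gen (set (take i fs))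
                         \<longrightarrow> g \<in> ideal_gen (set (take i fs))) \<and>
     ideal_gen (set fs) \<noteq> UNIV"

definition complete_intersection :: "'a::comm_ring_1 set \<Rightarrow> bool" where
  "complete_intersection I \<longleftrightarrow> (\<exists>fs. regular_sequence fs \<and> I = ideal_gen (set fs))"

definition linked_by :: "'a::comm_ring_1 list \<Rightarrow> 'a set \<Rightarrow> 'a set \<Rightarrow> bool" where
  "linked_by fs I J \<longleftrightarrow>
     is_ideal I \<and> I \<noteq> UNIV \<and> ideal_height I = enat (length fs) \<and>
     is_ideal J \<and> J \<noteq> UNIV \<and> ideal_height J = enat (length fs) \<and>
     regular_sequence fs \<and>
     ideal_colon (ideal_gen (set fs)) I = J \<and>
     ideal_colon (ideal_gen (set fs)) J = I"

section \<open>Standard graded polynomial rings\<close>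

text \<open>Polynomials over \<open>'k\<close> in the variables \<open>'v\<close>: finitely supported maps from exponent
  vectors to coefficients, with convolution as multiplication.\<close>

type_synonym ('v, 'k) mpoly = "('v \<Rightarrow>\<^sub>0 nat) \<Rightarrow>\<^sub>0 'k"

definition Var :: "'v \<Rightarrow> ('v, 'k::comm_ring_1) mpoly" where
  "Var v = Poly_Mapping.single (Poly_Mapping.single v 1) 1"

definition Const :: "'k \<Rightarrow> ('v, 'k::comm_ring_1) mpoly" where
  "Const c = Poly_Mapping.single 0 c"

definition monom_degree :: "('v \<Rightarrow>\<^sub>0 nat) \<Rightarrow> nat" where
  "monom_degree m = (\<Sum>v\<in>Poly_Mapping.keys m. Poly_Mapping.lookup m v)"

text \<open>The zero polynomial is homogeneous of every degree: \<open>homogeneous d\<close> describes the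
  graded piece of degree \<open>d\<close>.\<close>

definition homogeneous :: "nat \<Rightarrow> ('v, 'k::comm_ring_1) mpoly \<Rightarrow> bool" where
  "homogeneous d p \<longleftrightarrow> (\<forall>m\<in>Poly_Mapping.keys p. monom_degree m = d)"

definition homogeneous_ideal :: "('v, 'k::comm_ring_1) mpoly set \<Rightarrow> bool" where
  "homogeneous_ideal I \<longleftrightarrow> (\<exists>G. (\<forall>g\<in>G. \<exists>d. homogeneous d g) \<and> I = ideal_gen G)"

definition irrelevant_ideal :: "('v, 'k::comm_ring_1) mpoly set" where
  "irrelevant_ideal = ideal_gen (range Var)"

text \<open>\<open>quotient_graded_dim I d n\<close>: the degree \<open>d\<close> piece of the polynomial ring modulo \<open>I\<close> has
  dimension \<open>n\<close> over the field of coefficients, i.e. there are \<open>n\<close> forms of degree \<open>d\<close> whose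
  residue classes modulo \<open>I\<close> are a basis of it.\<close>

definition quotient_graded_dim :: "('v, 'k::field) mpoly set \<Rightarrow> nat \<Rightarrow> nat \<Rightarrow> bool" where
  "quotient_graded_dim I d n \<longleftrightarrow>
     (\<exists>bs. length bs = n \<and> (\<forall>b\<in>set bs. homogeneous d b) \<and>
       (\<forall>p. homogeneous d p \<longrightarrow>
         (\<exists>!cs. length cs = n \<and> p - (\<Sum>i<n. Const (cs ! i) * bs ! i) \<in> I)))"

definition quotient_hilbert_function :: "('v, 'k::field) mpoly set \<Rightarrow> nat list \<Rightarrow> bool" where
  "quotient_hilbert_function I hs \<longleftrightarrow>
     (hs \<noteq> [] \<longrightarrow> last hs \<noteq> 0) \<and>
     (\<forall>d. quotient_graded_dim I d (if d < length hs then hs ! d else 0))"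

section \<open>Minimal homogeneous free resolutions\<close>

text \<open>A list \<open>[a\<^sub>1, \<dots>, a\<^sub>r]\<close> stands for the graded free module
  \<open>S(-a\<^sub>1) \<oplus> \<dots> \<oplus> S(-a\<^sub>r)\<close>, whose elements are vectors of length \<open>r\<close>.
  A matrix \<open>A\<close> is a homogeneous map of degree \<open>0\<close> from the module of \<open>bs\<close> to the module of \<open>as\<close>
  iff its \<open>(i, j)\<close> entry is homogeneous of degree \<open>bs ! j - as ! i\<close>, hence zero if this is
  negative.\<close>

definition graded_map ::
    "nat list \<Rightarrow> nat list \<Rightarrow> ('v, 'k::comm_ring_1) mpoly mat \<Rightarrow> bool" where
  "graded_map bs as A \<longleftrightarrow>
     A \<in> carrier_mat (length as) (length bs) \<and>
     (\<forall>i<length as. \<forall>j<length bs.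
        if as ! i \<le> bs ! j then homogeneous (bs ! j - as ! i) (A $$ (i, j))
        else A $$ (i, j) = 0)"

definition mat_image :: "'a::comm_ring_1 mat \<Rightarrow> 'a vec set" where
  "mat_image A = (\<lambda>v. A *\<^sub>v v) ` carrier_vec (dim_col A)"

text \<open>\<open>Fs = [F\<^sub>0, \<dots>, F\<^sub>n]\<close> lists the modules of the resolution
  \<open>0 \<rightarrow> F\<^sub>n \<rightarrow> \<dots> \<rightarrow> F\<^sub>0 \<rightarrow> I \<rightarrow> 0\<close>.
  The matrix \<open>Ds ! 0\<close> is the augmentation, regarded as a map from \<open>F\<^sub>0\<close> to \<open>S\<close> with image \<open>I\<close>, and
  \<open>Ds ! i\<close> is the map from \<open>F\<^sub>i\<close> to \<open>F\<^sub>i\<^sub>-\<^sub>1\<close> for \<open>i > 0\<close>. Minimality: the maps between the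
  free modules have image in the irrelevant ideal times their target.\<close>

definition minimal_free_resolution ::
    "('v, 'k::field) mpoly set \<Rightarrow> nat list list \<Rightarrow> ('v, 'k) mpoly mat list \<Rightarrow> bool" where
  "minimal_free_resolution I Fs Ds \<longleftrightarrow>
     Fs \<noteq> [] \<and> length Ds = length Fs \<and>
     (\<forall>i<length Fs. graded_map (Fs ! i) (([0] # Fs) ! i) (Ds ! i)) \<and>
     (\<lambda>v. v $ 0) ` mat_image (Ds ! 0) = I \<and>
     (\<forall>i. Suc i < length Fs \<longrightarrow> mat_image (Ds ! Suc i) = mat_kernel (Ds ! i)) \<and>
     mat_kernel (last Ds) = {0\<^sub>v (dim_col (last Ds))} \<and>
     (\<forall>i. Suc i < length Fs \<longrightarrow> elements_mat (Ds ! Suc i) \<subseteq> irrelevant_ideal)"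

section \<open>Homogeneous linkage\<close>

definition directly_homogeneously_linked ::
    "('v, 'k::field) mpoly set \<Rightarrow> ('v, 'k) mpoly set \<Rightarrow> bool" where
  "directly_homogeneously_linked I J \<longleftrightarrow>
     (\<exists>fs. (\<forall>f\<in>set fs. \<exists>d. homogeneous d f) \<and> linked_by fs I J)"

definition homogeneously_licci :: "('v, 'k::field) mpoly set \<Rightarrow> bool" where
  "homogeneously_licci I \<longleftrightarrow>
     homogeneous_ideal I \<and>
     (\<exists>J. directly_homogeneously_linked\<^sup>*\<^sup>* I J \<and> complete_intersection J)"

text \<open>\<open>ds\<close> lists the degrees of \<open>fs\<close>; the members of a regular sequence in a polynomial ring over
  a field are nonzero, so \<open>ds\<close> is determined by \<open>fs\<close>.\<close>

definition homogeneous_regular_sequence_in ::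
    "('v, 'k::field) mpoly set \<Rightarrow> nat list \<Rightarrow> ('v, 'k) mpoly list \<Rightarrow> bool" where
  "homogeneous_regular_sequence_in I ds fs \<longleftrightarrow>
     set fs \<subseteq> I \<and> list_all2 homogeneous ds fs \<and> regular_sequence fs"

definition smallest_degree_regular_sequence_in ::
    "('v, 'k::field) mpoly set \<Rightarrow> ('v, 'k) mpoly list \<Rightarrow> bool" where
  "smallest_degree_regular_sequence_in I fs \<longleftrightarrow>
     (\<exists>ds. homogeneous_regular_sequence_in I ds fs \<and>
       (\<forall>es gs. homogeneous_regular_sequence_in I es gs \<and> length gs = length fs
          \<longrightarrow> list_all2 (\<le>) (sort ds) (sort es)))"

definition directly_minimally_homogeneously_linked ::
    "('v, 'k::field) mpoly set \<Rightarrow> ('v, 'k) mpoly set \<Rightarrow> bool" where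
  "directly_minimally_homogeneously_linked I J \<longleftrightarrow>
     homogeneous_ideal I \<and>
     (\<exists>fs. ideal_height I = enat (length fs) \<and>
       smallest_degree_regular_sequence_in I fs \<and>
       J = ideal_colon (ideal_gen (set fs)) I \<and>
       I = ideal_colon (ideal_gen (set fs)) J)"

definition minimally_homogeneously_licci :: "('v, 'k::field) mpoly set \<Rightarrow> bool" where
  "minimally_homogeneously_licci I \<longleftrightarrow>
     homogeneously_licci I \<and>
     (\<exists>J. directly_minimally_homogeneously_linked\<^sup>*\<^sup>* I J \<and> complete_intersection J)"

end

theory Submission
  imports Defs "HOL-Library.Product_Plus"
begin

text \<open>The ideal \<open>I\<close> is \<open>(f, q) + x K\<close> with \<open>f\<close> the cubic and \<open>q\<close> the product of \<open>z\<^sup>2\<close> and \<open>y\<^sup>2 - z\<^sup>2\<close>, so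
  that two links lead from \<open>I\<close> to \<open>K\<close>. One link takes \<open>K\<close> to an ideal generated by monomials, and
  further double links of the same shape take this to a complete intersection.

  A minimal link of \<open>I\<close> has degrees \<open>3, 3, 6\<close>, and its two cubics span a fixed pencil with a common
  linear factor \<open>x\<close> in the member \<open>x (y\<^sup>2 - z\<^sup>2)\<close>. This shape, together with conditions on the forms of
  degree at most \<open>5\<close>, passes from \<open>I\<close> to its link and back again along all further minimal links. An
  ideal with these properties is not a complete intersection, by duality modulo the regular
  sequence: the socle of \<open>S/L\<close> is one-dimensional, in degree \<open>9\<close> for degrees \<open>3, 3, 6\<close>.

  The Hilbert function comes from an explicit normal form modulo \<open>I\<close>. The free resolution is exact
  because multiplication by each member of a regular sequence in \<open>I\<close> is null-homotopic on it.\<close>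

section \<open>Ideals\<close>

text \<open>The double link that leads out of \<open>I\<close> passes through \<open>cubic\<close>,
  \<open>quartic2\<close> and x^6, of degrees 3, 4, 6: in place of the cubic
  \<open>varx * quadric\<close> it uses a quartic. A minimal link has to keep that cubic, and this
  is the obstruction. Modulo the pencil of cubics the form \<open>quartic1\<close> of
  \<open>I\<close> is annihilated by y and z, so forms of low degree in a minimal link of
  \<open>I\<close> vanish at the point (1:0:0). The conditions on the two kinds of ideals are
  exchanged by the perfect pairing into the socle degree 9, and the pencil fixes a minimal regular
  sequence of \<open>I\<close> up to its sextic. The infinite field supplies a sextic in
  \<open>I\<close> that is regular modulo the pencil.

  Complete intersections may have inhomogeneous generators, and heights refer to chains of arbitrary
  primes. Both are controlled by one fact: n + 1 polynomials in n variables are algebraically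
  dependent. It bounds the length of regular sequences and of chains of primes, and it puts powers
  of the variables into every ideal of three regular forms. The socle is computed by an elementary
  comparison of two Koszul complexes.\<close>

interpretation idl: Modules.module "(*) :: 'a::comm_ring_1 \<Rightarrow> 'a \<Rightarrow> 'a"
  by standard (simp_all add: algebra_simps)

text \<open>For multiplication as scaling this rule is associativity, oriented against
  \<open>mult.assoc\<close>.\<close>

declare idl.scale_scale [simp del]

lemma is_idealI:
  assumes "0 \<in> I" "\<And>a b. a \<in> I \<Longrightarrow> b \<in> I \<Longrightarrow> a + b \<in> I" "\<And>c a. a \<in> I \<Longrightarrow> c * a \<in> I"
  shows "is_ideal I"
  unfolding is_ideal_def using assms by (intro idl.subspaceI)

lemma is_ideal_0: "is_ideal I \<Longrightarrow> 0 \<in> I"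
  unfolding is_ideal_def by (rule idl.subspace_0)

lemma is_ideal_add: "is_ideal I \<Longrightarrow> a \<in> I \<Longrightarrow> b \<in> I \<Longrightarrow> a + b \<in> I"
  unfolding is_ideal_def by (rule idl.subspace_add)

lemma is_ideal_mult: "is_ideal I \<Longrightarrow> a \<in> I \<Longrightarrow> c * a \<in> I"
  unfolding is_ideal_def by (rule idl.subspace_scale)

lemma is_ideal_mult_right: "is_ideal I \<Longrightarrow> a \<in> I \<Longrightarrow> a * c \<in> I"
  using is_ideal_mult[of I a c] by (simp add: mult.commute)

lemma is_ideal_uminus: "is_ideal I \<Longrightarrow> a \<in> I \<Longrightarrow> - a \<in> I"
  unfolding is_ideal_def by (rule idl.subspace_neg)

lemma is_ideal_diff: "is_ideal I \<Longrightarrow> a \<in> I \<Longrightarrow> b \<in> I \<Longrightarrow> a - b \<in> I"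
  unfolding is_ideal_def by (rule idl.subspace_diff)

lemma is_ideal_sum: "is_ideal I \<Longrightarrow> (\<And>i. i \<in> A \<Longrightarrow> f i \<in> I) \<Longrightarrow> sum f A \<in> I"
  unfolding is_ideal_def by (rule idl.subspace_sum)

lemma is_ideal_add_cancel: "is_ideal I \<Longrightarrow> b \<in> I \<Longrightarrow> a + b \<in> I \<longleftrightarrow> a \<in> I"
  by (metis add_diff_cancel_right' is_ideal_add is_ideal_diff)

lemma is_ideal_diff_cancel: "is_ideal I \<Longrightarrow> a - b \<in> I \<Longrightarrow> a \<in> I \<longleftrightarrow> b \<in> I"
  by (metis diff_add_cancel is_ideal_add is_ideal_diff add.commute add_diff_cancel_left')

lemma is_ideal_eq_UNIV: "is_ideal I \<Longrightarrow> 1 \<in> I \<Longrightarrow> I = UNIV"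
  using is_ideal_mult[of I 1] by auto

lemma is_ideal_ideal_gen [simp]: "is_ideal (ideal_gen B)"
  unfolding is_ideal_def ideal_gen_def by (rule idl.subspace_span)

lemma ideal_gen_base: "b \<in> B \<Longrightarrow> b \<in> ideal_gen B"
  unfolding ideal_gen_def by (rule idl.span_base)

lemma ideal_gen_least: "is_ideal I \<Longrightarrow> B \<subseteq> I \<Longrightarrow> ideal_gen B \<subseteq> I"
  unfolding is_ideal_def ideal_gen_def by (intro idl.span_minimal)

lemma ideal_gen_mono: "A \<subseteq> B \<Longrightarrow> ideal_gen A \<subseteq> ideal_gen B"
  unfolding ideal_gen_def by (rule idl.span_mono)

lemma ideal_gen_eqI: "A \<subseteq> ideal_gen B \<Longrightarrow> B \<subseteq> ideal_gen A \<Longrightarrow> ideal_gen A = ideal_gen B"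
  by (meson ideal_gen_least is_ideal_ideal_gen subset_antisym)

lemma ideal_gen_empty [simp]: "ideal_gen {} = {0}"
  unfolding ideal_gen_def by simp

lemma mem_ideal_gen_insert: "p \<in> ideal_gen (insert a B) \<longleftrightarrow> (\<exists>k. p - k * a \<in> ideal_gen B)"
  unfolding ideal_gen_def by (simp add: idl.span_insert)

lemma mem_ideal_gen_1: "p \<in> ideal_gen {a} \<longleftrightarrow> (\<exists>u. p = u * a)"
  by (simp add: mem_ideal_gen_insert)

lemma mem_ideal_gen_2: "p \<in> ideal_gen {a, b} \<longleftrightarrow> (\<exists>u v. p = u * a + v * b)"
  by (simp add: mem_ideal_gen_insert diff_diff_eq)

lemma mem_ideal_gen_3: "p \<in> ideal_gen {a, b, c} \<longleftrightarrow> (\<exists>u v w. p = u * a + v * b + w * c)"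
  by (simp add: mem_ideal_gen_insert diff_diff_eq)

lemma mem_ideal_gen_finite:
  assumes "p \<in> ideal_gen G" "finite G"
  obtains u where "p = (\<Sum>g\<in>G. u g * g)"
  using assms unfolding ideal_gen_def by (auto simp: idl.span_finite)

lemma is_ideal_colon: "is_ideal L \<Longrightarrow> is_ideal (ideal_colon L I)"
  unfolding ideal_colon_def
  by (rule is_idealI; clarsimp simp only: mem_Collect_eq mult_zero_left distrib_right mult.assoc)
    (blast intro: is_ideal_0 is_ideal_add is_ideal_mult)+

lemma mem_ideal_colon: "w \<in> ideal_colon L I \<longleftrightarrow> (\<forall>g\<in>I. w * g \<in> L)"
  by (simp add: ideal_colon_def)

lemma mem_ideal_colon_gen:
  assumes "is_ideal L"
  shows "w \<in> ideal_colon L (ideal_gen G) \<longleftrightarrow> (\<forall>g\<in>G. w * g \<in> L)"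
proof
  assume *: "\<forall>g\<in>G. w * g \<in> L"
  have "is_ideal {g. w * g \<in> L}"
    using assms by (intro is_idealI)
      (auto simp: is_ideal_0 distrib_left mult.left_commute[of w] intro: is_ideal_add is_ideal_mult)
  with * have "ideal_gen G \<subseteq> {g. w * g \<in> L}" by (intro ideal_gen_least) auto
  then show "w \<in> ideal_colon L (ideal_gen G)" by (auto simp: mem_ideal_colon)
qed (auto simp: mem_ideal_colon ideal_gen_base)

lemma regular_sequence_3:
  "regular_sequence [a, b, c] \<longleftrightarrow>
     (\<forall>g. a * g = 0 \<longrightarrow> g = 0) \<and>
     (\<forall>g. b * g \<in> ideal_gen {a} \<longrightarrow> g \<in> ideal_gen {a}) \<and>
     (\<forall>g. c * g \<in> ideal_gen {a, b} \<longrightarrow> g \<in> ideal_gen {a, b}) \<and>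
     ideal_gen {a, b, c} \<noteq> UNIV"
proof -
  have *: "(\<forall>i<Suc (Suc (Suc 0)). Q i) \<longleftrightarrow> Q 0 \<and> Q (Suc 0) \<and> Q (Suc (Suc 0))" for Q :: "nat \<Rightarrow> bool"
    by (auto simp: less_Suc_eq)
  show ?thesis
    unfolding regular_sequence_def by (simp add: * conj_assoc)
qed

section \<open>Graded pieces of the polynomial ring\<close>

lemma monom_degree_UNIV: "monom_degree m = (\<Sum>v\<in>UNIV. Poly_Mapping.lookup m v)"
  for m :: "'v::finite \<Rightarrow>\<^sub>0 nat"
  unfolding monom_degree_def
  by (rule sum.mono_neutral_left) (auto simp: in_keys_iff)

lemma monom_degree_add [simp]: "monom_degree (m + n) = monom_degree m + monom_degree n"
  for m :: "'v::finite \<Rightarrow>\<^sub>0 nat"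
  by (simp add: monom_degree_UNIV lookup_add sum.distrib)

lemma monom_degree_0 [simp]: "monom_degree 0 = 0"
  by (simp add: monom_degree_def)

lemma monom_degree_single [simp]: "monom_degree (Poly_Mapping.single v n) = n"
  by (cases "n = 0") (simp_all add: monom_degree_def)

lemma monom_degree_eq_0_iff [simp]: "monom_degree m = 0 \<longleftrightarrow> m = 0"
  for m :: "'v::finite \<Rightarrow>\<^sub>0 nat"
  by (auto simp: monom_degree_UNIV intro: poly_mapping_eqI)

lemma poly_mapping_sum_single: "p = (\<Sum>m\<in>Poly_Mapping.keys p. Poly_Mapping.single m (Poly_Mapping.lookup p m))"
proof (rule poly_mapping_eqI)
  fix k
  show "Poly_Mapping.lookup p k = Poly_Mapping.lookup (\<Sum>m\<in>Poly_Mapping.keys p. Poly_Mapping.single m (Poly_Mapping.lookup p m)) k"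
    by (cases "k \<in> Poly_Mapping.keys p")
      (auto simp: lookup_sum lookup_single when_def in_keys_iff sum.delta)
qed

text \<open>The degree is an integer so that shifts by the degree of a factor are never truncated;
  parts of negative degree are 0.\<close>

definition hpart :: "int \<Rightarrow> ('v, 'k::comm_ring_1) mpoly \<Rightarrow> ('v, 'k) mpoly" where
  "hpart n p = Poly_Mapping.mapp (\<lambda>m c. c when int (monom_degree m) = n) p"

lemma lookup_hpart: "Poly_Mapping.lookup (hpart n p) m = (Poly_Mapping.lookup p m when int (monom_degree m) = n)"
  by (auto simp: hpart_def lookup_mapp when_def in_keys_iff)

lemma hpart_0 [simp]: "hpart n 0 = 0"
  by (rule poly_mapping_eqI) (simp add: lookup_hpart)

lemma hpart_add: "hpart n (p + q) = hpart n p + hpart n q"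
  by (rule poly_mapping_eqI) (simp add: lookup_hpart lookup_add when_add_distrib)

lemma hpart_diff: "hpart n (p - q) = hpart n p - hpart n q"
  by (rule poly_mapping_eqI) (simp add: lookup_hpart lookup_minus when_diff_distrib)

lemma hpart_uminus: "hpart n (- p) = - hpart n p"
  by (rule poly_mapping_eqI) (simp add: lookup_hpart when_uminus_distrib)

lemma hpart_sum: "hpart n (sum f A) = (\<Sum>a\<in>A. hpart n (f a))"
  by (induction A rule: infinite_finite_induct) (simp_all add: hpart_add)

lemma hpart_single:
  "hpart n (Poly_Mapping.single m c) = (if int (monom_degree m) = n then Poly_Mapping.single m c else 0)"
  by (rule poly_mapping_eqI) (auto simp: lookup_hpart lookup_single when_def)

lemma hpart_neg: "n < 0 \<Longrightarrow> hpart n p = 0"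
  by (rule poly_mapping_eqI) (simp add: lookup_hpart)

lemma homogeneous_hpart: "homogeneous d (hpart (int d) p)"
  by (auto simp: homogeneous_def in_keys_iff lookup_hpart when_def split: if_splits)

lemma hpart_homogeneous: "homogeneous d p \<Longrightarrow> hpart n p = (if n = int d then p else 0)"
  by (rule poly_mapping_eqI) (auto simp: lookup_hpart homogeneous_def in_keys_iff when_def)

lemma homogeneous_iff_hpart: "homogeneous d p \<longleftrightarrow> hpart (int d) p = p"
  by (metis homogeneous_hpart hpart_homogeneous)

lemma hpart_mult_homogeneous:
  fixes p g :: "('v::finite, 'k::comm_ring_1) mpoly"
  assumes "homogeneous d g"
  shows "hpart n (p * g) = hpart (n - int d) p * g"
proof -
  have *: "hpart n (p * Poly_Mapping.single m c) = hpart (n - int d) p * Poly_Mapping.single m c"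
    if "monom_degree m = d" for m c
  proof -
    have "p * Poly_Mapping.single m c =
        (\<Sum>l\<in>Poly_Mapping.keys p. Poly_Mapping.single (l + m) (Poly_Mapping.lookup p l * c))"
      by (subst (1) poly_mapping_sum_single[of p]) (simp add: sum_distrib_right mult_single)
    then have "hpart n (p * Poly_Mapping.single m c) =
        (\<Sum>l\<in>Poly_Mapping.keys p. if int (monom_degree l) = n - int d
           then Poly_Mapping.single (l + m) (Poly_Mapping.lookup p l * c) else 0)"
      using that by (auto simp: hpart_sum hpart_single intro!: sum.cong)
    also have "\<dots> = hpart (n - int d) p * Poly_Mapping.single m c"
      by (subst (2) poly_mapping_sum_single[of p])
        (simp add: hpart_sum hpart_single sum_distrib_right mult_single if_distrib[of "\<lambda>a. a * _"]
          cong: if_cong)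
    finally show ?thesis .
  qed
  have "hpart n (p * g) = (\<Sum>m\<in>Poly_Mapping.keys g. hpart n (p * Poly_Mapping.single m (Poly_Mapping.lookup g m)))"
    by (subst (1) poly_mapping_sum_single[of g]) (simp add: sum_distrib_left hpart_sum)
  also have "\<dots> = (\<Sum>m\<in>Poly_Mapping.keys g. hpart (n - int d) p * Poly_Mapping.single m (Poly_Mapping.lookup g m))"
    using assms by (intro sum.cong) (auto simp: * homogeneous_def)
  also have "\<dots> = hpart (n - int d) p * g"
    by (subst (3) poly_mapping_sum_single[of g]) (simp add: sum_distrib_left)
  finally show ?thesis .
qed

lemma hpart_homogeneous_mult:
  fixes p g :: "('v::finite, 'k::comm_ring_1) mpoly"
  shows "homogeneous d g \<Longrightarrow> hpart n (g * p) = g * hpart (n - int d) p"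
  using hpart_mult_homogeneous[of d g n p] by (simp add: mult.commute)

lemma sum_hpart:
  assumes "\<And>m. m \<in> Poly_Mapping.keys p \<Longrightarrow> monom_degree m \<le> D"
  shows "p = (\<Sum>i\<le>D. hpart (int i) p)"
proof (rule poly_mapping_eqI)
  fix m
  show "Poly_Mapping.lookup p m = Poly_Mapping.lookup (\<Sum>i\<le>D. hpart (int i) p) m"
    using assms[of m] by (cases "m \<in> Poly_Mapping.keys p")
      (auto simp: lookup_sum lookup_hpart when_def in_keys_iff)
qed

lemma is_ideal_if_hpart:
  assumes "is_ideal I" "\<And>n. hpart n p \<in> I"
  shows "p \<in> I"
proof -
  have "p = (\<Sum>i\<le>Max (monom_degree ` Poly_Mapping.keys p). hpart (int i) p)"
    by (rule sum_hpart) simp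
  then show ?thesis by (metis assms is_ideal_sum)
qed

lemma homogeneous_0 [simp]: "homogeneous d 0"
  by (simp add: homogeneous_def)

lemma homogeneous_add: "homogeneous d p \<Longrightarrow> homogeneous d q \<Longrightarrow> homogeneous d (p + q)"
  by (simp add: homogeneous_iff_hpart hpart_add)

lemma homogeneous_diff: "homogeneous d p \<Longrightarrow> homogeneous d q \<Longrightarrow> homogeneous d (p - q)"
  by (simp add: homogeneous_iff_hpart hpart_diff)

lemma homogeneous_uminus: "homogeneous d p \<Longrightarrow> homogeneous d (- p)"
  by (simp add: homogeneous_iff_hpart hpart_uminus)

lemma homogeneous_mult:
  fixes p q :: "('v::finite, 'k::comm_ring_1) mpoly"
  shows "homogeneous d p \<Longrightarrow> homogeneous e q \<Longrightarrow> homogeneous (d + e) (p * q)"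
  by (simp add: homogeneous_iff_hpart[of "d + e"] hpart_mult_homogeneous[of e] hpart_homogeneous[of d])

lemma homogeneous_Const [simp]: "homogeneous 0 (Const c)"
  by (auto simp: homogeneous_def Const_def)

lemma homogeneous_1 [simp]: "homogeneous 0 1"
  by (auto simp: homogeneous_def)

lemma homogeneous_Var [simp]: "homogeneous (Suc 0) (Var v)"
  by (auto simp: homogeneous_def Var_def)

lemma homogeneous_power:
  fixes p :: "('v::finite, 'k::comm_ring_1) mpoly"
  shows "homogeneous d p \<Longrightarrow> homogeneous (n * d) (p ^ n)"
  by (induction n) (simp_all add: homogeneous_mult)

lemma homogeneous_Const_mult:
  fixes p :: "('v::finite, 'k::comm_ring_1) mpoly"
  shows "homogeneous d p \<Longrightarrow> homogeneous d (Const c * p)"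
  using homogeneous_mult[of 0 "Const c" d p] by simp

lemma homogeneous_0_iff: "homogeneous 0 p \<longleftrightarrow> (\<exists>c. p = Const c)"
  for p :: "('v::finite, 'k::comm_ring_1) mpoly"
proof
  assume *: "homogeneous 0 p"
  have "p = Const (Poly_Mapping.lookup p 0)"
    using * by (intro poly_mapping_eqI)
      (auto simp: Const_def lookup_single when_def homogeneous_def in_keys_iff)
  then show "\<exists>c. p = Const c" ..
qed auto

lemma Const_0 [simp]: "Const 0 = 0"
  by (simp add: Const_def)

lemma Const_1 [simp]: "Const 1 = 1"
  by (simp add: Const_def)

lemma Const_add: "Const (a + b) = Const a + Const b"
  by (simp add: Const_def single_add)

lemma Const_mult: "Const (a * b) = Const a * Const b"
  by (simp add: Const_def mult_single)

lemma Const_uminus: "Const (- a) = - Const a"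
  by (simp add: Const_def single_uminus)

lemma Const_diff: "Const (a - b) = Const a - Const b"
  by (simp add: Const_def single_diff)

lemma Const_eq_iff [simp]: "Const a = Const b \<longleftrightarrow> a = b"
  by (metis Const_def lookup_single_eq)

lemma Const_eq_0_iff [simp]: "Const a = 0 \<longleftrightarrow> a = 0"
  using Const_eq_iff[of a 0] by simp

lemma lookup_Const_mult [simp]: "Poly_Mapping.lookup (Const c * p) m = c * Poly_Mapping.lookup p m"
proof -
  have "Const c * p = Poly_Mapping.map ((*) c) p"
    by (simp add: Const_def mult_map_scale_conv_mult)
  then show ?thesis by (simp add: Poly_Mapping.map.rep_eq when_def)
qed

lemma is_ideal_Const_cancel:
  fixes p :: "('v::finite, 'k::field) mpoly"
  assumes "is_ideal I" "Const c * p \<in> I" "c \<noteq> 0"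
  shows "p \<in> I"
proof -
  have "Const (inverse c) * (Const c * p) = p"
    using assms(3) by (simp flip: mult.assoc Const_mult)
  then show ?thesis using is_ideal_mult[OF assms(1,2), of "Const (inverse c)"] by simp
qed

text \<open>Homogeneity in terms of elements rather than generators. Colon ideals come without
  generators, so this is the form in which homogeneity is passed on to them.\<close>

definition hclosed :: "('v, 'k::comm_ring_1) mpoly set \<Rightarrow> bool" where
  "hclosed I \<longleftrightarrow> (\<forall>p\<in>I. \<forall>n. hpart n p \<in> I)"

lemma hclosedD: "hclosed I \<Longrightarrow> p \<in> I \<Longrightarrow> hpart n p \<in> I"
  by (simp add: hclosed_def)

lemma hclosed_ideal_gen:
  fixes G :: "('v::finite, 'k::comm_ring_1) mpoly set"
  assumes "\<And>g. g \<in> G \<Longrightarrow> \<exists>d. homogeneous d g"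
  shows "hclosed (ideal_gen G)"
  unfolding hclosed_def
proof (intro ballI allI)
  fix p n assume "p \<in> ideal_gen G"
  then show "hpart n p \<in> ideal_gen G"
    unfolding ideal_gen_def
  proof (induction rule: idl.span_induct_alt)
    case base
    then show ?case by (simp add: idl.span_zero)
  next
    case (step c g q)
    obtain d where "homogeneous d g" using assms step by blast
    then show ?case
      using step by (simp add: hpart_add hpart_mult_homogeneous idl.span_add idl.span_scale idl.span_base)
  qed
qed

lemma homogeneous_ideal_iff:
  fixes I :: "('v::finite, 'k::comm_ring_1) mpoly set"
  shows "homogeneous_ideal I \<longleftrightarrow> is_ideal I \<and> hclosed I"
proof
  assume "homogeneous_ideal I"
  then show "is_ideal I \<and> hclosed I"
    unfolding homogeneous_ideal_def using hclosed_ideal_gen by auto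
next
  assume I: "is_ideal I \<and> hclosed I"
  let ?G = "{g \<in> I. \<exists>d. homogeneous d g}"
  have "I \<subseteq> ideal_gen ?G"
  proof
    fix p assume p: "p \<in> I"
    have "hpart n p \<in> ideal_gen ?G" for n
    proof (cases "n < 0")
      case True
      then show ?thesis by (simp add: hpart_neg is_ideal_0)
    next
      case False
      then have "homogeneous (nat n) (hpart n p)" using homogeneous_hpart[of "nat n" p] by simp
      then show ?thesis using I p by (intro ideal_gen_base) (auto simp: hclosedD)
    qed
    then show "p \<in> ideal_gen ?G" by (rule is_ideal_if_hpart[OF is_ideal_ideal_gen])
  qed
  moreover have "ideal_gen ?G \<subseteq> I" using I by (intro ideal_gen_least) auto
  ultimately have "I = ideal_gen ?G" by (rule subset_antisym)
  then show "homogeneous_ideal I" unfolding homogeneous_ideal_def by (intro exI[of _ ?G]) simp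
qed

text \<open>For a form g of degree d, the part of degree n + d of w g is g times the part of degree
  n of w; hence it is enough to test the forms that generate \<open>I\<close>.\<close>

lemma hclosed_colon:
  fixes I L :: "('v::finite, 'k::comm_ring_1) mpoly set"
  assumes "is_ideal L" "hclosed L" "is_ideal I" "hclosed I"
  shows "hclosed (ideal_colon L I)"
  unfolding hclosed_def
proof (intro ballI allI)
  fix w n assume w: "w \<in> ideal_colon L I"
  have "homogeneous_ideal I" using assms by (simp add: homogeneous_ideal_iff)
  then obtain G where G: "\<And>g. g \<in> G \<Longrightarrow> \<exists>d. homogeneous d g" "I = ideal_gen G"
    unfolding homogeneous_ideal_def by auto
  have "hpart n w * g \<in> L" if "g \<in> G" for g
  proof -
    obtain d where d: "homogeneous d g" using G(1) \<open>g \<in> G\<close> by blast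
    have "w * g \<in> L" using w G that by (auto simp: mem_ideal_colon ideal_gen_base)
    then have "hpart (n + int d) (w * g) \<in> L" using assms hclosedD by blast
    then show ?thesis using d by (simp add: hpart_mult_homogeneous)
  qed
  then show "hpart n w \<in> ideal_colon L I" using G assms by (simp add: mem_ideal_colon_gen)
qed

section \<open>Algebraic dependence and dimension\<close>

text \<open>The coefficient of the lexicographically smallest monomial survives: strip off the smallest
  power of the first element, cancel it, and pass to the next ideal of the chain.\<close>

lemma coefficient_in_chain:
  fixes Q :: "nat \<Rightarrow> 'a::comm_ring_1 set"
  assumes "\<And>i. is_ideal (Q i)"
    and "\<And>i g. i < length as \<Longrightarrow> as ! i * g \<in> Q i \<Longrightarrow> g \<in> Q i"
    and "\<And>i. i < length as \<Longrightarrow> as ! i \<in> Q (Suc i)"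
    and "\<And>i. i < length as \<Longrightarrow> Q i \<subseteq> Q (Suc i)"
    and "finite E" "E \<noteq> {}" "\<And>e. e \<in> E \<Longrightarrow> length e = length as"
    and "(\<Sum>e\<in>E. c e * prod_list (map2 (^) as e)) \<in> Q 0"
  shows "\<exists>e\<in>E. c e \<in> Q (length as)"
  using assms
proof (induction as arbitrary: Q E c)
  case Nil
  then have "E = {[]}" by auto
  then show ?case using Nil.prems(8) by simp
next
  case (Cons a as)
  let ?pr = "\<lambda>e. prod_list (map2 (^) as e)"
  define m where "m = Min (hd ` E)"
  define F where "F = {e \<in> E. hd e = m}"
  have fin: "finite F" using Cons.prems(5) by (simp add: F_def)
  have m: "m \<le> hd e" if "e \<in> E" for e using that Cons.prems(5) by (simp add: m_def)
  have "m \<in> hd ` E" unfolding m_def using Cons.prems(5,6) by (intro Min_in) auto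
  then have F: "F \<noteq> {}" by (auto simp: F_def)
  have Ee: "e = hd e # tl e" if "e \<in> E" for e
    using Cons.prems(7)[OF that] by (cases e) auto
  have pre: "prod_list (map2 (^) (a # as) e) = a ^ hd e * ?pr (tl e)" if "e \<in> E" for e
    by (subst Ee[OF that]) simp
  define T where "T = (\<Sum>e\<in>F. c e * ?pr (tl e))"
  define R where "R = (\<Sum>e\<in>E - F. c e * (a ^ (hd e - Suc m) * ?pr (tl e)))"
  have "(\<Sum>e\<in>E. c e * prod_list (map2 (^) (a # as) e)) = (\<Sum>e\<in>E. c e * (a ^ hd e * ?pr (tl e)))"
    using pre by (intro sum.cong) auto
  also have "\<dots> = (\<Sum>e\<in>F. c e * (a ^ hd e * ?pr (tl e))) + (\<Sum>e\<in>E - F. c e * (a ^ hd e * ?pr (tl e)))"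
    using Cons.prems(5) by (subst sum.subset_diff[of F E]) (auto simp: F_def add.commute)
  also have "(\<Sum>e\<in>F. c e * (a ^ hd e * ?pr (tl e))) = a ^ m * T"
    unfolding T_def sum_distrib_left by (intro sum.cong) (auto simp: F_def mult_ac)
  also have "(\<Sum>e\<in>E - F. c e * (a ^ hd e * ?pr (tl e))) = a ^ m * (a * R)"
    unfolding R_def sum_distrib_left
  proof (intro sum.cong refl)
    fix e assume e: "e \<in> E - F"
    then have "m < hd e" using m[of e] by (auto simp: F_def)
    then have "hd e = m + Suc (hd e - Suc m)" by simp
    then have "a ^ hd e = a ^ m * (a * a ^ (hd e - Suc m))"
      by (metis power_Suc power_add)
    then show "c e * (a ^ hd e * ?pr (tl e)) = a ^ m * (a * (c e * (a ^ (hd e - Suc m) * ?pr (tl e))))"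
      by (simp add: mult_ac)
  qed
  finally have "a ^ m * (T + a * R) \<in> Q 0"
    using Cons.prems(8) by (simp add: distrib_left)
  moreover have "a ^ j * g \<in> Q 0 \<Longrightarrow> g \<in> Q 0" for j g
  proof (induction j arbitrary: g)
    case (Suc j)
    then have "a ^ j * (a * g) \<in> Q 0" by (simp add: mult_ac)
    then have "a * g \<in> Q 0" by (rule Suc.IH)
    then show ?case using Cons.prems(2)[of 0] by simp
  qed simp
  ultimately have "T + a * R \<in> Q 0" by blast
  then have "T + a * R \<in> Q 1" using Cons.prems(4)[of 0] by auto
  moreover have "a * R \<in> Q 1"
    using Cons.prems(1,3)[of 0] Cons.prems(1)[of 1] by (auto intro: is_ideal_mult_right)
  ultimately have T: "T \<in> Q 1" using Cons.prems(1)[of 1] by (metis is_ideal_add_cancel)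
  have inj: "inj_on tl F"
  proof (rule inj_onI)
    fix e e' assume "e \<in> F" "e' \<in> F" "tl e = tl e'"
    then show "e = e'" using Ee[of e] Ee[of e'] by (auto simp: F_def)
  qed
  have "T = (\<Sum>e\<in>tl ` F. c (m # e) * ?pr e)"
    unfolding T_def using Ee
    by (subst sum.reindex[OF inj]) (auto simp: F_def intro!: sum.cong)
  with T have "(\<Sum>e\<in>tl ` F. c (m # e) * ?pr e) \<in> Q (Suc 0)" by simp
  then have "\<exists>e\<in>tl ` F. c (m # e) \<in> Q (Suc (length as))"
  proof (intro Cons.IH[of "\<lambda>i. Q (Suc i)"])
    show "length e = length as" if "e \<in> tl ` F" for e
      using that Cons.prems(7) by (auto simp: F_def)
    show "g \<in> Q (Suc i)" if "i < length as" "as ! i * g \<in> Q (Suc i)" for i g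
      using that Cons.prems(2)[of "Suc i" g] by simp
    show "as ! i \<in> Q (Suc (Suc i))" if "i < length as" for i
      using that Cons.prems(3)[of "Suc i"] by simp
    show "Q (Suc i) \<subseteq> Q (Suc (Suc i))" if "i < length as" for i
      using that Cons.prems(4)[of "Suc i"] by simp
  qed (use fin F Cons.prems(1) in auto)
  then obtain e where e: "e \<in> F" "c (m # tl e) \<in> Q (length (a # as))" by auto
  then have "m # tl e = e" using Ee[of e] by (auto simp: F_def)
  with e show ?case by (intro bexI[of _ e]) (auto simp: F_def)
qed

interpretation mvs: vector_space "\<lambda>c p. Const c * p :: ('v, 'k::field) mpoly"
  by standard (simp_all add: algebra_simps Const_add Const_mult)

declare mvs.scale_scale [simp del]

text \<open>Exponents are bounded one by one, not in total: the exponent vectors then form a box,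
  which is easy to count, and the bounds still add up under products.\<close>

definition exponents_le :: "nat \<Rightarrow> ('v, 'k::comm_ring_1) mpoly \<Rightarrow> bool" where
  "exponents_le D p \<longleftrightarrow> (\<forall>m\<in>Poly_Mapping.keys p. \<forall>v. Poly_Mapping.lookup m v \<le> D)"

lemma exponents_le_mult:
  assumes "exponents_le D p" "exponents_le E q"
  shows "exponents_le (D + E) (p * q)"
  unfolding exponents_le_def
proof (intro ballI allI)
  fix m v assume "m \<in> Poly_Mapping.keys (p * q)"
  then obtain a b where ab: "a \<in> Poly_Mapping.keys p" "b \<in> Poly_Mapping.keys q" "m = a + b"
    using keys_mult[of p q] by blast
  then have "Poly_Mapping.lookup a v \<le> D" "Poly_Mapping.lookup b v \<le> E"
    using assms by (auto simp: exponents_le_def)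
  then show "Poly_Mapping.lookup m v \<le> D + E" using ab by (simp add: lookup_add)
qed

lemma exponents_le_power: "exponents_le D p \<Longrightarrow> exponents_le (n * D) (p ^ n)"
proof (induction n)
  case 0
  then show ?case by (simp add: exponents_le_def)
next
  case (Suc n)
  then show ?case using exponents_le_mult[of D p "n * D" "p ^ n"] by simp
qed

lemma exponents_le_mono: "exponents_le D p \<Longrightarrow> D \<le> E \<Longrightarrow> exponents_le E p"
  unfolding exponents_le_def by (meson order_trans)

lemma exponents_le_ex:
  fixes p :: "('v::finite, 'k::comm_ring_1) mpoly"
  shows "\<exists>D. exponents_le D p"
proof -
  have "Poly_Mapping.lookup m v \<le> Max ((\<lambda>(m, v). Poly_Mapping.lookup m v) ` (Poly_Mapping.keys p \<times> UNIV))"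
    if "m \<in> Poly_Mapping.keys p" for m v
    using that by (intro Max_ge) auto
  then show ?thesis unfolding exponents_le_def by blast
qed

lemma exponents_le_prod_list:
  assumes "\<And>a. a \<in> set as \<Longrightarrow> exponents_le D a" "length e = length as" "\<And>j. j \<in> set e \<Longrightarrow> j \<le> N"
  shows "exponents_le (length as * (N * D)) (prod_list (map2 (^) as e))"
  using assms
proof (induction as arbitrary: e)
  case Nil
  then show ?case by (simp add: exponents_le_def)
next
  case (Cons a as)
  then obtain j f where e: "e = j # f" by (cases e) auto
  have "exponents_le (N * D) (a ^ j)"
    using Cons.prems e by (auto intro: exponents_le_mono[OF exponents_le_power[of D]])
  moreover have "exponents_le (length as * (N * D)) (prod_list (map2 (^) as f))"
    using Cons.prems e by (intro Cons.IH) auto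
  ultimately show ?case using e exponents_le_mult by fastforce
qed

lemma card_bounded_exponents:
  "finite {m :: 'v::finite \<Rightarrow>\<^sub>0 nat. \<forall>v. Poly_Mapping.lookup m v \<le> D}"
  "card {m :: 'v::finite \<Rightarrow>\<^sub>0 nat. \<forall>v. Poly_Mapping.lookup m v \<le> D} \<le> Suc D ^ CARD('v)"
proof -
  let ?B = "{m :: 'v \<Rightarrow>\<^sub>0 nat. \<forall>v. Poly_Mapping.lookup m v \<le> D}"
  have sub: "Poly_Mapping.lookup ` ?B \<subseteq> PiE UNIV (\<lambda>_. {..D})" by auto
  have fin: "finite (PiE (UNIV :: 'v set) (\<lambda>_. {..D}))" by (intro finite_PiE) auto
  have inj: "inj_on Poly_Mapping.lookup ?B" by (rule inj_onI) (simp only: poly_mapping_eq_iff)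
  show "finite ?B" using finite_imageD[OF finite_subset[OF sub fin] inj] .
  have "card ?B = card (Poly_Mapping.lookup ` ?B)" using inj by (simp add: card_image)
  also have "\<dots> \<le> card (PiE (UNIV :: 'v set) (\<lambda>_. {..D}))" by (intro card_mono fin sub)
  also have "\<dots> = Suc D ^ CARD('v)" by (simp add: card_PiE)
  finally show "card ?B \<le> Suc D ^ CARD('v)" .
qed

lemma exponents_le_in_span:
  assumes "exponents_le D p"
  shows "p \<in> mvs.span ((\<lambda>m. Poly_Mapping.single m 1) ` {m. \<forall>v. Poly_Mapping.lookup m v \<le> D})"
proof -
  have "p = (\<Sum>m\<in>Poly_Mapping.keys p. Const (Poly_Mapping.lookup p m) * Poly_Mapping.single m 1)"
    by (subst (1) poly_mapping_sum_single[of p]) (simp add: Const_def mult_single)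
  also have "\<dots> \<in> mvs.span ((\<lambda>m. Poly_Mapping.single m 1) ` {m. \<forall>v. Poly_Mapping.lookup m v \<le> D})"
    using assms by (intro mvs.span_sum mvs.span_scale mvs.span_base) (auto simp: exponents_le_def)
  finally show ?thesis .
qed

text \<open>Counting: the \<open>N ^ (n + 1)\<close> monomials of exponents below \<open>N\<close> in \<open>n + 1\<close> elements lie in a space
  of dimension \<open>O(N ^ n)\<close>.\<close>

lemma algebraically_dependent:
  fixes as :: "('v::finite, 'k::field) mpoly list"
  assumes len: "length as = Suc CARD('v)"
  shows "\<exists>E c. finite E \<and> E \<noteq> {} \<and> (\<forall>e\<in>E. length e = length as \<and> c e \<noteq> 0) \<and>
    (\<Sum>e\<in>E. Const (c e) * prod_list (map2 (^) as e)) = 0"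
proof -
  let ?n = "CARD('v)" and ?b = "\<lambda>e. prod_list (map2 (^) as e)"
  have "\<forall>a :: ('v, 'k) mpoly. \<exists>D. exponents_le D a" using exponents_le_ex by blast
  from choice[OF this] obtain Da where Da: "\<And>a :: ('v, 'k) mpoly. exponents_le (Da a) a" by blast
  define D where "D = Suc (\<Sum>a\<in>set as. Da a)"
  have D: "exponents_le D a" if "a \<in> set as" for a
    using Da[of a] member_le_sum[of a "set as" Da] that
    by (intro exponents_le_mono[of "Da a" a D]) (auto simp: D_def)
  \<comment> \<open>With n for \<open>?n\<close>: the products below have exponents at most
    \<open>M\<close>, and \<open>Suc M\<close> is at most (n + 2) D N. This \<open>N\<close> makes
    ((n + 2) D N)^n smaller than N^(n + 1).\<close>
  define N where "N = Suc ((Suc (Suc ?n) * D) ^ ?n)"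
  define M where "M = Suc ?n * (N * D)"
  have small: "Suc M ^ ?n < N ^ Suc ?n"
  proof -
    have "Suc M \<le> (Suc (Suc ?n) * D) * N" by (simp add: M_def N_def D_def algebra_simps)
    then have "Suc M ^ ?n \<le> (Suc (Suc ?n) * D) ^ ?n * N ^ ?n"
      by (metis power_mono power_mult_distrib zero_le)
    also have "\<dots> < N * N ^ ?n" by (intro mult_strict_right_mono) (auto simp: N_def)
    finally show ?thesis by simp
  qed
  define B where "B = {e :: nat list. set e \<subseteq> {..<N} \<and> length e = Suc ?n}"
  have B: "finite B" "card B = N ^ Suc ?n"
    using finite_lists_length_eq[of "{..<N}" "Suc ?n"] card_lists_length_eq[of "{..<N}" "Suc ?n"]
    by (simp_all add: B_def)
  have span: "?b ` B \<subseteq> mvs.span ((\<lambda>m. Poly_Mapping.single m 1) ` {m. \<forall>v. Poly_Mapping.lookup m v \<le> M})"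
  proof
    fix p assume "p \<in> ?b ` B"
    then obtain e where e: "e \<in> B" "p = ?b e" by blast
    have "exponents_le (length as * (N * D)) (?b e)"
      using e len D by (intro exponents_le_prod_list) (auto simp: B_def)
    then show "p \<in> mvs.span ((\<lambda>m. Poly_Mapping.single m 1) ` {m. \<forall>v. Poly_Mapping.lookup m v \<le> M})"
      using e len by (intro exponents_le_in_span) (simp add: M_def)
  qed
  show ?thesis
  \<comment> \<open>Linear dependence is a property of sets, so two exponent vectors with the same
    product are a case of their own.\<close>
  proof (cases "inj_on ?b B")
    case False
    then obtain e e' where e: "e \<in> B" "e' \<in> B" "e \<noteq> e'" "?b e = ?b e'" by (auto simp: inj_on_def)
    show ?thesis
    proof (intro exI[of _ "{e, e'}"] exI[of _ "\<lambda>f. if f = e then 1 else -1"] conjI)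
      show "(\<Sum>f\<in>{e, e'}. Const (if f = e then 1 else -1 :: 'k) * ?b f) = 0"
        using e by (simp add: Const_uminus)
    qed (use e len in \<open>auto simp: B_def\<close>)
  next
    case True
    have "\<not> mvs.independent (?b ` B)"
    proof
      assume "mvs.independent (?b ` B)"
      from mvs.independent_span_bound[OF _ this span]
      have "card (?b ` B) \<le> card ((\<lambda>m. Poly_Mapping.single m (1::'k)) ` {m :: 'v \<Rightarrow>\<^sub>0 nat. \<forall>v. Poly_Mapping.lookup m v \<le> M})"
        using card_bounded_exponents(1) by blast
      also have "\<dots> \<le> card {m :: 'v \<Rightarrow>\<^sub>0 nat. \<forall>v. Poly_Mapping.lookup m v \<le> M}"
        by (intro card_image_le card_bounded_exponents)
      also have "\<dots> \<le> Suc M ^ ?n" by (rule card_bounded_exponents)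
      finally show False using small B True by (simp add: card_image)
    qed
    then obtain t u v where t: "finite t" "t \<subseteq> ?b ` B" "(\<Sum>v\<in>t. Const (u v) * v) = 0" "v \<in> t" "u v \<noteq> 0"
      unfolding mvs.dependent_explicit by blast
    define E where "E = {e \<in> B. ?b e \<in> t \<and> u (?b e) \<noteq> 0}"
    have inj: "inj_on ?b E" using True by (rule inj_on_subset) (auto simp: E_def)
    have im: "?b ` E = {v \<in> t. u v \<noteq> 0}" using t(2) by (auto simp: E_def)
    show ?thesis
    proof (intro exI[of _ E] exI[of _ "\<lambda>e. u (?b e)"] conjI)
      have "(\<Sum>e\<in>E. Const (u (?b e)) * ?b e) = (\<Sum>v\<in>?b ` E. Const (u v) * v)"
        by (simp add: sum.reindex[OF inj])
      also have "\<dots> = (\<Sum>v\<in>t. Const (u v) * v)"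
        unfolding im using t(1) by (intro sum.mono_neutral_left) auto
      finally show "(\<Sum>e\<in>E. Const (u (?b e)) * ?b e) = 0" using t by simp
      show "E \<noteq> {}" using t im by auto
      show "finite E" using B(1) by (simp add: E_def)
    qed (use len in \<open>auto simp: E_def B_def\<close>)
  qed
qed

lemma regular_sequenceD:
  "regular_sequence fs \<Longrightarrow> i < length fs \<Longrightarrow> fs ! i * g \<in> ideal_gen (set (take i fs)) \<Longrightarrow>
    g \<in> ideal_gen (set (take i fs))"
  unfolding regular_sequence_def by blast

text \<open>A relation with constant coefficients among n + 1 members would, along the chain of the
  ideals of initial segments, put a nonzero constant into the ideal of these members.\<close>

lemma length_regular_sequence_le:
  fixes fs :: "('v::finite, 'k::field) mpoly list"
  assumes fs: "regular_sequence fs"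
  shows "length fs \<le> CARD('v)"
proof (rule ccontr)
  assume "\<not> ?thesis"
  then have len: "Suc CARD('v) \<le> length fs" by simp
  define as where "as = take (Suc CARD('v)) fs"
  have as: "length as = Suc CARD('v)" using len by (simp add: as_def)
  obtain E c where "finite E" "E \<noteq> {}" "\<forall>e\<in>E. length e = length as \<and> c e \<noteq> 0"
    "(\<Sum>e\<in>E. Const (c e) * prod_list (map2 (^) as e)) = 0"
    using algebraically_dependent[OF as] by (elim exE conjE) (rule that)
  note * = this
  have E: "finite E" "E \<noteq> {}" "\<And>e. e \<in> E \<Longrightarrow> length e = length as"
    "\<And>e. e \<in> E \<Longrightarrow> c e \<noteq> 0" "(\<Sum>e\<in>E. Const (c e) * prod_list (map2 (^) as e)) = 0"
    using * by simp_all
  have "\<exists>e\<in>E. Const (c e) \<in> ideal_gen (set (take (length as) fs))"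
  proof (rule coefficient_in_chain[of "\<lambda>i. ideal_gen (set (take i fs))" as E "\<lambda>e. Const (c e)"])
    show "g \<in> ideal_gen (set (take i fs))" if "i < length as" "as ! i * g \<in> ideal_gen (set (take i fs))" for i g
      using regular_sequenceD[OF fs, of i g] that len by (simp add: as_def)
    show "as ! i \<in> ideal_gen (set (take (Suc i) fs))" if "i < length as" for i
    proof -
      have "as ! i = fs ! i" using that by (simp add: as_def)
      then show ?thesis using that as len by (intro ideal_gen_base) (auto simp: take_Suc_conv_app_nth)
    qed
    show "ideal_gen (set (take i fs)) \<subseteq> ideal_gen (set (take (Suc i) fs))" for i
      by (intro ideal_gen_mono set_take_subset_set_take) simp
  qed (use E in auto)
  then obtain e where e: "e \<in> E" "Const (c e) \<in> ideal_gen (set (take (length as) fs))" by blast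
  then have "Const (c e) * 1 \<in> ideal_gen (set fs)"
    using ideal_gen_mono[OF set_take_subset] by auto
  then have "1 \<in> ideal_gen (set fs)" using E(4) e(1) is_ideal_Const_cancel is_ideal_ideal_gen by blast
  then show False using fs is_ideal_eq_UNIV[OF is_ideal_ideal_gen] by (auto simp: regular_sequence_def)
qed

text \<open>Here the polynomials in \<open>t\<close> play the role of the coefficients.\<close>

lemma power_in_regular_ideal:
  fixes fs :: "('v::finite, 'k::field) mpoly list"
  assumes fs: "regular_sequence fs" and len: "length fs = CARD('v)"
    and hom: "\<And>f. f \<in> set fs \<Longrightarrow> \<exists>d. homogeneous d f" and t: "homogeneous (Suc 0) t"
  shows "\<exists>N. t ^ N \<in> ideal_gen (set fs)"
proof -
  have "length (fs @ [t]) = Suc CARD('v)" using len by simp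
  from algebraically_dependent[OF this]
  obtain E c where "finite E" "E \<noteq> {}" "\<forall>e\<in>E. length e = length (fs @ [t]) \<and> c e \<noteq> 0"
    "(\<Sum>e\<in>E. Const (c e) * prod_list (map2 (^) (fs @ [t]) e)) = 0"
    by (elim exE conjE) (rule that)
  note * = this
  have E: "finite E" "E \<noteq> {}" "\<And>e. e \<in> E \<Longrightarrow> length e = length (fs @ [t])"
    "\<And>e. e \<in> E \<Longrightarrow> c e \<noteq> 0" "(\<Sum>e\<in>E. Const (c e) * prod_list (map2 (^) (fs @ [t]) e)) = 0"
    using * by simp_all
  have Ee: "e = butlast e @ [last e]" if "e \<in> E" for e
    using E(3)[OF that] by (cases e rule: rev_cases) auto
  \<comment> \<open>The relation is collected by the exponents of \<open>fs\<close>; its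
    coefficients are polynomials in \<open>t\<close>.\<close>
  define C where "C = (\<lambda>f. \<Sum>e\<in>{e \<in> E. butlast e = f}. Const (c e) * t ^ last e)"
  have "(\<Sum>f\<in>butlast ` E. C f * prod_list (map2 (^) fs f)) =
      (\<Sum>f\<in>butlast ` E. \<Sum>e\<in>{e \<in> E. butlast e = f}. Const (c e) * prod_list (map2 (^) (fs @ [t]) e))"
    unfolding C_def sum_distrib_right
  proof (rule sum.cong[OF refl], rule sum.cong[OF refl])
    fix f e assume "e \<in> {e \<in> E. butlast e = f}"
    then have e: "e \<in> E" and f: "f = butlast e" by auto
    have "prod_list (map2 (^) (fs @ [t]) e) = prod_list (map2 (^) fs (butlast e)) * t ^ last e"
      using E(3)[OF e] by (subst Ee[OF e]) simp
    then show "Const (c e) * t ^ last e * prod_list (map2 (^) fs f) =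
       Const (c e) * prod_list (map2 (^) (fs @ [t]) e)" by (simp add: f mult_ac)
  qed
  also have "\<dots> = 0" using E(1,5) by (subst sum.group) auto
  finally have 0: "(\<Sum>f\<in>butlast ` E. C f * prod_list (map2 (^) fs f)) = 0" .
  have "\<exists>f\<in>butlast ` E. C f \<in> ideal_gen (set (take (length fs) fs))"
  proof (rule coefficient_in_chain[of "\<lambda>i. ideal_gen (set (take i fs))" fs "butlast ` E" C])
    show "g \<in> ideal_gen (set (take i fs))" if "i < length fs" "fs ! i * g \<in> ideal_gen (set (take i fs))" for i g
      using regular_sequenceD[OF fs, of i g] that by simp
    show "fs ! i \<in> ideal_gen (set (take (Suc i) fs))" if "i < length fs" for i
      using that by (intro ideal_gen_base) (auto simp: take_Suc_conv_app_nth)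
    show "ideal_gen (set (take i fs)) \<subseteq> ideal_gen (set (take (Suc i) fs))" for i
      by (intro ideal_gen_mono set_take_subset_set_take) simp
  qed (use E 0 in auto)
  then obtain e where e: "e \<in> E" "C (butlast e) \<in> ideal_gen (set fs)" by auto
  \<comment> \<open>The terms of \<open>C\<close> are forms of different degrees, one for each power
    of \<open>t\<close>, and the ideal is homogeneous, so every single term lies in it.\<close>
  have "hclosed (ideal_gen (set fs))" using hom by (rule hclosed_ideal_gen)
  then have "hpart (int (last e)) (C (butlast e)) \<in> ideal_gen (set fs)" using e by (simp add: hclosedD)
  also have "hpart (int (last e)) (C (butlast e)) = Const (c e) * t ^ last e"
  proof -
    have hp: "homogeneous j (Const b * t ^ j)" for b j
      using homogeneous_Const_mult[OF homogeneous_power[OF t, of j]] by simp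
    have "hpart (int (last e)) (C (butlast e)) =
      (\<Sum>f\<in>{f \<in> E. butlast f = butlast e}. if f = e then Const (c f) * t ^ last f else 0)"
      unfolding C_def hpart_sum
    proof (intro sum.cong refl)
      fix f assume "f \<in> {f \<in> E. butlast f = butlast e}"
      then have "last e = last f \<longleftrightarrow> f = e" using Ee[of f] Ee[OF e(1)] by auto
      then show "hpart (int (last e)) (Const (c f) * t ^ last f) = (if f = e then Const (c f) * t ^ last f else 0)"
        by (subst hpart_homogeneous[OF hp]) auto
    qed
    also have "\<dots> = Const (c e) * t ^ last e" using E(1) e(1) by simp
    finally show ?thesis .
  qed
  finally have "t ^ last e \<in> ideal_gen (set fs)"
    using E(4) e(1) is_ideal_Const_cancel is_ideal_ideal_gen by blast
  then show ?thesis ..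
qed

section \<open>Primes generated by variables, and heights\<close>

text \<open>Substitution of 0 for the variables in \<open>V\<close>, given on coefficients. It is
  multiplicative, and its kernel is the ideal of these variables.\<close>

definition kill :: "'v set \<Rightarrow> ('v, 'k::comm_ring_1) mpoly \<Rightarrow> ('v, 'k) mpoly" where
  "kill V p = Poly_Mapping.mapp (\<lambda>m c. c when (\<forall>v\<in>V. Poly_Mapping.lookup m v = 0)) p"

lemma lookup_kill:
  "Poly_Mapping.lookup (kill V p) m = (Poly_Mapping.lookup p m when (\<forall>v\<in>V. Poly_Mapping.lookup m v = 0))"
  by (auto simp: kill_def lookup_mapp when_def in_keys_iff)

lemma kill_0 [simp]: "kill V 0 = 0"
  by (rule poly_mapping_eqI) (simp add: lookup_kill)

lemma kill_add: "kill V (p + q) = kill V p + kill V q"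
  by (rule poly_mapping_eqI) (simp add: lookup_kill lookup_add when_add_distrib)

lemma kill_sum: "kill V (sum f A) = (\<Sum>a\<in>A. kill V (f a))"
  by (induction A rule: infinite_finite_induct) (simp_all add: kill_add)

lemma kill_single:
  "kill V (Poly_Mapping.single m c) =
    (if \<forall>v\<in>V. Poly_Mapping.lookup m v = 0 then Poly_Mapping.single m c else 0)"
  by (rule poly_mapping_eqI) (auto simp: lookup_kill lookup_single when_def)

lemma kill_mult: "kill V (p * q) = kill V p * kill V q"
proof -
  let ?s = "\<lambda>p m. Poly_Mapping.single m (Poly_Mapping.lookup p m)"
  have "p * q = (\<Sum>m\<in>Poly_Mapping.keys p. \<Sum>n\<in>Poly_Mapping.keys q. ?s p m * ?s q n)"
    by (subst (1) poly_mapping_sum_single[of p], subst (1) poly_mapping_sum_single[of q])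
      (simp add: sum_product)
  then have "kill V (p * q) = (\<Sum>m\<in>Poly_Mapping.keys p. \<Sum>n\<in>Poly_Mapping.keys q. kill V (?s p m) * kill V (?s q n))"
    by (auto simp: kill_sum kill_single mult_single lookup_add intro!: sum.cong)
  also have "\<dots> = kill V p * kill V q"
  proof -
    have "kill V r = (\<Sum>m\<in>Poly_Mapping.keys r. kill V (?s r m))" for r
      by (metis kill_sum poly_mapping_sum_single)
    from this[of p] this[of q] show ?thesis by (simp only: sum_product)
  qed
  finally show ?thesis .
qed

lemma kill_Var: "kill V (Var v) = (if v \<in> V then 0 else Var v)"
  by (auto simp: Var_def kill_single lookup_single when_def)

lemma kill_Const [simp]: "kill V (Const c) = Const c"
  by (simp add: Const_def kill_single)

lemma Var_neq_0 [simp]: "Var v \<noteq> (0 :: ('v, 'k::field) mpoly)"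
  by (metis Var_def lookup_single_eq lookup_zero one_neq_zero)

lemma diff_kill_in_ideal: "p - kill V p \<in> ideal_gen (Var ` V)"
proof -
  let ?s = "\<lambda>m. Poly_Mapping.single m (Poly_Mapping.lookup p m)"
  have "p - kill V p = (\<Sum>m\<in>Poly_Mapping.keys p. ?s m) - kill V (\<Sum>m\<in>Poly_Mapping.keys p. ?s m)"
    using poly_mapping_sum_single[of p] by simp
  also have "\<dots> = (\<Sum>m\<in>Poly_Mapping.keys p. ?s m - kill V (?s m))"
    by (simp add: kill_sum sum_subtractf)
  also have "\<dots> \<in> ideal_gen (Var ` V)"
  proof (rule is_ideal_sum[OF is_ideal_ideal_gen])
    fix m
    show "?s m - kill V (?s m) \<in> ideal_gen (Var ` V)"
    proof (cases "\<forall>v\<in>V. Poly_Mapping.lookup m v = 0")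
      case True
      then show ?thesis by (simp add: kill_single is_ideal_0[OF is_ideal_ideal_gen])
    next
      case False
      then obtain v where v: "v \<in> V" "Poly_Mapping.lookup m v \<noteq> 0" by blast
      have "m = (m - Poly_Mapping.single v 1) + Poly_Mapping.single v 1"
        using v by (intro poly_mapping_eqI) (auto simp: lookup_add lookup_minus lookup_single when_def)
      then have "?s m = Poly_Mapping.single (m - Poly_Mapping.single v 1) (Poly_Mapping.lookup p m) * Var v"
        by (simp add: Var_def mult_single)
      also have "\<dots> \<in> ideal_gen (Var ` V)" using v by (intro is_ideal_mult) (auto intro: ideal_gen_base)
      finally show ?thesis using False unfolding kill_single by (simp only: if_False diff_zero)
    qed
  qed
  finally show ?thesis .
qed

lemma ideal_gen_Var: "p \<in> ideal_gen (Var ` V) \<longleftrightarrow> kill V p = 0"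
proof
  assume "kill V p = 0"
  then show "p \<in> ideal_gen (Var ` V)" using diff_kill_in_ideal[of p V] by simp
next
  have "is_ideal {p :: ('a, 'b) mpoly. kill V p = 0}"
    by (rule is_idealI) (simp_all add: kill_add kill_mult)
  then have "ideal_gen (Var ` V) \<subseteq> {p :: ('a, 'b) mpoly. kill V p = 0}"
    by (rule ideal_gen_least) (auto simp: kill_Var)
  then show "p \<in> ideal_gen (Var ` V) \<Longrightarrow> kill V p = 0" by auto
qed

lemma Const_in_ideal_gen_Var: "Const c \<in> ideal_gen (Var ` V) \<longleftrightarrow> c = 0"
  by (simp add: ideal_gen_Var)

lemma Var_in_ideal_gen_Var: "Var v \<in> (ideal_gen (Var ` V) :: ('v, 'k::field) mpoly set) \<longleftrightarrow> v \<in> V"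
  by (simp add: ideal_gen_Var kill_Var)

text \<open>The ideal is the kernel of a multiplicative map into a domain. The linear order of the
  variables orders the monomials, which is what excludes zero divisors.\<close>

lemma prime_ideal_Var:
  "prime_ideal (ideal_gen (Var ` V) :: ('v::{finite, linorder}, 'k::field) mpoly set)"
proof -
  have "1 \<notin> (ideal_gen (Var ` V) :: ('v, 'k) mpoly set)"
    using Const_in_ideal_gen_Var[of "1::'k" V] by simp
  then show ?thesis unfolding prime_ideal_def by (auto simp: ideal_gen_Var kill_mult)
qed

lemma irrelevant_ideal_hpart:
  fixes p :: "('v::finite, 'k::field) mpoly"
  shows "p \<in> irrelevant_ideal \<longleftrightarrow> hpart 0 p = 0"
proof -
  have "(\<forall>v. Poly_Mapping.lookup m v = 0) \<longleftrightarrow> m = 0" for m :: "'v \<Rightarrow>\<^sub>0 nat"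
    by (auto intro: poly_mapping_eqI)
  then have "kill UNIV p = hpart 0 p"
    by (intro poly_mapping_eqI) (simp add: lookup_kill lookup_hpart)
  then show ?thesis unfolding irrelevant_ideal_def by (simp add: ideal_gen_Var)
qed

lemma homogeneous_in_irrelevant:
  fixes p :: "('v::finite, 'k::field) mpoly"
  shows "homogeneous d p \<Longrightarrow> 0 < d \<Longrightarrow> p \<in> irrelevant_ideal"
  by (simp add: irrelevant_ideal_hpart hpart_homogeneous)

lemma proper_hclosed_subset:
  fixes T :: "('v::finite, 'k::field) mpoly set"
  assumes "is_ideal T" "hclosed T" "T \<noteq> UNIV"
  shows "T \<subseteq> irrelevant_ideal"
proof
  fix p assume p: "p \<in> T"
  obtain c where c: "hpart 0 p = Const c"
    using homogeneous_hpart[of 0 p] homogeneous_0_iff[of "hpart 0 p"] by auto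
  have "Const c * 1 \<in> T" using hclosedD[OF assms(2) p, of 0] c by simp
  then have "c = 0" using assms is_ideal_Const_cancel is_ideal_eq_UNIV by blast
  then show "p \<in> irrelevant_ideal" using c by (simp add: irrelevant_ideal_hpart)
qed

lemma prime_ideal_power:
  assumes "prime_ideal P" "a ^ n \<in> P"
  shows "a \<in> P"
  using assms(2)
proof (induction n)
  case 0
  then show ?case using assms(1) is_ideal_eq_UNIV[of P] by (simp add: prime_ideal_def)
next
  case (Suc n)
  then show ?case using assms(1) by (auto simp: prime_ideal_def)
qed

text \<open>A prime that contains all variables consists of elements without constant term, since
  otherwise it would contain a unit.\<close>

lemma prime_over_powers:
  fixes P :: "('v::finite, 'k::field) mpoly set"
  assumes P: "prime_ideal P" and pow: "\<And>v. \<exists>N. Var v ^ N \<in> P"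
  shows "P = irrelevant_ideal"
proof
  have I: "is_ideal P" "P \<noteq> UNIV" using P by (auto simp: prime_ideal_def)
  show M: "irrelevant_ideal \<subseteq> P"
    unfolding irrelevant_ideal_def using P pow I by (intro ideal_gen_least) (auto dest: prime_ideal_power)
  show "P \<subseteq> irrelevant_ideal"
  proof
    fix p assume p: "p \<in> P"
    obtain c where c: "hpart 0 p = Const c"
      using homogeneous_hpart[of 0 p] homogeneous_0_iff[of "hpart 0 p"] by auto
    have "p - hpart 0 p \<in> irrelevant_ideal"
      by (simp add: irrelevant_ideal_hpart hpart_diff hpart_homogeneous[OF homogeneous_hpart[of 0 p, simplified], of 0, simplified])
    then have "Const c * 1 \<in> P" using M p c I by (metis is_ideal_diff_cancel mult.right_neutral subsetD)
    then have "c = 0" using I is_ideal_Const_cancel is_ideal_eq_UNIV by blast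
    then show "p \<in> irrelevant_ideal" using c by (simp add: irrelevant_ideal_hpart)
  qed
qed

text \<open>Choose a_i in the (i + 1)-st prime but not in the i-th. It is not a zero divisor modulo
  the i-th prime, so the chain behaves like the ideals of a regular sequence, and an algebraic
  relation among the a_i would put a nonzero constant into a prime.\<close>

lemma prime_chain_length_le:
  fixes Q :: "nat \<Rightarrow> ('v::finite, 'k::field) mpoly set"
  assumes Q: "\<And>i. i \<le> n \<Longrightarrow> prime_ideal (Q i)" "\<And>i. i < n \<Longrightarrow> Q i \<subset> Q (Suc i)"
  shows "n \<le> CARD('v)"
proof (rule ccontr)
  assume "\<not> ?thesis"
  then have n: "Suc CARD('v) \<le> n" by simp
  have "\<exists>a. i < n \<longrightarrow> a \<in> Q (Suc i) \<and> a \<notin> Q i" for i using Q(2)[of i] by auto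
  then obtain a where a: "\<And>i. i < n \<Longrightarrow> a i \<in> Q (Suc i) \<and> a i \<notin> Q i" by metis
  define as where "as = map a [0..<Suc CARD('v)]"
  have len: "length as = Suc CARD('v)" by (simp add: as_def)
  have nth: "as ! i = a i" if "i < length as" for i
    using that by (simp add: as_def del: upt_Suc)
  obtain E c where "finite E" "E \<noteq> {}" "\<forall>e\<in>E. length e = length as \<and> c e \<noteq> 0"
    "(\<Sum>e\<in>E. Const (c e) * prod_list (map2 (^) as e)) = 0"
    using algebraically_dependent[OF len] by (elim exE conjE) (rule that)
  note * = this
  have E: "finite E" "E \<noteq> {}" "\<And>e. e \<in> E \<Longrightarrow> length e = length as"
    "\<And>e. e \<in> E \<Longrightarrow> c e \<noteq> 0" "(\<Sum>e\<in>E. Const (c e) * prod_list (map2 (^) as e)) = 0"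
    using * by simp_all
  \<comment> \<open>The chain is continued by the unit ideal, because
    \<open>coefficient_in_chain\<close> asks for an ideal at every index.\<close>
  let ?Q = "\<lambda>i. if i \<le> n then Q i else UNIV"
  have "\<exists>e\<in>E. Const (c e) \<in> ?Q (length as)"
  proof (rule coefficient_in_chain[of ?Q as E "\<lambda>e. Const (c e)"])
    show "is_ideal (?Q i)" for i
      using Q(1)[of i] by (auto simp: prime_ideal_def intro!: is_idealI)
    show "g \<in> ?Q i" if "i < length as" "as ! i * g \<in> ?Q i" for i g
      using that Q(1)[of i] a[of i] nth[of i] len n by (auto simp: prime_ideal_def split: if_splits)
    show "as ! i \<in> ?Q (Suc i)" if "i < length as" for i
      using that a[of i] nth[of i] len n by auto
    show "?Q i \<subseteq> ?Q (Suc i)" if "i < length as" for i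
      using that Q(2)[of i] len n by auto
    show "(\<Sum>e\<in>E. Const (c e) * prod_list (map2 (^) as e)) \<in> ?Q 0"
      using E(5) Q(1)[of 0] by (simp add: prime_ideal_def is_ideal_0)
  qed (use E in auto)
  then obtain e where e: "e \<in> E" "Const (c e) * 1 \<in> Q (length as)" using len n by auto
  have "is_ideal (Q (length as))" "Q (length as) \<noteq> UNIV"
    using Q(1)[of "length as"] len n by (auto simp: prime_ideal_def)
  then show False using E(4)[OF e(1)] e(2) is_ideal_Const_cancel is_ideal_eq_UNIV by blast
qed

lemma prime_height_irrelevant: "prime_height (irrelevant_ideal :: (3, 'k::field) mpoly set) = 3"
proof -
  define Q :: "nat \<Rightarrow> (3, 'k) mpoly set" where
    "Q = (\<lambda>i. ideal_gen (Var ` (if i = 0 then {} else if i = 1 then {0} else if i = 2 then {0, 1} else UNIV)))"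
  have neq: "(0::3) \<noteq> 1" "(0::3) \<noteq> 2" "(1::3) \<noteq> 2" by simp_all
  have "Q i \<subset> Q (Suc i)" if "i < 3" for i
  proof -
    have "i = 0 \<or> i = 1 \<or> i = 2" using that by auto
    then have "Var (of_nat i) \<in> Q (Suc i)" "Var (of_nat i) \<notin> Q i"
      using neq by (auto simp: Q_def Var_in_ideal_gen_Var simp del: ideal_gen_empty image_empty image_insert)
    moreover have "Q i \<subseteq> Q (Suc i)" unfolding Q_def by (intro ideal_gen_mono image_mono) auto
    ultimately show ?thesis by blast
  qed
  moreover have "prime_ideal (Q i)" for i unfolding Q_def by (rule prime_ideal_Var)
  moreover have "Q 3 = irrelevant_ideal" by (simp add: Q_def irrelevant_ideal_def)
  ultimately have "enat 3 \<in> {enat n |n. \<exists>Q :: nat \<Rightarrow> (3, 'k) mpoly set.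
     (\<forall>i\<le>n. prime_ideal (Q i)) \<and> (\<forall>i<n. Q i \<subset> Q (Suc i)) \<and> Q n = irrelevant_ideal}"
    by blast
  then have "enat 3 \<le> prime_height (irrelevant_ideal :: (3, 'k) mpoly set)"
    unfolding prime_height_def by (rule Sup_upper)
  moreover have "prime_height (irrelevant_ideal :: (3, 'k) mpoly set) \<le> enat 3"
    unfolding prime_height_def
  proof (rule Sup_least, clarify)
    fix n and Q :: "nat \<Rightarrow> (3, 'k) mpoly set"
    assume "\<forall>i\<le>n. prime_ideal (Q i)" "\<forall>i<n. Q i \<subset> Q (Suc i)"
    then show "enat n \<le> enat 3" using prime_chain_length_le[of n Q] by simp
  qed
  ultimately show ?thesis by (simp add: numeral_eq_enat)
qed

text \<open>The irrelevant ideal is the only prime above \<open>T\<close>.\<close>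

lemma ideal_height_eq_3:
  fixes T :: "(3, 'k::field) mpoly set"
  assumes "is_ideal T" "T \<subseteq> irrelevant_ideal" "\<And>v. \<exists>N. Var v ^ N \<in> T"
  shows "ideal_height T = 3"
proof -
  have "prime_ideal (irrelevant_ideal :: (3, 'k) mpoly set)"
    unfolding irrelevant_ideal_def by (rule prime_ideal_Var)
  moreover have "P = irrelevant_ideal" if "prime_ideal P" "T \<subseteq> P" for P
    using that assms(3) by (intro prime_over_powers) blast+
  ultimately have "{prime_height P |P. prime_ideal P \<and> T \<subseteq> P} = {3}"
    using assms(2) prime_height_irrelevant by force
  then show ?thesis unfolding ideal_height_def by simp
qed

section \<open>Duality modulo a regular sequence of length three\<close>

text \<open>Exactness of the Koszul complex at the module of relations: the relation is solved for
  \<open>a3\<close> modulo \<open>r1\<close> and \<open>r2\<close>, then for \<open>a2\<close>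
  modulo \<open>r1\<close>, and \<open>a1\<close> is then determined.\<close>

lemma koszul_exact_1:
  fixes r1 r2 r3 :: "'a::idom"
  assumes "regular_sequence [r1, r2, r3]" and 0: "a1 * r1 + a2 * r2 + a3 * r3 = 0"
  obtains b1 b2 b3 where "a1 = r2 * b3 - r3 * b2" "a2 = r3 * b1 - r1 * b3" "a3 = r1 * b2 - r2 * b1"
proof -
  note reg = assms(1)[unfolded regular_sequence_3]
  have "r3 * a3 = (a1 * r1 + a2 * r2 + a3 * r3) + ((- a1) * r1 + (- a2) * r2)"
    by (simp add: algebra_simps)
  then have "r3 * a3 = (- a1) * r1 + (- a2) * r2" using 0 by simp
  then have "r3 * a3 \<in> ideal_gen {r1, r2}" unfolding mem_ideal_gen_2 by blast
  then have "a3 \<in> ideal_gen {r1, r2}" using reg by blast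
  then obtain u v where a3: "a3 = u * r1 + v * r2" unfolding mem_ideal_gen_2 by blast
  have "r2 * (a2 + v * r3) = a1 * r1 + a2 * r2 + a3 * r3 + (- (a1 + u * r3)) * r1"
    unfolding a3 by (simp add: algebra_simps)
  then have "r2 * (a2 + v * r3) = (- (a1 + u * r3)) * r1" using 0 by simp
  then have "r2 * (a2 + v * r3) \<in> ideal_gen {r1}" unfolding mem_ideal_gen_1 by blast
  then have "a2 + v * r3 \<in> ideal_gen {r1}" using reg by blast
  then obtain w where w: "a2 + v * r3 = w * r1" unfolding mem_ideal_gen_1 by blast
  have "r1 * (a1 + u * r3 + w * r2) = a1 * r1 + a2 * r2 + a3 * r3 + r2 * (w * r1 - (a2 + v * r3))"
    unfolding a3 by (simp add: algebra_simps)
  then have "r1 * (a1 + u * r3 + w * r2) = 0" using 0 w by simp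
  then have z: "a1 + u * r3 + w * r2 = 0" using reg by blast
  show thesis
  proof (rule that[of "- w" u "- v"])
    have "a1 = (a1 + u * r3 + w * r2) + (r2 * (- w) - r3 * u)" by (simp add: algebra_simps)
    then show "a1 = r2 * (- w) - r3 * u" using z by simp
    have "a2 = (a2 + v * r3) + r3 * (- v)" by (simp add: algebra_simps)
    then show "a2 = r3 * (- v) - r1 * (- w)" unfolding w by (simp add: algebra_simps)
    show "a3 = r1 * u - r2 * (- v)" using a3 by (simp add: algebra_simps)
  qed
qed

text \<open>Exactness of the Koszul complex one place further. Two of the three equations of a
  vanishing cross product suffice, because \<open>r1\<close> can be cancelled.\<close>

lemma koszul_exact_2:
  fixes r1 r2 r3 :: "'a::idom"
  assumes "regular_sequence [r1, r2, r3]"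
    and "r1 * b2 = r2 * b1" "r1 * b3 = r3 * b1"
  obtains c where "b1 = c * r1" "b2 = c * r2" "b3 = c * r3"
proof -
  note reg = assms(1)[unfolded regular_sequence_3]
  have "r2 * b1 = b2 * r1" using assms(2) by (simp add: mult.commute)
  then have "r2 * b1 \<in> ideal_gen {r1}" unfolding mem_ideal_gen_1 by blast
  then have "b1 \<in> ideal_gen {r1}" using reg by blast
  then obtain c where c: "b1 = c * r1" unfolding mem_ideal_gen_1 by blast
  have "r1 * (b2 - c * r2) = 0" "r1 * (b3 - c * r3) = 0"
    using assms(2,3) c by (simp_all add: algebra_simps)
  then have "b2 - c * r2 = 0" "b3 - c * r3 = 0" using reg by blast+
  with c that[of c] show thesis by simp
qed

section \<open>Comparison of the Koszul complexes of the variables and of three forms\<close>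

type_synonym 'a triple = "'a \<times> 'a \<times> 'a"

fun dot3 :: "'a::comm_ring_1 triple \<Rightarrow> 'a triple \<Rightarrow> 'a" where
  "dot3 (a, b, c) (d, e, f) = a * d + b * e + c * f"

fun cross3 :: "'a::comm_ring_1 triple \<Rightarrow> 'a triple \<Rightarrow> 'a triple" where
  "cross3 (a, b, c) (d, e, f) = (b * f - c * e, c * d - a * f, a * e - b * d)"

fun scale3 :: "'a::comm_ring_1 \<Rightarrow> 'a triple \<Rightarrow> 'a triple" where
  "scale3 s (a, b, c) = (s * a, s * b, s * c)"

text \<open>A chase through the double complex of the Koszul complexes of \<open>(x, y, z)\<close> and of \<open>g\<close>: it starts
  at a socle element \<open>a\<close> modulo \<open>(g)\<close> and ends at a scalar \<open>\<delta>\<close>, well defined modulo the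
  irrelevant ideal.\<close>

definition koszul_lift ::
    "(3, 'k::field) mpoly triple \<Rightarrow> (3, 'k) mpoly \<Rightarrow> (3, 'k) mpoly \<Rightarrow> bool" where
  "koszul_lift g a \<delta> \<longleftrightarrow> (\<exists>ax ay az cxy cxz cyz.
     Var 0 * a = dot3 ax g \<and> Var 1 * a = dot3 ay g \<and> Var 2 * a = dot3 az g \<and>
     scale3 (Var 0) ay - scale3 (Var 1) ax = cross3 g cxy \<and>
     scale3 (Var 0) az - scale3 (Var 2) ax = cross3 g cxz \<and>
     scale3 (Var 1) az - scale3 (Var 2) ay = cross3 g cyz \<and>
     scale3 (Var 0) cyz - scale3 (Var 1) cxz + scale3 (Var 2) cxy = scale3 \<delta> g)"

lemma UNIV_3: "(UNIV :: 3 set) = {0, 1, 2}"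
proof -
  have "x = 0 \<or> x = 1 \<or> x = 2" for x :: 3
  proof (induct x)
    case (of_int z)
    then have "z = 0 \<or> z = 1 \<or> z = 2" by auto
    then show ?case by auto
  qed
  then show ?thesis by auto
qed

lemma irrelevant_ideal_3: "irrelevant_ideal = ideal_gen {Var 0, Var 1, Var (2::3)}"
  unfolding irrelevant_ideal_def UNIV_3 by simp

lemma regular_sequence_Var: "regular_sequence [Var 0, Var 1, Var 2 :: (3, 'k::field) mpoly]"
proof -
  have 1: "prime_ideal (ideal_gen {Var 0 :: (3, 'k) mpoly})"
    using prime_ideal_Var[of "{0::3}"] by simp
  have 2: "prime_ideal (ideal_gen {Var 0, Var 1 :: (3, 'k) mpoly})"
    using prime_ideal_Var[of "{0::3, 1}"] by simp
  have 3: "Var 1 \<notin> ideal_gen {Var 0 :: (3, 'k) mpoly}"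
    using Var_in_ideal_gen_Var[of 1 "{0::3}"] by simp
  have 4: "Var 2 \<notin> ideal_gen {Var 0, Var 1 :: (3, 'k) mpoly}"
    using Var_in_ideal_gen_Var[of 2 "{0::3, 1}"] by simp
  have 5: "ideal_gen {Var 0, Var 1, Var 2 :: (3, 'k) mpoly} \<noteq> UNIV"
    using prime_ideal_Var[of "UNIV :: 3 set", where ?'k = 'k] unfolding prime_ideal_def UNIV_3 by simp
  show ?thesis unfolding regular_sequence_3
  proof (intro conjI allI impI)
    fix g :: "(3, 'k) mpoly"
    show "Var 0 * g = 0 \<Longrightarrow> g = 0" by simp
    show "Var 1 * g \<in> ideal_gen {Var 0} \<Longrightarrow> g \<in> ideal_gen {Var 0}"
      using 1 3 unfolding prime_ideal_def by blast
    show "Var 2 * g \<in> ideal_gen {Var 0, Var 1} \<Longrightarrow> g \<in> ideal_gen {Var 0, Var 1}"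
      using 2 4 unfolding prime_ideal_def by blast
  qed (rule 5)
qed

lemma koszul_exact_1_triple:
  fixes g u :: "'a::idom triple"
  assumes "regular_sequence [fst g, fst (snd g), snd (snd g)]" "dot3 u g = 0"
  obtains c where "u = cross3 g c"
proof -
  obtain g1 g2 g3 u1 u2 u3 where [simp]: "g = (g1, g2, g3)" "u = (u1, u2, u3)"
    by (metis prod.collapse)
  obtain b1 b2 b3 where "u1 = g2 * b3 - g3 * b2" "u2 = g3 * b1 - g1 * b3" "u3 = g1 * b2 - g2 * b1"
  proof (rule koszul_exact_1)
    show "regular_sequence [g1, g2, g3]" "u1 * g1 + u2 * g2 + u3 * g3 = 0" using assms by simp_all
  qed
  then show thesis using that[of "(b1, b2, b3)"] by simp
qed

text \<open>Each row of the chase is found by exactness of the Koszul complex of \<open>g\<close>: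
  the row before it, combined with the variables as in their own Koszul complex, is a cycle.\<close>

lemma koszul_lift_ex:
  fixes g :: "(3, 'k::field) mpoly triple"
  assumes reg: "regular_sequence [fst g, fst (snd g), snd (snd g)]"
    and soc: "\<And>v. Var v * a \<in> ideal_gen {fst g, fst (snd g), snd (snd g)}"
  obtains \<delta> where "koszul_lift g a \<delta>"
proof -
  obtain g1 g2 g3 where g: "g = (g1, g2, g3)" by (metis prod.collapse)
  have "\<exists>u. Var v * a = dot3 u g" for v
    using soc[of v] unfolding mem_ideal_gen_3 g by (auto intro!: exI[of _ "(_, _, _)"])
  then obtain ax ay az where a: "Var 0 * a = dot3 ax g" "Var 1 * a = dot3 ay g" "Var 2 * a = dot3 az g"
    by meson
  have lin: "dot3 (scale3 s u - scale3 t v) g = s * dot3 u g - t * dot3 v g"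
    for s t and u v :: "(3, 'k) mpoly triple"
    unfolding g by (cases u; cases v) (simp add: algebra_simps)
  have "dot3 (scale3 (Var 0) ay - scale3 (Var 1) ax) g = 0"
    "dot3 (scale3 (Var 0) az - scale3 (Var 2) ax) g = 0"
    "dot3 (scale3 (Var 1) az - scale3 (Var 2) ay) g = 0"
    unfolding lin by (simp_all add: mult.left_commute flip: a)
  then obtain cxy cxz cyz where c:
    "scale3 (Var 0) ay - scale3 (Var 1) ax = cross3 g cxy"
    "scale3 (Var 0) az - scale3 (Var 2) ax = cross3 g cxz"
    "scale3 (Var 1) az - scale3 (Var 2) ay = cross3 g cyz"
    by (metis koszul_exact_1_triple[OF reg])
  let ?d = "scale3 (Var 0) cyz - scale3 (Var 1) cxz + scale3 (Var 2) cxy"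
  have "cross3 g (scale3 r u - scale3 s v + scale3 t w) =
      scale3 r (cross3 g u) - scale3 s (cross3 g v) + scale3 t (cross3 g w)"
    for r s t and u v w :: "(3, 'k) mpoly triple"
    unfolding g by (cases u; cases v; cases w) (simp add: algebra_simps)
  \<comment> \<open>The right-hand side applies two successive Koszul differentials of the
    variables, so its terms cancel in pairs.\<close>
  then have "cross3 g ?d = scale3 (Var 0) (scale3 (Var 1) az - scale3 (Var 2) ay)
    - scale3 (Var 1) (scale3 (Var 0) az - scale3 (Var 2) ax) + scale3 (Var 2) (scale3 (Var 0) ay - scale3 (Var 1) ax)"
    by (simp add: c)
  also have "\<dots> = 0"
    by (cases ax; cases ay; cases az) (simp add: algebra_simps zero_prod_def)
  finally have 0: "cross3 g ?d = 0" .
  obtain d1 d2 d3 where d: "?d = (d1, d2, d3)" by (metis prod.collapse)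
  have "g1 * d2 = g2 * d1" "g1 * d3 = g3 * d1"
    using 0 unfolding d by (simp_all add: g zero_prod_def algebra_simps)
  then obtain \<delta> where "d1 = \<delta> * g1" "d2 = \<delta> * g2" "d3 = \<delta> * g3"
    using koszul_exact_2[of g1 g2 g3 d2 d1 d3] reg by (auto simp: g)
  then have "?d = scale3 \<delta> g" unfolding d by (simp add: g)
  then have "koszul_lift g a \<delta>" unfolding koszul_lift_def using a c by blast
  then show thesis by (rule that)
qed

text \<open>Linearity of the chase. It lets one socle element be corrected by a multiple of another
  until the scalar at the end vanishes.\<close>

lemma koszul_lift_combine:
  assumes "koszul_lift g a d" "koszul_lift g a' d'"
  shows "koszul_lift g (s * a + s' * a') (s * d + s' * d')"
proof -
  obtain ax ay az cxy cxz cyz where 1: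
     "Var 0 * a = dot3 ax g" "Var 1 * a = dot3 ay g" "Var 2 * a = dot3 az g"
     "scale3 (Var 0) ay - scale3 (Var 1) ax = cross3 g cxy"
     "scale3 (Var 0) az - scale3 (Var 2) ax = cross3 g cxz"
     "scale3 (Var 1) az - scale3 (Var 2) ay = cross3 g cyz"
     "scale3 (Var 0) cyz - scale3 (Var 1) cxz + scale3 (Var 2) cxy = scale3 d g"
    using assms(1) unfolding koszul_lift_def by blast
  obtain ax' ay' az' cxy' cxz' cyz' where 2:
     "Var 0 * a' = dot3 ax' g" "Var 1 * a' = dot3 ay' g" "Var 2 * a' = dot3 az' g"
     "scale3 (Var 0) ay' - scale3 (Var 1) ax' = cross3 g cxy'"
     "scale3 (Var 0) az' - scale3 (Var 2) ax' = cross3 g cxz'"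
     "scale3 (Var 1) az' - scale3 (Var 2) ay' = cross3 g cyz'"
     "scale3 (Var 0) cyz' - scale3 (Var 1) cxz' + scale3 (Var 2) cxy' = scale3 d' g"
    using assms(2) unfolding koszul_lift_def by blast
  let ?c = "\<lambda>u v. scale3 s u + scale3 s' v"
  have dot: "dot3 (?c u v) g = s * dot3 u g + s' * dot3 v g" for u v
    by (cases u; cases v; cases g) (simp add: algebra_simps)
  have cross: "cross3 g (?c u v) = ?c (cross3 g u) (cross3 g v)" for u v
    by (cases u; cases v; cases g) (simp add: algebra_simps)
  have com: "scale3 t (?c u v) = ?c (scale3 t u) (scale3 t v)" for t u v
    by (cases u; cases v) (simp add: algebra_simps)
  have diff: "?c u v - ?c u' v' = ?c (u - u') (v - v')" "?c u v + ?c u' v' = ?c (u + u') (v + v')" for u v u' v'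
    by (cases u; cases v; cases u'; cases v'; simp add: algebra_simps)+
  have "?c (scale3 d g) (scale3 d' g) = scale3 (s * d + s' * d') g"
    by (cases g) (simp add: algebra_simps)
  then have last: "?c (scale3 (Var 0) cyz - scale3 (Var 1) cxz + scale3 (Var 2) cxy)
      (scale3 (Var 0) cyz' - scale3 (Var 1) cxz' + scale3 (Var 2) cxy') = scale3 (s * d + s' * d') g"
    by (simp only: 1 2)
  show ?thesis unfolding koszul_lift_def
    by (rule exI[of _ "?c ax ax'"], rule exI[of _ "?c ay ay'"], rule exI[of _ "?c az az'"],
        rule exI[of _ "?c cxy cxy'"], rule exI[of _ "?c cxz cxz'"], rule exI[of _ "?c cyz cyz'"])
      (simp only: dot cross com diff last 1(1-6)[symmetric] 2(1-6)[symmetric] distrib_left mult.left_commute[of _ s]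
        mult.left_commute[of _ s'] simp_thms)
qed

text \<open>The chase is run backwards: the Koszul complex of the variables is exact as well and
  removes the rows one after the other, from the last to the first.\<close>

lemma koszul_lift_irrelevant:
  fixes g :: "(3, 'k::field) mpoly triple"
  assumes lift: "koszul_lift g a \<delta>" and \<delta>: "\<delta> \<in> irrelevant_ideal"
  shows "a \<in> ideal_gen {fst g, fst (snd g), snd (snd g)}"
proof -
  let ?x = "Var 0 :: (3, 'k) mpoly" and ?y = "Var 1 :: (3, 'k) mpoly" and ?z = "Var 2 :: (3, 'k) mpoly"
  obtain ax ay az cxy cxz cyz where a:
     "?x * a = dot3 ax g" "?y * a = dot3 ay g" "?z * a = dot3 az g"
    and c: "scale3 ?x ay - scale3 ?y ax = cross3 g cxy"
     "scale3 ?x az - scale3 ?z ax = cross3 g cxz"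
     "scale3 ?y az - scale3 ?z ay = cross3 g cyz"
    and d: "scale3 ?x cyz - scale3 ?y cxz + scale3 ?z cxy = scale3 \<delta> g"
    using lift unfolding koszul_lift_def by blast
  obtain d1 d2 d3 where \<delta>': "\<delta> = d1 * ?x + d2 * ?y + d3 * ?z"
    using \<delta> unfolding irrelevant_ideal_3 mem_ideal_gen_3 by blast
  note reg = regular_sequence_Var[where ?'k = 'k]
  obtain g1 g2 g3 where g: "g = (g1, g2, g3)" by (metis prod.collapse)
  \<comment> \<open>Multiples of \<open>g\<close> do not change the cross products with
    \<open>g\<close>; these ones absorb \<open>\<delta>\<close>, so that the last row becomes
    0.\<close>
  define pyz pxz pxy where p: "pyz = cyz - scale3 d1 g" "pxz = cxz + scale3 d2 g" "pxy = cxy - scale3 d3 g"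
  have p0: "scale3 ?x pyz - scale3 ?y pxz + scale3 ?z pxy = 0"
  proof -
    have "scale3 ?x pyz - scale3 ?y pxz + scale3 ?z pxy =
        (scale3 ?x cyz - scale3 ?y cxz + scale3 ?z cxy) - scale3 \<delta> g"
      unfolding p \<delta>' by (cases g; cases cyz; cases cxz; cases cxy) (simp add: algebra_simps)
    then show ?thesis using d by simp
  qed
  have pc: "cross3 g pyz = cross3 g cyz" "cross3 g pxz = cross3 g cxz" "cross3 g pxy = cross3 g cxy"
    unfolding p by (cases g; cases cyz; cases cxz; cases cxy; simp add: algebra_simps)+
  have comp: "\<exists>e f h. q = ?y * h - ?z * f \<and> r = ?x * h - ?z * e \<and> s = ?x * f - ?y * e"
    if "?x * q - ?y * r + ?z * s = 0" for q r s
  proof -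
    have "q * ?x + (- r) * ?y + s * ?z = 0" using that by (simp add: algebra_simps)
    then obtain e f h where "q = ?y * h - ?z * f" "- r = ?z * e - ?x * h" "s = ?x * f - ?y * e"
      using koszul_exact_1[OF reg] by metis
    moreover from this(2) have "r = - (?z * e - ?x * h)" by (metis minus_minus)
    then have "r = ?x * h - ?z * e" by simp
    ultimately show ?thesis by blast
  qed
  obtain q1 q2 q3 r1 r2 r3 s1 s2 s3 where qrs: "pyz = (q1, q2, q3)" "pxz = (r1, r2, r3)" "pxy = (s1, s2, s3)"
    by (metis prod.collapse)
  have "?x * q1 - ?y * r1 + ?z * s1 = 0" "?x * q2 - ?y * r2 + ?z * s2 = 0" "?x * q3 - ?y * r3 + ?z * s3 = 0"
    using p0 by (simp_all add: qrs zero_prod_def)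
  from this[THEN comp] obtain e1 f1 h1 e2 f2 h2 e3 f3 h3 where efh:
    "q1 = ?y * h1 - ?z * f1" "r1 = ?x * h1 - ?z * e1" "s1 = ?x * f1 - ?y * e1"
    "q2 = ?y * h2 - ?z * f2" "r2 = ?x * h2 - ?z * e2" "s2 = ?x * f2 - ?y * e2"
    "q3 = ?y * h3 - ?z * f3" "r3 = ?x * h3 - ?z * e3" "s3 = ?x * f3 - ?y * e3"
    by metis
  \<comment> \<open>After this correction the three rows satisfy the relations of a multiple of (x,
    y, z), and x can be cancelled from \<open>?x * a\<close>.\<close>
  define bx where "bx = ax - cross3 g (e1, e2, e3)"
  define by' where "by' = ay - cross3 g (f1, f2, f3)"
  define bz where "bz = az - cross3 g (h1, h2, h3)"
  have "scale3 ?x by' - scale3 ?y bx = cross3 g cxy - cross3 g pxy"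
    unfolding c(1)[symmetric] by'_def bx_def qrs efh
    by (cases g; cases ax; cases ay) (simp add: algebra_simps)
  then have 1: "scale3 ?x by' - scale3 ?y bx = 0" using pc by simp
  have "scale3 ?x bz - scale3 ?z bx = cross3 g cxz - cross3 g pxz"
    unfolding c(2)[symmetric] bz_def bx_def qrs efh
    by (cases g; cases ax; cases az) (simp add: algebra_simps)
  then have 2: "scale3 ?x bz - scale3 ?z bx = 0" using pc by simp
  obtain x1 x2 x3 y1 y2 y3 z1 z2 z3 where b: "bx = (x1, x2, x3)" "by' = (y1, y2, y3)" "bz = (z1, z2, z3)"
    by (metis prod.collapse)
  have ex: "\<exists>c. q = c * ?x" if "?x * r = ?y * q" "?x * s = ?z * q" for q r s
    using koszul_exact_2[OF reg that] by metis
  have "?x * y1 = ?y * x1" "?x * z1 = ?z * x1" "?x * y2 = ?y * x2" "?x * z2 = ?z * x2"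
    "?x * y3 = ?y * x3" "?x * z3 = ?z * x3"
    using 1 2 by (simp_all add: b zero_prod_def)
  then obtain t1 t2 t3 where t: "x1 = t1 * ?x" "x2 = t2 * ?x" "x3 = t3 * ?x" using ex by meson
  have "?x * a = dot3 bx g"
    unfolding bx_def a(1) by (cases g; cases ax) (simp add: algebra_simps)
  then have "?x * a = ?x * (t1 * g1 + t2 * g2 + t3 * g3)"
    by (simp add: b t g algebra_simps)
  then have "a = t1 * g1 + t2 * g2 + t3 * g3" by simp
  then show ?thesis unfolding mem_ideal_gen_3 g by auto
qed

text \<open>Every equation of the chase is homogeneous, so each datum may be replaced by its part in
  the fitting degree. Three multiplications by a variable add 3 to the degree of \<open>a\<close>,
  and the members of \<open>g\<close> account for the subtracted degrees.\<close>

lemma koszul_lift_hpart: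
  fixes g1 g2 g3 :: "(3, 'k::field) mpoly"
  assumes lift: "koszul_lift (g1, g2, g3) a \<delta>"
    and g: "homogeneous d1 g1" "homogeneous d2 g2" "homogeneous d3 g3" and a: "homogeneous e a"
  shows "koszul_lift (g1, g2, g3) a (hpart (int e + 3 - int d1 - int d2 - int d3) \<delta>)"
proof -
  let ?x = "Var 0 :: (3, 'k) mpoly" and ?y = "Var 1 :: (3, 'k) mpoly" and ?z = "Var 2 :: (3, 'k) mpoly"
  let ?g = "(g1, g2, g3)"
  obtain ax ay az cxy cxz cyz where *:
     "?x * a = dot3 ax ?g" "?y * a = dot3 ay ?g" "?z * a = dot3 az ?g"
     "scale3 ?x ay - scale3 ?y ax = cross3 ?g cxy"
     "scale3 ?x az - scale3 ?z ax = cross3 ?g cxz"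
     "scale3 ?y az - scale3 ?z ay = cross3 ?g cyz"
     "scale3 ?x cyz - scale3 ?y cxz + scale3 ?z cxy = scale3 \<delta> ?g"
    using lift unfolding koszul_lift_def by blast
  define H :: "int \<Rightarrow> int \<Rightarrow> int \<Rightarrow> int \<Rightarrow> (3, 'k) mpoly triple \<Rightarrow> (3, 'k) mpoly triple" where
    "H = (\<lambda>n k1 k2 k3 (u, v, w). (hpart (n + k1) u, hpart (n + k2) v, hpart (n + k3) w))"
  \<comment> \<open>The i-th components have degree e + 1 - d_i in the first rows (\<open>A\<close>)
    and e + 2 - d1 - d2 - d3 + d_i in the second rows (\<open>C\<close>); \<open>B\<close> and
    \<open>D\<close> take the matching parts of the equations between the rows.\<close>
  define A where "A = H (int e + 1) (- int d1) (- int d2) (- int d3)"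
  define B where "B = H (int e + 2) (- int d1) (- int d2) (- int d3)"
  define C where "C = H (int e + 2 - int d1 - int d2 - int d3) (int d1) (int d2) (int d3)"
  define D where "D = H (int e + 3 - int d1 - int d2 - int d3) (int d1) (int d2) (int d3)"
  have mult: "hpart n (g1 * p) = g1 * hpart (n - int d1) p" "hpart n (g2 * p) = g2 * hpart (n - int d2) p"
    "hpart n (g3 * p) = g3 * hpart (n - int d3) p" "hpart n (p * g1) = hpart (n - int d1) p * g1"
    "hpart n (p * g2) = hpart (n - int d2) p * g2" "hpart n (p * g3) = hpart (n - int d3) p * g3"
    "hpart n (Var v * p) = Var v * hpart (n - 1) p" "hpart n (p * Var v) = hpart (n - 1) p * Var v"
    for n p and v :: 3
    using g by (simp_all add: hpart_homogeneous_mult hpart_mult_homogeneous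
      hpart_homogeneous_mult[of "Suc 0"] hpart_mult_homogeneous[of "Suc 0"])
  have dot: "hpart (int e + 1) (dot3 u ?g) = dot3 (A u) ?g" for u
    by (cases u) (simp add: A_def H_def hpart_add mult algebra_simps)
  have va: "hpart (int e + 1) (Var v * a) = Var v * a" for v
    using hpart_homogeneous[OF a, of "int e"] by (simp add: mult)
  have sA: "B (scale3 (Var v) u - scale3 (Var w) u') = scale3 (Var v) (A u) - scale3 (Var w) (A u')" for v w u u'
    by (cases u; cases u') (simp add: A_def B_def H_def mult hpart_diff algebra_simps)
  have crossC: "B (cross3 ?g u) = cross3 ?g (C u)" for u
    by (cases u) (simp add: C_def B_def H_def mult hpart_diff algebra_simps)
  have sC: "D (scale3 (Var v) u - scale3 (Var w) u' + scale3 (Var r) u'') =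
      scale3 (Var v) (C u) - scale3 (Var w) (C u') + scale3 (Var r) (C u'')" for v w r u u' u''
    by (cases u; cases u'; cases u'') (simp add: C_def D_def H_def mult hpart_diff hpart_add algebra_simps)
  have D\<delta>: "D (scale3 \<delta> ?g) = scale3 (hpart (int e + 3 - int d1 - int d2 - int d3) \<delta>) ?g"
    by (simp add: D_def H_def mult algebra_simps)
  show ?thesis unfolding koszul_lift_def
  proof (intro exI conjI)
    show "?x * a = dot3 (A ax) ?g" "?y * a = dot3 (A ay) ?g" "?z * a = dot3 (A az) ?g"
      using *(1-3) by (metis dot va)+
    show "scale3 ?x (A ay) - scale3 ?y (A ax) = cross3 ?g (C cxy)"
      "scale3 ?x (A az) - scale3 ?z (A ax) = cross3 ?g (C cxz)"
      "scale3 ?y (A az) - scale3 ?z (A ay) = cross3 ?g (C cyz)"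
      using *(4-6) by (metis sA crossC)+
    show "scale3 ?x (C cyz) - scale3 ?y (C cxz) + scale3 ?z (C cxy) =
        scale3 (hpart (int e + 3 - int d1 - int d2 - int d3) \<delta>) ?g"
      using *(7) by (metis sC D\<delta>)
  qed
qed

section \<open>The socle of the quotient by three regular forms\<close>

locale graded_regular =
  fixes g1 g2 g3 :: "(3, 'k::field) mpoly" and d1 d2 d3 :: nat
  assumes regular: "regular_sequence [g1, g2, g3]"
    and hom: "homogeneous d1 g1" "homogeneous d2 g2" "homogeneous d3 g3"
begin

abbreviation L :: "(3, 'k) mpoly set" where "L \<equiv> ideal_gen {g1, g2, g3}"

abbreviation s :: nat where "s \<equiv> d1 + d2 + d3"

lemma hclosed_L: "hclosed L"
  using hom by (intro hclosed_ideal_gen) auto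

lemma L_proper: "L \<noteq> UNIV" "1 \<notin> L"
  using regular is_ideal_eq_UNIV[of L] unfolding regular_sequence_3 by auto

text \<open>The scalar at the end of the chase can be taken homogeneous of degree e + 3 - s; unless
  this is 0, it lies in the irrelevant ideal.\<close>

lemma socle_degree:
  assumes a: "homogeneous e a" and soc: "\<And>v. Var v * a \<in> L" and e: "e + 3 \<noteq> s"
  shows "a \<in> L"
proof -
  obtain \<delta> where "koszul_lift (g1, g2, g3) a \<delta>"
    using koszul_lift_ex[of "(g1, g2, g3)" a] regular soc by auto
  then have *: "koszul_lift (g1, g2, g3) a (hpart (int e + 3 - int d1 - int d2 - int d3) \<delta>)"
    using hom a by (rule koszul_lift_hpart)
  have "hpart (int e + 3 - int d1 - int d2 - int d3) \<delta> \<in> irrelevant_ideal"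
    using e by (auto simp: irrelevant_ideal_hpart intro!: poly_mapping_eqI simp: lookup_hpart when_def)
  with koszul_lift_irrelevant[OF *] show ?thesis by simp
qed

text \<open>In the socle degree both elements lift to constants, \<open>u\<close> and
  \<open>v\<close>; the combination whose constant is 0 lies in \<open>L\<close>.\<close>

lemma socle_dim:
  assumes a: "homogeneous e a" "\<And>v. Var v * a \<in> L" "a \<notin> L"
    and b: "homogeneous e b" "\<And>v. Var v * b \<in> L"
  shows "\<exists>c. b - Const c * a \<in> L"
proof -
  have e: "e + 3 = s" using socle_degree a by blast
  then have n: "int e + 3 - int d1 - int d2 - int d3 = int 0" by simp
  have ex: "\<exists>c. koszul_lift (g1, g2, g3) p (Const c)"
    if p: "homogeneous e p" "\<And>v. Var v * p \<in> L" for p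
  proof -
    obtain \<delta> where "koszul_lift (g1, g2, g3) p \<delta>"
      using koszul_lift_ex[of "(g1, g2, g3)" p] regular p by auto
    then have "koszul_lift (g1, g2, g3) p (hpart (int 0) \<delta>)"
      using koszul_lift_hpart[OF _ hom p(1), of \<delta>] n by simp
    moreover obtain c where "hpart (int 0) \<delta> = Const c"
      using homogeneous_hpart[of 0 \<delta>] homogeneous_0_iff by blast
    ultimately show ?thesis by auto
  qed
  obtain u v where uv: "koszul_lift (g1, g2, g3) a (Const u)" "koszul_lift (g1, g2, g3) b (Const v)"
    using ex[OF a(1,2)] ex[OF b(1,2)] by (elim exE) (rule that)
  have u: "u \<noteq> 0"
    using koszul_lift_irrelevant[OF uv(1)] a(3) by (auto simp: irrelevant_ideal_hpart)
  have "koszul_lift (g1, g2, g3) (1 * b + Const (- (v / u)) * a) (1 * Const v + Const (- (v / u)) * Const u)"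
    by (rule koszul_lift_combine[OF uv(2,1)])
  moreover have "1 * Const v + Const (- (v / u)) * Const u = (0 :: (3, 'k) mpoly)"
    using u by (simp flip: Const_mult Const_add)
  ultimately have "koszul_lift (g1, g2, g3) (b - Const (v / u) * a) 0"
    by (simp add: Const_uminus)
  from koszul_lift_irrelevant[OF this] have "b - Const (v / u) * a \<in> L"
    by (simp add: irrelevant_ideal_hpart)
  then show ?thesis ..
qed

lemma Var_power_in_L: "\<exists>N. Var v ^ N \<in> L"
  using power_in_regular_ideal[OF regular, of "Var v"] hom by auto

end

text \<open>A monomial of degree at least 3 N has an exponent of at least N.\<close>

lemma high_degree_in_ideal:
  fixes T :: "(3, 'k::field) mpoly set"
  assumes T: "is_ideal T" and N: "\<And>v. Var v ^ N \<in> T" and a: "homogeneous e a" "3 * N \<le> e"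
  shows "a \<in> T"
proof -
  have "Poly_Mapping.single m (Poly_Mapping.lookup a m) \<in> T" if "m \<in> Poly_Mapping.keys a" for m
  proof -
    have "monom_degree m = e" using a(1) that by (auto simp: homogeneous_def)
    then have "Poly_Mapping.lookup m 0 + Poly_Mapping.lookup m 1 + Poly_Mapping.lookup m 2 = e"
      unfolding monom_degree_UNIV UNIV_3 by simp
    then have "\<not> (Poly_Mapping.lookup m 0 < N \<and> Poly_Mapping.lookup m 1 < N \<and> Poly_Mapping.lookup m 2 < N)"
      using a(2) by linarith
    then obtain v where v: "N \<le> Poly_Mapping.lookup m v" unfolding not_le de_Morgan_conj not_less by blast
    have pow: "Var v ^ j = (Poly_Mapping.single (Poly_Mapping.single v j) 1 :: (3, 'k) mpoly)" for j
      by (induction j) (simp_all add: Var_def mult_single flip: single_add)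
    have "m = (m - Poly_Mapping.single v N) + Poly_Mapping.single v N"
      using v by (intro poly_mapping_eqI) (auto simp: lookup_add lookup_minus lookup_single when_def)
    then have "Poly_Mapping.single m (Poly_Mapping.lookup a m) =
        Poly_Mapping.single (m - Poly_Mapping.single v N) (Poly_Mapping.lookup a m) * Var v ^ N"
      by (simp add: pow mult_single)
    then show ?thesis by (simp only: is_ideal_mult[OF T N])
  qed
  then have "(\<Sum>m\<in>Poly_Mapping.keys a. Poly_Mapping.single m (Poly_Mapping.lookup a m)) \<in> T"
    by (intro is_ideal_sum[OF T])
  then show ?thesis using poly_mapping_sum_single[of a] by simp
qed

context graded_regular begin

text \<open>Descending induction from a degree beyond which everything lies in \<open>L\<close>: the
  products of \<open>a\<close> with the variables are in \<open>L\<close> by induction, so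
  \<open>a\<close> is a socle element in a wrong degree.\<close>

lemma above_socle:
  assumes "homogeneous e a" "s < e + 3"
  shows "a \<in> L"
proof -
  have "\<forall>v. \<exists>N. Var v ^ N \<in> L" using Var_power_in_L by blast
  from choice[OF this] obtain N where N: "\<And>v. Var v ^ N v \<in> L" by blast
  define M where "M = (\<Sum>v\<in>UNIV. N v)"
  have M: "Var v ^ M \<in> L" for v
  proof -
    have "N v \<le> M" unfolding M_def by (rule member_le_sum) auto
    then have "Var v ^ M = Var v ^ (M - N v) * (Var v ^ N v :: (3, 'k) mpoly)"
      by (simp flip: power_add)
    then show ?thesis using is_ideal_mult[OF is_ideal_ideal_gen N] by metis
  qed
  show ?thesis using assms
  proof (induction "3 * M - e" arbitrary: e a)
    case 0
    then show ?case using high_degree_in_ideal[OF is_ideal_ideal_gen M] by auto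
  next
    case (Suc n)
    have "Var v * a \<in> L" for v
      using Suc.hyps(1)[of "Suc e" "Var v * a"] Suc.hyps(2) Suc.prems homogeneous_mult[of "Suc 0" "Var v" e a]
      by auto
    then show ?case using socle_degree[OF Suc.prems(1)] Suc.prems(2) by simp
  qed
qed

text \<open>Nondegeneracy of the multiplication into the socle degree. In the induction on
  \<open>n\<close>, the product of \<open>a\<close> with a form of degree one less is a socle
  element below the socle degree.\<close>

lemma below_socle:
  assumes "homogeneous e a" "\<And>m. homogeneous n m \<Longrightarrow> a * m \<in> L" "e + n + 3 \<le> s"
  shows "a \<in> L"
  using assms
proof (induction n)
  case 0
  then show ?case using 0(2)[of 1] by simp
next
  case (Suc n)
  have "a * m \<in> L" if m: "homogeneous n m" for m
  proof (rule socle_degree)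
    show "homogeneous (e + n) (a * m)" using Suc.prems(1) m by (rule homogeneous_mult)
    show "Var v * (a * m) \<in> L" for v
      using Suc.prems(2)[of "Var v * m"] homogeneous_mult[of "Suc 0" "Var v" n m] m
      by (simp add: mult_ac)
  qed (use Suc.prems in simp)
  then show ?case using Suc.IH Suc.prems by simp
qed

end

text \<open>A subspace of a finite-dimensional space is cut out by the linear forms that vanish on
  it; the space is that of the values of the functionals \<open>\<phi>\<close>. The induction splits
  off one functional, which is either 0 on \<open>U\<close> or normalized to 1 at some
  \<open>u0\<close>.\<close>

lemma finite_dimensional_separation:
  fixes \<phi> :: "'i \<Rightarrow> ('v, 'k::field) mpoly \<Rightarrow> 'k"
  assumes "finite A"
    and add: "\<And>i a b. \<phi> i (a + b) = \<phi> i a + \<phi> i b"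
    and scale: "\<And>i c a. \<phi> i (Const c * a) = c * \<phi> i a"
    and "mvs.subspace U"
    and "\<And>l. (\<And>u. u \<in> U \<Longrightarrow> (\<Sum>i\<in>A. l i * \<phi> i u) = 0) \<Longrightarrow> (\<Sum>i\<in>A. l i * \<phi> i f) = 0"
  shows "\<exists>u\<in>U. \<forall>i\<in>A. \<phi> i (f - u) = 0"
  using assms(1,4,5)
proof (induction A arbitrary: U f rule: finite_induct)
  case empty
  then show ?case using mvs.subspace_0 by blast
next
  case (insert j A)
  have diff: "\<phi> i (a - b) = \<phi> i a - \<phi> i b" for i a b
    using add[of i "a - b" b] by simp
  have sum_split: "(\<Sum>i\<in>insert j A. l i * \<phi> i u) = l j * \<phi> j u + (\<Sum>i\<in>A. l i * \<phi> i u)" for l u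
    using insert.hyps by simp
  show ?case
  proof (cases "\<forall>u\<in>U. \<phi> j u = 0")
    case True
    have f: "\<phi> j f = 0"
    proof -
      have *: "(\<Sum>i\<in>insert j A. (if i = j then 1 else 0) * \<phi> i u) = \<phi> j u" for u
      proof -
        have "(\<Sum>i\<in>A. (if i = j then 1 else 0) * \<phi> i u) = 0"
          using insert.hyps by (intro sum.neutral) auto
        then show ?thesis unfolding sum_split by simp
      qed
      have "(\<Sum>i\<in>insert j A. (if i = j then 1 else 0) * \<phi> i f) = 0"
        using True by (intro insert.prems(2)) (simp only: *)
      then show ?thesis unfolding * .
    qed
    have "\<exists>u\<in>U. \<forall>i\<in>A. \<phi> i (f - u) = 0"
    proof (rule insert.IH[OF insert.prems(1)])
      fix l assume l: "\<And>u. u \<in> U \<Longrightarrow> (\<Sum>i\<in>A. l i * \<phi> i u) = 0"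
      have "(\<Sum>i\<in>insert j A. l i * \<phi> i f) = 0"
        using l True by (intro insert.prems(2)) (simp add: sum_split)
      then show "(\<Sum>i\<in>A. l i * \<phi> i f) = 0" using f by (simp add: sum_split)
    qed
    then show ?thesis using True f by (auto simp: diff)
  next
    case False
    then obtain u1 where u1: "u1 \<in> U" "\<phi> j u1 \<noteq> 0" by blast
    define u0 where "u0 = Const (inverse (\<phi> j u1)) * u1"
    have u0: "u0 \<in> U" "\<phi> j u0 = 1"
      using u1 mvs.subspace_scale[OF insert.prems(1)] by (auto simp: u0_def scale)
    define U' where "U' = {u \<in> U. \<phi> j u = 0}"
    have U': "mvs.subspace U'"
    proof (rule mvs.subspaceI)
      have "\<phi> j 0 = 0" using scale[of j 0 0] by simp
      then show "0 \<in> U'" using mvs.subspace_0[OF insert.prems(1)] by (simp add: U'_def)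
    qed (auto simp: U'_def add scale intro: mvs.subspace_add[OF insert.prems(1)]
          mvs.subspace_scale[OF insert.prems(1)])
    define f' where "f' = f - Const (\<phi> j f) * u0"
    have "\<exists>u\<in>U'. \<forall>i\<in>A. \<phi> i (f' - u) = 0"
    proof (rule insert.IH[OF U'])
      fix l assume l: "\<And>u. u \<in> U' \<Longrightarrow> (\<Sum>i\<in>A. l i * \<phi> i u) = 0"
      \<comment> \<open>The coefficient \<open>- s\<close> at \<open>j\<close> turns a relation on
        the kernel \<open>U'\<close> of the functional \<open>j\<close> into a relation on all of
        \<open>U\<close>.\<close>
      define s where "s = (\<Sum>i\<in>A. l i * \<phi> i u0)"
      have red: "(\<Sum>i\<in>A. l i * \<phi> i (u - Const (\<phi> j u) * u0)) = (\<Sum>i\<in>A. l i * \<phi> i u) - \<phi> j u * s" for u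
        by (simp add: diff scale s_def right_diff_distrib sum_subtractf sum_distrib_left mult.left_commute)
      have *: "(\<Sum>i\<in>insert j A. (if i = j then - s else l i) * \<phi> i u) = (\<Sum>i\<in>A. l i * \<phi> i u) - \<phi> j u * s" for u
      proof -
        have "(\<Sum>i\<in>A. (if i = j then - s else l i) * \<phi> i u) = (\<Sum>i\<in>A. l i * \<phi> i u)"
          using insert.hyps by (intro sum.cong) auto
        then show ?thesis unfolding sum_split by simp
      qed
      have "(\<Sum>i\<in>insert j A. (if i = j then - s else l i) * \<phi> i f) = 0"
      proof (rule insert.prems(2))
        fix u assume u: "u \<in> U"
        have "u - Const (\<phi> j u) * u0 \<in> U'"
          using u u0 mvs.subspace_diff[OF insert.prems(1)] mvs.subspace_scale[OF insert.prems(1)]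
          by (auto simp: U'_def diff scale)
        from l[OF this] show "(\<Sum>i\<in>insert j A. (if i = j then - s else l i) * \<phi> i u) = 0"
          by (simp only: red *)
      qed
      then show "(\<Sum>i\<in>A. l i * \<phi> i f') = 0" by (simp only: f'_def red *)
    qed
    then obtain u where u: "u \<in> U'" "\<forall>i\<in>A. \<phi> i (f' - u) = 0" by blast
    let ?w = "Const (\<phi> j f) * u0 + u"
    have "?w \<in> U"
      using u u0 mvs.subspace_add[OF insert.prems(1)] mvs.subspace_scale[OF insert.prems(1)]
      by (auto simp: U'_def)
    moreover have "\<phi> j (f - ?w) = 0" using u u0 by (simp add: U'_def diff add scale)
    moreover have "\<forall>i\<in>A. \<phi> i (f - ?w) = 0"
    proof -
      have "f - ?w = f' - u" by (simp add: f'_def)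
      then show ?thesis using u(2) by (simp only:)
    qed
    ultimately show ?thesis by blast
  qed
qed

section \<open>Double annihilators and links\<close>

context graded_regular begin

text \<open>The pairing between the ideal and its annihilator takes the coefficient \<open>\<tau>\<close> of a product along a socle generator \<open>w\<close>.\<close>

theorem double_colon:
  assumes I: "is_ideal I" "hclosed I" "L \<subseteq> I"
  shows "ideal_colon L (ideal_colon L I) = I"
proof
  show "I \<subseteq> ideal_colon L (ideal_colon L I)"
  proof
    fix t assume t: "t \<in> I"
    have "t * g \<in> L" if "g \<in> ideal_colon L I" for g
    proof -
      have "g * t \<in> L" using that t by (simp add: mem_ideal_colon)
      then show ?thesis by (simp only: mult.commute)
    qed
    then show "t \<in> ideal_colon L (ideal_colon L I)" by (subst mem_ideal_colon) blast
  qed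
  have LI: "is_ideal L" by simp
  have s3: "3 \<le> s"
  proof (rule ccontr)
    assume "\<not> 3 \<le> s"
    then have "1 \<in> L" by (intro above_socle[of 0]) auto
    then show False using L_proper by simp
  qed
  \<comment> \<open>If \<open>L\<close> contained all forms of the socle degree, nondegeneracy would
    put 1 into \<open>L\<close>.\<close>
  have "\<exists>w. homogeneous (s - 3) w \<and> w \<notin> L"
  proof (rule ccontr)
    assume *: "\<not> ?thesis"
    have "1 \<in> L"
    proof (rule below_socle[of 0 1 "s - 3"])
      show "1 * m \<in> L" if "homogeneous (s - 3) m" for m using * that by simp
    qed (use s3 in auto)
    then show False using L_proper by simp
  qed
  then obtain w where w: "homogeneous (s - 3) w" "w \<notin> L" by blast
  have soc: "Var v * p \<in> L" if "homogeneous (s - 3) p" for p v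
    using that s3 homogeneous_mult[OF homogeneous_Var[of v] that] by (intro above_socle) auto
  have ex: "\<exists>c. hpart (int (s - 3)) p - Const c * w \<in> L" for p
    using socle_dim[OF w(1) soc[OF w(1)] w(2) homogeneous_hpart soc[OF homogeneous_hpart]] .
  define \<tau> where "\<tau> p = (SOME c. hpart (int (s - 3)) p - Const c * w \<in> L)" for p
  have \<tau>: "hpart (int (s - 3)) p - Const (\<tau> p) * w \<in> L" for p
    unfolding \<tau>_def using ex by (rule someI_ex)
  have unique: "\<tau> p = c" if "hpart (int (s - 3)) p - Const c * w \<in> L" for p c
  proof (rule ccontr)
    assume ne: "\<tau> p \<noteq> c"
    have "(hpart (int (s - 3)) p - Const c * w) - (hpart (int (s - 3)) p - Const (\<tau> p) * w) \<in> L"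
      using is_ideal_diff[OF LI that \<tau>] .
    then have "Const (\<tau> p - c) * w \<in> L" by (simp add: Const_diff left_diff_distrib)
    then show False using is_ideal_Const_cancel[OF LI] ne w(2) by (metis right_minus_eq)
  qed
  have \<tau>_add: "\<tau> (a + b) = \<tau> a + \<tau> b" for a b
    using is_ideal_add[OF LI \<tau>[of a] \<tau>[of b]]
    by (intro unique) (simp add: hpart_add Const_add algebra_simps)
  have \<tau>_scale: "\<tau> (Const c * a) = c * \<tau> a" for c a
    using is_ideal_mult[OF LI \<tau>[of a], of "Const c"]
    by (intro unique)
      (simp add: hpart_homogeneous_mult[OF homogeneous_Const] Const_mult right_diff_distrib mult.assoc)
  have \<tau>_0: "\<tau> p = 0 \<longleftrightarrow> hpart (int (s - 3)) p \<in> L" for p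
    using \<tau>[of p] unique[of p 0] by auto
  have \<tau>_L: "\<tau> p = 0" if "p \<in> L" for p
    using that hclosed_L hclosedD \<tau>_0 by blast
  show "ideal_colon L (ideal_colon L I) \<subseteq> I"
  proof
    fix f assume f: "f \<in> ideal_colon L (ideal_colon L I)"
    have LLI: "is_ideal (ideal_colon L (ideal_colon L I))" "hclosed (ideal_colon L (ideal_colon L I))"
      using I hclosed_L by (simp_all add: is_ideal_colon hclosed_colon)
    have "hpart n f \<in> I" for n
    proof (rule ccontr)
      assume nI: "hpart n f \<notin> I"
      define q where "q = hpart n f"
      have "0 \<le> n" using nI is_ideal_0[OF I(1)] by (cases "n < 0") (auto simp: hpart_neg)
      then obtain j where j: "n = int j" using nonneg_int_cases by blast
      have q: "homogeneous j q" "q \<in> ideal_colon L (ideal_colon L I)" "q \<notin> I"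
        using homogeneous_hpart[of j f] hclosedD[OF LLI(2) f] nI by (auto simp: q_def j)
      have js: "j + 3 \<le> s" using above_socle[OF q(1)] q(3) I(3) by force
      define A where "A = {m :: 3 \<Rightarrow>\<^sub>0 nat. monom_degree m = s - 3 - j}"
      have "A \<subseteq> {m. \<forall>v. Poly_Mapping.lookup m v \<le> s - 3 - j}"
      proof (clarify)
        fix m v assume "m \<in> A"
        then show "Poly_Mapping.lookup m v \<le> s - 3 - j"
          using member_le_sum[of v UNIV "Poly_Mapping.lookup m"] by (simp add: A_def monom_degree_UNIV)
      qed
      then have A: "finite A" using card_bounded_exponents(1) finite_subset by blast
      let ?m = "\<lambda>m. Poly_Mapping.single m 1 :: (3, 'k) mpoly"
      have hom_sum: "(\<Sum>m\<in>A. Const (Poly_Mapping.lookup p m) * ?m m) = p"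
        if "homogeneous (s - 3 - j) p" for p
      proof -
        have "p = (\<Sum>m\<in>Poly_Mapping.keys p. Const (Poly_Mapping.lookup p m) * ?m m)"
          by (subst (1) poly_mapping_sum_single[of p]) (simp add: Const_def mult_single)
        also have "\<dots> = (\<Sum>m\<in>A. Const (Poly_Mapping.lookup p m) * ?m m)"
          using A that by (intro sum.mono_neutral_left) (auto simp: A_def homogeneous_def in_keys_iff)
        finally show ?thesis by simp
      qed
      \<comment> \<open>A member of \<open>I\<close> with the same pairings as \<open>q\<close>
        would differ from \<open>q\<close>, in degree \<open>j\<close>, by a form that multiplies
        the complementary degree into \<open>L\<close>, and such a form is itself in
        \<open>L\<close>.\<close>
      have no: "\<not> (\<exists>u\<in>I. \<forall>m\<in>A. \<tau> (?m m * (q - u)) = 0)"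
      proof
        assume "\<exists>u\<in>I. \<forall>m\<in>A. \<tau> (?m m * (q - u)) = 0"
        then obtain u where u: "u \<in> I" "\<And>m. m \<in> A \<Longrightarrow> \<tau> (?m m * (q - u)) = 0" by blast
        define r where "r = q - hpart (int j) u"
        have r: "homogeneous j r" unfolding r_def using q homogeneous_hpart homogeneous_diff by blast
        have rm: "r * ?m m \<in> L" if m: "m \<in> A" for m
        proof -
          have "homogeneous (s - 3 - j) (?m m)" using m by (auto simp: homogeneous_def A_def)
          then have "hpart (int (s - 3)) (?m m * (q - u)) = ?m m * hpart (int j) (q - u)"
            using js by (simp add: hpart_homogeneous_mult of_nat_diff)
          also have "hpart (int j) (q - u) = r" using q(1) by (simp add: r_def hpart_diff hpart_homogeneous)
          finally show ?thesis using u(2)[OF m] \<tau>_0 by (simp add: mult.commute)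
        qed
        have "r \<in> L"
        proof (rule below_socle[OF r])
          fix p :: "(3, 'k) mpoly" assume p: "homogeneous (s - 3 - j) p"
          have "r * p = (\<Sum>m\<in>A. Const (Poly_Mapping.lookup p m) * (r * ?m m))"
            by (subst (1) hom_sum[OF p, symmetric]) (simp add: sum_distrib_left mult.left_commute)
          also have "\<dots> \<in> L" by (rule is_ideal_sum[OF LI], rule is_ideal_mult[OF LI], rule rm)
          finally show "r * p \<in> L" .
        qed (use js in simp)
        moreover have "q = r + hpart (int j) u" by (simp add: r_def)
        ultimately show False using q(3) u(1) I hclosedD is_ideal_add by blast
      qed
      have "\<exists>l. (\<forall>u\<in>I. (\<Sum>m\<in>A. l m * \<tau> (?m m * u)) = 0) \<and> (\<Sum>m\<in>A. l m * \<tau> (?m m * q)) \<noteq> 0"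
      proof (rule ccontr)
        assume *: "\<not> ?thesis"
        have "\<exists>u\<in>I. \<forall>m\<in>A. \<tau> (?m m * (q - u)) = 0"
        proof (rule finite_dimensional_separation[OF A])
          show "mvs.subspace I"
            using I(1) by (intro mvs.subspaceI) (auto intro: is_ideal_0 is_ideal_add is_ideal_mult)
          show "\<tau> (?m m * (Const c * a)) = c * \<tau> (?m m * a)" for m c a
            using \<tau>_scale[of c "?m m * a"] by (simp add: mult.left_commute)
        qed (use * in \<open>auto simp: distrib_left \<tau>_add\<close>)
        with no show False ..
      qed
      then obtain l where l: "\<And>u. u \<in> I \<Longrightarrow> (\<Sum>m\<in>A. l m * \<tau> (?m m * u)) = 0"
        "(\<Sum>m\<in>A. l m * \<tau> (?m m * q)) \<noteq> 0" by blast
      \<comment> \<open>The separating functional is multiplication by \<open>h\<close> followed by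
        \<open>\<tau>\<close>: it vanishes on \<open>I\<close> but not at \<open>q\<close>.\<close>
      define h where "h = (\<Sum>m\<in>A. Const (l m) * ?m m)"
      have \<tau>_sum: "\<tau> (sum g B) = (\<Sum>b\<in>B. \<tau> (g b))" for g and B :: "(3 \<Rightarrow>\<^sub>0 nat) set"
      proof (induction B rule: infinite_finite_induct)
        case (insert b B)
        then show ?case by (simp add: \<tau>_add)
      qed (simp_all add: \<tau>_0 is_ideal_0)
      have \<tau>h: "\<tau> (h * u) = (\<Sum>m\<in>A. l m * \<tau> (?m m * u))" for u
        by (simp add: h_def sum_distrib_right \<tau>_sum mult.assoc \<tau>_scale)
      have hh: "homogeneous (s - 3 - j) h"
        unfolding h_def homogeneous_iff_hpart hpart_sum
        by (intro sum.cong refl)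
          (auto simp: A_def Const_def mult_single hpart_single)
      have "h * u \<in> L" if u: "u \<in> I" for u
      proof (rule is_ideal_if_hpart[OF LI])
        fix n
        have "hpart n (h * u) = h * hpart (n - int (s - 3 - j)) u" by (rule hpart_homogeneous_mult[OF hh])
        moreover have "h * hpart k u \<in> L" for k
        proof (cases "k < 0")
          case True
          then show ?thesis by (simp add: hpart_neg is_ideal_0)
        next
          case False
          define i where "i = nat k"
          define u' where "u' = hpart k u"
          have u': "homogeneous i u'" "u' \<in> I"
            using homogeneous_hpart[of i u] False hclosedD[OF I(2) u] by (auto simp: i_def u'_def)
          have hu': "homogeneous (s - 3 - j + i) (h * u')" using hh u'(1) by (rule homogeneous_mult)
          show "h * hpart k u \<in> L" unfolding u'_def[symmetric]
          \<comment> \<open>Products beyond the socle degree lie in \<open>L\<close>. Otherwise it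
            is enough to multiply further by forms of degree \<open>j - i\<close>, which leads into
            the socle degree, where \<open>\<tau>\<close> decides.\<close>
          proof (cases "i \<le> j")
            case False
            then show "h * u' \<in> L" using hu' js by (intro above_socle[OF hu']) linarith
          next
            case True
            show "h * u' \<in> L"
            proof (rule below_socle[OF hu'])
              fix m :: "(3, 'k) mpoly" assume m: "homogeneous (j - i) m"
              have "\<tau> (h * (u' * m)) = 0"
                using l(1)[of "u' * m"] u'(2) is_ideal_mult_right[OF I(1)] by (simp add: \<tau>h)
              moreover have "homogeneous (s - 3) (h * u' * m)"
                using homogeneous_mult[OF hu' m] True js by simp
              ultimately show "h * u' * m \<in> L"
                by (simp add: \<tau>_0 hpart_homogeneous mult.assoc)
            qed (use True js in simp)
          qed
        qed
        ultimately show "hpart n (h * u) \<in> L" by simp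
      qed
      then have "h \<in> ideal_colon L I" by (simp add: mem_ideal_colon)
      then have "h * q \<in> L" using q(2) by (auto simp: mem_ideal_colon mult.commute)
      then show False using \<tau>_L l(2) \<tau>h by metis
    qed
    then show "f \<in> I" by (rule is_ideal_if_hpart[OF I(1)])
  qed
qed

lemma height_over_L:
  assumes "is_ideal T" "hclosed T" "L \<subseteq> T" "T \<noteq> UNIV"
  shows "ideal_height T = 3"
  using assms Var_power_in_L proper_hclosed_subset by (intro ideal_height_eq_3) blast+

lemma colon_proper:
  assumes "L \<subseteq> I" "I \<noteq> L"
  shows "ideal_colon L I \<noteq> UNIV"
proof
  assume "ideal_colon L I = UNIV"
  then have "1 \<in> ideal_colon L I" by simp
  then have "I \<subseteq> L" by (auto simp: mem_ideal_colon)
  then show False using assms by blast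
qed

lemma L_subset_colon: "is_ideal I \<Longrightarrow> L \<subseteq> ideal_colon L I"
  by (auto simp: mem_ideal_colon intro: is_ideal_mult_right[OF is_ideal_ideal_gen])

text \<open>The double colon makes the relation symmetric, and both ideals have height 3 because
  they are proper, homogeneous and contain \<open>L\<close>.\<close>

lemma linked_by_colon:
  assumes I: "is_ideal I" "hclosed I" "L \<subseteq> I" "I \<noteq> L" "I \<noteq> UNIV"
  shows "linked_by [g1, g2, g3] I (ideal_colon L I)"
proof -
  have "is_ideal (ideal_colon L I)" "hclosed (ideal_colon L I)"
    using I hclosed_L by (simp_all add: is_ideal_colon hclosed_colon)
  then show ?thesis
    unfolding linked_by_def
    using I regular double_colon[OF I(1-3)] colon_proper[OF I(3,4)] L_subset_colon[OF I(1)]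
    by (auto simp: height_over_L numeral_eq_enat)
qed

end

section \<open>Regular sequences of forms\<close>

abbreviation varx :: "(3, 'k::field) mpoly" where "varx \<equiv> Var 0"
abbreviation vary :: "(3, 'k::field) mpoly" where "vary \<equiv> Var 1"
abbreviation varz :: "(3, 'k::field) mpoly" where "varz \<equiv> Var 2"

lemma hpart_hpart [simp]: "hpart n (hpart n p) = hpart n p"
  by (rule poly_mapping_eqI) (simp add: lookup_hpart when_def)

lemma is_ideal_irrelevant [simp]: "is_ideal irrelevant_ideal"
  by (simp add: irrelevant_ideal_def)

lemma homogeneous_in_pair:
  fixes g1 g2 :: "(3, 'k::field) mpoly"
  assumes "a \<in> ideal_gen {g1, g2}" "homogeneous d a" "homogeneous d1 g1" "homogeneous d2 g2"
  obtains u v where "a = u * g1 + v * g2" "u = hpart (int d - int d1) u" "v = hpart (int d - int d2) v"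
proof -
  obtain u v where uv: "a = u * g1 + v * g2" using assms(1) unfolding mem_ideal_gen_2 by blast
  have "a = hpart (int d) a" using assms(2) by (simp add: hpart_homogeneous)
  also have "\<dots> = hpart (int d - int d1) u * g1 + hpart (int d - int d2) v * g2"
    unfolding uv using assms(3,4) by (simp add: hpart_add hpart_mult_homogeneous)
  finally show thesis
    by (rule that) simp_all
qed

lemma homogeneous_in_triple:
  fixes g1 g2 g3 :: "(3, 'k::field) mpoly"
  assumes "a \<in> ideal_gen {g1, g2, g3}" "homogeneous d a"
    "homogeneous d1 g1" "homogeneous d2 g2" "homogeneous d3 g3"
  obtains u v w where "a = u * g1 + v * g2 + w * g3"
    "u = hpart (int d - int d1) u" "v = hpart (int d - int d2) v" "w = hpart (int d - int d3) w"
proof -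
  obtain u v w where uv: "a = u * g1 + v * g2 + w * g3" using assms(1) unfolding mem_ideal_gen_3 by blast
  have "a = hpart (int d) a" using assms(2) by (simp add: hpart_homogeneous)
  also have "\<dots> = hpart (int d - int d1) u * g1 + hpart (int d - int d2) v * g2 + hpart (int d - int d3) w * g3"
    unfolding uv using assms(3-) by (simp add: hpart_add hpart_mult_homogeneous)
  finally show thesis
    by (rule that) simp_all
qed

lemma hpart_eq_Const:
  fixes u :: "('v::finite, 'k::field) mpoly"
  assumes "u = hpart n u" "n \<le> 0"
  shows "\<exists>c. u = Const c"
proof (cases "n = 0")
  case True
  then show ?thesis using assms(1) homogeneous_hpart[of 0 u] homogeneous_0_iff[of u] by simp
next
  case False
  then have "u = 0" using assms hpart_neg[of n u] by simp
  then show ?thesis by (intro exI[of _ 0]) simp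
qed

lemma low_degree_in_pair_eq_0:
  fixes g1 g2 :: "(3, 'k::field) mpoly"
  assumes "a \<in> ideal_gen {g1, g2}" "homogeneous d a" "homogeneous d1 g1" "homogeneous d2 g2" "d < d1" "d < d2"
  shows "a = 0"
proof -
  obtain u v where "a = u * g1 + v * g2" "u = hpart (int d - int d1) u" "v = hpart (int d - int d2) v"
    using homogeneous_in_pair[OF assms(1-4)] .
  moreover have "hpart (int d - int d1) u = 0" "hpart (int d - int d2) v = 0"
    using assms(5,6) by (simp_all add: hpart_neg)
  ultimately show ?thesis by simp
qed

lemma low_degree_in_triple:
  fixes g1 g2 g3 :: "(3, 'k::field) mpoly"
  assumes "a \<in> ideal_gen {g1, g2, g3}" "homogeneous d a"
    "homogeneous d1 g1" "homogeneous d2 g2" "homogeneous d3 g3" "d < d3"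
  shows "a \<in> ideal_gen {g1, g2}"
proof -
  obtain u v w where "a = u * g1 + v * g2 + w * g3" "w = hpart (int d - int d3) w"
    using homogeneous_in_triple[OF assms(1-5)] .
  moreover have "hpart (int d - int d3) w = 0" using assms(6) by (simp add: hpart_neg)
  ultimately show ?thesis unfolding mem_ideal_gen_2 by auto
qed

text \<open>If a g = h b, then h is a multiple of a since b is regular modulo a, and a can be
  cancelled.\<close>

lemma regular_sequence_swap12:
  fixes a b c :: "(3, 'k::field) mpoly"
  assumes "regular_sequence [a, b, c]"
  shows "regular_sequence [b, a, c]"
proof -
  note reg = assms[unfolded regular_sequence_3]
  have proper: "1 \<notin> ideal_gen {a, b, c}"
    using reg is_ideal_eq_UNIV[OF is_ideal_ideal_gen] by blast
  have a: "a \<noteq> 0" using reg by (metis mult_zero_left one_neq_zero)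
  have b: "b \<noteq> 0"
  proof
    assume "b = 0"
    then have "b * 1 \<in> ideal_gen {a}" by (simp add: is_ideal_0)
    then have "1 \<in> ideal_gen {a}" using reg by blast
    then show False using proper ideal_gen_mono[of "{a}" "{a, b, c}"] by auto
  qed
  have "g \<in> ideal_gen {b}" if ag: "a * g \<in> ideal_gen {b}" for g
  proof -
    obtain h where h: "a * g = h * b" using ag unfolding mem_ideal_gen_1 by blast
    then have "b * h = g * a" by (simp add: mult.commute)
    then have "b * h \<in> ideal_gen {a}" unfolding mem_ideal_gen_1 by blast
    then have "h \<in> ideal_gen {a}" using reg by blast
    then obtain t where "h = t * a" unfolding mem_ideal_gen_1 by blast
    then have "a * g = a * (t * b)" using h by (simp add: mult_ac)
    then have "g = t * b" using a by simp
    then show ?thesis unfolding mem_ideal_gen_1 by blast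
  qed
  moreover have "{b, a, c} = {a, b, c}" "{b, a} = {a, b}" by auto
  ultimately show ?thesis using b reg unfolding regular_sequence_3 by (metis mult_eq_0_iff)
qed

text \<open>Graded Nakayama: \<open>0 :\<^bsub>S/a\<^esub> c\<close> equals \<open>b\<close> times itself.\<close>

lemma regular_sequence_swap23:
  fixes a b c :: "(3, 'k::field) mpoly"
  assumes reg: "regular_sequence [a, b, c]"
    and hom: "homogeneous da a" "homogeneous db b" "homogeneous dc c" "0 < db"
  shows "regular_sequence [a, c, b]"
proof -
  note reg = reg[unfolded regular_sequence_3]
  have ha: "hclosed (ideal_gen {a})" using hom by (intro hclosed_ideal_gen) auto
  have step: "g \<in> ideal_gen {a}" if "homogeneous d g" "c * g \<in> ideal_gen {a}" for d g
    using that
  proof (induction d arbitrary: g rule: less_induct)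
    case (less d)
    have "ideal_gen {a} \<subseteq> ideal_gen {a, b}" by (rule ideal_gen_mono) auto
    then have "g \<in> ideal_gen {a, b}" using reg less.prems by blast
    then obtain s t where st: "g = s * a + t * b" "s = hpart (int d - int da) s" "t = hpart (int d - int db) t"
      using homogeneous_in_pair less.prems(1) hom(1,2) by metis
    \<comment> \<open>\<open>t\<close> satisfies the same hypothesis as \<open>g\<close>, in a
      degree smaller by \<open>db\<close>.\<close>
    have "b * (c * t) = c * g - (c * s) * a" unfolding st(1) by (simp add: algebra_simps)
    also have "\<dots> \<in> ideal_gen {a}"
      by (rule is_ideal_diff[OF is_ideal_ideal_gen less.prems(2) is_ideal_mult[OF is_ideal_ideal_gen]])
        (rule ideal_gen_base, simp)
    finally have ct: "c * t \<in> ideal_gen {a}" using reg by blast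
    have "t \<in> ideal_gen {a}"
    proof (cases "db \<le> d")
      case True
      then have "homogeneous (d - db) t"
        using homogeneous_hpart[of "d - db" t] st(3) by (simp add: of_nat_diff)
      then show ?thesis using less.IH[of "d - db" t] True hom(4) ct by simp
    next
      case False
      then have "t = 0" using st(3) hpart_neg[of "int d - int db" t] by simp
      then show ?thesis by (simp add: is_ideal_0)
    qed
    then show ?case unfolding st(1)
      by (intro is_ideal_add is_ideal_mult is_ideal_mult_right) (auto intro: ideal_gen_base)
  qed
  have 1: "g \<in> ideal_gen {a}" if g: "c * g \<in> ideal_gen {a}" for g
  proof (rule is_ideal_if_hpart[OF is_ideal_ideal_gen])
    fix n
    show "hpart n g \<in> ideal_gen {a}"
    proof (cases "n < 0")
      case True
      then show ?thesis by (simp add: hpart_neg is_ideal_0)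
    next
      case False
      have "hpart (n + int dc) (c * g) \<in> ideal_gen {a}" using ha g by (rule hclosedD)
      then have "c * hpart n g \<in> ideal_gen {a}" by (simp add: hpart_homogeneous_mult[OF hom(3)])
      then show ?thesis using step[of "nat n" "hpart n g"] homogeneous_hpart[of "nat n" g] False by simp
    qed
  qed
  have 2: "g \<in> ideal_gen {a, c}" if "b * g \<in> ideal_gen {a, c}" for g
  proof -
    obtain s t where st: "b * g = s * a + t * c" using \<open>b * g \<in> ideal_gen {a, c}\<close> unfolding mem_ideal_gen_2 by blast
    then have "c * t = (- s) * a + g * b" by (simp add: algebra_simps)
    then have "c * t \<in> ideal_gen {a, b}" unfolding mem_ideal_gen_2 by blast
    then have "t \<in> ideal_gen {a, b}" using reg by blast
    then obtain p q where pq: "t = p * a + q * b" unfolding mem_ideal_gen_2 by blast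
    have "b * (g - q * c) = (s + p * c) * a"
      using st unfolding pq by (simp add: algebra_simps)
    then have "b * (g - q * c) \<in> ideal_gen {a}" unfolding mem_ideal_gen_1 by blast
    then have "g - q * c \<in> ideal_gen {a}" using reg by blast
    then obtain r where "g - q * c = r * a" unfolding mem_ideal_gen_1 by blast
    then have "g = r * a + q * c" by (simp add: algebra_simps)
    then show ?thesis unfolding mem_ideal_gen_2 by blast
  qed
  have "{a, c, b} = {a, b, c}" by auto
  then show ?thesis using 1 2 reg unfolding regular_sequence_3 by metis
qed

text \<open>Minimality compares sorted lists of degrees, while the sequence may list its members in
  any order; transpositions bring the two cubics to the front.\<close>

lemma regular_sequence_arrange:
  fixes fs :: "(3, 'k::field) mpoly list"
  assumes reg: "regular_sequence fs" and hom: "list_all2 homogeneous ds fs" and ds: "sort ds = [3, 3, d]" "0 < d"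
  obtains p1 p2 c where "regular_sequence [p1, p2, c]" "homogeneous 3 p1" "homogeneous 3 p2" "homogeneous d c"
    "set fs = {p1, p2, c}"
proof -
  have len: "length ds = 3" using ds(1) by (metis length_sort length_Cons list.size(3) numeral_3_eq_3)
  then obtain e1 e2 e3 where e: "ds = [e1, e2, e3]"
    by (metis (no_types, lifting) length_0_conv length_Suc_conv numeral_3_eq_3)
  then obtain f1 f2 f3 where f: "fs = [f1, f2, f3]" and h: "homogeneous e1 f1" "homogeneous e2 f2" "homogeneous e3 f3"
    using hom by (auto simp: list_all2_Cons1)
  have "mset ds = {#3, 3, d#}" using ds(1) by (metis mset_sort mset.simps)
  then have "e1 = 3 \<and> e2 = 3 \<and> e3 = d \<or> e1 = 3 \<and> e2 = d \<and> e3 = 3 \<or> e1 = d \<and> e2 = 3 \<and> e3 = 3"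
    unfolding e by (auto simp: add_eq_conv_ex)
  then show thesis
  proof (elim disjE conjE)
    assume "e1 = 3" "e2 = 3" "e3 = d"
    then show thesis using that[of f1 f2 f3] reg h f by simp
  next
    assume *: "e1 = 3" "e2 = d" "e3 = 3"
    then have "regular_sequence [f1, f3, f2]"
      using regular_sequence_swap23[of f1 f2 f3 e1 e2 e3] reg h f ds(2) by simp
    then show thesis using that[of f1 f3 f2] h f * by auto
  next
    assume *: "e1 = d" "e2 = 3" "e3 = 3"
    then have "regular_sequence [f2, f1, f3]" using regular_sequence_swap12 reg f by simp
    then have "regular_sequence [f2, f3, f1]"
      using regular_sequence_swap23[of f2 f1 f3 e2 e1 e3] h ds(2) * by simp
    then show thesis using that[of f2 f3 f1] h f * by auto
  qed
qed

lemma regular_sequence_nonzero: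
  assumes "regular_sequence fs" "f \<in> set fs"
  shows "f \<noteq> 0"
proof
  assume "f = 0"
  obtain i where i: "i < length fs" "fs ! i = f" using assms(2) by (auto simp: in_set_conv_nth)
  have "1 \<in> ideal_gen (set (take i fs))"
    using regular_sequenceD[OF assms(1) i(1), of 1] i(2) \<open>f = 0\<close> by (simp add: is_ideal_0)
  then have "1 \<in> ideal_gen (set fs)" using ideal_gen_mono[OF set_take_subset] by blast
  then show False using assms(1) is_ideal_eq_UNIV[OF is_ideal_ideal_gen] by (auto simp: regular_sequence_def)
qed

text \<open>In equal degrees the coefficients are constants, and the members of a regular sequence
  are linearly independent, so the change of basis is invertible.\<close>

lemma same_pair:
  fixes p1 p2 g1 g2 c :: "(3, 'k::field) mpoly"
  assumes reg: "regular_sequence [p1, p2, c]"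
    and p: "p1 \<in> ideal_gen {g1, g2}" "p2 \<in> ideal_gen {g1, g2}"
    and hom: "homogeneous d p1" "homogeneous d p2" "homogeneous d g1" "homogeneous d g2"
  shows "ideal_gen {p1, p2} = ideal_gen {g1, g2}"
proof -
  have const: "\<exists>u v. p = Const u * g1 + Const v * g2" if q: "p \<in> ideal_gen {g1, g2}" "homogeneous d p" for p
  proof -
    obtain u v where "p = u * g1 + v * g2" "u = hpart (int d - int d) u" "v = hpart (int d - int d) v"
      using homogeneous_in_pair[OF q hom(3,4)] .
    then show ?thesis using hpart_eq_Const[of u "int d - int d"] hpart_eq_Const[of v "int d - int d"] by auto
  qed
  obtain a b where 1: "p1 = Const a * g1 + Const b * g2" using const p hom by blast
  obtain a' b' where 2: "p2 = Const a' * g1 + Const b' * g2" using const p hom by blast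
  have indep: False if "Const s * p1 + Const t * p2 = 0" "s \<noteq> 0 \<or> t \<noteq> 0" for s t
  proof (cases "t = 0")
    case True
    then have "p1 = 0" using that by simp
    then show False using regular_sequence_nonzero[OF reg] by simp
  next
    case False
    have "p2 * Const t = (- Const s) * p1" using that(1) by (simp add: algebra_simps add_eq_0_iff)
    then have "p2 * Const t \<in> ideal_gen {p1}" unfolding mem_ideal_gen_1 by blast
    then have "Const t * 1 \<in> ideal_gen {p1}" using reg unfolding regular_sequence_3 by auto
    then have "1 \<in> ideal_gen {p1}" using False is_ideal_Const_cancel is_ideal_ideal_gen by blast
    then have "1 \<in> ideal_gen {p1, p2, c}" using ideal_gen_mono[of "{p1}" "{p1, p2, c}"] by auto
    then show False using reg is_ideal_eq_UNIV[OF is_ideal_ideal_gen] unfolding regular_sequence_3 by auto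
  qed
  \<comment> \<open>The determinant of the change of basis; the next two equations are Cramer's
    rule.\<close>
  define D where "D = a * b' - b * a'"
  have e1: "Const b' * p1 + Const (- b) * p2 = Const D * g1"
    unfolding 1 2 D_def by (simp add: Const_mult Const_diff Const_uminus algebra_simps)
  have e2: "Const (- a') * p1 + Const a * p2 = Const D * g2"
    unfolding 1 2 D_def by (simp add: Const_mult Const_diff Const_uminus algebra_simps)
  have "D \<noteq> 0"
  proof
    assume "D = 0"
    then have "b' = 0 \<and> - b = 0" "- a' = 0 \<and> a = 0" using e1 e2 indep[of b' "- b"] indep[of "- a'" a] by auto
    then have "p1 = 0" using 1 by simp
    then show False using regular_sequence_nonzero[OF reg] by simp
  qed
  have "g1 \<in> ideal_gen {p1, p2}" "g2 \<in> ideal_gen {p1, p2}"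
    by (rule is_ideal_Const_cancel[OF is_ideal_ideal_gen _ \<open>D \<noteq> 0\<close>];
        unfold mem_ideal_gen_2; use e1 e2 in \<open>metis\<close>)+
  then show ?thesis using p by (intro ideal_gen_eqI) auto
qed

lemma regular_sequence_same_pair:
  assumes "regular_sequence [p1, p2, c]" "regular_sequence [g1, g2, h]"
    "ideal_gen {p1, p2} = ideal_gen {g1, g2}"
  shows "regular_sequence [g1, g2, c]" "ideal_gen {p1, p2, c} = ideal_gen {g1, g2, c}"
proof -
  have *: "ideal_gen {p1, p2} \<subseteq> ideal_gen {p1, p2, c}" "ideal_gen {g1, g2} \<subseteq> ideal_gen {g1, g2, c}"
    by (intro ideal_gen_mono; auto)+
  have "p1 \<in> ideal_gen {g1, g2}" "p2 \<in> ideal_gen {g1, g2}" "g1 \<in> ideal_gen {p1, p2}" "g2 \<in> ideal_gen {p1, p2}"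
    using assms(3) by (metis ideal_gen_base insertCI)+
  with * show eq: "ideal_gen {p1, p2, c} = ideal_gen {g1, g2, c}"
    by (intro ideal_gen_eqI) (auto intro: ideal_gen_base)
  show "regular_sequence [g1, g2, c]"
    using assms(1) assms(2) unfolding regular_sequence_3 assms(3) eq by (intro conjI) (elim conjE, assumption)+
qed

section \<open>Removing a linear factor from a regular sequence\<close>

text \<open>The shape of the regular sequences in the minimal links, with the cubic divisible by x
  in second place. Dropping the factor x lowers the socle degree from 9 to 8; duality is used modulo
  both ideals, \<open>big.L\<close> and \<open>small.L\<close>.\<close>

locale factored_regular =
  fixes g r c :: "(3, 'k::field) mpoly"
  assumes reg: "regular_sequence [g, varx * r, c]"
    and hg: "homogeneous 3 g" and hr: "homogeneous 2 r" and hc: "homogeneous 6 c"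
begin

lemma hxr: "homogeneous 3 (varx * r)"
  using homogeneous_mult[OF homogeneous_Var hr, of 0] by (simp add: numeral_3_eq_3)

sublocale big: graded_regular g "varx * r" c 3 3 6
  using reg hg hxr hc by unfold_locales

lemma regular_facts:
  "varx * r * u \<in> ideal_gen {g} \<Longrightarrow> u \<in> ideal_gen {g}"
  "c * u \<in> ideal_gen {g, varx * r} \<Longrightarrow> u \<in> ideal_gen {g, varx * r}"
  using reg unfolding regular_sequence_3 by blast+

lemma cancel_varx: "varx * u \<in> ideal_gen {g} \<Longrightarrow> u \<in> ideal_gen {g}"
  using regular_facts(1)[of u] is_ideal_mult[of "ideal_gen {g}" "varx * u" r] by (simp add: mult_ac)

lemma cancel_r: "r * u \<in> ideal_gen {g} \<Longrightarrow> u \<in> ideal_gen {g}"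
  using regular_facts(1)[of u] is_ideal_mult[of "ideal_gen {g}" "r * u" varx] by (simp add: mult_ac)

lemma cancel_pair: "varx * u \<in> ideal_gen {g, varx * r} \<Longrightarrow> u \<in> ideal_gen {g, r}"
proof -
  assume "varx * u \<in> ideal_gen {g, varx * r}"
  then obtain s t where "varx * u = s * g + t * (varx * r)" unfolding mem_ideal_gen_2 by blast
  then have "varx * (u - t * r) = s * g" by (simp add: algebra_simps)
  then have "u - t * r \<in> ideal_gen {g}" using cancel_varx unfolding mem_ideal_gen_1 by blast
  then obtain q where "u - t * r = q * g" unfolding mem_ideal_gen_1 by blast
  then have "u = q * g + t * r" by (simp add: algebra_simps)
  then show ?thesis unfolding mem_ideal_gen_2 by blast
qed

lemma mult_pair: "u \<in> ideal_gen {g, r} \<Longrightarrow> varx * u \<in> ideal_gen {g, varx * r}"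
proof -
  assume "u \<in> ideal_gen {g, r}"
  then obtain s t where "u = s * g + t * r" unfolding mem_ideal_gen_2 by blast
  then have "varx * u = (varx * s) * g + t * (varx * r)" by (simp add: algebra_simps)
  then show ?thesis unfolding mem_ideal_gen_2 by blast
qed

text \<open>Multiplied by \<open>r\<close>, the relation takes place modulo \<open>g\<close> and
  \<open>varx * r\<close>, where \<open>c\<close> is regular; afterwards \<open>r\<close> is
  cancelled modulo \<open>g\<close>.\<close>

lemma cancel_c_varx: "c * u \<in> ideal_gen {g, varx} \<Longrightarrow> u \<in> ideal_gen {g, varx}"
proof -
  assume "c * u \<in> ideal_gen {g, varx}"
  then obtain s t where st: "c * u = s * g + t * varx" unfolding mem_ideal_gen_2 by blast
  have "c * (r * u) = r * (c * u)" by (rule mult.left_commute)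
  then have "c * (r * u) = (r * s) * g + t * (varx * r)" unfolding st by (simp add: algebra_simps)
  then have "r * u \<in> ideal_gen {g, varx * r}" using regular_facts(2) unfolding mem_ideal_gen_2 by blast
  then obtain p q where "r * u = p * g + q * (varx * r)" unfolding mem_ideal_gen_2 by blast
  then have "r * (u - q * varx) = p * g" by (simp add: algebra_simps)
  then have "u - q * varx \<in> ideal_gen {g}" using cancel_r unfolding mem_ideal_gen_1 by blast
  then obtain k where "u - q * varx = k * g" unfolding mem_ideal_gen_1 by blast
  then have "u = k * g + q * varx" by (simp add: algebra_simps)
  then show ?thesis unfolding mem_ideal_gen_2 by blast
qed

text \<open>The coefficient of \<open>c\<close> lies in the ideal of \<open>g\<close> and x, so that
  the whole relation is divisible by x modulo \<open>g\<close>.\<close>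

lemma cancel_triple: "varx * u \<in> ideal_gen {g, varx * r, c} \<Longrightarrow> u \<in> ideal_gen {g, r, c}"
proof -
  assume "varx * u \<in> ideal_gen {g, varx * r, c}"
  then obtain s t w where stw: "varx * u = s * g + t * (varx * r) + w * c" unfolding mem_ideal_gen_3 by blast
  then have "c * w = (- s) * g + (u - t * r) * varx" by (simp add: algebra_simps)
  then have "w \<in> ideal_gen {g, varx}" using cancel_c_varx unfolding mem_ideal_gen_2 by blast
  then obtain p q where pq: "w = p * g + q * varx" unfolding mem_ideal_gen_2 by blast
  have "varx * (u - t * r - q * c) = (s + p * c) * g"
    using stw unfolding pq by (simp add: algebra_simps)
  then have "u - t * r - q * c \<in> ideal_gen {g}" using cancel_varx unfolding mem_ideal_gen_1 by blast
  then obtain k where "u - t * r - q * c = k * g" unfolding mem_ideal_gen_1 by blast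
  then have "u = k * g + t * r + q * c" by (simp add: algebra_simps)
  then show ?thesis unfolding mem_ideal_gen_3 by blast
qed

lemma regular_small: "regular_sequence [g, r, c]"
  unfolding regular_sequence_3
proof (intro conjI allI impI)
  show "g * u = 0 \<Longrightarrow> u = 0" for u using reg unfolding regular_sequence_3 by blast
  show "r * u \<in> ideal_gen {g} \<Longrightarrow> u \<in> ideal_gen {g}" for u by (rule cancel_r)
  show "u \<in> ideal_gen {g, r}" if "c * u \<in> ideal_gen {g, r}" for u
  proof -
    have "c * (varx * u) \<in> ideal_gen {g, varx * r}" using mult_pair[OF that] by (simp add: mult_ac)
    then show ?thesis using regular_facts(2) cancel_pair by blast
  qed
  have "ideal_gen {g, r, c} \<subseteq> irrelevant_ideal"
    using homogeneous_in_irrelevant[OF hg] homogeneous_in_irrelevant[OF hr] homogeneous_in_irrelevant[OF hc]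
    by (intro ideal_gen_least) auto
  moreover have "1 \<notin> (irrelevant_ideal :: (3, 'k) mpoly set)"
    by (simp add: irrelevant_ideal_hpart hpart_homogeneous[OF homogeneous_1])
  ultimately show "ideal_gen {g, r, c} \<noteq> UNIV" by blast
qed

sublocale small: graded_regular g r c 3 2 6
  using regular_small hg hr hc by unfold_locales

lemma pair_subset: "ideal_gen {g, varx * r} \<subseteq> big.L"
  by (rule ideal_gen_mono) auto

text \<open>If \<open>g\<close> were u x, then x r u would be a multiple of \<open>g\<close>, hence
  so would u, and x would be a unit.\<close>

lemma g_not_in_varx: "g \<notin> ideal_gen {varx}"
proof
  assume "g \<in> ideal_gen {varx}"
  then obtain u where u: "g = u * varx" unfolding mem_ideal_gen_1 by blast
  have "varx * r * u = r * g" unfolding u by (simp add: mult_ac)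
  then have "u \<in> ideal_gen {g}" using regular_facts(1) unfolding mem_ideal_gen_1 by blast
  then obtain t where "u = t * g" unfolding mem_ideal_gen_1 by blast
  then have "g * (1 - t * varx) = 0" using u by (simp add: algebra_simps)
  moreover have "g \<noteq> 0" using regular_sequence_nonzero[OF reg] by simp
  ultimately have "1 = t * varx" by simp
  then have "(1 :: (3, 'k) mpoly) \<in> ideal_gen {varx}" unfolding mem_ideal_gen_1 by (rule exI)
  then show False using Const_in_ideal_gen_Var[of "1 :: 'k" "{0::3}"] by simp
qed

end

text \<open>Its forms are those that vanish at (1:0:0).\<close>

abbreviation point_ideal :: "(3, 'k::field) mpoly set" where
  "point_ideal \<equiv> ideal_gen {vary, varz}"

lemma prime_point_ideal: "prime_ideal (point_ideal :: (3, 'k::field) mpoly set)"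
  using prime_ideal_Var[of "{1::3, 2}"] by simp

lemma varx_not_in_point_ideal: "varx \<notin> (point_ideal :: (3, 'k::field) mpoly set)"
  using Var_in_ideal_gen_Var[of 0 "{1::3, 2}"] by simp

text \<open>Three regular forms have no common zero in the projective plane; for this point it
  follows from a power of x in their ideal.\<close>

lemma regular_not_in_point_ideal:
  fixes fs :: "(3, 'k::field) mpoly list"
  assumes "regular_sequence fs" "length fs = 3" "\<And>f. f \<in> set fs \<Longrightarrow> \<exists>d. homogeneous d f"
  shows "\<not> set fs \<subseteq> point_ideal"
proof
  assume "set fs \<subseteq> point_ideal"
  then have "ideal_gen (set fs) \<subseteq> point_ideal" by (intro ideal_gen_least) auto
  moreover obtain N where "varx ^ N \<in> ideal_gen (set fs)"
    using power_in_regular_ideal[OF assms(1) _ assms(3), of varx] assms(2) by auto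
  ultimately show False using prime_ideal_power[OF prime_point_ideal] varx_not_in_point_ideal by blast
qed

section \<open>The two kinds of ideals along a sequence of minimal links\<close>

text \<open>Invariants of minimal links that start at the ideal of the theorem: the ideals are alternately of
  the even and of the odd kind, and each link has degrees \<open>3, 3, 6\<close>. All forms of degree at most \<open>5\<close>
  in an ideal of the odd kind vanish at the point \<open>(1:0:0)\<close>, and this forces the last degree \<open>6\<close>.\<close>

definition even_kind_over ::
    "(3, 'k::field) mpoly set \<Rightarrow> (3, 'k) mpoly \<Rightarrow> (3, 'k) mpoly \<Rightarrow> bool" where
  "even_kind_over I g r \<longleftrightarrow>
     (\<forall>d a. homogeneous d a \<and> a \<in> I \<and> d \<le> 3 \<longrightarrow> a \<in> ideal_gen {g, varx * r}) \<and>
     (\<forall>d a. homogeneous d a \<and> a \<in> I \<and> d \<le> 5 \<longrightarrow>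
        varx * vary * a \<in> ideal_gen {g, varx * r} \<and> varx * varz * a \<in> ideal_gen {g, varx * r})"

text \<open>In socle degree 9, forms of degree 6 are dual to those of degree 3, and the multiples of
  x y and x z are dual to the second condition of \<open>even_kind_over\<close>. The condition on
  cubics says that modulo x they span at most a line; it produces the member of the pencil that is
  divisible by x. The last condition bounds the minimal degrees by 3, 3, 6.\<close>

definition odd_kind :: "(3, 'k::field) mpoly set \<Rightarrow> bool" where
  "odd_kind J \<longleftrightarrow> is_ideal J \<and> hclosed J \<and>
     (\<forall>d h. homogeneous d h \<and> h \<in> J \<and> d < 3 \<longrightarrow> h = 0) \<and>
     (\<forall>d h. homogeneous d h \<and> h \<in> J \<and> d \<le> 5 \<longrightarrow> h \<in> point_ideal) \<and>
     (\<forall>h. homogeneous 6 h \<longrightarrow> h \<in> J) \<and>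
     (\<exists>G. homogeneous 3 G \<and> (\<forall>h\<in>J. homogeneous 3 h \<longrightarrow> (\<exists>c. h - Const c * G \<in> ideal_gen {varx}))) \<and>
     (\<forall>d h. homogeneous d h \<and> 2 \<le> d \<longrightarrow> varx * vary * h \<in> J \<and> varx * varz * h \<in> J) \<and>
     (\<exists>p1 p2 c. regular_sequence [p1, p2, c] \<and> homogeneous 3 p1 \<and> homogeneous 3 p2 \<and> homogeneous 6 c \<and>
        {p1, p2, c} \<subseteq> J)"

text \<open>The link through one regular sequence is required to be of the odd kind; links through
  other sextics are compared with this one.\<close>

definition even_kind :: "(3, 'k::field) mpoly set \<Rightarrow> bool" where
  "even_kind I \<longleftrightarrow> is_ideal I \<and> hclosed I \<and>
     (\<exists>g r c. factored_regular g r c \<and> {g, varx * r, c} \<subseteq> I \<and> even_kind_over I g r \<and>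
        odd_kind (ideal_colon (ideal_gen {g, varx * r, c}) I))"

lemma odd_kindD:
  assumes "odd_kind J"
  shows "is_ideal J" "hclosed J"
    "homogeneous d h \<Longrightarrow> h \<in> J \<Longrightarrow> d < 3 \<Longrightarrow> h = 0"
    "homogeneous d h \<Longrightarrow> h \<in> J \<Longrightarrow> d \<le> 5 \<Longrightarrow> h \<in> point_ideal"
    "homogeneous 6 h \<Longrightarrow> h \<in> J"
    "\<exists>G. homogeneous 3 G \<and> (\<forall>h\<in>J. homogeneous 3 h \<longrightarrow> (\<exists>c. h - Const c * G \<in> ideal_gen {varx}))"
    "homogeneous d h \<Longrightarrow> 2 \<le> d \<Longrightarrow> varx * vary * h \<in> J \<and> varx * varz * h \<in> J"
    "\<exists>p1 p2 c. regular_sequence [p1, p2, c] \<and> homogeneous 3 p1 \<and> homogeneous 3 p2 \<and> homogeneous 6 c \<and>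
        {p1, p2, c} \<subseteq> J"
proof -
  note * = assms[unfolded odd_kind_def]
  show "is_ideal J" "hclosed J" using *[THEN conjunct1] *[THEN conjunct2, THEN conjunct1] by blast+
  show "homogeneous d h \<Longrightarrow> h \<in> J \<Longrightarrow> d < 3 \<Longrightarrow> h = 0" using *[THEN conjunct2, THEN conjunct2, THEN conjunct1] by blast
  show "homogeneous d h \<Longrightarrow> h \<in> J \<Longrightarrow> d \<le> 5 \<Longrightarrow> h \<in> point_ideal" using *[THEN conjunct2, THEN conjunct2, THEN conjunct2, THEN conjunct1] by blast
  show "homogeneous 6 h \<Longrightarrow> h \<in> J" using *[THEN conjunct2, THEN conjunct2, THEN conjunct2, THEN conjunct2, THEN conjunct1] by blast
  show "\<exists>G. homogeneous 3 G \<and> (\<forall>h\<in>J. homogeneous 3 h \<longrightarrow> (\<exists>c. h - Const c * G \<in> ideal_gen {varx}))"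
    by (rule *[THEN conjunct2, THEN conjunct2, THEN conjunct2, THEN conjunct2, THEN conjunct2, THEN conjunct1])
  show "homogeneous d h \<Longrightarrow> 2 \<le> d \<Longrightarrow> varx * vary * h \<in> J \<and> varx * varz * h \<in> J"
    using *[THEN conjunct2, THEN conjunct2, THEN conjunct2, THEN conjunct2, THEN conjunct2, THEN conjunct2, THEN conjunct1] by blast
  show "\<exists>p1 p2 c. regular_sequence [p1, p2, c] \<and> homogeneous 3 p1 \<and> homogeneous 3 p2 \<and> homogeneous 6 c \<and>
        {p1, p2, c} \<subseteq> J"
    by (rule *[THEN conjunct2, THEN conjunct2, THEN conjunct2, THEN conjunct2, THEN conjunct2, THEN conjunct2, THEN conjunct2])
qed

lemma colon_homogeneousI:
  fixes I L :: "('v::finite, 'k::comm_ring_1) mpoly set"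
  assumes L: "is_ideal L" and I: "hclosed I" and *: "\<And>d i. homogeneous d i \<Longrightarrow> i \<in> I \<Longrightarrow> w * i \<in> L"
  shows "w \<in> ideal_colon L I"
proof (subst mem_ideal_colon, intro ballI)
  fix i assume i: "i \<in> I"
  have "is_ideal {i. w * i \<in> L}"
  proof (rule is_idealI)
    show "c * a \<in> {i. w * i \<in> L}" if "a \<in> {i. w * i \<in> L}" for a c
      using is_ideal_mult[OF L, of "w * a" c] that by (simp add: mult.left_commute)
  qed (use L in \<open>auto simp: is_ideal_0 distrib_left intro: is_ideal_add\<close>)
  moreover have "hpart n i \<in> {i. w * i \<in> L}" for n
  proof (cases "n < 0")
    case True
    then show ?thesis using L by (simp add: hpart_neg is_ideal_0)
  next
    case False
    then show ?thesis using *[of "nat n" "hpart n i"] homogeneous_hpart[of "nat n" i] hclosedD[OF I i] by simp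
  qed
  ultimately have "i \<in> {i. w * i \<in> L}" by (rule is_ideal_if_hpart)
  then show "w * i \<in> L" by simp
qed

text \<open>Two links of \<open>I\<close> that differ only in the third form are compared. As
  \<open>g3\<close> is in \<open>I\<close>, the product g3 h equals some e c modulo the pair, and
  since \<open>c\<close> can be cancelled there, \<open>e\<close> belongs to the other link.\<close>

lemma colon_homogeneous_lift:
  fixes I :: "(3, 'k::field) mpoly set"
  assumes reg: "regular_sequence [g1, g2, c]" and gI: "g3 \<in> I"
    and hom: "homogeneous d1 g1" "homogeneous d2 g2" "homogeneous d3 g3" "homogeneous d3 c"
    and h: "h \<in> ideal_colon (ideal_gen {g1, g2, c}) I" "homogeneous d h"
  obtains e where "homogeneous d e" "e \<in> ideal_colon (ideal_gen {g1, g2, g3}) I"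
    "g3 * h - e * c \<in> ideal_gen {g1, g2}"
proof -
  have "h * g3 \<in> ideal_gen {g1, g2, c}" using h(1) gI by (simp add: mem_ideal_colon)
  then obtain u v e where e: "h * g3 = u * g1 + v * g2 + e * c" "e = hpart (int (d + d3) - int d3) e"
    using homogeneous_in_triple[OF _ homogeneous_mult[OF h(2) hom(3)] hom(1,2,4)] by metis
  have he: "homogeneous d e" using e(2) homogeneous_hpart[of d e] by simp
  have diff: "g3 * h - e * c = u * g1 + v * g2" using e(1) by (simp add: algebra_simps)
  have "e * i \<in> ideal_gen {g1, g2, g3}" if i: "i \<in> I" for i
  proof -
    have "h * i \<in> ideal_gen {g1, g2, c}" using h(1) i by (simp add: mem_ideal_colon)
    then obtain p q w where w: "h * i = p * g1 + q * g2 + w * c" unfolding mem_ideal_gen_3 by blast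
    have "c * (e * i - g3 * w) = g3 * (h * i - w * c) - i * (g3 * h - e * c)"
      by (simp add: algebra_simps)
    also have "\<dots> = (g3 * p - i * u) * g1 + (g3 * q - i * v) * g2"
      unfolding w diff by (simp add: algebra_simps)
    finally have "c * (e * i - g3 * w) \<in> ideal_gen {g1, g2}" unfolding mem_ideal_gen_2 by blast
    then have "e * i - g3 * w \<in> ideal_gen {g1, g2}" using reg unfolding regular_sequence_3 by blast
    then obtain s t where "e * i - g3 * w = s * g1 + t * g2" unfolding mem_ideal_gen_2 by blast
    then have "e * i = s * g1 + t * g2 + w * g3" by (simp add: algebra_simps)
    then show ?thesis unfolding mem_ideal_gen_3 by blast
  qed
  then have "e \<in> ideal_colon (ideal_gen {g1, g2, g3}) I" by (subst mem_ideal_colon) blast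
  moreover have "g3 * h - e * c \<in> ideal_gen {g1, g2}" unfolding diff mem_ideal_gen_2 by blast
  ultimately show thesis using that he by blast
qed

text \<open>Degree 3 pairs with degree 6, and \<open>J\<close> contains all of the latter. For the
  second condition the factor x is cancelled, and the pairing takes place modulo
  \<open>small.L\<close>, in socle degree 8.\<close>

lemma even_kind_over_if_linked:
  assumes J: "odd_kind J" and fr: "factored_regular g r c" and sub: "{g, varx * r, c} \<subseteq> J"
  shows "even_kind_over (ideal_colon (ideal_gen {g, varx * r, c}) J) g r"
proof -
  interpret factored_regular g r c by (rule fr)
  note J = odd_kindD[OF J]
  let ?I = "ideal_colon big.L J"
  have pt: "g \<in> point_ideal" "varx * r \<in> point_ideal"
    using J(4)[OF hg] J(4)[OF hxr] sub by auto
  then have rpt: "r \<in> point_ideal"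
    using prime_point_ideal varx_not_in_point_ideal unfolding prime_ideal_def by blast
  have cpt: "c \<notin> point_ideal"
    using regular_not_in_point_ideal[OF reg] pt hg hxr hc by auto
  have low: "a \<in> ideal_gen {g, varx * r}" if a: "homogeneous d a" "a \<in> ?I" "d \<le> 3" for d a
  proof -
    have "a \<in> big.L"
    proof (rule big.below_socle[OF a(1), of 6])
      show "a * m \<in> big.L" if "homogeneous 6 m" for m
        using a(2) J(5)[OF that] by (simp add: mem_ideal_colon)
    qed (use a(3) in simp)
    then show ?thesis using low_degree_in_triple[OF _ a(1) hg hxr hc] a(3) by simp
  qed
  have mid: "varx * v * a \<in> ideal_gen {g, varx * r}"
    if a: "homogeneous d a" "a \<in> ?I" "d \<le> 5" and v: "v = vary \<or> v = varz" for d a v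
  proof -
    have hv: "homogeneous 1 v" and vpt: "v \<in> point_ideal" using v by (auto intro: ideal_gen_base)
    have hva: "homogeneous (1 + d) (v * a)" by (rule homogeneous_mult[OF hv a(1)])
    have va: "v * a \<in> small.L"
    \<comment> \<open>The degrees 1 + d and 7 - d add up to 8, and 7 - d is at least 2, as needed
      for the products with x y and x z in \<open>J\<close>.\<close>
    proof (rule small.below_socle[OF hva, of "7 - d"])
      fix m :: "(3, 'a) mpoly" assume m: "homogeneous (7 - d) m"
      have "varx * v * m \<in> J" using J(7)[OF m] v a(3) by auto
      then have "a * (varx * v * m) \<in> big.L" using a(2) by (simp add: mem_ideal_colon)
      then have "varx * (v * a * m) \<in> big.L" by (simp add: mult_ac)
      then show "v * a * m \<in> small.L" by (rule cancel_triple)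
    qed (use a(3) in simp)
    \<comment> \<open>The coefficient of \<open>c\<close> has degree at most 0, so it is a constant.
      It vanishes by evaluation at (1:0:0), a zero of all other terms but not of
      \<open>c\<close>.\<close>
    obtain p q w where w: "v * a = p * g + q * r + w * c" "w = hpart (int (1 + d) - int 6) w"
      using homogeneous_in_triple[OF va hva hg hr hc] .
    obtain k where k: "w = Const k" using hpart_eq_Const[OF w(2)] a(3) by auto
    have "w * c = v * a - (p * g + q * r)" using w(1) by (simp add: algebra_simps)
    also have "\<dots> \<in> point_ideal"
      using vpt pt rpt by (intro is_ideal_diff is_ideal_add is_ideal_mult[of _ g] is_ideal_mult[of _ r]
          is_ideal_mult_right[of _ v]) simp_all
    finally have "Const k * c \<in> point_ideal" unfolding k .
    then have "k = 0" using cpt is_ideal_Const_cancel[OF is_ideal_ideal_gen] by blast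
    then have "v * a = p * g + q * r" using w(1) k by simp
    then have "v * a \<in> ideal_gen {g, r}" unfolding mem_ideal_gen_2 by blast
    from mult_pair[OF this] show ?thesis by (simp add: mult.assoc)
  qed
  show ?thesis unfolding even_kind_over_def using low mid by blast
qed

text \<open>The remaining conditions follow by degrees. Members of \<open>I\<close> of degree above
  3 times forms of degree 6, and members of degree above 5 times x y h or x z h with h of degree at
  least 2, lie beyond the socle degree 9; members of lower degree are covered by
  \<open>even_kind_over\<close>.\<close>

lemma odd_kind_colonI:
  assumes I: "is_ideal I" "hclosed I" "c \<in> I" and over: "even_kind_over I g r" and fr: "factored_regular g r c"
  defines "J \<equiv> ideal_colon (ideal_gen {g, varx * r, c}) I"
  assumes L1: "\<And>d h. homogeneous d h \<Longrightarrow> h \<in> J \<Longrightarrow> d < 3 \<Longrightarrow> h = 0"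
    and L2: "\<And>d h. homogeneous d h \<Longrightarrow> h \<in> J \<Longrightarrow> d \<le> 5 \<Longrightarrow> h \<in> point_ideal"
    and L4: "\<And>h. homogeneous 3 h \<Longrightarrow> h \<in> J \<Longrightarrow> h \<in> ideal_gen {g, varx}"
  shows "odd_kind J"
proof -
  interpret factored_regular g r c by (rule fr)
  have low: "a \<in> ideal_gen {g, varx * r}" if "homogeneous d a" "a \<in> I" "d \<le> 3" for d a
    using over that unfolding even_kind_over_def by blast
  have mid: "varx * vary * a \<in> ideal_gen {g, varx * r}" "varx * varz * a \<in> ideal_gen {g, varx * r}"
    if "homogeneous d a" "a \<in> I" "d \<le> 5" for d a
    using over that unfolding even_kind_over_def by blast+
  have L3: "h \<in> J" if h: "homogeneous 6 h" for h
    unfolding J_def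
  proof (rule colon_homogeneousI[OF is_ideal_ideal_gen I(2)])
    fix d i assume i: "homogeneous d i" "i \<in> I"
    show "h * i \<in> big.L"
    proof (cases "d \<le> 3")
      case True
      then show ?thesis using low[OF i] pair_subset is_ideal_mult[OF is_ideal_ideal_gen] by blast
    next
      case False
      then show ?thesis using big.above_socle[OF homogeneous_mult[OF h i(1)]] by simp
    qed
  qed
  have L5: "varx * v * h \<in> J" if h: "homogeneous d h" "2 \<le> d" and v: "v = vary \<or> v = varz" for d h v
    unfolding J_def
  proof (rule colon_homogeneousI[OF is_ideal_ideal_gen I(2)])
    fix e i assume i: "homogeneous e i" "i \<in> I"
    show "varx * v * h * i \<in> big.L"
    proof (cases "e \<le> 5")
      case True
      then have "varx * v * i \<in> big.L" using mid[OF i] pair_subset v by blast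
      then have "h * (varx * v * i) \<in> big.L" by (simp add: is_ideal_mult)
      then show ?thesis by (simp add: mult_ac)
    next
      case False
      have "homogeneous 1 v" using v by auto
      then have "homogeneous (1 + 1 + d + e) (varx * v * h * i)"
        using h(1) i(1) homogeneous_Var[of 0] by (intro homogeneous_mult) simp_all
      then show ?thesis using False h(2) by (intro big.above_socle) auto
    qed
  qed
  have L6: "\<exists>p1 p2 c. regular_sequence [p1, p2, c] \<and> homogeneous 3 p1 \<and> homogeneous 3 p2 \<and> homogeneous 6 c \<and>
        {p1, p2, c} \<subseteq> J"
    using reg hg hxr hc big.L_subset_colon[OF I(1)] unfolding J_def
    by (intro exI[of _ g] exI[of _ "varx * r"] exI[of _ c]) (auto intro: ideal_gen_base)
  have L0: "is_ideal J" "hclosed J"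
    using I big.hclosed_L unfolding J_def by (simp_all add: is_ideal_colon hclosed_colon)
  have L4': "\<exists>k. h - Const k * g \<in> ideal_gen {varx}" if h: "homogeneous 3 h" "h \<in> J" for h
  proof -
    obtain u v where u: "h = u * g + v * varx" "u = hpart (int 3 - int 3) u"
      using homogeneous_in_pair[OF L4[OF h] h(1) hg homogeneous_Var] by metis
    obtain k where "u = Const k" using hpart_eq_Const[OF u(2)] by auto
    then have "h - Const k * g = v * varx" using u(1) by simp
    then show ?thesis unfolding mem_ideal_gen_1 by blast
  qed
  show ?thesis unfolding odd_kind_def
  proof (intro conjI allI impI)
    show "\<exists>G. homogeneous 3 G \<and> (\<forall>h\<in>J. homogeneous 3 h \<longrightarrow> (\<exists>c. h - Const c * G \<in> ideal_gen {varx}))"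
      using hg L4' by (intro exI[of _ g] conjI ballI impI) simp_all
  qed (use L0 in simp, use L0 in simp, use L1 in blast, use L2 in blast, use L3 in blast,
       use L5 in blast, use L5 in blast, rule L6)
qed

text \<open>A form \<open>h\<close> of the new link is carried to a form \<open>e\<close> of the
  same degree in the old one. What is known about \<open>e\<close> returns to \<open>h\<close>,
  since \<open>g3\<close> is regular modulo the pair and modulo the ideal of \<open>g\<close> and x,
  and does not vanish at (1:0:0).\<close>

lemma odd_kind_if_linked:
  assumes I: "is_ideal I" "hclosed I" and over: "even_kind_over I g r"
    and fr: "factored_regular g r g3" "{g, varx * r, g3} \<subseteq> I"
    and J: "odd_kind (ideal_colon (ideal_gen {g, varx * r, g3}) I)"
    and fr': "factored_regular g r c" "c \<in> I"
  shows "odd_kind (ideal_colon (ideal_gen {g, varx * r, c}) I)"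
proof -
  interpret old: factored_regular g r g3 by (rule fr(1))
  interpret new: factored_regular g r c by (rule fr'(1))
  note J = odd_kindD[OF J]
  let ?K = "ideal_gen {g, varx * r}" and ?J' = "ideal_colon new.big.L I"
  have gJ: "{g, varx * r, g3} \<subseteq> ideal_colon old.big.L I"
    using old.big.L_subset_colon[OF I(1)] by (auto intro: ideal_gen_base)
  have pt: "g \<in> point_ideal" "varx * r \<in> point_ideal"
    using J(4)[OF old.hg] J(4)[OF old.hxr] gJ by auto
  have Kpt: "?K \<subseteq> point_ideal" using pt by (intro ideal_gen_least) auto
  have cpt: "g3 \<notin> point_ideal"
    using regular_not_in_point_ideal[OF old.reg] pt old.hg old.hxr old.hc by auto
  have lift: "\<exists>e. homogeneous d e \<and> e \<in> ideal_colon old.big.L I \<and> g3 * h - e * c \<in> ?K"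
    if "homogeneous d h" "h \<in> ?J'" for d h
    using colon_homogeneous_lift[OF new.reg _ old.hg old.hxr old.hc new.hc that(2,1)] fr(2) by blast
  have L1: "h = 0" if h: "homogeneous d h" "h \<in> ?J'" "d < 3" for d h
  proof -
    obtain e where e: "homogeneous d e" "e \<in> ideal_colon old.big.L I" "g3 * h - e * c \<in> ?K"
      using lift h by blast
    then have "g3 * h \<in> ?K" using J(3)[OF e(1,2)] h(3) by simp
    then have "h \<in> ?K" by (rule old.regular_facts)
    then show ?thesis using low_degree_in_pair_eq_0[OF _ h(1) old.hg old.hxr] h(3) by simp
  qed
  have L2: "h \<in> point_ideal" if h: "homogeneous d h" "h \<in> ?J'" "d \<le> 5" for d h
  proof -
    obtain e where e: "homogeneous d e" "e \<in> ideal_colon old.big.L I" "g3 * h - e * c \<in> ?K"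
      using lift h by blast
    have "e * c \<in> point_ideal" using J(4)[OF e(1,2)] h(3) by (simp add: is_ideal_mult_right)
    then have "g3 * h \<in> point_ideal" using e(3) Kpt is_ideal_diff_cancel[OF is_ideal_ideal_gen] by blast
    then show ?thesis using prime_point_ideal cpt unfolding prime_ideal_def by blast
  qed
  have L4: "h \<in> ideal_gen {g, varx}" if h: "homogeneous 3 h" "h \<in> ?J'" for h
  proof -
    obtain e where e: "homogeneous 3 e" "e \<in> ideal_colon old.big.L I" "g3 * h - e * c \<in> ?K"
      using lift h by blast
    obtain G where G: "\<And>h. h \<in> ideal_colon old.big.L I \<Longrightarrow> homogeneous 3 h \<Longrightarrow>
        \<exists>c. h - Const c * G \<in> ideal_gen {varx}"
      using J(6) by blast
    \<comment> \<open>Modulo x both \<open>e\<close> and \<open>g\<close> are multiples of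
      \<open>G\<close>, and \<open>g\<close> is not 0 there, so \<open>e\<close> is a multiple of
      \<open>g\<close> modulo x.\<close>
    obtain a b where a: "e - Const a * G \<in> ideal_gen {varx}" and b: "g - Const b * G \<in> ideal_gen {varx}"
      using G[OF e(2,1)] G[OF _ old.hg] gJ by blast
    have b0: "b \<noteq> 0" using b old.g_not_in_varx by auto
    have x: "ideal_gen {varx} \<subseteq> ideal_gen {g, varx}" by (rule ideal_gen_mono) auto
    have K: "?K \<subseteq> ideal_gen {g, varx}"
      by (intro ideal_gen_least) (auto intro: ideal_gen_base is_ideal_mult_right)
    have gg: "g \<in> ideal_gen {g, varx}" by (rule ideal_gen_base) simp
    have "Const b * G \<in> ideal_gen {g, varx}"
      using b x gg is_ideal_diff_cancel[OF is_ideal_ideal_gen] by blast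
    then have "G \<in> ideal_gen {g, varx}" using b0 is_ideal_Const_cancel is_ideal_ideal_gen by blast
    then have "Const a * G \<in> ideal_gen {g, varx}" by (simp add: is_ideal_mult)
    then have "e \<in> ideal_gen {g, varx}" using a x is_ideal_diff_cancel[OF is_ideal_ideal_gen] by blast
    then have "e * c \<in> ideal_gen {g, varx}" by (simp add: is_ideal_mult_right)
    then have "g3 * h \<in> ideal_gen {g, varx}" using e(3) K is_ideal_diff_cancel[OF is_ideal_ideal_gen] by blast
    then show ?thesis by (rule old.cancel_c_varx)
  qed
  show ?thesis by (rule odd_kind_colonI[OF I fr'(2) over fr'(1) L1 L2 L4])
qed

section \<open>Ideals of the two kinds are not complete intersections\<close>

lemma mvs_dependent_family:
  fixes w :: "nat \<Rightarrow> ('v, 'k::field) mpoly"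
  assumes "finite B" "card B < n" "\<And>i. i < n \<Longrightarrow> w i \<in> mvs.span B"
  shows "\<exists>l. (\<exists>i<n. l i \<noteq> 0) \<and> (\<Sum>i<n. Const (l i) * w i) = 0"
proof (cases "inj_on w {..<n}")
  case False
  then obtain i j where ij: "i < n" "j < n" "i \<noteq> j" "w i = w j" by (auto simp: inj_on_def)
  let ?l = "\<lambda>k. if k = i then 1 else if k = j then -1 else 0 :: 'k"
  have "(\<Sum>k<n. Const (?l k) * w k) = (\<Sum>k\<in>{i, j}. Const (?l k) * w k)"
    using ij by (intro sum.mono_neutral_right) auto
  also have "\<dots> = 0" using ij by (simp add: Const_uminus)
  finally have "(\<Sum>k<n. Const (?l k) * w k) = 0" .
  then show ?thesis using ij(1) by (intro exI[of _ ?l]) auto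
next
  case True
  have "\<not> mvs.independent (w ` {..<n})"
  proof
    assume "mvs.independent (w ` {..<n})"
    from mvs.independent_span_bound[OF assms(1) this] have "card (w ` {..<n}) \<le> card B"
      using assms(3) by blast
    then show False using assms(2) True by (simp add: card_image)
  qed
  then obtain t u v where t: "finite t" "t \<subseteq> w ` {..<n}" "(\<Sum>v\<in>t. Const (u v) * v) = 0" "v \<in> t" "u v \<noteq> 0"
    unfolding mvs.dependent_explicit by blast
  let ?l = "\<lambda>i. if w i \<in> t then u (w i) else 0"
  have "(\<Sum>i<n. Const (?l i) * w i) = (\<Sum>v\<in>w ` {..<n}. Const (if v \<in> t then u v else 0) * v)"
    by (simp add: sum.reindex[OF True])
  also have "\<dots> = (\<Sum>v\<in>t. Const (u v) * v)"
    using t(2) by (intro sum.mono_neutral_cong_right) auto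
  finally have "(\<Sum>i<n. Const (?l i) * w i) = 0" using t(3) by simp
  moreover have "\<exists>i<n. ?l i \<noteq> 0" using t(2,4,5) by auto
  ultimately show ?thesis by (intro exI[of _ ?l]) auto
qed

text \<open>The part of degree n of \<open>t\<close> meets only the constant term of
  \<open>p\<close>, which is 0; all other contributions involve parts of \<open>t\<close> of smaller
  degree.\<close>

lemma hpart_irrelevant_mult:
  fixes T :: "('v::finite, 'k::field) mpoly set"
  assumes T: "hclosed T" and p: "p \<in> irrelevant_ideal" and t: "t \<in> T"
  shows "hpart n (p * t) \<in> ideal_gen {a \<in> T. \<exists>d. int d < n \<and> homogeneous d a}"
proof -
  obtain D where D: "t = (\<Sum>i\<le>D. hpart (int i) t)"
    using sum_hpart[of t "Max (monom_degree ` Poly_Mapping.keys t)"] by auto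
  have "p * t = (\<Sum>i\<le>D. p * hpart (int i) t)"
    by (subst D) (simp add: sum_distrib_left)
  then have "hpart n (p * t) = (\<Sum>i\<le>D. hpart (n - int i) p * hpart (int i) t)"
    by (simp add: hpart_sum hpart_mult_homogeneous[OF homogeneous_hpart])
  also have "\<dots> \<in> ideal_gen {a \<in> T. \<exists>d. int d < n \<and> homogeneous d a}"
  proof (rule is_ideal_sum[OF is_ideal_ideal_gen])
    fix i
    consider "int i < n" | "int i = n" | "n < int i" by linarith
    then show "hpart (n - int i) p * hpart (int i) t \<in> ideal_gen {a \<in> T. \<exists>d. int d < n \<and> homogeneous d a}"
    proof cases
      case 1
      then have "hpart (int i) t \<in> {a \<in> T. \<exists>d. int d < n \<and> homogeneous d a}"
        using hclosedD[OF T t] homogeneous_hpart by blast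
      then show ?thesis by (intro is_ideal_mult[OF is_ideal_ideal_gen] ideal_gen_base)
    next
      case 2
      then show ?thesis using p by (simp add: irrelevant_ideal_hpart is_ideal_0)
    next
      case 3
      then show ?thesis by (simp add: hpart_neg is_ideal_0)
    qed
  qed
  finally show ?thesis .
qed

text \<open>A regular sequence has at most three members. An element \<open>a\<close> of least
  degree in \<open>T\<close> outside the ideal of \<open>p1, p2, c\<close> would be a fourth minimal
  generator, because the last two hypotheses make these three forms part of a minimal system of
  generators.\<close>

lemma complete_intersection_few_generators:
  fixes T :: "(3, 'k::field) mpoly set"
  assumes T: "is_ideal T" "hclosed T" "complete_intersection T"
    and reg: "regular_sequence [p1, p2, c]"
    and hom: "homogeneous 3 p1" "homogeneous 3 p2" "homogeneous 6 c" and sub: "{p1, p2, c} \<subseteq> T"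
    and low: "\<And>d a. homogeneous d a \<Longrightarrow> a \<in> T \<Longrightarrow> d < 3 \<Longrightarrow> a = 0"
    and c: "c \<notin> ideal_gen {a \<in> T. \<exists>d. d \<le> 5 \<and> homogeneous d a}"
  shows "T = ideal_gen {p1, p2, c}"
proof (rule ccontr)
  assume ne: "T \<noteq> ideal_gen {p1, p2, c}"
  let ?L = "ideal_gen {p1, p2, c}"
  have LT: "?L \<subseteq> T" using sub T(1) by (intro ideal_gen_least) auto
  have "\<exists>d a. homogeneous d a \<and> a \<in> T \<and> a \<notin> ?L"
  proof (rule ccontr)
    assume *: "\<not> ?thesis"
    have "p \<in> ?L" if p: "p \<in> T" for p
    proof (rule is_ideal_if_hpart[OF is_ideal_ideal_gen])
      fix n
      show "hpart n p \<in> ?L"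
        using * hclosedD[OF T(2) p, of n] homogeneous_hpart[of "nat n" p]
        by (cases "n < 0") (auto simp: hpart_neg is_ideal_0)
    qed
    then show False using ne LT by blast
  qed
  then obtain j0 where j0: "\<exists>a. homogeneous j0 a \<and> a \<in> T \<and> a \<notin> ?L" by blast
  define j where "j = (LEAST j. \<exists>a. homogeneous j a \<and> a \<in> T \<and> a \<notin> ?L)"
  have "\<exists>a. homogeneous j a \<and> a \<in> T \<and> a \<notin> ?L" unfolding j_def by (rule LeastI) (rule j0)
  then obtain a where a: "homogeneous j a" "a \<in> T" "a \<notin> ?L" by blast
  have min: "b \<in> ?L" if "homogeneous d b" "b \<in> T" "d < j" for d b
    using that not_less_Least[of d] unfolding j_def by blast
  obtain fs where fs: "regular_sequence fs" "T = ideal_gen (set fs)"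
    using T(3) unfolding complete_intersection_def by blast
  have card: "card (set fs) < 4"
    using length_regular_sequence_le[OF fs(1)] card_length[of fs] by simp
  define v where "v = (\<lambda>i. [p1, p2, c, a] ! i)"
  have "\<exists>w. w \<in> mvs.span (set fs) \<and> (\<forall>n. hpart n (v i - w) \<in> ideal_gen {a \<in> T. \<exists>d. int d < n \<and> homogeneous d a})"
    if i: "i < 4" for i
  proof -
    have "v i \<in> T" using i sub a(2) by (auto simp: v_def less_Suc_eq numeral_eq_Suc)
    then obtain u where u: "v i = (\<Sum>f\<in>set fs. u f * f)"
      using mem_ideal_gen_finite[of "v i" "set fs"] fs(2) by auto
    \<comment> \<open>As in Nakayama's lemma, modulo the irrelevant ideal times \<open>T\<close>
      only the constant terms of the coefficients count. Thus four elements lie in a space with at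
      most three generators, also if the members of \<open>fs\<close> are inhomogeneous.\<close>
    have "\<forall>f. \<exists>k. hpart 0 (u f) = Const k"
      using homogeneous_hpart[of 0] homogeneous_0_iff by auto
    from choice[OF this] obtain k where k: "\<And>f. hpart 0 (u f) = Const (k f)" by blast
    define w where "w = (\<Sum>f\<in>set fs. Const (k f) * f)"
    have "w \<in> mvs.span (set fs)"
      unfolding w_def by (intro mvs.span_sum mvs.span_scale mvs.span_base)
    moreover have "hpart n (v i - w) \<in> ideal_gen {a \<in> T. \<exists>d. int d < n \<and> homogeneous d a}" for n
    proof -
      have "v i - w = (\<Sum>f\<in>set fs. (u f - hpart 0 (u f)) * f)"
        by (simp add: u w_def k sum_subtractf left_diff_distrib)
      moreover have irr: "u f - hpart 0 (u f) \<in> irrelevant_ideal" for f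
        by (simp add: irrelevant_ideal_hpart hpart_diff)
      moreover have fT: "f \<in> T" if "f \<in> set fs" for f
        using that fs(2) by (simp add: ideal_gen_base)
      moreover have "hpart n (\<Sum>f\<in>set fs. (u f - hpart 0 (u f)) * f)
          \<in> ideal_gen {a \<in> T. \<exists>d. int d < n \<and> homogeneous d a}"
        unfolding hpart_sum
        by (rule is_ideal_sum[OF is_ideal_ideal_gen]) (rule hpart_irrelevant_mult[OF T(2) irr fT])
      ultimately show ?thesis by simp
    qed
    ultimately show ?thesis by blast
  qed
  then have "\<forall>i. \<exists>w. i < 4 \<longrightarrow> w \<in> mvs.span (set fs) \<and>
      (\<forall>n. hpart n (v i - w) \<in> ideal_gen {a \<in> T. \<exists>d. int d < n \<and> homogeneous d a})" by blast
  from choice[OF this] obtain w where w: "\<And>i. i < 4 \<Longrightarrow> w i \<in> mvs.span (set fs)"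
    "\<And>i n. i < 4 \<Longrightarrow> hpart n (v i - w i) \<in> ideal_gen {a \<in> T. \<exists>d. int d < n \<and> homogeneous d a}"
    by blast
  obtain l where l: "\<exists>i<4. l i \<noteq> 0" "(\<Sum>i<4. Const (l i) * w i) = 0"
    using mvs_dependent_family[of "set fs" 4 w] card w(1) by auto
  define E where "E = Const (l 0) * p1 + Const (l 1) * p2 + Const (l 2) * c + Const (l 3) * a"
  have E: "E = (\<Sum>i<4. Const (l i) * (v i - w i))"
  proof -
    have "(\<Sum>i<4. Const (l i) * (v i - w i)) = (\<Sum>i<4. Const (l i) * v i)"
      using l(2) by (simp add: right_diff_distrib sum_subtractf)
    then show ?thesis by (simp add: E_def v_def numeral_eq_Suc)
  qed
  have hE: "hpart n E \<in> ideal_gen {a \<in> T. \<exists>d. int d < n \<and> homogeneous d a}" for n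
    unfolding E hpart_sum
    by (rule is_ideal_sum[OF is_ideal_ideal_gen])
      (simp add: hpart_homogeneous_mult[OF homogeneous_Const] is_ideal_mult w(2))
  have hpE: "hpart n E = (if n = 3 then Const (l 0) * p1 + Const (l 1) * p2 else 0) +
      (if n = 6 then Const (l 2) * c else 0) + (if n = int j then Const (l 3) * a else 0)" for n
    using hom a(1) by (simp add: E_def hpart_add hpart_homogeneous[OF homogeneous_Const_mult])
  have L: "p1 \<in> ?L" "p2 \<in> ?L" "c \<in> ?L" by (auto intro: ideal_gen_base)
  \<comment> \<open>The linear relation is read off degree by degree: degree \<open>j\<close> yields
    \<open>l 3 = 0\<close>, then degree 6 yields \<open>l 2 = 0\<close>, and degree 3 the rest. The
    degree \<open>j\<close> may coincide with 3 or 6.\<close>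
  have "ideal_gen {a \<in> T. \<exists>d. int d < int j \<and> homogeneous d a} \<subseteq> ?L"
    using min by (intro ideal_gen_least) auto
  then have "hpart (int j) E \<in> ?L" using hE by blast
  moreover have "(if int j = 3 then Const (l 0) * p1 + Const (l 1) * p2 else 0) +
      (if int j = 6 then Const (l 2) * c else 0) \<in> ?L"
    using L by (auto intro!: is_ideal_add is_ideal_mult simp: is_ideal_0)
  ultimately have "Const (l 3) * a \<in> ?L"
    unfolding hpE by (simp add: is_ideal_add_cancel add.commute[of _ "Const (l 3) * a"])
  then have l3: "l 3 = 0" using a(3) is_ideal_Const_cancel is_ideal_ideal_gen by blast
  have "int d < 6 \<longleftrightarrow> d \<le> 5" for d by linarith
  then have "{a \<in> T. \<exists>d. int d < 6 \<and> homogeneous d a} = {a \<in> T. \<exists>d. d \<le> 5 \<and> homogeneous d a}" by simp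
  then have "Const (l 2) * c \<in> ideal_gen {a \<in> T. \<exists>d. d \<le> 5 \<and> homogeneous d a}"
    using hE[of 6] hpE[of 6] unfolding l3 by (simp cong: if_cong)
  then have l2: "l 2 = 0" using c is_ideal_Const_cancel is_ideal_ideal_gen by blast
  have "ideal_gen {a \<in> T. \<exists>d. int d < 3 \<and> homogeneous d a} \<subseteq> {0}"
    using low by (intro ideal_gen_least) (auto intro!: is_idealI)
  then have rel: "Const (l 0) * p1 + Const (l 1) * p2 = 0"
    using hE[of 3] hpE[of 3] unfolding l3 by (auto cong: if_cong)
  have l1: "l 1 = 0"
  proof (rule ccontr)
    assume "l 1 \<noteq> 0"
    have "p2 * Const (l 1) = (- Const (l 0)) * p1" using rel by (simp add: algebra_simps add_eq_0_iff)
    then have "p2 * Const (l 1) \<in> ideal_gen {p1}" unfolding mem_ideal_gen_1 by blast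
    then have "Const (l 1) * 1 \<in> ideal_gen {p1}" using reg unfolding regular_sequence_3 by auto
    then have "1 \<in> ideal_gen {p1}" using \<open>l 1 \<noteq> 0\<close> is_ideal_Const_cancel is_ideal_ideal_gen by blast
    then have "1 \<in> ?L" using ideal_gen_mono[of "{p1}" "{p1, p2, c}"] by auto
    then show False using reg is_ideal_eq_UNIV[OF is_ideal_ideal_gen] unfolding regular_sequence_3 by auto
  qed
  have "l 0 = 0" using rel l1 regular_sequence_nonzero[OF reg, of p1] by auto
  then show False using l(1) l1 l2 l3 by (auto simp: numeral_eq_Suc less_Suc_eq)
qed

text \<open>Modulo x the two cubics are multiples of one form \<open>G\<close>, so a combination of
  them is divisible by x.\<close>

lemma factor_varx:
  assumes J: "odd_kind J" and reg: "regular_sequence [p1, p2, c]"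
    and hom: "homogeneous 3 p1" "homogeneous 3 p2" "homogeneous 6 c" and sub: "{p1, p2, c} \<subseteq> J"
  obtains g r where "factored_regular g r c" "{g, varx * r, c} \<subseteq> J"
    "ideal_gen {p1, p2, c} = ideal_gen {g, varx * r, c}"
proof -
  note result = that
  note J = odd_kindD[OF J]
  obtain G where G: "\<And>h. h \<in> J \<Longrightarrow> homogeneous 3 h \<Longrightarrow> \<exists>c. h - Const c * G \<in> ideal_gen {varx}"
    using J(6) by blast
  have "p1 \<in> J" "p2 \<in> J" using sub by simp_all
  from G[OF this(1) hom(1)] G[OF this(2) hom(2)]
  obtain a b where a: "p1 - Const a * G \<in> ideal_gen {varx}" and b: "p2 - Const b * G \<in> ideal_gen {varx}"
    by blast
  have wlog: thesis
    if *: "regular_sequence [q1, q2, c]" "homogeneous 3 q1" "homogeneous 3 q2" "q1 \<in> J" "q2 \<in> ideal_gen {varx}"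
      "ideal_gen {p1, p2, c} = ideal_gen {q1, q2, c}" "q2 \<in> J" for q1 q2
  proof -
    obtain u where u: "q2 = u * varx" using *(5) unfolding mem_ideal_gen_1 by blast
    define r where "r = hpart (int 2) u"
    have "q2 = hpart (int 3) q2" using *(3) by (simp add: hpart_homogeneous)
    also have "\<dots> = varx * r"
      unfolding u r_def hpart_mult_homogeneous[OF homogeneous_Var] by (simp add: mult.commute)
    finally have q2: "q2 = varx * r" .
    have "factored_regular q1 r c"
      using *(1,2) hom(3) homogeneous_hpart[of 2 u] unfolding q2 r_def by unfold_locales simp_all
    then show thesis using result[of q1 r] * sub q2 by auto
  qed
  show thesis
  proof (cases "b = 0")
    case True
    then show thesis using wlog[of p1 p2] reg hom sub b by simp
  next
    case False
    define k where "k = a / b"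
    define q where "q = p1 - Const k * p2"
    have "q = (p1 - Const a * G) - Const k * (p2 - Const b * G)"
      using False unfolding q_def k_def by (simp add: algebra_simps flip: Const_mult mult.assoc)
    then have qx: "q \<in> ideal_gen {varx}" using a b by (simp add: is_ideal_diff is_ideal_mult)
    have hq: "homogeneous 3 q" unfolding q_def by (intro homogeneous_diff homogeneous_Const_mult hom)
    have p1: "p1 = q + Const k * p2" by (simp add: q_def)
    have pair: "ideal_gen {p2, p1} = ideal_gen {p2, q}"
    proof (rule ideal_gen_eqI)
      show "{p2, p1} \<subseteq> ideal_gen {p2, q}"
        unfolding p1 by (auto intro!: is_ideal_add is_ideal_mult intro: ideal_gen_base)
      show "{p2, q} \<subseteq> ideal_gen {p2, p1}"
        unfolding q_def by (auto intro!: is_ideal_diff is_ideal_mult intro: ideal_gen_base)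
    qed
    have triple: "ideal_gen {p1, p2, c} = ideal_gen {p2, q, c}"
    proof (rule ideal_gen_eqI)
      show "{p1, p2, c} \<subseteq> ideal_gen {p2, q, c}"
        unfolding p1 by (auto intro!: is_ideal_add is_ideal_mult intro: ideal_gen_base)
      show "{p2, q, c} \<subseteq> ideal_gen {p1, p2, c}"
        unfolding q_def by (auto intro!: is_ideal_diff is_ideal_mult intro: ideal_gen_base)
    qed
    have reg': "regular_sequence [p2, p1, c]" using reg by (rule regular_sequence_swap12)
    have "regular_sequence [p2, q, c]"
      unfolding regular_sequence_3
    proof (intro conjI allI impI)
      show "p2 * u = 0 \<Longrightarrow> u = 0" for u using reg' unfolding regular_sequence_3 by blast
      show "u \<in> ideal_gen {p2}" if qu: "q * u \<in> ideal_gen {p2}" for u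
      proof -
        have "p1 * u = q * u + Const k * u * p2" by (simp add: p1 algebra_simps)
        also have "\<dots> \<in> ideal_gen {p2}"
          by (rule is_ideal_add[OF is_ideal_ideal_gen qu is_ideal_mult[OF is_ideal_ideal_gen]])
            (rule ideal_gen_base, simp)
        finally show ?thesis using reg' unfolding regular_sequence_3 by blast
      qed
      show "c * u \<in> ideal_gen {p2, q} \<Longrightarrow> u \<in> ideal_gen {p2, q}" for u
        using reg' unfolding regular_sequence_3 pair by blast
      show "ideal_gen {p2, q, c} \<noteq> UNIV" using reg unfolding regular_sequence_3 triple by blast
    qed
    moreover have "q \<in> J" unfolding q_def using sub J(1) by (auto intro!: is_ideal_diff is_ideal_mult)
    ultimately show thesis using wlog[of p2 q] hom hq qx triple sub by simp
  qed
qed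

text \<open>Otherwise \<open>J\<close> would be generated by three of its forms and would contain x
  y m for every quadratic form m. After cancelling x, duality places y in the ideal of
  \<open>g, r, c0\<close>, whose generators have degree at least 2.\<close>

lemma odd_kind_not_complete_intersection:
  assumes J: "odd_kind J"
  shows "\<not> complete_intersection J"
proof
  assume ci: "complete_intersection J"
  note JD = odd_kindD[OF J]
  obtain p1 p2 c0 where p: "regular_sequence [p1, p2, c0]" "homogeneous 3 p1" "homogeneous 3 p2" "homogeneous 6 c0"
    "{p1, p2, c0} \<subseteq> J" using JD(8) by blast
  obtain g r where fr: "factored_regular g r c0" "{g, varx * r, c0} \<subseteq> J"
    using factor_varx[OF J p] by metis
  interpret factored_regular g r c0 by (rule fr(1))
  have low: "{a \<in> J. \<exists>d. d \<le> 5 \<and> homogeneous d a} \<subseteq> point_ideal" using JD(4) by blast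
  then have low': "ideal_gen {a \<in> J. \<exists>d. d \<le> 5 \<and> homogeneous d a} \<subseteq> point_ideal"
    by (intro ideal_gen_least) simp_all
  have "g \<in> point_ideal" "varx * r \<in> point_ideal" using JD(4)[OF hg] JD(4)[OF hxr] fr(2) by auto
  then have "c0 \<notin> point_ideal" using regular_not_in_point_ideal[OF reg] hg hxr hc by auto
  then have "J = big.L"
    using complete_intersection_few_generators[OF JD(1,2) ci reg hg hxr hc fr(2)] JD(3) low' by blast
  have "vary \<in> small.L"
  proof (rule small.below_socle[of 1 vary 2])
    fix m :: "(3, 'a) mpoly" assume "homogeneous 2 m"
    then have "varx * (vary * m) \<in> big.L" using JD(7)[of 2 m] \<open>J = big.L\<close> by (simp add: mult.assoc)
    then show "vary * m \<in> small.L" by (rule cancel_triple)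
  qed simp_all
  then have "vary \<in> ideal_gen {g, r}"
    using low_degree_in_triple[of vary g r c0 1 3 2 6] hg hr hc by simp
  then have "vary = (0 :: (3, 'a) mpoly)"
    using low_degree_in_pair_eq_0[of vary g r 1 3 2] hg hr by simp
  then show False by simp
qed

lemma varxy_not_in_pair:
  assumes "factored_regular g r c"
  shows "varx * vary \<notin> ideal_gen {g, varx * r}"
proof
  interpret factored_regular g r c by (rule assms)
  assume "varx * vary \<in> ideal_gen {g, varx * r}"
  moreover have "homogeneous (1 + 1) (varx * vary :: (3, 'a) mpoly)" by (rule homogeneous_mult) simp_all
  ultimately have "varx * vary = (0 :: (3, 'a) mpoly)"
    using low_degree_in_pair_eq_0[OF _ _ hg hxr, of "varx * vary" "1 + 1"] by simp
  then show False by simp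
qed

text \<open>The product x y multiplies the forms of \<open>I\<close> of degree at most 5 into the
  pair, but not \<open>c\<close>, which is therefore a minimal generator. If the three forms
  generated \<open>I\<close>, the link would be the unit ideal, which is not of the odd
  kind.\<close>

lemma even_kind_not_complete_intersection:
  assumes I: "even_kind I"
  shows "\<not> complete_intersection I"
proof
  assume ci: "complete_intersection I"
  obtain g r c where fr: "factored_regular g r c" "{g, varx * r, c} \<subseteq> I" and over: "even_kind_over I g r"
    and J: "odd_kind (ideal_colon (ideal_gen {g, varx * r, c}) I)" and I': "is_ideal I" "hclosed I"
    using I unfolding even_kind_def by blast
  interpret factored_regular g r c by (rule fr(1))
  let ?K = "ideal_gen {g, varx * r}"
  have low: "a = 0" if a: "homogeneous d a" "a \<in> I" "d < 3" for d a
  proof -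
    have "a \<in> ?K" using over a unfolding even_kind_over_def by (meson less_imp_le)
    then show ?thesis using low_degree_in_pair_eq_0[OF _ a(1) hg hxr] a(3) by simp
  qed
  have "c \<notin> ideal_gen {a \<in> I. \<exists>d. d \<le> 5 \<and> homogeneous d a}"
  proof
    assume c: "c \<in> ideal_gen {a \<in> I. \<exists>d. d \<le> 5 \<and> homogeneous d a}"
    have "varx * vary \<in> ideal_colon ?K (ideal_gen {a \<in> I. \<exists>d. d \<le> 5 \<and> homogeneous d a})"
      using over unfolding mem_ideal_colon_gen[OF is_ideal_ideal_gen] even_kind_over_def by blast
    then have "c * (varx * vary) \<in> ?K" using c by (simp add: mem_ideal_colon mult.commute)
    then show False using regular_facts(2) varxy_not_in_pair[OF fr(1)] by blast
  qed
  then have "I = big.L"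
    using complete_intersection_few_generators[OF I' ci reg hg hxr hc fr(2)] low by blast
  then have "1 \<in> ideal_colon big.L I" by (simp add: mem_ideal_colon)
  then show False using odd_kindD(3)[OF J homogeneous_1] by simp
qed

section \<open>Minimal links\<close>

lemma sorted_degrees_bounded:
  assumes "list_all2 (\<le>) (sort ds) [3, 3, 6 :: nat]" "\<And>d. d \<in> set ds \<Longrightarrow> 3 \<le> d"
  obtains d where "sort ds = [3, 3, d]" "3 \<le> d" "d \<le> 6"
proof -
  obtain a b c where abc: "sort ds = [a, b, c]" "a \<le> 3" "b \<le> 3" "c \<le> 6"
    using assms(1) by (auto simp: list_all2_Cons2)
  have "a \<in> set ds" "b \<in> set ds" "c \<in> set ds" using abc(1) by (metis list.set_intros set_sort)+
  then show thesis using that[of c] abc assms(2) by (metis le_antisym)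
qed

text \<open>The reference sequence bounds the sorted degrees by 3, 3, 6, and the absence of forms of
  degree below 3 fixes the first two; \<open>no\<close> excludes a third degree below 6.\<close>

lemma smallest_degrees:
  fixes T :: "(3, 'k::field) mpoly set"
  assumes T: "\<And>d h. homogeneous d h \<Longrightarrow> h \<in> T \<Longrightarrow> d < 3 \<Longrightarrow> h = 0"
    and ref: "regular_sequence [p1, p2, c]" "homogeneous 3 p1" "homogeneous 3 p2" "homogeneous 6 c" "{p1, p2, c} \<subseteq> T"
    and fs: "smallest_degree_regular_sequence_in T fs" "length fs = 3"
    and no: "\<And>q1 q2 b d. regular_sequence [q1, q2, b] \<Longrightarrow> homogeneous 3 q1 \<Longrightarrow> homogeneous 3 q2 \<Longrightarrow>
      homogeneous d b \<Longrightarrow> {q1, q2, b} \<subseteq> T \<Longrightarrow> 3 \<le> d \<Longrightarrow> d \<le> 5 \<Longrightarrow> False"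
  obtains q1 q2 b where "regular_sequence [q1, q2, b]" "homogeneous 3 q1" "homogeneous 3 q2" "homogeneous 6 b"
    "{q1, q2, b} \<subseteq> T" "set fs = {q1, q2, b}"
proof -
  obtain ds where ds: "homogeneous_regular_sequence_in T ds fs"
    and min: "\<And>es gs. homogeneous_regular_sequence_in T es gs \<Longrightarrow> length gs = length fs \<Longrightarrow>
      list_all2 (\<le>) (sort ds) (sort es)"
    using fs(1) unfolding smallest_degree_regular_sequence_in_def by blast
  have reg: "regular_sequence fs" "list_all2 homogeneous ds fs" "set fs \<subseteq> T"
    using ds unfolding homogeneous_regular_sequence_in_def by blast+
  have "homogeneous_regular_sequence_in T [3, 3, 6] [p1, p2, c]"
    using ref unfolding homogeneous_regular_sequence_in_def by simp
  then have "list_all2 (\<le>) (sort ds) [3, 3, 6]" using min fs(2) by fastforce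
  moreover have "3 \<le> d" if d: "d \<in> set ds" for d
  proof -
    obtain i where i: "i < length ds" "ds ! i = d" using d by (auto simp: in_set_conv_nth)
    have len: "length ds = length fs" using reg(2) by (rule list_all2_lengthD)
    then have "fs ! i \<in> set fs" "homogeneous d (fs ! i)"
      using reg(2) i by (auto simp: list_all2_conv_all_nth)
    then show ?thesis using T[of d "fs ! i"] reg regular_sequence_nonzero not_less by blast
  qed
  ultimately obtain d where d: "sort ds = [3, 3, d]" "3 \<le> d" "d \<le> 6"
    using sorted_degrees_bounded by blast
  obtain q1 q2 b where q: "regular_sequence [q1, q2, b]" "homogeneous 3 q1" "homogeneous 3 q2" "homogeneous d b"
    "set fs = {q1, q2, b}"
    using regular_sequence_arrange[OF reg(1,2) d(1)] d(2) by auto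
  have sub: "{q1, q2, b} \<subseteq> T" using reg(3) q(5) by simp
  have "\<not> d \<le> 5" using no[OF q(1-4) sub d(2)] by blast
  then have "d = 6" using d(3) by simp
  then show thesis using that q sub by blast
qed

lemma odd_kind_step:
  assumes J: "odd_kind J" and link: "directly_minimally_homogeneously_linked J I"
  shows "even_kind I"
proof -
  note JD = odd_kindD[OF J]
  obtain p1 p2 c0 where p: "regular_sequence [p1, p2, c0]" "homogeneous 3 p1" "homogeneous 3 p2" "homogeneous 6 c0"
    "{p1, p2, c0} \<subseteq> J" using JD(8) by blast
  interpret P: graded_regular p1 p2 c0 3 3 6 using p by unfold_locales
  have "J \<noteq> UNIV" using JD(3)[OF homogeneous_1] by auto
  then have h3: "ideal_height J = 3"
    using P.height_over_L[OF JD(1,2)] p(5) JD(1) ideal_gen_least by blast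
  obtain fs where fs: "ideal_height J = enat (length fs)" "smallest_degree_regular_sequence_in J fs"
    "I = ideal_colon (ideal_gen (set fs)) J" "J = ideal_colon (ideal_gen (set fs)) I"
    using link unfolding directly_minimally_homogeneously_linked_def by blast
  have len: "length fs = 3" using h3 fs(1) by (simp add: numeral_eq_enat)
  obtain q1 q2 b where q: "regular_sequence [q1, q2, b]" "homogeneous 3 q1" "homogeneous 3 q2" "homogeneous 6 b"
    "{q1, q2, b} \<subseteq> J" "set fs = {q1, q2, b}"
  proof (rule smallest_degrees[OF JD(3) p fs(2) len])
    fix q1 q2 b d
    assume a: "regular_sequence [q1, q2, b]" "homogeneous 3 q1" "homogeneous 3 q2" "homogeneous d b"
      "{q1, q2, b} \<subseteq> J" "3 \<le> d" "d \<le> 5"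
    have "\<not> set [q1, q2, b] \<subseteq> point_ideal" by (rule regular_not_in_point_ideal) (use a in auto)
    moreover have "set [q1, q2, b] \<subseteq> point_ideal"
      using JD(4)[OF a(2)] JD(4)[OF a(3)] JD(4)[OF a(4)] a(5,7) by simp
    ultimately show False by blast
  qed blast
  obtain g r where fr: "factored_regular g r b" "{g, varx * r, b} \<subseteq> J"
    "ideal_gen {q1, q2, b} = ideal_gen {g, varx * r, b}"
    using factor_varx[OF J q(1-5)] .
  interpret factored_regular g r b by (rule fr(1))
  have I: "I = ideal_colon big.L J" "J = ideal_colon big.L I" using fs(3,4) q(6) fr(3) by simp_all
  have "is_ideal I" "hclosed I"
    unfolding I(1) using JD(1,2) big.hclosed_L by (simp_all add: is_ideal_colon hclosed_colon)
  moreover have "even_kind_over I g r" unfolding I(1) by (rule even_kind_over_if_linked[OF J fr(1,2)])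
  moreover have "{g, varx * r, b} \<subseteq> I"
    using big.L_subset_colon[OF JD(1)] unfolding I(1) by (auto intro: ideal_gen_base)
  moreover have "odd_kind (ideal_colon big.L I)" using J I(2) by simp
  ultimately show ?thesis unfolding even_kind_def using fr(1) by blast
qed

lemma even_kind_step:
  assumes I: "even_kind I" and link: "directly_minimally_homogeneously_linked I J"
  shows "odd_kind J"
proof -
  obtain g r c where fr: "factored_regular g r c" "{g, varx * r, c} \<subseteq> I" and over: "even_kind_over I g r"
    and odd: "odd_kind (ideal_colon (ideal_gen {g, varx * r, c}) I)" and I': "is_ideal I" "hclosed I"
    using I unfolding even_kind_def by blast
  interpret factored_regular g r c by (rule fr(1))
  let ?K = "ideal_gen {g, varx * r}"
  have inK: "a \<in> ?K" if "homogeneous d a" "a \<in> I" "d \<le> 3" for d a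
    using over that unfolding even_kind_over_def by blast
  have low: "a = 0" if a: "homogeneous d a" "a \<in> I" "d < 3" for d a
    using inK[OF a(1,2)] low_degree_in_pair_eq_0[OF _ a(1) hg hxr] a(3) by simp
  have "I \<noteq> UNIV" using low[OF homogeneous_1] by auto
  then have h3: "ideal_height I = 3"
    using big.height_over_L[OF I'] fr(2) I'(1) ideal_gen_least by blast
  obtain fs where fs: "ideal_height I = enat (length fs)" "smallest_degree_regular_sequence_in I fs"
    "J = ideal_colon (ideal_gen (set fs)) I"
    using link unfolding directly_minimally_homogeneously_linked_def by blast
  have len: "length fs = 3" using h3 fs(1) by (simp add: numeral_eq_enat)
  have pair: "ideal_gen {q1, q2} = ?K"
    if q: "regular_sequence [q1, q2, b]" "homogeneous 3 q1" "homogeneous 3 q2" "{q1, q2, b} \<subseteq> I" for q1 q2 b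
    using inK[OF q(2)] inK[OF q(3)] q(4) by (intro same_pair[OF q(1) _ _ q(2,3) hg hxr]) auto
  obtain q1 q2 b where q: "regular_sequence [q1, q2, b]" "homogeneous 3 q1" "homogeneous 3 q2" "homogeneous 6 b"
    "{q1, q2, b} \<subseteq> I" "set fs = {q1, q2, b}"
  proof (rule smallest_degrees[OF low reg hg hxr hc fr(2) fs(2) len])
    fix q1 q2 b d
    assume a: "regular_sequence [q1, q2, b]" "homogeneous 3 q1" "homogeneous 3 q2" "homogeneous d b"
      "{q1, q2, b} \<subseteq> I" "3 \<le> d" "d \<le> 5"
    \<comment> \<open>Since \<open>b\<close> is regular modulo the pencil, x y would lie in its
      ideal, although all forms there have degree at least 3.\<close>
    have "varx * vary * b \<in> ?K" using over a(4,5,7) unfolding even_kind_over_def by blast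
    then have "b * (varx * vary) \<in> ideal_gen {q1, q2}" using pair[OF a(1-3,5)] by (simp add: mult.commute)
    then have "varx * vary \<in> ideal_gen {q1, q2}" using a(1) unfolding regular_sequence_3 by blast
    then show False using pair[OF a(1-3,5)] varxy_not_in_pair[OF fr(1)] by simp
  qed blast
  note same = regular_sequence_same_pair[OF q(1) reg pair[OF q(1-3,5)]]
  have "factored_regular g r b" using same(1) hg hr q(4) by unfold_locales
  then have "odd_kind (ideal_colon (ideal_gen {g, varx * r, b}) I)"
    using q(5) by (intro odd_kind_if_linked[OF I' over fr odd]) auto
  then show ?thesis using fs(3) q(6) same(2) by simp
qed

theorem even_kind_not_minimally_licci:
  assumes "even_kind I"
  shows "\<not> minimally_homogeneously_licci I"
proof
  assume "minimally_homogeneously_licci I"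
  then obtain J where J: "directly_minimally_homogeneously_linked\<^sup>*\<^sup>* I J" "complete_intersection J"
    unfolding minimally_homogeneously_licci_def by blast
  from J(1) have "even_kind J \<or> odd_kind J"
  proof (induction rule: rtranclp_induct)
    case base
    show ?case using assms by simp
  next
    case (step J J')
    then show ?case using even_kind_step odd_kind_step by blast
  qed
  then show False
    using J(2) even_kind_not_complete_intersection odd_kind_not_complete_intersection by blast
qed

section \<open>Producing regular sequences of forms\<close>

text \<open>Positive degrees are part of the notion: they make it invariant under permutations and
  keep the ideal proper.\<close>

definition form_regular :: "(3, 'k::field) mpoly \<Rightarrow> (3, 'k) mpoly \<Rightarrow> (3, 'k) mpoly \<Rightarrow> bool" where
  "form_regular a b c \<longleftrightarrow> regular_sequence [a, b, c] \<and>
     (\<forall>p\<in>{a, b, c}. \<exists>d>0. homogeneous d p)"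

lemma form_regularD: "form_regular a b c \<Longrightarrow> regular_sequence [a, b, c]"
  by (simp add: form_regular_def)

lemma form_regular_swap12: "form_regular a b c \<Longrightarrow> form_regular b a c"
  by (auto simp: form_regular_def regular_sequence_swap12)

lemma form_regular_swap23: "form_regular a b c \<Longrightarrow> form_regular a c b"
  unfolding form_regular_def using regular_sequence_swap23 by fastforce

lemma form_regular_rotate: "form_regular a b c \<Longrightarrow> form_regular b c a"
  using form_regular_swap23[OF form_regular_swap12] .

lemma form_regular_reverse: "form_regular a b c \<Longrightarrow> form_regular c b a"
  using form_regular_swap12[OF form_regular_rotate] .

lemma form_regular_Var: "form_regular varx vary (varz :: (3, 'k::field) mpoly)"
proof -
  have "homogeneous 1 (Var v :: (3, 'k::field) mpoly)" for v by simp
  then have "\<exists>d>0. homogeneous d (Var v :: (3, 'k) mpoly)" for v by (intro exI[of _ 1]) simp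
  then show ?thesis unfolding form_regular_def using regular_sequence_Var by simp
qed

lemma homogeneous_in_triple_irrelevant:
  assumes "\<And>p. p \<in> {a, b, c} \<Longrightarrow> \<exists>d>0. homogeneous d (p :: (3, 'k::field) mpoly)"
  shows "ideal_gen {a, b, c} \<noteq> UNIV"
proof -
  have "ideal_gen {a, b, c} \<subseteq> irrelevant_ideal"
    using assms homogeneous_in_irrelevant by (intro ideal_gen_least is_ideal_irrelevant) blast
  moreover have "1 \<notin> (irrelevant_ideal :: (3, 'k) mpoly set)"
    by (simp add: irrelevant_ideal_hpart hpart_homogeneous[OF homogeneous_1])
  ultimately show ?thesis by blast
qed

lemma form_regular_mult:
  assumes "form_regular a b c" "form_regular a b d"
  shows "form_regular a b (c * d)"
proof -
  note c = assms(1)[unfolded form_regular_def] and d = assms(2)[unfolded form_regular_def]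
  obtain i j where "0 < i" "homogeneous i c" "homogeneous j d" using c d by auto
  then have h: "\<exists>e>0. homogeneous e (c * d)"
    using homogeneous_mult[of i c j d] by (intro exI[of _ "i + j"]) simp
  have all: "\<forall>p\<in>{a, b, c * d}. \<exists>e>0. homogeneous e p" using c h by simp
  have "regular_sequence [a, b, c * d]"
    unfolding regular_sequence_3
  proof (intro conjI allI impI)
    show "g \<in> ideal_gen {a, b}" if "c * d * g \<in> ideal_gen {a, b}" for g
    proof -
      have "c * (d * g) \<in> ideal_gen {a, b}" using that by (simp add: mult.assoc)
      then show ?thesis using c d unfolding regular_sequence_3 by blast
    qed
    show "a * g = 0 \<Longrightarrow> g = 0" "b * g \<in> ideal_gen {a} \<Longrightarrow> g \<in> ideal_gen {a}" for g
      using c unfolding regular_sequence_3 by blast+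
    show "ideal_gen {a, b, c * d} \<noteq> UNIV" using all by (intro homogeneous_in_triple_irrelevant) blast
  qed
  then show ?thesis using all unfolding form_regular_def by blast
qed

lemma form_regular_power: "form_regular a b c \<Longrightarrow> form_regular a b (c ^ Suc n)"
proof (induction n)
  case (Suc n)
  then have "form_regular a b (c * c ^ Suc n)" by (intro form_regular_mult)
  then show ?case by simp
qed simp

text \<open>Modulo \<open>a\<close> and \<open>b\<close>, the forms \<open>e\<close> and
  \<open>c\<close> agree up to a unit.\<close>

lemma form_regular_modify:
  assumes reg: "form_regular a b c" and u: "u \<noteq> 0" and e: "e - Const u * c \<in> ideal_gen {a, b}"
    and h: "homogeneous d e" "0 < d"
  shows "form_regular a b e"
proof -
  note c = reg[unfolded form_regular_def]
  have all: "\<forall>p\<in>{a, b, e}. \<exists>d>0. homogeneous d p" using c h by auto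
  have "regular_sequence [a, b, e]"
    unfolding regular_sequence_3
  proof (intro conjI allI impI)
    show "g \<in> ideal_gen {a, b}" if eg: "e * g \<in> ideal_gen {a, b}" for g
    proof -
      have "Const u * (c * g) = e * g - g * (e - Const u * c)" by (simp add: algebra_simps)
      also have "\<dots> \<in> ideal_gen {a, b}"
        by (rule is_ideal_diff[OF is_ideal_ideal_gen eg is_ideal_mult[OF is_ideal_ideal_gen e]])
      finally have "c * g \<in> ideal_gen {a, b}" using u is_ideal_Const_cancel is_ideal_ideal_gen by blast
      then show ?thesis using c unfolding regular_sequence_3 by blast
    qed
    show "a * g = 0 \<Longrightarrow> g = 0" "b * g \<in> ideal_gen {a} \<Longrightarrow> g \<in> ideal_gen {a}" for g
      using c unfolding regular_sequence_3 by blast+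
    show "ideal_gen {a, b, e} \<noteq> UNIV" using all by (intro homogeneous_in_triple_irrelevant) blast
  qed
  then show ?thesis using all unfolding form_regular_def by blast
qed

lemma homogeneous_monomial:
  "homogeneous (i + j + k) (varx ^ i * vary ^ j * varz ^ k :: (3, 'k::field) mpoly)"
  using homogeneous_power[OF homogeneous_Var, of i 0] homogeneous_power[OF homogeneous_Var, of j 1]
    homogeneous_power[OF homogeneous_Var, of k 2]
  by (intro homogeneous_mult) simp_all

lemma homogeneous_monomial': "homogeneous d (varx ^ i * vary ^ j * varz ^ k :: (3, 'k::field) mpoly)"
  if "i + j + k = d"
  using homogeneous_monomial that by blast

section \<open>The ideal and its linked regular sequences\<close>

abbreviation cubic :: "(3, 'k::field) mpoly" where
  "cubic \<equiv> varx ^ 2 * vary + vary ^ 3 - vary * varz ^ 2 - varz ^ 3"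
abbreviation quadric :: "(3, 'k::field) mpoly" where
  "quadric \<equiv> vary ^ 2 - varz ^ 2"
abbreviation quartic1 :: "(3, 'k::field) mpoly" where
  "quartic1 \<equiv> varx ^ 3 * varz - varx * vary * varz ^ 2"
abbreviation quartic2 :: "(3, 'k::field) mpoly" where
  "quartic2 \<equiv> varz ^ 2 * quadric"
abbreviation sextic :: "'k \<Rightarrow> (3, 'k::field) mpoly" where
  "sextic t \<equiv> varx ^ 6 + Const t * (varx * varz ^ 5) + varz ^ 6"

lemma homogeneous_forms:
  "homogeneous 3 (cubic :: (3, 'k::field) mpoly)"
  "homogeneous 2 (quadric :: (3, 'k) mpoly)"
  "homogeneous 4 (quartic1 :: (3, 'k) mpoly)"
  "homogeneous 4 (quartic2 :: (3, 'k) mpoly)"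
  "homogeneous 6 (sextic t :: (3, 'k) mpoly)"
  "homogeneous 1 (vary - varz :: (3, 'k) mpoly)"
  "homogeneous 1 (vary + varz :: (3, 'k) mpoly)"
  "homogeneous 1 (varx - varz :: (3, 'k) mpoly)"
  "homogeneous 1 (varx + varz :: (3, 'k) mpoly)"
  "homogeneous 2 (varx ^ 2 + varz ^ 2 :: (3, 'k) mpoly)"
  "homogeneous 3 (varz ^ 3 - varx ^ 2 * vary :: (3, 'k) mpoly)"
proof -
  note m = homogeneous_monomial'[where ?'k = 'k]
  show 2: "homogeneous 2 (quadric :: (3, 'k) mpoly)"
    using m[of 0 2 0 2] m[of 0 0 2 2] by (intro homogeneous_diff) simp_all
  show "homogeneous 3 (cubic :: (3, 'k) mpoly)"
    using m[of 2 1 0 3] m[of 0 3 0 3] m[of 0 1 2 3] m[of 0 0 3 3]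
    by (intro homogeneous_diff homogeneous_add) simp_all
  show "homogeneous 4 (quartic1 :: (3, 'k) mpoly)"
    using m[of 3 0 1 4] m[of 1 1 2 4] by (intro homogeneous_diff) simp_all
  show "homogeneous 4 (quartic2 :: (3, 'k) mpoly)"
    using homogeneous_mult[OF m[of 0 0 2 2] 2] by simp
  show "homogeneous 6 (sextic t :: (3, 'k) mpoly)"
    using m[of 6 0 0 6] m[of 1 0 5 6] m[of 0 0 6 6]
    by (intro homogeneous_add homogeneous_Const_mult) simp_all
  show "homogeneous 1 (vary - varz :: (3, 'k) mpoly)" "homogeneous 1 (varx - varz :: (3, 'k) mpoly)"
    by (intro homogeneous_diff; simp)+
  show "homogeneous 1 (vary + varz :: (3, 'k) mpoly)" "homogeneous 1 (varx + varz :: (3, 'k) mpoly)"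
    by (intro homogeneous_add; simp)+
  show "homogeneous 2 (varx ^ 2 + varz ^ 2 :: (3, 'k) mpoly)"
    using m[of 2 0 0 2] m[of 0 0 2 2] by (intro homogeneous_add) simp_all
  show "homogeneous 3 (varz ^ 3 - varx ^ 2 * vary :: (3, 'k) mpoly)"
    using m[of 2 1 0 3] m[of 0 0 3 3] by (intro homogeneous_diff) simp_all
qed

text \<open>The working rule: a form that reduces to a power of \<open>c\<close> modulo
  \<open>a\<close> and \<open>b\<close> can take the place of \<open>c\<close>; \<open>p\<close> and
  \<open>q\<close> are the explicit certificate.\<close>

lemma form_regular_by_power:
  assumes "form_regular a b c" "u \<noteq> 0" "e - Const u * c ^ Suc n = p * a + q * b" "homogeneous d e" "0 < d"
  shows "form_regular a b e"
  using form_regular_modify[OF form_regular_power[OF assms(1), of n] assms(2) _ assms(4,5)]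
    assms(3) unfolding mem_ideal_gen_2 by blast

lemma Const_numeral: "Const (numeral w) = numeral w"
  by (simp add: Const_def)

lemma form_regular_linear:
  "form_regular varx varz (vary - varz :: (3, 'k::field) mpoly)"
  "form_regular varx varz (vary + varz :: (3, 'k) mpoly)"
proof -
  have *: "form_regular (varx :: (3, 'k) mpoly) varz vary" by (rule form_regular_swap23[OF form_regular_Var])
  show "form_regular (varx :: (3, 'k) mpoly) varz (vary - varz)"
    by (rule form_regular_by_power[OF *, where u = 1 and n = 0 and p = 0 and q = "- 1" and d = 1])
      (simp_all only: homogeneous_forms, simp_all)
  show "form_regular (varx :: (3, 'k) mpoly) varz (vary + varz)"
    by (rule form_regular_by_power[OF *, where u = 1 and n = 0 and p = 0 and q = 1 and d = 1])
      (simp_all only: homogeneous_forms, simp_all)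
qed

lemma regular_varx_cubic: "form_regular (varx :: (3, 'k::field) mpoly) cubic varz"
proof (rule form_regular_swap23, rule form_regular_by_power[OF form_regular_swap23[OF form_regular_Var]])
  show "cubic - Const 1 * (vary :: (3, 'k) mpoly) ^ Suc 2 = (varx * vary) * varx + (- (vary * varz) - varz ^ 2) * varz"
    by (simp add: algebra_simps numeral_eq_Suc)
qed (simp, rule homogeneous_forms, simp)

text \<open>\<open>quartic2\<close> splits as z^2 (y - z)(y + z). Modulo x, \<open>cubic\<close>
  becomes y^3 where z = 0, and - z^3 where y = z or y = - z.\<close>

lemma regular_cubic_quartic: "form_regular cubic quartic2 (varx :: (3, 'k::field) mpoly)"
proof -
  have 2: "form_regular (varx :: (3, 'k) mpoly) cubic (vary - varz)"
  proof (rule form_regular_swap23, rule form_regular_by_power[OF form_regular_swap23[OF form_regular_linear(1)]])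
    show "cubic - Const (- 1) * (varz :: (3, 'k) mpoly) ^ Suc 2 = (varx * vary) * varx + (vary * (vary + varz)) * (vary - varz)"
      by (simp add: algebra_simps numeral_eq_Suc Const_uminus)
  qed (simp, rule homogeneous_forms, simp)
  have 3: "form_regular (varx :: (3, 'k) mpoly) cubic (vary + varz)"
  proof (rule form_regular_swap23, rule form_regular_by_power[OF form_regular_swap23[OF form_regular_linear(2)]])
    show "cubic - Const (- 1) * (varz :: (3, 'k) mpoly) ^ Suc 2 = (varx * vary) * varx + (vary * (vary - varz)) * (vary + varz)"
      by (simp add: algebra_simps numeral_eq_Suc Const_uminus)
  qed (simp, rule homogeneous_forms, simp)
  have m: "form_regular (varx :: (3, 'k) mpoly) cubic (varz ^ Suc 1 * ((vary - varz) * (vary + varz)))"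
    by (intro form_regular_mult form_regular_power regular_varx_cubic 2 3)
  have "varz ^ Suc 1 * ((vary - varz) * (vary + varz)) = (quartic2 :: (3, 'k) mpoly)"
    by (simp add: algebra_simps numeral_eq_Suc)
  with form_regular_rotate[OF m] show ?thesis by (simp only:)
qed

text \<open>The factors of x (y - z)(y + z) are treated one by one. Modulo x the sextic is z^6.
  Where y = z, \<open>cubic\<close> is z (x - z)(x + z), and on its factors the sextic is x^6, (2 +
  t) z^6 and (2 - t) z^6. Where y = - z, \<open>cubic\<close> is - z (x^2 + z^2), and as x^2 + z^2
  divides x^6 + z^6, only t x z^5 is left on the second factor. Hence the three conditions on
  \<open>t\<close>.\<close>

lemma regular_cubic_sextic:
  fixes t :: "'k::field"
  assumes t: "t \<noteq> 0" "2 + t \<noteq> 0" "2 - t \<noteq> 0"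
  shows "form_regular cubic ((varx :: (3, 'k) mpoly) * quadric) (sextic t)"
proof -
  note hf = homogeneous_forms[where ?'k = 'k]
  have x: "form_regular cubic (sextic t) (varx :: (3, 'k) mpoly)"
  proof (rule form_regular_rotate, rule form_regular_by_power[OF regular_varx_cubic])
    show "sextic t - Const 1 * (varz :: (3, 'k) mpoly) ^ Suc 5 = (varx ^ 5 + Const t * varz ^ 5) * varx + 0 * cubic"
      by (simp add: algebra_simps numeral_eq_Suc)
  qed (simp, rule hf, simp)
  have sextic_z: "form_regular l (sextic t) (varz :: (3, 'k) mpoly)" if "form_regular varx varz l" for l
  proof (rule form_regular_swap23, rule form_regular_by_power)
    show "form_regular l (varz :: (3, 'k) mpoly) varx"
      by (rule form_regular_reverse[OF that])
    show "sextic t - Const 1 * (varx :: (3, 'k) mpoly) ^ Suc 5 = 0 * l + (Const t * (varx * varz ^ 4) + varz ^ 5) * varz"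
      by (simp add: algebra_simps numeral_eq_Suc)
  qed (simp, rule hf, simp)
  have l1: "form_regular ((vary :: (3, 'k) mpoly) - varz) (sextic t) (varx - varz)"
  proof (rule form_regular_swap23, rule form_regular_by_power)
    have *: "form_regular ((vary :: (3, 'k) mpoly) - varz) varz varx"
      by (rule form_regular_reverse[OF form_regular_linear(1)])
    have "form_regular ((vary :: (3, 'k) mpoly) - varz) varz (varx - varz)"
      by (rule form_regular_by_power[OF *, where u = 1 and n = 0 and p = 0 and q = "- 1" and d = 1])
        (use hf in auto)
    then show "form_regular ((vary :: (3, 'k) mpoly) - varz) (varx - varz) varz" by (rule form_regular_swap23)
    show "sextic t - Const (2 + t) * (varz :: (3, 'k) mpoly) ^ Suc 5 = 0 * (vary - varz) +
        (varx ^ 5 + varx ^ 4 * varz + varx ^ 3 * varz ^ 2 + varx ^ 2 * varz ^ 3 + varx * varz ^ 4 + varz ^ 5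
          + Const t * varz ^ 5) * (varx - varz)"
      by (simp add: algebra_simps numeral_eq_Suc Const_add Const_numeral)
  qed (use t in simp, rule hf, simp)
  have l2: "form_regular ((vary :: (3, 'k) mpoly) - varz) (sextic t) (varx + varz)"
  proof (rule form_regular_swap23, rule form_regular_by_power)
    have *: "form_regular ((vary :: (3, 'k) mpoly) - varz) varz varx"
      by (rule form_regular_reverse[OF form_regular_linear(1)])
    have "form_regular ((vary :: (3, 'k) mpoly) - varz) varz (varx + varz)"
      by (rule form_regular_by_power[OF *, where u = 1 and n = 0 and p = 0 and q = 1 and d = 1])
        (use hf in auto)
    then show "form_regular ((vary :: (3, 'k) mpoly) - varz) (varx + varz) varz" by (rule form_regular_swap23)
    show "sextic t - Const (2 - t) * (varz :: (3, 'k) mpoly) ^ Suc 5 = 0 * (vary - varz) +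
        (varx ^ 5 - varx ^ 4 * varz + varx ^ 3 * varz ^ 2 - varx ^ 2 * varz ^ 3 + varx * varz ^ 4 - varz ^ 5
          + Const t * varz ^ 5) * (varx + varz)"
      by (simp add: algebra_simps numeral_eq_Suc Const_add Const_diff Const_numeral)
  qed (use t in simp, rule hf, simp)
  have "form_regular ((vary :: (3, 'k) mpoly) - varz) (sextic t) (varz * ((varx - varz) * (varx + varz)))"
    by (intro form_regular_mult sextic_z form_regular_linear l1 l2)
  then have m1: "form_regular ((vary :: (3, 'k) mpoly) - varz) (sextic t) cubic"
  proof (rule form_regular_by_power[where n = 0])
    show "cubic - Const 1 * ((varz :: (3, 'k) mpoly) * ((varx - varz) * (varx + varz))) ^ Suc 0 =
        (varx ^ 2 + vary * (vary + varz)) * (vary - varz) + 0 * sextic t"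
      by (simp add: algebra_simps numeral_eq_Suc)
  qed (simp, rule hf, simp)
  have q: "form_regular ((vary :: (3, 'k) mpoly) + varz) (varx ^ 2 + varz ^ 2) varx"
    "form_regular (vary + varz) (varx ^ 2 + varz ^ 2) (varz :: (3, 'k) mpoly)"
  proof -
    have *: "form_regular ((vary :: (3, 'k) mpoly) + varz) varx varz" "form_regular (vary + varz) varz (varx :: (3, 'k) mpoly)"
      by (rule form_regular_rotate[OF form_regular_rotate[OF form_regular_linear(2)]],
          rule form_regular_reverse[OF form_regular_linear(2)])
    show "form_regular ((vary :: (3, 'k) mpoly) + varz) (varx ^ 2 + varz ^ 2) varx"
      by (rule form_regular_swap23, rule form_regular_by_power[OF *(1), where u = 1 and n = 1 and p = 0 and q = varx and d = 2])
        (use hf in \<open>auto simp: power2_eq_square\<close>)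
    show "form_regular ((vary :: (3, 'k) mpoly) + varz) (varx ^ 2 + varz ^ 2) varz"
      by (rule form_regular_swap23, rule form_regular_by_power[OF *(2), where u = 1 and n = 1 and p = 0 and q = varz and d = 2])
        (use hf in \<open>auto simp: power2_eq_square\<close>)
  qed
  have "form_regular ((vary :: (3, 'k) mpoly) + varz) (varx ^ 2 + varz ^ 2) (varx * varz ^ Suc 4)"
    by (intro form_regular_mult form_regular_power q)
  then have "form_regular ((vary :: (3, 'k) mpoly) + varz) (varx ^ 2 + varz ^ 2) (sextic t)"
  proof (rule form_regular_by_power[where n = 0])
    show "sextic t - Const t * ((varx :: (3, 'k) mpoly) * varz ^ Suc 4) ^ Suc 0 =
        0 * (vary + varz) + (varx ^ 4 - varx ^ 2 * varz ^ 2 + varz ^ 4) * (varx ^ 2 + varz ^ 2)"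
      by (simp add: algebra_simps numeral_eq_Suc)
  qed (use t in simp, rule hf, simp)
  then have "form_regular ((vary :: (3, 'k) mpoly) + varz) (sextic t) (varz * (varx ^ 2 + varz ^ 2))"
    by (intro form_regular_mult sextic_z form_regular_linear form_regular_swap23[of _ _ "sextic t"])
  then have m2: "form_regular ((vary :: (3, 'k) mpoly) + varz) (sextic t) cubic"
  proof (rule form_regular_by_power[where n = 0])
    show "cubic - Const (- 1) * ((varz :: (3, 'k) mpoly) * (varx ^ 2 + varz ^ 2)) ^ Suc 0 =
        (varx ^ 2 + vary * (vary - varz)) * (vary + varz) + 0 * sextic t"
      by (simp add: algebra_simps numeral_eq_Suc Const_uminus)
  qed (simp, rule hf, simp)
  have "form_regular cubic (sextic t) ((vary :: (3, 'k) mpoly) - varz)" "form_regular cubic (sextic t) (vary + varz)"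
    by (rule form_regular_reverse[OF m1], rule form_regular_reverse[OF m2])
  then have m: "form_regular cubic (sextic t) ((varx :: (3, 'k) mpoly) * ((vary - varz) * (vary + varz)))"
    by (intro form_regular_mult x)
  have "varx * ((vary - varz) * (vary + varz)) = (varx * quadric :: (3, 'k) mpoly)"
    by (simp add: algebra_simps numeral_eq_Suc)
  with form_regular_swap23[OF m] show ?thesis by (simp only:)
qed

lemma regular_quadric:
  "form_regular varx quadric (varz :: (3, 'k::field) mpoly)"
  "form_regular quadric (varz ^ 3 - varx ^ 2 * vary) (varx :: (3, 'k) mpoly)"
proof -
  note hf = homogeneous_forms
  have "form_regular (varx :: (3, 'k) mpoly) varz quadric"
  proof (rule form_regular_by_power[OF form_regular_swap23[OF form_regular_Var]])
    show "quadric - Const 1 * (vary :: (3, 'k) mpoly) ^ Suc 1 = 0 * varx + (- varz) * varz" by (simp add: power2_eq_square)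
  qed (simp, rule hf, simp)
  then show 1: "form_regular (varx :: (3, 'k) mpoly) quadric varz" by (rule form_regular_swap23)
  have "form_regular (varx :: (3, 'k) mpoly) quadric (varz ^ 3 - varx ^ 2 * vary)"
  proof (rule form_regular_by_power[OF 1])
    show "(varz :: (3, 'k) mpoly) ^ 3 - varx ^ 2 * vary - Const 1 * varz ^ Suc 2 = (- varx * vary) * varx + 0 * quadric"
      by (simp add: power2_eq_square algebra_simps numeral_eq_Suc)
  qed (simp, rule hf, simp)
  then show "form_regular quadric (varz ^ 3 - varx ^ 2 * vary) (varx :: (3, 'k) mpoly)" by (rule form_regular_rotate)
qed

lemma regular_powers:
  "form_regular varz (vary ^ 2) (varx :: (3, 'k::field) mpoly)"
  "form_regular (vary ^ 2) (varz ^ 2) (varx :: (3, 'k) mpoly)"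
proof -
  have "form_regular (varz :: (3, 'k) mpoly) varx (vary ^ Suc 1)"
    by (rule form_regular_power[OF form_regular_rotate[OF form_regular_rotate[OF form_regular_Var]]])
  then show 1: "form_regular varz (vary ^ 2) (varx :: (3, 'k) mpoly)"
    using form_regular_swap23 by (fastforce simp: eval_nat_numeral)
  have "form_regular ((vary :: (3, 'k) mpoly) ^ 2) varx (varz ^ Suc 1)"
    by (rule form_regular_power[OF form_regular_rotate[OF 1]])
  then show "form_regular (vary ^ 2) (varz ^ 2) (varx :: (3, 'k) mpoly)"
    using form_regular_swap23 by (fastforce simp: eval_nat_numeral)
qed

section \<open>Normal forms and the Hilbert function\<close>

abbreviation the_ideal :: "(3, 'k::field) mpoly set" where
  "the_ideal \<equiv> ideal_gen {cubic, varx * quadric, quartic1, quartic2, varx ^ 6, varz ^ 6, varx * varz ^ 5}"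

definition mon :: "nat \<Rightarrow> nat \<Rightarrow> nat \<Rightarrow> (3, 'k::field) mpoly" where
  "mon a b c = varx ^ a * vary ^ b * varz ^ c"

definition expo :: "nat \<Rightarrow> nat \<Rightarrow> nat \<Rightarrow> 3 \<Rightarrow>\<^sub>0 nat" where
  "expo a b c = Poly_Mapping.single 0 a + Poly_Mapping.single 1 b + Poly_Mapping.single 2 c"

lemma lookup_expo [simp]:
  "Poly_Mapping.lookup (expo a b c) 0 = a" "Poly_Mapping.lookup (expo a b c) 1 = b"
  "Poly_Mapping.lookup (expo a b c) 2 = c"
  by (simp_all add: expo_def lookup_add lookup_single)

lemma expo_lookup [simp]:
  "expo (Poly_Mapping.lookup m 0) (Poly_Mapping.lookup m 1) (Poly_Mapping.lookup m 2) = m"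
proof (rule poly_mapping_eqI)
  fix v :: 3
  have "v = 0 \<or> v = 1 \<or> v = 2" using UNIV_3 by blast
  then show "Poly_Mapping.lookup (expo (Poly_Mapping.lookup m 0) (Poly_Mapping.lookup m 1)
      (Poly_Mapping.lookup m 2)) v = Poly_Mapping.lookup m v"
    by (elim disjE) simp_all
qed

lemma expo_eq_iff [simp]: "expo a b c = expo a' b' c' \<longleftrightarrow> a = a' \<and> b = b' \<and> c = c'"
  by (metis lookup_expo)

lemma mon_eq_single: "(mon a b c :: (3, 'k::field) mpoly) = Poly_Mapping.single (expo a b c) 1"
proof -
  have "Var v ^ j = (Poly_Mapping.single (Poly_Mapping.single v j) 1 :: (3, 'k) mpoly)" for v :: 3 and j
    by (induction j) (simp_all add: Var_def mult_single flip: single_add)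
  then show ?thesis by (simp add: mon_def expo_def mult_single)
qed

lemma mon_eq_iff: "mon a b c = (mon a' b' c' :: (3, 'k::field) mpoly) \<longleftrightarrow> a = a' \<and> b = b' \<and> c = c'"
proof
  assume "mon a b c = (mon a' b' c' :: (3, 'k) mpoly)"
  then have "Poly_Mapping.lookup (mon a b c :: (3, 'k) mpoly) (expo a b c) =
    Poly_Mapping.lookup (mon a' b' c') (expo a b c)" by simp
  then show "a = a' \<and> b = b' \<and> c = c'"
    by (auto simp: mon_eq_single lookup_single when_def split: if_splits)
qed simp

lemma mon_mult: "mon a b c * mon a' b' c' = mon (a + a') (b + b') (c + c')"
  by (simp add: mon_def power_add mult_ac)

lemma homogeneous_mon: "homogeneous (a + b + c) (mon a b c)"
  unfolding mon_def by (rule homogeneous_monomial)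

lemma sum_mon:
  "p = (\<Sum>m\<in>Poly_Mapping.keys p. Const (Poly_Mapping.lookup p m) *
    mon (Poly_Mapping.lookup m 0) (Poly_Mapping.lookup m 1) (Poly_Mapping.lookup m 2))"
  by (subst (1) poly_mapping_sum_single[of p]) (simp add: mon_eq_single Const_def mult_single)

text \<open>The monomials outside the initial ideal: each clause removes the multiples of the
  leading monomial of one relation in \<open>groebner_relations\<close>, in the same order.\<close>

definition standard :: "nat \<Rightarrow> nat \<Rightarrow> nat \<Rightarrow> bool" where
  "standard a b c \<longleftrightarrow> \<not> (2 \<le> a \<and> 1 \<le> b) \<and> \<not> (1 \<le> a \<and> 2 \<le> c) \<and> \<not> (3 \<le> a \<and> 1 \<le> c) \<and> c < 4 \<and>
     \<not> (3 \<le> b \<and> 2 \<le> c) \<and> a < 6 \<and> \<not> (1 \<le> a \<and> 4 \<le> b \<and> 1 \<le> c) \<and> b < 6"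

definition standard_exponents :: "nat \<Rightarrow> (nat \<times> nat \<times> nat) set" where
  "standard_exponents d = {(a, b, c). standard a b c \<and> a + b + c = d}"

definition standard_monomials :: "nat \<Rightarrow> (3, 'k::field) mpoly set" where
  "standard_monomials d = (\<lambda>(a, b, c). mon a b c) ` standard_exponents d"

text \<open>The leading monomials with respect to the weights \<open>2, 0, 1\<close> of \<open>x, y, z\<close> come first.\<close>

lemma groebner_relations:
  "mon 2 1 0 - (mon 0 1 2 + mon 0 0 3 - mon 0 3 0) \<in> (the_ideal :: (3, 'k::field) mpoly set)"
  "mon 1 0 2 - mon 1 2 0 \<in> (the_ideal :: (3, 'k::field) mpoly set)"
  "mon 3 0 1 - mon 1 3 0 \<in> (the_ideal :: (3, 'k::field) mpoly set)"
  "mon 0 0 4 - mon 0 2 2 \<in> (the_ideal :: (3, 'k::field) mpoly set)"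
  "mon 0 3 2 - mon 0 5 0 \<in> (the_ideal :: (3, 'k::field) mpoly set)"
  "mon 6 0 0 \<in> (the_ideal :: (3, 'k::field) mpoly set)"
  "mon 1 4 1 \<in> (the_ideal :: (3, 'k::field) mpoly set)"
  "mon 0 6 0 \<in> (the_ideal :: (3, 'k::field) mpoly set)"
proof -
  note id = is_ideal_ideal_gen
  have g: "cubic \<in> (the_ideal :: (3, 'k) mpoly set)" "varx * quadric \<in> (the_ideal :: (3, 'k) mpoly set)" "quartic1 \<in> (the_ideal :: (3, 'k) mpoly set)" "quartic2 \<in> (the_ideal :: (3, 'k) mpoly set)"
    "varx ^ 6 \<in> (the_ideal :: (3, 'k) mpoly set)" "varz ^ 6 \<in> (the_ideal :: (3, 'k) mpoly set)" "varx * varz ^ 5 \<in> (the_ideal :: (3, 'k) mpoly set)"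
    by (auto intro: ideal_gen_base)
  have "mon 2 1 0 - (mon 0 1 2 + mon 0 0 3 - mon 0 3 0) = (cubic :: (3, 'k) mpoly)"
    by (simp add: mon_def)
  then show "mon 2 1 0 - (mon 0 1 2 + mon 0 0 3 - mon 0 3 0) \<in> (the_ideal :: (3, 'k) mpoly set)" using g by simp
  have "mon 1 0 2 - mon 1 2 0 = (- (varx * quadric) :: (3, 'k) mpoly)"
    by (simp add: mon_def algebra_simps)
  then show "mon 1 0 2 - mon 1 2 0 \<in> (the_ideal :: (3, 'k) mpoly set)" using is_ideal_uminus[OF id g(2)] by simp
  have "mon 3 0 1 - mon 1 3 0 = (quartic1 - vary * (varx * quadric) :: (3, 'k) mpoly)"
    by (simp add: mon_def algebra_simps numeral_eq_Suc)
  then show "mon 3 0 1 - mon 1 3 0 \<in> (the_ideal :: (3, 'k) mpoly set)" using is_ideal_diff[OF id g(3) is_ideal_mult[OF id g(2)]] by simp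
  have "mon 0 0 4 - mon 0 2 2 = (- quartic2 :: (3, 'k) mpoly)"
    by (simp add: mon_def algebra_simps numeral_eq_Suc)
  then show 4: "mon 0 0 4 - mon 0 2 2 \<in> (the_ideal :: (3, 'k) mpoly set)" using is_ideal_uminus[OF id g(4)] by simp
  \<comment> \<open>The S-polynomial of \<open>cubic\<close> and \<open>varx * quadric\<close>, in
    which the product of x^2 y with \<open>quadric\<close> cancels; \<open>quartic2\<close> reduces
    the rest.\<close>
  have "mon 0 3 2 - mon 0 5 0 = ((varx * vary) * (varx * quadric) - (quadric * cubic + (vary + varz) * quartic2) :: (3, 'k) mpoly)"
    by (simp add: mon_def algebra_simps numeral_eq_Suc)
  also have "\<dots> \<in> (the_ideal :: (3, 'k) mpoly set)"
    by (rule is_ideal_diff[OF id is_ideal_mult[OF id g(2)] is_ideal_add[OF id is_ideal_mult[OF id g(1)] is_ideal_mult[OF id g(4)]]])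
  finally show 5: "mon 0 3 2 - mon 0 5 0 \<in> (the_ideal :: (3, 'k) mpoly set)" .
  have "mon 6 0 0 = (varx ^ 6 :: (3, 'k) mpoly)" by (simp add: mon_def)
  then show "mon 6 0 0 \<in> (the_ideal :: (3, 'k) mpoly set)" using g by simp
  \<comment> \<open>The generators x z^5 and, below, z^6 are not reduced themselves; the other
    relations turn them into x y^4 z and y^6.\<close>
  have "mon 1 4 1 = (varx * varz ^ 5 + (varz * (vary ^ 2 + varz ^ 2)) * (varx * quadric) :: (3, 'k) mpoly)"
    by (simp add: mon_def algebra_simps numeral_eq_Suc)
  also have "\<dots> \<in> (the_ideal :: (3, 'k) mpoly set)" by (rule is_ideal_add[OF id g(7) is_ideal_mult[OF id g(2)]])
  finally show "mon 1 4 1 \<in> (the_ideal :: (3, 'k) mpoly set)" .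
  have "mon 0 6 0 = (varz ^ 6 + ((vary ^ 2 + varz ^ 2) * quartic2 - vary * (mon 0 3 2 - mon 0 5 0)) :: (3, 'k) mpoly)"
    by (simp add: mon_def algebra_simps numeral_eq_Suc)
  also have "\<dots> \<in> (the_ideal :: (3, 'k) mpoly set)"
    by (rule is_ideal_add[OF id g(6) is_ideal_diff[OF id is_ideal_mult[OF id g(4)] is_ideal_mult[OF id 5]]])
  finally show "mon 0 6 0 \<in> (the_ideal :: (3, 'k) mpoly set)" .
qed

section \<open>Standard monomials span the quotient\<close>

definition reducible_to_standard :: "nat \<Rightarrow> (3, 'k::field) mpoly \<Rightarrow> bool" where
  "reducible_to_standard d p \<longleftrightarrow> (\<exists>q\<in>mvs.span (standard_monomials d). p - q \<in> the_ideal)"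

lemma reducible_congr:
  assumes "reducible_to_standard d q" "p - q \<in> the_ideal"
  shows "reducible_to_standard d p"
proof -
  obtain r where r: "r \<in> mvs.span (standard_monomials d)" "q - r \<in> the_ideal"
    using assms(1) unfolding reducible_to_standard_def by blast
  have "p - r = (p - q) + (q - r)" by simp
  then have "p - r \<in> the_ideal" using is_ideal_add[OF is_ideal_ideal_gen assms(2) r(2)] by simp
  then show ?thesis using r(1) unfolding reducible_to_standard_def by blast
qed

lemma reducible_0: "p \<in> the_ideal \<Longrightarrow> reducible_to_standard d p"
  unfolding reducible_to_standard_def using mvs.span_zero by (intro bexI[of _ 0]) simp_all

lemma reducible_add:
  fixes p q :: "(3, 'k::field) mpoly"
  assumes "reducible_to_standard d p" "reducible_to_standard d q"
  shows "reducible_to_standard d (p + q)"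
proof -
  obtain r s where r: "r \<in> mvs.span (standard_monomials d)" "p - r \<in> the_ideal"
    and s: "s \<in> mvs.span (standard_monomials d)" "q - s \<in> the_ideal"
    using assms unfolding reducible_to_standard_def by blast
  have "p + q - (r + s) = (p - r) + (q - s)" by simp
  then have "p + q - (r + s) \<in> the_ideal" using is_ideal_add[OF is_ideal_ideal_gen r(2) s(2)] by (simp only:)
  then show ?thesis using mvs.span_add[OF r(1) s(1)] unfolding reducible_to_standard_def by blast
qed

lemma reducible_scale:
  fixes p :: "(3, 'k::field) mpoly"
  assumes "reducible_to_standard d p"
  shows "reducible_to_standard d (Const k * p)"
proof -
  obtain r where r: "r \<in> mvs.span (standard_monomials d)" "p - r \<in> the_ideal"
    using assms unfolding reducible_to_standard_def by blast
  have "Const k * p - Const k * r = Const k * (p - r)" by (simp add: right_diff_distrib)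
  then have "Const k * p - Const k * r \<in> the_ideal" using is_ideal_mult[OF is_ideal_ideal_gen r(2)] by simp
  then show ?thesis using mvs.span_scale[OF r(1)] unfolding reducible_to_standard_def by blast
qed

lemma reducible_diff:
  assumes "reducible_to_standard d p" "reducible_to_standard d q"
  shows "reducible_to_standard d (p - q)"
  using reducible_add[OF assms(1) reducible_scale[OF assms(2), of "- 1"]] by (simp add: Const_uminus)

text \<open>Each relation replaces its leading monomial by monomials of smaller weight 2 a + c and
  of the same degree; the three monomial relations end the reduction.\<close>

lemma mon_reducible: "reducible_to_standard (a + b + c) (mon a b c :: (3, 'k::field) mpoly)"
proof (induction "2 * a + c" arbitrary: a b c rule: less_induct)
  case less
  have IH: "reducible_to_standard (a + b + c) (mon a' b' c' :: (3, 'k) mpoly)"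
    if "2 * a' + c' < 2 * a + c" "a' + b' + c' = a + b + c" for a' b' c'
    using less[OF that(1), of b'] that(2) by (simp only:)
  note mult = is_ideal_mult[OF is_ideal_ideal_gen]
  consider "2 \<le> a \<and> 1 \<le> b" | "1 \<le> a \<and> 2 \<le> c" | "3 \<le> a \<and> 1 \<le> c" | "4 \<le> c" | "3 \<le> b \<and> 2 \<le> c"
    | "6 \<le> a" | "1 \<le> a \<and> 4 \<le> b \<and> 1 \<le> c" | "6 \<le> b" | "standard a b c"
    unfolding standard_def by linarith
  then show ?case
  proof cases
    case 1
    then obtain a' b' where ab: "a = a' + 2" "b = b' + 1" by (metis add.commute le_iff_add)
    have "reducible_to_standard (a + b + c) (mon a' (b' + 1) (c + 2) + mon a' b' (c + 3) - mon a' (b' + 3) c :: (3, 'k) mpoly)"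
      using ab by (intro reducible_add reducible_diff IH) simp_all
    moreover have "mon a b c - (mon a' (b' + 1) (c + 2) + mon a' b' (c + 3) - mon a' (b' + 3) c) \<in> (the_ideal :: (3, 'k) mpoly set)"
      using mult[OF groebner_relations(1), of "mon a' b' c"]
      by (simp add: ab right_diff_distrib distrib_left mon_mult)
    ultimately show ?thesis by (rule reducible_congr)
  next
    case 2
    then obtain a' c' where ac: "a = a' + 1" "c = c' + 2" by (metis add.commute le_iff_add)
    have "reducible_to_standard (a + b + c) (mon a (b + 2) c' :: (3, 'k) mpoly)"
      using ac by (intro IH) simp_all
    moreover have "mon a b c - mon a (b + 2) c' \<in> (the_ideal :: (3, 'k) mpoly set)"
      using mult[OF groebner_relations(2), of "mon a' b c'"] by (simp add: ac right_diff_distrib mon_mult)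
    ultimately show ?thesis by (rule reducible_congr)
  next
    case 3
    then obtain a' c' where ac: "a = a' + 3" "c = c' + 1" by (metis add.commute le_iff_add)
    have "reducible_to_standard (a + b + c) (mon (a' + 1) (b + 3) c' :: (3, 'k) mpoly)"
      using ac by (intro IH) simp_all
    moreover have "mon a b c - mon (a' + 1) (b + 3) c' \<in> (the_ideal :: (3, 'k) mpoly set)"
      using mult[OF groebner_relations(3), of "mon a' b c'"] by (simp add: ac right_diff_distrib mon_mult)
    ultimately show ?thesis by (rule reducible_congr)
  next
    case 4
    then obtain c' where c: "c = c' + 4" by (metis add.commute le_iff_add)
    have "reducible_to_standard (a + b + c) (mon a (b + 2) (c' + 2) :: (3, 'k) mpoly)"
      using c by (intro IH) simp_all
    moreover have "mon a b c - mon a (b + 2) (c' + 2) \<in> (the_ideal :: (3, 'k) mpoly set)"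
      using mult[OF groebner_relations(4), of "mon a b c'"] by (simp add: c right_diff_distrib mon_mult)
    ultimately show ?thesis by (rule reducible_congr)
  next
    case 5
    then obtain b' c' where bc: "b = b' + 3" "c = c' + 2" by (metis add.commute le_iff_add)
    have "reducible_to_standard (a + b + c) (mon a (b' + 5) c' :: (3, 'k) mpoly)"
      using bc by (intro IH) simp_all
    moreover have "mon a b c - mon a (b' + 5) c' \<in> (the_ideal :: (3, 'k) mpoly set)"
      using mult[OF groebner_relations(5), of "mon a b' c'"] by (simp add: bc right_diff_distrib mon_mult)
    ultimately show ?thesis by (rule reducible_congr)
  next
    case 6
    then obtain a' where a: "a = a' + 6" by (metis add.commute le_iff_add)
    have "mon a b c \<in> (the_ideal :: (3, 'k) mpoly set)"
      using mult[OF groebner_relations(6), of "mon a' b c"] by (simp add: a mon_mult)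
    then show ?thesis by (rule reducible_0)
  next
    case 7
    then obtain a' b' c' where abc: "a = a' + 1" "b = b' + 4" "c = c' + 1" by (metis add.commute le_iff_add)
    have "mon a b c \<in> (the_ideal :: (3, 'k) mpoly set)"
      using mult[OF groebner_relations(7), of "mon a' b' c'"] by (simp add: abc mon_mult)
    then show ?thesis by (rule reducible_0)
  next
    case 8
    then obtain b' where b: "b = b' + 6" by (metis add.commute le_iff_add)
    have "mon a b c \<in> (the_ideal :: (3, 'k) mpoly set)"
      using mult[OF groebner_relations(8), of "mon a b' c"] by (simp add: b mon_mult)
    then show ?thesis by (rule reducible_0)
  next
    case 9
    then have "(mon a b c :: (3, 'k) mpoly) \<in> standard_monomials (a + b + c)"
      unfolding standard_monomials_def standard_exponents_def by (intro image_eqI[of _ _ "(a, b, c)"]) auto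
    then have "(mon a b c :: (3, 'k) mpoly) \<in> mvs.span (standard_monomials (a + b + c))" by (rule mvs.span_base)
    then show ?thesis unfolding reducible_to_standard_def
      by (intro bexI[of _ "mon a b c"]) (simp_all add: is_ideal_0)
  qed
qed

lemma homogeneous_reducible:
  fixes p :: "(3, 'k::field) mpoly"
  assumes "homogeneous d p"
  shows "reducible_to_standard d p"
proof -
  have "reducible_to_standard d (\<Sum>m\<in>A. Const (Poly_Mapping.lookup p m) *
    mon (Poly_Mapping.lookup m 0) (Poly_Mapping.lookup m 1) (Poly_Mapping.lookup m 2))"
    if "A \<subseteq> Poly_Mapping.keys p" for A
    using that
  proof (induction A rule: infinite_finite_induct)
    case (insert m A)
    have "monom_degree m = d" using assms insert.prems by (auto simp: homogeneous_def)
    then have "Poly_Mapping.lookup m 0 + Poly_Mapping.lookup m 1 + Poly_Mapping.lookup m 2 = d"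
      unfolding monom_degree_UNIV UNIV_3 by simp
    then have "reducible_to_standard d (Const (Poly_Mapping.lookup p m) *
        mon (Poly_Mapping.lookup m 0) (Poly_Mapping.lookup m 1) (Poly_Mapping.lookup m 2))"
      using reducible_scale[OF mon_reducible] by metis
    then show ?case
      using insert by (simp add: reducible_add)
  qed (simp_all add: reducible_0[OF is_ideal_0[OF is_ideal_ideal_gen]])
  from this[OF subset_refl] show ?thesis by (subst sum_mon)
qed

lemma standard_exponents_empty: "7 \<le> d \<Longrightarrow> standard_exponents d = {}"
  unfolding standard_exponents_def standard_def by auto

lemma degree_7_in_ideal:
  assumes "homogeneous d p" "7 \<le> d"
  shows "p \<in> the_ideal"
proof -
  obtain q where "q \<in> mvs.span (standard_monomials d)" "p - q \<in> the_ideal"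
    using homogeneous_reducible[OF assms(1)] unfolding reducible_to_standard_def by blast
  then show ?thesis using standard_exponents_empty[OF assms(2)] by (simp add: standard_monomials_def)
qed

text \<open>The normal form of y^b z^c. The table follows from z^4 = y^2 z^2, y^3 z^2 = y^5 and y^6
  = 0: for instance, in degree 5 the even powers of z lead to y^5, and z^3 and z^5 to y^2
  z^3.\<close>

definition normal_form0 :: "nat \<Rightarrow> nat \<Rightarrow> (3, 'k::field) mpoly" where
  "normal_form0 b c =
    (if b + c < 4 then mon 0 b c
     else if b + c = 4 then (if c = 4 then mon 0 2 2 else mon 0 b c)
     else if b + c = 5 then (if c = 1 then mon 0 4 1 else if even c then mon 0 5 0 else mon 0 2 3)
     else if b + c = 6 \<and> odd c then mon 0 5 1 else 0)"

text \<open>The normal form of x y^b z^c. Next to x, z^2 may be replaced by y^2, so only the parity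
  of \<open>c\<close> counts; the bounds come from y^6 = 0 and x y^4 z = 0.\<close>

definition normal_form1 :: "nat \<Rightarrow> nat \<Rightarrow> (3, 'k::field) mpoly" where
  "normal_form1 b c =
    (if even c then (if b + c < 6 then mon 1 (b + c) 0 else 0)
     else if b + c < 5 then mon 1 (b + c - 1) 1 else 0)"

text \<open>An explicit function of the exponents instead of a rewriting process: no confluence has
  to be shown, and the independence of the standard monomials follows once the linear extension
  vanishes on the ideal. The recursion applies the relations for x^2 y and x^3 z; the equation for
  x^2 z^2 first uses x z^2 = x y^2.\<close>

fun normal_form :: "nat \<Rightarrow> nat \<Rightarrow> nat \<Rightarrow> (3, 'k::field) mpoly" where
  "normal_form 0 b c = normal_form0 b c"
| "normal_form (Suc 0) b c = normal_form1 b c"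
| "normal_form (Suc (Suc a)) (Suc b) c =
     normal_form a (Suc b) (Suc (Suc c)) + normal_form a b (Suc (Suc (Suc c))) - normal_form a (Suc (Suc (Suc b))) c"
| "normal_form (Suc (Suc a)) 0 (Suc (Suc c)) =
     normal_form a 2 (Suc (Suc c)) + normal_form a 1 (Suc (Suc (Suc c))) - normal_form a 4 c"
| "normal_form (Suc (Suc a)) 0 (Suc 0) = (if a = 0 then mon 2 0 1 else normal_form a 3 0)"
| "normal_form (Suc (Suc a)) 0 0 = (if a < 4 then mon (Suc (Suc a)) 0 0 else 0)"

lemma normal_form0_step:
  "(normal_form0 b (Suc (Suc c)) :: (3, 'k::field) mpoly) = normal_form0 (Suc (Suc b)) c" if "1 \<le> b \<and> 2 \<le> c \<or> 3 \<le> b \<or> 2 \<le> c"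
proof -
  have "b = 0 \<and> c = 2 \<or> b = 1 \<and> c = 2 \<or> b = 0 \<and> c = 3 \<or> b = 3 \<and> c = 0 \<or> b + c = 4 \<or> 5 \<le> b + c"
    using that by arith
  then show ?thesis by (elim disjE) (auto simp: normal_form0_def, simp add: numeral_2_eq_2)
qed

text \<open>Invariance under x z^2 = x y^2. One unfolding of the recursion leaves exponents of y and
  z that are large enough for \<open>normal_form0_step\<close> when no factor x remains.\<close>

lemma normal_form_step: "(normal_form (Suc a) b (Suc (Suc c)) :: (3, 'k::field) mpoly) = normal_form (Suc a) (Suc (Suc b)) c"
proof (induction a arbitrary: b c rule: less_induct)
  case (less a)
  consider "a = 0" | n where "a = Suc n" by (cases a) auto
  then show ?case
  proof cases
    case 1
    then show ?thesis by (simp add: normal_form1_def)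
  next
    case (2 n)
    show ?thesis
    proof (cases b)
      case 0
      then show ?thesis using 2 by (simp add: numeral_eq_Suc)
    next
      case (Suc m)
      have step: "(normal_form n i (Suc (Suc j)) :: (3, 'k) mpoly) = normal_form n (Suc (Suc i)) j" if "3 \<le> i \<or> 2 \<le> j" for i j
        using less[of "n - 1"] 2 normal_form0_step[of i j, where ?'k = 'k] that by (cases n) auto
      show ?thesis
        using step[of "Suc (Suc (Suc m))" c] step[of "Suc m" "Suc (Suc c)"] step[of m "Suc (Suc (Suc c))"]
        by (simp add: 2 Suc)
    qed
  qed
qed

lemma normal_form_step': "(normal_form a b (c + 4) :: (3, 'k::field) mpoly) = normal_form a (b + 2) (c + 2)"
  using normal_form_step[of "a - 1" b "c + 2", where ?'k = 'k] normal_form0_step[of b "c + 2", where ?'k = 'k]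
  by (cases a) (simp_all add: numeral_eq_Suc)

lemma normal_form_quartic1: "(normal_form (a + 3) b (c + 1) :: (3, 'k::field) mpoly) = normal_form (a + 1) (b + 1) (c + 2)"
proof -
  have step: "(normal_form (Suc a) i (Suc (Suc j)) :: (3, 'k) mpoly) = normal_form (Suc a) (Suc (Suc i)) j" for i j
    by (rule normal_form_step)
  show ?thesis
  proof (cases b)
    case 0
    show ?thesis
    proof (cases c)
      case 0
      then show ?thesis using \<open>b = 0\<close> step[of 1 0] by (simp add: numeral_eq_Suc)
    next
      case (Suc j)
      then show ?thesis using \<open>b = 0\<close> step[of 2 j] by (simp add: numeral_eq_Suc)
    qed
  next
    case (Suc m)
    then show ?thesis
      using step[of "Suc m" "Suc c"] step[of m "Suc (Suc c)"] by (simp add: numeral_eq_Suc)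
  qed
qed

lemma normal_form_high: "7 \<le> a + b + c \<Longrightarrow> normal_form a b c = (0 :: (3, 'k::field) mpoly)"
  by (induction a b c rule: normal_form.induct) (auto simp: normal_form0_def normal_form1_def)

lemma normal_form_standard: "standard a b c \<Longrightarrow> normal_form a b c = (mon a b c :: (3, 'k::field) mpoly)"
proof -
  assume s: "standard a b c"
  consider "a = 0" | "a = 1" | n where "a = Suc (Suc n)" by (metis One_nat_def not0_implies_Suc)
  then show ?thesis
  proof cases
    case 1
    then have "c < 4" "b < 6" "3 \<le> b \<Longrightarrow> c < 2" using s by (auto simp: standard_def)
    then have "(b = 0 \<or> b = 1 \<or> b = 2) \<and> (c = 0 \<or> c = 1 \<or> c = 2 \<or> c = 3) \<or> (b = 3 \<or> b = 4 \<or> b = 5) \<and> (c = 0 \<or> c = 1)"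
      by linarith
    then show ?thesis using 1 by (elim disjE conjE) (simp_all add: normal_form0_def)
  next
    case 2
    then have "c = 0 \<and> b < 6 \<or> c = 1 \<and> b < 4" using s by (auto simp: standard_def)
    then show ?thesis using 2 by (auto simp: normal_form1_def)
  next
    case (3 n)
    then have "b = 0 \<and> (c = 0 \<and> n < 4 \<or> c = 1 \<and> n = 0)" using s by (auto simp: standard_def)
    then show ?thesis using 3 by (auto simp: numeral_eq_Suc)
  qed
qed

section \<open>The linear extension of the normal form\<close>

definition reduce :: "(3, 'k::field) mpoly \<Rightarrow> (3, 'k) mpoly" where
  "reduce p = (\<Sum>m\<in>Poly_Mapping.keys p. Const (Poly_Mapping.lookup p m) *
    normal_form (Poly_Mapping.lookup m 0) (Poly_Mapping.lookup m 1) (Poly_Mapping.lookup m 2))"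

lemma reduce_eq_sum:
  assumes "finite A" "Poly_Mapping.keys p \<subseteq> A"
  shows "reduce p = (\<Sum>m\<in>A. Const (Poly_Mapping.lookup p m) *
    normal_form (Poly_Mapping.lookup m 0) (Poly_Mapping.lookup m 1) (Poly_Mapping.lookup m 2))"
  unfolding reduce_def using assms by (intro sum.mono_neutral_left) (auto simp: in_keys_iff)

lemma reduce_add: "reduce (p + q) = reduce p + reduce q"
proof -
  let ?A = "Poly_Mapping.keys p \<union> Poly_Mapping.keys q"
  have "Poly_Mapping.keys (p + q) \<subseteq> ?A" by (rule keys_add)
  then show ?thesis
    using reduce_eq_sum[of ?A p] reduce_eq_sum[of ?A q] reduce_eq_sum[of ?A "p + q"]
    by (simp add: lookup_add Const_add distrib_right sum.distrib)
qed

lemma reduce_0 [simp]: "reduce 0 = 0"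
  by (simp add: reduce_def)

lemma reduce_scale: "reduce (Const c * p) = Const c * reduce p"
proof -
  have "Poly_Mapping.keys (Const c * p) \<subseteq> Poly_Mapping.keys p"
    by (auto simp: in_keys_iff)
  then show ?thesis
    using reduce_eq_sum[of "Poly_Mapping.keys p" "Const c * p"]
    by (simp add: reduce_def Const_mult sum_distrib_left mult.assoc)
qed

lemma reduce_uminus: "reduce (- p) = - reduce p"
  using reduce_scale[of "- 1" p] by (simp add: Const_uminus)

lemma reduce_diff: "reduce (p - q) = reduce p - reduce q"
  using reduce_add[of p "- q"] by (simp add: reduce_uminus)

lemma reduce_sum: "reduce (sum f A) = (\<Sum>a\<in>A. reduce (f a))"
  by (induction A rule: infinite_finite_induct) (simp_all add: reduce_add)

lemma reduce_mon: "reduce (mon a b c) = normal_form a b c"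
  by (simp add: reduce_def mon_eq_single)

text \<open>By linearity only monomial multiples of the generators matter. For the first four
  generators these are the invariances of \<open>normal_form\<close>; the three monomials of degree
  6 have normal form 0, and so have their proper multiples by degree.\<close>

lemma reduce_ideal:
  assumes "p \<in> (the_ideal :: (3, 'k::field) mpoly set)"
  shows "reduce p = 0"
proof -
  let ?G = "{cubic, varx * quadric, quartic1, quartic2, varx ^ 6, varz ^ 6, varx * varz ^ 5} :: (3, 'k) mpoly set"
  have gens: "reduce (mon a b c * g) = 0" if "g \<in> ?G" for g a b c
  proof -
    have g: "cubic = mon 2 1 0 + mon 0 3 0 - mon 0 1 2 - (mon 0 0 3 :: (3, 'k) mpoly)"
      "varx * quadric = mon 1 2 0 - (mon 1 0 2 :: (3, 'k) mpoly)"
      "quartic1 = mon 3 0 1 - (mon 1 1 2 :: (3, 'k) mpoly)"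
      "quartic2 = mon 0 2 2 - (mon 0 0 4 :: (3, 'k) mpoly)"
      "varx ^ 6 = (mon 6 0 0 :: (3, 'k) mpoly)" "varz ^ 6 = (mon 0 0 6 :: (3, 'k) mpoly)"
      "varx * varz ^ 5 = (mon 1 0 5 :: (3, 'k) mpoly)"
      by (simp_all add: mon_def algebra_simps numeral_eq_Suc)
    have "reduce (mon a b c * (mon 2 1 0 + mon 0 3 0 - mon 0 1 2 - (mon 0 0 3 :: (3, 'k) mpoly))) = 0"
      by (simp add: right_diff_distrib distrib_left mon_mult reduce_add reduce_diff reduce_mon numeral_eq_Suc)
    moreover have "reduce (mon a b c * (mon 1 2 0 - (mon 1 0 2 :: (3, 'k) mpoly))) = 0"
      using normal_form_step[of a b c, where ?'k = 'k]
      by (simp add: right_diff_distrib mon_mult reduce_diff reduce_mon)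
    moreover have "reduce (mon a b c * (mon 3 0 1 - (mon 1 1 2 :: (3, 'k) mpoly))) = 0"
      using normal_form_quartic1[of a b c, where ?'k = 'k]
      by (simp add: right_diff_distrib mon_mult reduce_diff reduce_mon)
    moreover have "reduce (mon a b c * (mon 0 2 2 - (mon 0 0 4 :: (3, 'k) mpoly))) = 0"
      using normal_form_step'[of a b c, where ?'k = 'k]
      by (simp add: right_diff_distrib mon_mult reduce_diff reduce_mon)
    moreover have "normal_form (a + 6) b c = (0 :: (3, 'k) mpoly)" "normal_form a b (c + 6) = (0 :: (3, 'k) mpoly)"
      "normal_form (a + 1) b (c + 5) = (0 :: (3, 'k) mpoly)"
    proof -
      have "normal_form 0 0 6 = (0 :: (3, 'k) mpoly)" "normal_form (Suc 0) 0 5 = (0 :: (3, 'k) mpoly)"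
        by (simp_all only: normal_form.simps) (simp_all add: normal_form0_def normal_form1_def)
      moreover have "normal_form 6 0 0 = (0 :: (3, 'k) mpoly)" by (simp add: numeral_eq_Suc)
      ultimately have "normal_form 6 0 0 = (0 :: (3, 'k) mpoly)" "normal_form 0 0 6 = (0 :: (3, 'k) mpoly)"
        "normal_form 1 0 5 = (0 :: (3, 'k) mpoly)" by simp_all
      then show "normal_form (a + 6) b c = (0 :: (3, 'k) mpoly)" "normal_form a b (c + 6) = (0 :: (3, 'k) mpoly)"
        "normal_form (a + 1) b (c + 5) = (0 :: (3, 'k) mpoly)"
        using normal_form_high[of "a + 6" b c, where ?'k = 'k] normal_form_high[of a b "c + 6", where ?'k = 'k]
          normal_form_high[of "a + 1" b "c + 5", where ?'k = 'k]
        by (cases "a = 0 \<and> b = 0 \<and> c = 0"; auto)+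
    qed
    ultimately show ?thesis using that unfolding g by (auto simp: mon_mult reduce_mon)
  qed
  obtain u where u: "p = (\<Sum>g\<in>?G. u g * g)" using mem_ideal_gen_finite[OF assms] by auto
  have "reduce (u g * g) = 0" if "g \<in> ?G" for g
    by (subst sum_mon[of "u g"])
      (simp add: sum_distrib_right reduce_sum mult.assoc reduce_scale gens[OF that])
  then show ?thesis unfolding u reduce_sum by (intro sum.neutral) blast
qed

text \<open>The standard monomials span by \<open>homogeneous_reducible\<close>. They are
  independent because \<open>reduce\<close> vanishes on the ideal and fixes each of them.\<close>

lemma hilbert_function_card: "quotient_graded_dim (the_ideal :: (3, 'k::field) mpoly set) d (card (standard_exponents d))"
proof -
  have "standard_exponents d \<subseteq> {..<6} \<times> {..<6} \<times> {..<4}"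
    by (auto simp: standard_exponents_def standard_def)
  then have "finite (standard_exponents d)" by (rule finite_subset) auto
  then obtain ts where ts: "set ts = standard_exponents d" "distinct ts"
    using finite_distinct_list by blast
  let ?n = "card (standard_exponents d)"
  have len: "length ts = ?n" using ts distinct_card by metis
  define bs where "bs = map (\<lambda>(a, b, c). mon a b c :: (3, 'k) mpoly) ts"
  have lb: "length bs = ?n" by (simp add: bs_def len)
  have expand: "\<exists>!cs. length cs = ?n \<and> p - (\<Sum>i<?n. Const (cs ! i) * bs ! i) \<in> (the_ideal :: (3, 'k) mpoly set)"
    if p: "homogeneous d p" for p
  proof -
    obtain q where q: "q \<in> mvs.span (standard_monomials d)" "p - q \<in> the_ideal"
      using homogeneous_reducible[OF p] unfolding reducible_to_standard_def by blast
    have set_bs: "set bs = standard_monomials d" by (simp add: bs_def standard_monomials_def ts(1))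
    have dist: "distinct bs"
      unfolding bs_def distinct_map using ts(2) by (auto simp: inj_on_def mon_eq_iff)
    obtain k where k: "q = (\<Sum>v\<in>set bs. Const (k v) * v)"
      using q(1) unfolding set_bs[symmetric] by (auto simp: mvs.span_finite)
    have "q = (\<Sum>i<?n. Const (k (bs ! i)) * bs ! i)"
      unfolding k using dist lb by (simp add: sum.distinct_set_conv_list sum_list_sum_nth atLeast0LessThan)
    then have q': "q = (\<Sum>i<?n. Const (map k bs ! i) * bs ! i)" using lb by simp
    show ?thesis
    proof (rule ex1I[of _ "map k bs"])
      show "length (map k bs) = ?n \<and> p - (\<Sum>i<?n. Const (map k bs ! i) * bs ! i) \<in> the_ideal"
        using q(2) lb unfolding q'[symmetric] by simp
      fix cs assume cs: "length cs = ?n \<and> p - (\<Sum>i<?n. Const (cs ! i) * bs ! i) \<in> the_ideal"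
      define e where "e = (\<Sum>i<?n. Const (cs ! i - map k bs ! i) * bs ! i)"
      have "e = (p - q) - (p - (\<Sum>i<?n. Const (cs ! i) * bs ! i))"
        unfolding q' e_def by (simp add: Const_diff left_diff_distrib sum_subtractf)
      then have "e \<in> the_ideal" using is_ideal_diff[OF is_ideal_ideal_gen q(2)] cs by blast
      then have "reduce e = 0" by (rule reduce_ideal)
      moreover have "reduce (bs ! i) = bs ! i" if "i < ?n" for i
      proof -
        obtain a b c where abc: "ts ! i = (a, b, c)" by (metis prod.collapse)
        then have "(a, b, c) \<in> standard_exponents d" using that len ts(1) nth_mem by metis
        then have "standard a b c" by (simp add: standard_exponents_def)
        then show ?thesis using that len abc by (simp add: bs_def reduce_mon normal_form_standard)
      qed
      ultimately have e0: "e = 0" by (simp add: e_def reduce_sum reduce_scale)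
      show "cs = map k bs"
      proof (rule nth_equalityI)
        fix i assume i: "i < length cs"
        obtain a b c where abc: "ts ! i = (a, b, c)" by (metis prod.collapse)
        have bi: "Poly_Mapping.lookup (bs ! j) (expo a b c) = (if j = i then 1 else 0)" if j: "j < ?n" for j
        proof -
          obtain a' b' c' where abc': "ts ! j = (a', b', c')" by (metis prod.collapse)
          have "j = i \<longleftrightarrow> ts ! j = ts ! i"
            using nth_eq_iff_index_eq[OF ts(2)] i j cs len by metis
          then show ?thesis
            using j len abc abc' by (auto simp: bs_def mon_eq_single lookup_single when_def)
        qed
        have "0 = Poly_Mapping.lookup e (expo a b c)" by (simp add: e0)
        also have "\<dots> = (\<Sum>j<?n. (cs ! j - map k bs ! j) * Poly_Mapping.lookup (bs ! j) (expo a b c))"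
          by (simp add: e_def lookup_sum)
        also have "\<dots> = (\<Sum>j<?n. if j = i then cs ! j - map k bs ! j else 0)"
          by (intro sum.cong) (auto simp: bi)
        also have "\<dots> = cs ! i - map k bs ! i" using i cs by simp
        finally show "cs ! i = map k bs ! i" by simp
      qed (use cs lb in simp)
    qed
  qed
  have "\<forall>b\<in>set bs. homogeneous d b"
    using ts(1) homogeneous_mon by (auto simp: bs_def standard_exponents_def)
  then show ?thesis unfolding quotient_graded_dim_def using lb expand by blast
qed

lemma card_standard_exponents:
  "card (standard_exponents d) = (if d < 7 then [1, 3, 6, 8, 7, 6, 2] ! d else 0)"
proof (cases "d < 7")
  case True
  have bound: "a < 6 \<and> b < 6 \<and> c < 4" if "standard a b c" for a b c
    using that by (simp add: standard_def)
  have set: "standard_exponents d = set (filter (\<lambda>(a, b, c). standard a b c \<and> a + b + c = d)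
      (List.product [0..<6] (List.product [0..<6] [0..<4])))" for d
    by (auto simp: standard_exponents_def dest: bound)
  have "map (\<lambda>d. length (remdups (filter (\<lambda>(a, b, c). standard a b c \<and> a + b + c = d)
      (List.product [0..<6] (List.product [0..<6] [0..<4]))))) [0..<7] = [1, 3, 6, 8, 7, 6, 2]"
    by code_simp
  then have "map (\<lambda>d. card (standard_exponents d)) [0..<7] = [1, 3, 6, 8, 7, 6, 2]"
    by (simp only: set length_remdups_card_conv)
  then have "map (\<lambda>d. card (standard_exponents d)) [0..<7] ! d = [1, 3, 6, 8, 7, 6, 2] ! d" by simp
  then show ?thesis using True by (subst (asm) nth_map) simp_all
next
  case False
  then show ?thesis using standard_exponents_empty[of d] by simp
qed

lemma hilbert_function: "quotient_hilbert_function (the_ideal :: (3, 'k::field) mpoly set) [1, 3, 6, 8, 7, 6, 2]"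
  unfolding quotient_hilbert_function_def
proof (intro conjI allI)
  fix d
  have "length [1, 3, 6, 8, 7, 6, 2 :: nat] = 7" by simp
  then show "quotient_graded_dim (the_ideal :: (3, 'k) mpoly set) d
      (if d < length [1, 3, 6, 8, 7, 6, 2 :: nat] then [1, 3, 6, 8, 7, 6, 2] ! d else 0)"
    using hilbert_function_card[of d, where ?'k = 'k] by (simp only: card_standard_exponents)
qed simp

lemma Const_power: "Const (c ^ n) = Const c ^ n"
  by (induction n) (simp_all add: Const_mult)

section \<open>The ideal is primary to the irrelevant ideal\<close>

lemma hclosed_the_ideal: "hclosed the_ideal"
proof (rule hclosed_ideal_gen)
  fix g :: "(3, 'a) mpoly"
  assume "g \<in> {cubic, varx * quadric, quartic1, quartic2, varx ^ 6, varz ^ 6, varx * varz ^ 5}"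
  then show "\<exists>d. homogeneous d g"
    using homogeneous_forms homogeneous_mult[OF homogeneous_Var homogeneous_forms(2), of 0]
      homogeneous_monomial[of 6 0 0] homogeneous_monomial[of 0 0 6] homogeneous_monomial[of 1 0 5]
    by auto
qed

text \<open>Comparing degrees removes the generators of degree 6, and in degree at most 3 also the
  quartics.\<close>

lemma low_degree_the_ideal:
  assumes "homogeneous d a" "a \<in> the_ideal" "d \<le> 5"
  obtains u1 u2 u3 u4 where "a = u1 * cubic + u2 * (varx * quadric) + u3 * quartic1 + u4 * quartic2"
    "d \<le> 3 \<Longrightarrow> u3 = 0" "d \<le> 3 \<Longrightarrow> u4 = 0" "d < 3 \<Longrightarrow> a = 0"
proof -
  obtain u1 where u1: "a - u1 * cubic \<in> ideal_gen {varx * quadric, quartic1, quartic2, varx ^ 6, varz ^ 6, varx * varz ^ 5}"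
    using assms(2) by (auto simp: mem_ideal_gen_insert[of _ cubic])
  obtain u2 where u2: "a - u1 * cubic - u2 * (varx * quadric) \<in> ideal_gen {quartic1, quartic2, varx ^ 6, varz ^ 6, varx * varz ^ 5}"
    using u1 by (auto simp: mem_ideal_gen_insert[of _ "varx * quadric"])
  obtain u3 where u3: "a - u1 * cubic - u2 * (varx * quadric) - u3 * quartic1 \<in> ideal_gen {quartic2, varx ^ 6, varz ^ 6, varx * varz ^ 5}"
    using u2 by (auto simp: mem_ideal_gen_insert[of _ quartic1])
  obtain u4 where u4: "a - u1 * cubic - u2 * (varx * quadric) - u3 * quartic1 - u4 * quartic2 \<in> ideal_gen {varx ^ 6, varz ^ 6, varx * varz ^ 5}"
    using u3 by (auto simp: mem_ideal_gen_insert[of _ quartic2])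
  obtain u5 u6 u7 where u: "a = u1 * cubic + u2 * (varx * quadric) + u3 * quartic1 + u4 * quartic2
      + (u5 * varx ^ 6 + u6 * varz ^ 6 + u7 * (varx * varz ^ 5))"
    using u4 unfolding mem_ideal_gen_3 by (auto simp: algebra_simps)
  have h6: "homogeneous 6 (varx ^ 6 :: (3, 'a) mpoly)" "homogeneous 6 (varz ^ 6 :: (3, 'a) mpoly)"
    "homogeneous 6 (varx * varz ^ 5 :: (3, 'a) mpoly)" "homogeneous 3 (varx * quadric :: (3, 'a) mpoly)"
    using homogeneous_monomial[of 6 0 0] homogeneous_monomial[of 0 0 6] homogeneous_monomial[of 1 0 5]
      homogeneous_mult[OF homogeneous_Var homogeneous_forms(2), of 0] by (auto simp: numeral_3_eq_3)
  have "a = hpart (int d) a" using assms(1) by (simp add: hpart_homogeneous)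
  also have "\<dots> = hpart (int d - 3) u1 * cubic + hpart (int d - 3) u2 * (varx * quadric)
     + hpart (int d - 4) u3 * quartic1 + hpart (int d - 4) u4 * quartic2"
    unfolding u using assms(3)
    by (simp only: hpart_add hpart_mult_homogeneous[OF h6(1)] hpart_mult_homogeneous[OF h6(2)]
        hpart_mult_homogeneous[OF h6(3)] hpart_mult_homogeneous[OF h6(4)]
        hpart_mult_homogeneous[OF homogeneous_forms(1)] hpart_mult_homogeneous[OF homogeneous_forms(3)]
        hpart_mult_homogeneous[OF homogeneous_forms(4)])
      (simp add: hpart_neg)
  finally have a: "a = hpart (int d - 3) u1 * cubic + hpart (int d - 3) u2 * (varx * quadric)
     + hpart (int d - 4) u3 * quartic1 + hpart (int d - 4) u4 * quartic2" .
  show thesis by (rule that[OF a]) (use a in \<open>simp_all add: hpart_neg\<close>)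
qed

lemma one_not_in_the_ideal: "1 \<notin> the_ideal"
  using low_degree_the_ideal[OF homogeneous_1] by (metis le0 one_neq_zero zero_less_numeral)

text \<open>The ideal contains all forms of degree at least 7, hence the seventh powers of elements
  without constant term; an element with a nonzero constant term is invertible modulo the
  ideal.\<close>

lemma the_ideal_primary: "primary_to (ideal_gen {varx, vary, varz}) (the_ideal :: (3, 'k::field) mpoly set)"
proof -
  have I: "is_ideal (the_ideal :: (3, 'k) mpoly set)" "(the_ideal :: (3, 'k) mpoly set) \<noteq> UNIV" using one_not_in_the_ideal by auto
  have sub: "(the_ideal :: (3, 'k) mpoly set) \<subseteq> irrelevant_ideal"
    by (rule proper_hclosed_subset[OF I(1) hclosed_the_ideal I(2)])
  have power: "p ^ 7 \<in> (the_ideal :: (3, 'k) mpoly set)" if p: "p \<in> irrelevant_ideal" for p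
  proof (rule is_ideal_if_hpart[OF I(1)])
    fix n
    have low: "hpart n (p ^ j) = 0" if "n < int j" for n j
      using that
    proof (induction j arbitrary: n)
      case 0
      then show ?case by (simp add: hpart_neg)
    next
      case (Suc j)
      obtain D where D: "p = (\<Sum>i\<le>D. hpart (int i) p)"
        using sum_hpart[of p "Max (monom_degree ` Poly_Mapping.keys p)"] by auto
      have "p ^ Suc j = (\<Sum>i\<le>D. p ^ j * hpart (int i) p)"
        by (subst (1) power_Suc2, subst (2) D) (simp add: sum_distrib_left)
      then have "hpart n (p ^ Suc j) = (\<Sum>i\<le>D. hpart (n - int i) (p ^ j) * hpart (int i) p)"
        by (simp add: hpart_sum hpart_mult_homogeneous[OF homogeneous_hpart])
      also have "\<dots> = 0"
      proof (rule sum.neutral, intro ballI)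
        fix i
        show "hpart (n - int i) (p ^ j) * hpart (int i) p = 0"
          using p Suc.IH[of "n - int i"] Suc.prems by (cases "i = 0") (simp_all add: irrelevant_ideal_hpart)
      qed
      finally show ?case .
    qed
    show "hpart n (p ^ 7) \<in> the_ideal"
    proof (cases "n < 7")
      case True
      then show ?thesis using low[of n 7] by (simp add: is_ideal_0)
    next
      case False
      then show ?thesis
        using degree_7_in_ideal[of "nat n" "hpart n (p ^ 7)"] homogeneous_hpart[of "nat n" "p ^ 7"] by simp
    qed
  qed
  have prime: "prime_ideal (irrelevant_ideal :: (3, 'k) mpoly set)"
    unfolding irrelevant_ideal_def by (rule prime_ideal_Var)
  have "radical (the_ideal :: (3, 'k) mpoly set) = irrelevant_ideal"
  proof
    show "radical (the_ideal :: (3, 'k) mpoly set) \<subseteq> irrelevant_ideal"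
    proof
      fix a :: "(3, 'k) mpoly" assume "a \<in> radical (the_ideal :: (3, 'k) mpoly set)"
      then obtain n where "a ^ n \<in> (the_ideal :: (3, 'k) mpoly set)" by (auto simp: radical_def)
      then show "a \<in> irrelevant_ideal" using sub prime_ideal_power[OF prime] by blast
    qed
    show "irrelevant_ideal \<subseteq> radical (the_ideal :: (3, 'k) mpoly set)" unfolding radical_def using power by blast
  qed
  moreover have "a \<in> the_ideal \<or> (\<exists>n. b ^ n \<in> the_ideal)" if ab: "a * b \<in> the_ideal" for a b :: "(3, 'k) mpoly"
  proof (cases "b \<in> irrelevant_ideal")
    case True
    then show ?thesis using power by blast
  next
    case False
    obtain c where c: "hpart 0 b = Const c"
      using homogeneous_hpart[of 0 b] homogeneous_0_iff[of "hpart 0 b"] by auto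
    have c0: "c \<noteq> 0" using False c by (auto simp: irrelevant_ideal_hpart)
    \<comment> \<open>A geometric sum: c^7 - m^7 is a multiple of c - m, which is \<open>b\<close>,
      and m^7 is in the ideal.\<close>
    define m where "m = Const c - b"
    have "m \<in> irrelevant_ideal"
      by (simp add: m_def irrelevant_ideal_hpart hpart_diff c hpart_homogeneous[OF homogeneous_Const])
    then have m7: "a * m ^ 7 \<in> the_ideal" using power is_ideal_mult[OF I(1)] by blast
    obtain t where t: "Const c ^ 7 - m ^ 7 = b * t"
      using power_diff_sumr2[of "Const c" 7 m] by (auto simp: m_def)
    have "a * Const c ^ 7 = a * (Const c ^ 7 - m ^ 7) + a * m ^ 7" by (simp add: algebra_simps)
    then have "a * Const c ^ 7 = t * (a * b) + a * m ^ 7" unfolding t by (simp add: mult_ac)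
    then have "Const (c ^ 7) * a \<in> the_ideal"
      using is_ideal_add[OF I(1) is_ideal_mult[OF I(1) ab] m7] by (simp add: Const_power mult.commute)
    then show ?thesis using c0 is_ideal_Const_cancel[OF I(1)] by auto
  qed
  ultimately show ?thesis
    unfolding primary_to_def primary_ideal_def using I irrelevant_ideal_3 by metis
qed

section \<open>The ideal is not minimally licci\<close>

lemma form_regular_cancel: "form_regular a b c \<Longrightarrow> c * p \<in> ideal_gen {a, b} \<Longrightarrow> p \<in> ideal_gen {a, b}"
  unfolding form_regular_def regular_sequence_3 by blast

text \<open>Modulo the pencil of cubics \<open>quartic1\<close> is supported at (1:0:0): the ideal
  of this point annihilates it. This makes the forms of degree at most 5 in the link vanish
  there.\<close>

lemma quartic1_socle:
  "vary * quartic1 \<in> ideal_gen {cubic, varx * quadric :: (3, 'k::field) mpoly}"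
  "varz * quartic1 \<in> ideal_gen {cubic, varx * quadric :: (3, 'k) mpoly}"
proof -
  have "vary * quartic1 = (varx * varz) * cubic + (- (varz ^ 2) - vary * varz) * (varx * quadric :: (3, 'k) mpoly)"
    by (simp add: algebra_simps numeral_eq_Suc)
  then show "vary * quartic1 \<in> ideal_gen {cubic, varx * quadric :: (3, 'k) mpoly}"
    unfolding mem_ideal_gen_2 by blast
  have "varz * quartic1 = (varx * vary) * cubic + (- (varx ^ 2) - vary ^ 2) * (varx * quadric :: (3, 'k) mpoly)"
    by (simp add: algebra_simps numeral_eq_Suc)
  then show "varz * quartic1 \<in> ideal_gen {cubic, varx * quadric :: (3, 'k) mpoly}"
    unfolding mem_ideal_gen_2 by blast
qed

text \<open>Modulo y the supposed relation is divisible by z, and the division leaves x^3 in the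
  ideal of the point (1:0:0).\<close>

lemma quartic1_not_in_pair: "quartic1 \<notin> ideal_gen {cubic, varx * quadric :: (3, 'k::field) mpoly}"
proof
  assume "quartic1 \<in> ideal_gen {cubic, varx * quadric :: (3, 'k) mpoly}"
  then obtain u v where uv: "quartic1 = u * cubic + v * (varx * quadric :: (3, 'k) mpoly)"
    unfolding mem_ideal_gen_2 by blast
  define w where "w = varx ^ 3 - varx * vary * varz + u * vary * varz + u * varz ^ 2 + v * varx * varz"
  have "varz * w = quartic1 - (u * cubic + v * (varx * quadric)) + (u * (varx ^ 2 + vary ^ 2) + v * varx * vary) * vary"
    by (simp add: w_def algebra_simps numeral_eq_Suc)
  then have "varz * w = (u * (varx ^ 2 + vary ^ 2) + v * varx * vary) * vary" unfolding uv by simp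
  then have "varz * w \<in> ideal_gen {vary}" unfolding mem_ideal_gen_1 by blast
  moreover have "varz \<notin> (ideal_gen {vary} :: (3, 'k) mpoly set)"
    using Var_in_ideal_gen_Var[of 2 "{1::3}", where ?'k = 'k] by simp
  ultimately have "w \<in> ideal_gen {vary}"
    using prime_ideal_Var[of "{1::3}", where ?'k = 'k] unfolding prime_ideal_def by auto
  then obtain q where q: "w = q * vary" unfolding mem_ideal_gen_1 by blast
  have "varx ^ 3 = w + (varx * vary * varz - u * vary * varz - u * varz ^ 2 - v * varx * varz)"
    by (simp add: w_def)
  also have "\<dots> = q * vary + (varx * vary - u * vary - u * varz - v * varx) * varz"
    unfolding q by (simp add: algebra_simps numeral_eq_Suc)
  finally have "varx ^ 3 \<in> (point_ideal :: (3, 'k) mpoly set)" unfolding mem_ideal_gen_2 by blast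
  then show False using prime_ideal_power[OF prime_point_ideal] varx_not_in_point_ideal by blast
qed

lemma homogeneous_mod_point_ideal:
  fixes h :: "(3, 'k::field) mpoly"
  assumes "homogeneous d h"
  shows "\<exists>a. h - Const a * varx ^ d \<in> point_ideal"
proof -
  have "\<exists>a. (\<Sum>m\<in>A. Const (Poly_Mapping.lookup h m) *
    mon (Poly_Mapping.lookup m 0) (Poly_Mapping.lookup m 1) (Poly_Mapping.lookup m 2)) - Const a * varx ^ d \<in> point_ideal"
    if "A \<subseteq> Poly_Mapping.keys h" for A
    using that
  proof (induction A rule: infinite_finite_induct)
    case (insert m A)
    then obtain a where a: "(\<Sum>m\<in>A. Const (Poly_Mapping.lookup h m) *
      mon (Poly_Mapping.lookup m 0) (Poly_Mapping.lookup m 1) (Poly_Mapping.lookup m 2)) - Const a * varx ^ d \<in> point_ideal"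
      by blast
    let ?m = "Const (Poly_Mapping.lookup h m) *
      mon (Poly_Mapping.lookup m 0) (Poly_Mapping.lookup m 1) (Poly_Mapping.lookup m 2)"
    obtain i j k where ijk: "i = Poly_Mapping.lookup m 0" "j = Poly_Mapping.lookup m 1" "k = Poly_Mapping.lookup m 2" by blast
    have "monom_degree m = d" using assms insert.prems by (auto simp: homogeneous_def)
    then have d: "i + j + k = d" unfolding monom_degree_UNIV UNIV_3 ijk by simp
    have "\<exists>b. ?m - Const b * varx ^ d \<in> point_ideal"
    proof (cases "j = 0 \<and> k = 0")
      case True
      then show ?thesis using d ijk by (intro exI[of _ "Poly_Mapping.lookup h m"]) (simp add: mon_def is_ideal_0)
    next
      case False
      have yz: "vary \<in> (point_ideal :: (3, 'k) mpoly set)" "varz \<in> (point_ideal :: (3, 'k) mpoly set)"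
        by (auto intro: ideal_gen_base)
      have "mon i j k \<in> (point_ideal :: (3, 'k) mpoly set)"
      proof (cases j)
        case 0
        then obtain l where "k = Suc l" using False by (cases k) auto
        then have "mon i j k = (varx ^ i * vary ^ j * varz ^ l) * (varz :: (3, 'k) mpoly)"
          by (simp add: mon_def mult_ac)
        then show ?thesis using is_ideal_mult[OF is_ideal_ideal_gen yz(2)] by (simp only:)
      next
        case (Suc l)
        then have "mon i j k = (varx ^ i * vary ^ l * varz ^ k) * (vary :: (3, 'k) mpoly)"
          by (simp add: mon_def mult_ac)
        then show ?thesis using is_ideal_mult[OF is_ideal_ideal_gen yz(1)] by (simp only:)
      qed
      then show ?thesis unfolding ijk by (intro exI[of _ 0]) (simp add: is_ideal_mult)
    qed
    then obtain b where b: "?m - Const b * varx ^ d \<in> point_ideal" by blast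
    have "(\<Sum>m\<in>insert m A. Const (Poly_Mapping.lookup h m) *
      mon (Poly_Mapping.lookup m 0) (Poly_Mapping.lookup m 1) (Poly_Mapping.lookup m 2)) - Const (b + a) * varx ^ d
      = (?m - Const b * varx ^ d) + ((\<Sum>m\<in>A. Const (Poly_Mapping.lookup h m) *
      mon (Poly_Mapping.lookup m 0) (Poly_Mapping.lookup m 1) (Poly_Mapping.lookup m 2)) - Const a * varx ^ d)"
      using insert.hyps by (simp add: Const_add algebra_simps)
    then show ?case using is_ideal_add[OF is_ideal_ideal_gen b a] by metis
  qed (intro exI[of _ 0]; simp add: is_ideal_0)+
  from this[OF subset_refl] show ?thesis by (simp only: sum_mon[symmetric])
qed

text \<open>In degree at most 5 only the cubics and quartics contribute. Of the quartics,
  \<open>quartic1\<close> enters the pair after multiplication by y or z, and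
  \<open>quartic2\<close> after multiplication by x.\<close>

lemma even_kind_over_the_ideal: "even_kind_over (the_ideal :: (3, 'k::field) mpoly set) cubic quadric"
proof -
  let ?K = "ideal_gen {cubic, varx * quadric} :: (3, 'k) mpoly set"
  note mult = is_ideal_mult[OF is_ideal_ideal_gen] and add = is_ideal_add[OF is_ideal_ideal_gen]
  have K: "cubic \<in> ?K" "varx * quadric \<in> ?K" by (auto intro: ideal_gen_base)
  have q: "varx * v * quartic1 \<in> ?K" "varx * v * quartic2 \<in> ?K" if v: "v = vary \<or> v = varz" for v
  proof -
    have "v * quartic1 \<in> ?K" using v quartic1_socle[where ?'k = 'k] by blast
    then have "varx * (v * quartic1) \<in> ?K" by (rule mult)
    then show "varx * v * quartic1 \<in> ?K" by (simp add: mult.assoc)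
    have "varx * v * quartic2 = (v * varz ^ 2) * (varx * quadric)" by (simp add: algebra_simps)
    then show "varx * v * quartic2 \<in> ?K" using mult[OF K(2), of "v * varz ^ 2"] by (simp only:)
  qed
  have "a \<in> ?K" if a: "homogeneous d a" "a \<in> the_ideal" "d \<le> 3" for d a
  proof -
    obtain u1 u2 where "a = u1 * cubic + u2 * (varx * quadric)"
      by (rule low_degree_the_ideal[OF a(1,2)]) (use a(3) in auto)
    then show ?thesis unfolding mem_ideal_gen_2 by blast
  qed
  moreover have "varx * v * a \<in> ?K"
    if a: "homogeneous d a" "a \<in> the_ideal" "d \<le> 5" and v: "v = vary \<or> v = varz" for d a v
  proof -
    obtain u1 u2 u3 u4 where u: "a = u1 * cubic + u2 * (varx * quadric) + u3 * quartic1 + u4 * quartic2"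
      by (rule low_degree_the_ideal[OF a]) auto
    have "varx * v * a = (varx * v * u1) * cubic + (varx * v * u2) * (varx * quadric)
        + u3 * (varx * v * quartic1) + u4 * (varx * v * quartic2)"
      unfolding u by (simp only: distrib_left mult_ac)
    also have "\<dots> \<in> ?K" by (intro add mult[OF K(1)] mult[OF K(2)] mult[OF q(1)[OF v]] mult[OF q(2)[OF v]])
    finally show ?thesis .
  qed
  ultimately show ?thesis unfolding even_kind_over_def by blast
qed

lemma sextic_in_the_ideal: "sextic t \<in> (the_ideal :: (3, 'k::field) mpoly set)"
  by (rule is_ideal_add[OF is_ideal_ideal_gen is_ideal_add[OF is_ideal_ideal_gen _ is_ideal_mult[OF is_ideal_ideal_gen]]])
    (simp_all add: ideal_gen_base)

lemma even_kind_the_ideal: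
  assumes t: "t \<noteq> 0" "2 + t \<noteq> 0" "2 - t \<noteq> (0 :: 'k::field)"
  shows "even_kind (the_ideal :: (3, 'k) mpoly set)"
proof -
  have fr: "factored_regular (cubic :: (3, 'k) mpoly) quadric (sextic t)"
    using form_regularD[OF regular_cubic_sextic[OF t]] homogeneous_forms by unfold_locales
  interpret factored_regular "cubic :: (3, 'k) mpoly" quadric "sextic t" by (rule fr)
  note id = is_ideal_ideal_gen
  let ?I = "the_ideal :: (3, 'k) mpoly set"
  let ?K = "ideal_gen {cubic, varx * quadric} :: (3, 'k) mpoly set"
  have I: "cubic \<in> ?I" "varx * quadric \<in> ?I" "quartic1 \<in> ?I" "quartic2 \<in> ?I" by (auto intro: ideal_gen_base)
  have q1: "quartic1 \<notin> big.L"
    using quartic1_not_in_pair low_degree_in_triple[OF _ homogeneous_forms(3) hg hxr hc] by auto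
  have q1': "v * quartic1 \<in> big.L" if "v = vary \<or> v = varz" for v
    using that quartic1_socle[where ?'k = 'k] pair_subset by blast
  have L1: "h = 0" if h: "homogeneous d h" "h \<in> ideal_colon big.L ?I" "d < 3" for d h
  proof -
    have "h \<in> big.L"
    proof (rule big.below_socle[OF h(1), of 7])
      show "h * m \<in> big.L" if "homogeneous 7 m" for m
        using h(2) degree_7_in_ideal[OF that] by (simp add: mem_ideal_colon)
    qed (use h(3) in simp)
    then have "h \<in> ?K" using low_degree_in_triple[OF _ h(1) hg hxr hc] h(3) by simp
    then show ?thesis using low_degree_in_pair_eq_0[OF _ h(1) hg hxr] h(3) by simp
  qed
  have L2: "h \<in> point_ideal" if h: "homogeneous d h" "h \<in> ideal_colon big.L ?I" "d \<le> 5" for d h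
  proof -
    obtain a where a: "h - Const a * varx ^ d \<in> point_ideal" using homogeneous_mod_point_ideal[OF h(1)] by blast
    then obtain u v where uv: "h - Const a * varx ^ d = u * vary + v * varz" unfolding mem_ideal_gen_2 by blast
    \<comment> \<open>As y and z annihilate \<open>quartic1\<close> modulo \<open>big.L\<close>, the
      vanishing of its multiple by x^(j + 1) would make its multiple by x^j a socle element in
      degree j + 4, below 9.\<close>
    have descend: "varx ^ j * quartic1 \<in> big.L \<Longrightarrow> j \<le> 5 \<Longrightarrow> False" for j
    proof (induction j)
      case 0
      then show ?case using q1 by simp
    next
      case (Suc j)
      have hj: "homogeneous (j + 4) (varx ^ j * quartic1 :: (3, 'k) mpoly)"
        using homogeneous_mult[OF homogeneous_power[OF homogeneous_Var, of j 0] homogeneous_forms(3)] by simp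
      have "varx ^ j * quartic1 \<in> big.L"
      proof (rule big.socle_degree[OF hj])
        fix i :: 3
        have "i = 0 \<or> i = 1 \<or> i = 2" using UNIV_3 by blast
        then show "Var i * (varx ^ j * quartic1) \<in> big.L"
        proof (elim disjE)
          assume "i = 0"
          then show ?thesis using Suc.prems(1) by (simp add: mult.assoc)
        next
          assume "i = 1"
          then show ?thesis using is_ideal_mult[OF id q1'[of vary], of "varx ^ j"] by (simp only: mult.left_commute simp_thms)
        next
          assume "i = 2"
          then show ?thesis using is_ideal_mult[OF id q1'[of varz], of "varx ^ j"] by (simp only: mult.left_commute simp_thms)
        qed
      qed (use Suc.prems in simp)
      then show ?case using Suc.IH Suc.prems by simp
    qed
    have "h * quartic1 \<in> big.L" using h(2) I(3) unfolding mem_ideal_colon by blast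
    moreover have "h * quartic1 - Const a * (varx ^ d * quartic1) = u * (vary * quartic1) + v * (varz * quartic1)"
      using arg_cong[OF uv, of "\<lambda>p. p * quartic1"] by (simp only: left_diff_distrib distrib_right mult.assoc)
    moreover have "u * (vary * quartic1) + v * (varz * quartic1) \<in> big.L"
      by (intro is_ideal_add[OF id] is_ideal_mult[OF id] q1') simp_all
    ultimately have "Const a * (varx ^ d * quartic1) \<in> big.L" using is_ideal_diff_cancel[OF id] by metis
    then have "a = 0" using is_ideal_Const_cancel[OF id] descend h(3) by blast
    then show ?thesis using a by simp
  qed
  \<comment> \<open>The condition comes from \<open>quartic2\<close>. In \<open>h * quartic2\<close>
    the coefficient of the sextic is a linear form; it is 0, because x times \<open>quartic2\<close>
    lies in the pair. Then \<open>quadric\<close> and z^2 are cancelled.\<close>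
  have L4: "h \<in> ideal_gen {cubic, varx}" if h: "homogeneous 3 h" "h \<in> ideal_colon big.L ?I" for h
  proof -
    have "h * quartic2 \<in> big.L" using h(2) I(4) unfolding mem_ideal_colon by blast
    then obtain u v w where w: "h * quartic2 = u * cubic + v * (varx * quadric) + w * sextic t"
      "w = hpart (int (3 + 4) - int 6) w"
      using homogeneous_in_triple[OF _ homogeneous_mult[OF h(1) homogeneous_forms(4)] hg hxr hc] by metis
    have "sextic t * (varx * w) = varx * (u * cubic + v * (varx * quadric) + w * sextic t)
        + (- (varx * u)) * cubic + (- (varx * v)) * (varx * quadric)"
      by (simp add: algebra_simps)
    also have "\<dots> = (- (varx * u)) * cubic + (h * varz ^ 2 - varx * v) * (varx * quadric)"
      unfolding w(1)[symmetric] by (simp add: algebra_simps)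
    finally have "sextic t * (varx * w) \<in> ?K" unfolding mem_ideal_gen_2 by blast
    then have "varx * w \<in> ?K" by (rule regular_facts)
    moreover have "homogeneous 2 (varx * w)"
      using homogeneous_mult[OF homogeneous_Var homogeneous_hpart[of 1 w], of 0] w(2) by (simp add: numeral_2_eq_2)
    ultimately have "varx * w = 0" by (rule low_degree_in_pair_eq_0[OF _ _ hg hxr]) simp_all
    moreover have "varx \<noteq> (0 :: (3, 'k) mpoly)"
      using varx_not_in_point_ideal[where ?'k = 'k] is_ideal_0[OF id, of "{vary, varz :: (3, 'k) mpoly}"] by auto
    ultimately have "w = 0" by simp
    then have "quadric * (h * varz ^ 2 - v * varx) = u * cubic" using w(1) by (simp add: algebra_simps)
    then have "quadric * (h * varz ^ 2 - v * varx) \<in> ideal_gen {cubic}" unfolding mem_ideal_gen_1 by (rule exI)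
    then have "h * varz ^ 2 - v * varx \<in> ideal_gen {cubic}" by (rule cancel_r)
    then obtain q where "h * varz ^ 2 - v * varx = q * cubic" unfolding mem_ideal_gen_1 by blast
    then have "varz * (varz * h) = v * varx + q * cubic" by (simp add: algebra_simps power2_eq_square)
    then have "varz * (varz * h) \<in> ideal_gen {varx, cubic}" unfolding mem_ideal_gen_2 by (intro exI)
    then have "varz * h \<in> ideal_gen {varx, cubic}" by (rule form_regular_cancel[OF regular_varx_cubic])
    then have "h \<in> ideal_gen {varx, cubic}" by (rule form_regular_cancel[OF regular_varx_cubic])
    then show ?thesis by (simp only: insert_commute)
  qed
  have "odd_kind (ideal_colon big.L ?I)"
    by (rule odd_kind_colonI[OF _ hclosed_the_ideal sextic_in_the_ideal even_kind_over_the_ideal fr L1 L2 L4]) simp_all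
  then show ?thesis
    unfolding even_kind_def using fr I sextic_in_the_ideal even_kind_over_the_ideal hclosed_the_ideal
    by (intro conjI exI[of _ cubic] exI[of _ quadric] exI[of _ "sextic t"]) simp_all
qed

section \<open>The ideal is licci\<close>

lemma ideal_gen_forms_proper:
  assumes "\<And>g. g \<in> G \<Longrightarrow> \<exists>d>0. homogeneous d (g :: (3, 'k::field) mpoly)"
  shows "ideal_gen G \<noteq> UNIV"
proof -
  have "ideal_gen G \<subseteq> irrelevant_ideal"
    using assms homogeneous_in_irrelevant by (intro ideal_gen_least is_ideal_irrelevant) blast
  moreover have "1 \<notin> (irrelevant_ideal :: (3, 'k) mpoly set)"
    by (simp add: irrelevant_ideal_hpart hpart_homogeneous[OF homogeneous_1])
  ultimately show ?thesis by blast
qed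

lemma form_regular_graded:
  assumes "form_regular a b c"
  obtains d1 d2 d3 where "graded_regular a b c d1 d2 d3"
  using assms unfolding form_regular_def graded_regular_def by auto

lemma directly_linked_colon:
  assumes "form_regular a b c" "is_ideal I" "hclosed I" "{a, b, c} \<subseteq> I" "I \<noteq> ideal_gen {a, b, c}" "I \<noteq> UNIV"
  shows "directly_homogeneously_linked I (ideal_colon (ideal_gen {a, b, c}) I)"
    "directly_homogeneously_linked (ideal_colon (ideal_gen {a, b, c}) I) I"
proof -
  obtain d1 d2 d3 where "graded_regular a b c d1 d2 d3" using form_regular_graded[OF assms(1)] .
  then interpret graded_regular a b c d1 d2 d3 .
  have *: "linked_by [a, b, c] I (ideal_colon L I)"
    using assms by (intro linked_by_colon ideal_gen_least) auto
  then have "linked_by [a, b, c] (ideal_colon L I) I" unfolding linked_by_def by auto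
  moreover have "\<forall>f\<in>set [a, b, c]. \<exists>d. homogeneous d f" using hom by auto
  ultimately show "directly_homogeneously_linked I (ideal_colon (ideal_gen {a, b, c}) I)"
    "directly_homogeneously_linked (ideal_colon (ideal_gen {a, b, c}) I) I"
    unfolding directly_homogeneously_linked_def using * by blast+
qed

text \<open>A basic double link: both ideals have the same link, with respect to \<open>(a, b, ch)\<close>
  and \<open>(a, b, h)\<close>.\<close>

lemma basic_double_link:
  fixes G H :: "(3, 'k::field) mpoly set"
  assumes reg: "form_regular a b (c * h)" "form_regular a b h"
    and G: "\<And>g. g \<in> G \<Longrightarrow> \<exists>d>0. homogeneous d g" and H: "\<And>g. g \<in> H \<Longrightarrow> \<exists>d>0. homogeneous d g"
    and ab: "a \<in> ideal_gen G" "b \<in> ideal_gen G"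
    and mult: "\<And>k. k \<in> H \<Longrightarrow> c * k \<in> ideal_gen G"
    and div: "\<And>g. g \<in> G \<Longrightarrow> \<exists>k\<in>ideal_gen H. g - c * k \<in> ideal_gen {a, b}"
    and abh: "a \<in> ideal_gen H" "b \<in> ideal_gen H" "h \<in> ideal_gen H" "ideal_gen H \<noteq> ideal_gen {a, b, h}"
  shows "directly_homogeneously_linked\<^sup>*\<^sup>* (ideal_gen G) (ideal_gen H)"
proof -
  note id = is_ideal_ideal_gen
  let ?I = "ideal_gen G" and ?K = "ideal_gen H" and ?L = "ideal_gen {a, b, c * h}" and ?M = "ideal_gen {a, b, h}"
  \<comment> \<open>As a factor of \<open>c * h\<close>, also \<open>c\<close> is regular modulo
    \<open>a\<close> and \<open>b\<close>.\<close>
  have cancel: "x \<in> ideal_gen {a, b}" if "c * x \<in> ideal_gen {a, b}" for x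
  proof -
    have "h * (c * x) \<in> ideal_gen {a, b}" using that by (rule is_ideal_mult[OF id])
    then have "c * h * x \<in> ideal_gen {a, b}" by (simp only: mult_ac)
    then show ?thesis by (rule form_regular_cancel[OF reg(1)])
  qed
  have hI: "c * k \<in> ?I" if "k \<in> ?K" for k
  proof -
    have "is_ideal {k. c * k \<in> ?I}"
      by (rule is_idealI) (auto simp: is_ideal_0 distrib_left mult.left_commute intro: is_ideal_add is_ideal_mult)
    then have "?K \<subseteq> {k. c * k \<in> ?I}" using mult by (intro ideal_gen_least) auto
    then show ?thesis using that by blast
  qed
  have abL: "ideal_gen {a, b} \<subseteq> ?L" by (rule ideal_gen_mono) auto
  have colon: "ideal_colon ?L ?I = ideal_colon ?M ?K"
  proof (intro subset_antisym subsetI)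
      fix f assume f: "f \<in> ideal_colon ?L ?I"
      show "f \<in> ideal_colon ?M ?K" unfolding mem_ideal_colon
      proof
        fix k assume "k \<in> ?K"
        then have "f * (c * k) \<in> ?L" using f hI unfolding mem_ideal_colon by blast
        then obtain u v w where "f * (c * k) = u * a + v * b + w * (c * h)" unfolding mem_ideal_gen_3 by blast
        then have "c * (f * k - w * h) = u * a + v * b" by (simp add: algebra_simps)
        then have "f * k - w * h \<in> ideal_gen {a, b}" using cancel unfolding mem_ideal_gen_2 by blast
        then obtain u v where "f * k - w * h = u * a + v * b" unfolding mem_ideal_gen_2 by blast
        then have "f * k = u * a + v * b + w * h" by (simp add: algebra_simps)
        then show "f * k \<in> ?M" unfolding mem_ideal_gen_3 by blast
      qed
    next
      fix f assume f: "f \<in> ideal_colon ?M ?K"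
      show "f \<in> ideal_colon ?L ?I" unfolding mem_ideal_colon_gen[OF id]
      proof
        fix g assume "g \<in> G"
        then obtain k where k: "k \<in> ?K" "g - c * k \<in> ideal_gen {a, b}" using div by blast
        have "f * k \<in> ?M" using f k(1) unfolding mem_ideal_colon by blast
        then obtain u v w where uvw: "f * k = u * a + v * b + w * h" unfolding mem_ideal_gen_3 by blast
        have "f * g = f * (g - c * k) + c * (f * k)" by (simp add: algebra_simps)
        also have "c * (f * k) = (c * u) * a + (c * v) * b + w * (c * h)" unfolding uvw by (simp add: algebra_simps)
        also have "f * (g - c * k) + ((c * u) * a + (c * v) * b + w * (c * h)) \<in> ?L"
        proof (rule is_ideal_add[OF id])
          show "f * (g - c * k) \<in> ?L" using is_ideal_mult[OF id k(2), of f] abL by blast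
          show "(c * u) * a + (c * v) * b + w * (c * h) \<in> ?L" unfolding mem_ideal_gen_3 by blast
        qed
        finally show "f * g \<in> ?L" .
      qed
  qed
  have K: "?K \<noteq> UNIV" and I: "?I \<noteq> UNIV" using ideal_gen_forms_proper G H by blast+
  have hc: "hclosed ?K" "hclosed ?I" using G H by (intro hclosed_ideal_gen; blast)+
  \<comment> \<open>Otherwise the common link would be the unit ideal, although \<open>?K\<close> is
    larger than \<open>?M\<close>.\<close>
  have "?I \<noteq> ?L"
  proof
    assume "?I = ?L"
    then have "ideal_colon ?M ?K = UNIV" unfolding colon[symmetric] by (auto simp: mem_ideal_colon is_ideal_mult)
    moreover obtain d1 d2 d3 where "graded_regular a b h d1 d2 d3" using form_regular_graded[OF reg(2)] .
    then interpret graded_regular a b h d1 d2 d3 .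
    have "ideal_colon ?M ?K \<noteq> UNIV" using abh by (intro colon_proper ideal_gen_least) auto
    ultimately show False by blast
  qed
  then have "directly_homogeneously_linked ?I (ideal_colon ?L ?I)"
    using I hc ab hI[OF abh(3)] by (intro directly_linked_colon reg) auto
  moreover have "directly_homogeneously_linked (ideal_colon ?L ?I) ?K"
    unfolding colon using K hc abh by (intro directly_linked_colon reg) auto
  ultimately show ?thesis by (meson converse_rtranclp_into_rtranclp r_into_rtranclp)
qed

lemma homogeneous_monomial_pos:
  "\<exists>d>0. homogeneous d (varx ^ i * vary ^ j * varz ^ k :: (3, 'k::field) mpoly)" if "0 < i + j + k"
  using that homogeneous_monomial by blast

text \<open>\<open>ideal1\<close> is the ideal K of the overview: the generators of
  \<open>the_ideal\<close> are divided by x modulo \<open>cubic\<close> and \<open>quartic2\<close>.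
  In the same way \<open>ideal2\<close> arises from \<open>ideal3\<close> with y^2 and z^2, and
  \<open>ideal3\<close> from \<open>ideal4\<close> with z and y^2; from \<open>ideal1\<close> to
  \<open>ideal2\<close> there is a single link.\<close>

abbreviation ideal1 :: "(3, 'k::field) mpoly set" where
  "ideal1 \<equiv> {quadric, varz ^ 3 - varx ^ 2 * vary, varx ^ 2 * varz - vary * varz ^ 2, varx ^ 5,
     varx * vary * varz ^ 3, varz ^ 5}"
abbreviation ideal2 :: "(3, 'k::field) mpoly set" where
  "ideal2 \<equiv> {varx * varz, vary ^ 2, varz ^ 2, varx ^ 2 * vary, varx ^ 5}"
abbreviation ideal3 :: "(3, 'k::field) mpoly set" where
  "ideal3 \<equiv> {varz, vary ^ 2, varx * vary, varx ^ 4}"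
abbreviation ideal4 :: "(3, 'k::field) mpoly set" where
  "ideal4 \<equiv> {varz, vary, varx ^ 3}"

lemma homogeneous_ideal1: "g \<in> ideal1 \<Longrightarrow> \<exists>d>0. homogeneous d (g :: (3, 'k::field) mpoly)"
proof -
  have "homogeneous 3 (varx ^ 2 * varz - vary * varz ^ 2 :: (3, 'k) mpoly)"
    using homogeneous_monomial[of 2 0 1, where ?'k = 'k] homogeneous_monomial[of 0 1 2, where ?'k = 'k]
    by (intro homogeneous_diff) (simp_all add: numeral_3_eq_3)
  moreover have "\<exists>d>0. homogeneous d (varx ^ 5 :: (3, 'k) mpoly)" "\<exists>d>0. homogeneous d (varz ^ 5 :: (3, 'k) mpoly)"
    "\<exists>d>0. homogeneous d (varx * vary * varz ^ 3 :: (3, 'k) mpoly)"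
    using homogeneous_monomial_pos[of 5 0 0, where ?'k = 'k] homogeneous_monomial_pos[of 0 0 5, where ?'k = 'k]
      homogeneous_monomial_pos[of 1 1 3, where ?'k = 'k] by simp_all
  ultimately show "g \<in> ideal1 \<Longrightarrow> \<exists>d>0. homogeneous d (g :: (3, 'k::field) mpoly)"
    using homogeneous_forms(2,11)[where ?'k = 'k] zero_less_numeral by (elim insertE emptyE) blast+
qed

lemma homogeneous_monomial_ideals:
  "g \<in> ideal2 \<Longrightarrow> \<exists>d>0. homogeneous d (g :: (3, 'k::field) mpoly)"
  "g \<in> ideal3 \<Longrightarrow> \<exists>d>0. homogeneous d (g :: (3, 'k) mpoly)"
  "g \<in> ideal4 \<Longrightarrow> \<exists>d>0. homogeneous d (g :: (3, 'k) mpoly)"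
proof -
  note m = homogeneous_monomial_pos[where ?'k = 'k]
  show "g \<in> ideal2 \<Longrightarrow> \<exists>d>0. homogeneous d (g :: (3, 'k::field) mpoly)"
    using m[of 1 0 1] m[of 0 2 0] m[of 0 0 2] m[of 2 1 0] m[of 5 0 0] by auto
  show "g \<in> ideal3 \<Longrightarrow> \<exists>d>0. homogeneous d (g :: (3, 'k) mpoly)"
    using m[of 0 0 1] m[of 0 2 0] m[of 1 1 0] m[of 4 0 0] by auto
  show "g \<in> ideal4 \<Longrightarrow> \<exists>d>0. homogeneous d (g :: (3, 'k) mpoly)"
    using m[of 0 0 1] m[of 0 1 0] m[of 3 0 0] by auto
qed

lemma homogeneous_generators:
  "g \<in> {cubic, varx * quadric, quartic1, quartic2, varx ^ 6, varz ^ 6, varx * varz ^ 5}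
    \<Longrightarrow> \<exists>d>0. homogeneous d (g :: (3, 'k::field) mpoly)"
proof -
  have "\<exists>d>0. homogeneous d (varx ^ 6 :: (3, 'k) mpoly)" "\<exists>d>0. homogeneous d (varz ^ 6 :: (3, 'k) mpoly)"
    "\<exists>d>0. homogeneous d (varx * varz ^ 5 :: (3, 'k) mpoly)" 
    using homogeneous_monomial_pos[of 6 0 0, where ?'k = 'k] homogeneous_monomial_pos[of 0 0 6, where ?'k = 'k]
      homogeneous_monomial_pos[of 1 0 5, where ?'k = 'k] by simp_all
  moreover have "\<exists>d>0. homogeneous d (varx * quadric :: (3, 'k) mpoly)"
    using homogeneous_mult[OF homogeneous_Var homogeneous_forms(2), of 0] by (intro exI conjI) simp_all
  ultimately show "g \<in> {cubic, varx * quadric, quartic1, quartic2, varx ^ 6, varz ^ 6, varx * varz ^ 5}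
    \<Longrightarrow> \<exists>d>0. homogeneous d (g :: (3, 'k::field) mpoly)"
    using homogeneous_forms(1,3,4)[where ?'k = 'k] zero_less_numeral by (elim insertE emptyE) blast+
qed

lemma mem_ideal_gen_1': "p = u * a \<Longrightarrow> a \<in> B \<Longrightarrow> p \<in> ideal_gen B"
  by (simp add: ideal_gen_base is_ideal_mult)

lemma link_the_ideal: "directly_homogeneously_linked\<^sup>*\<^sup>* the_ideal (ideal_gen (ideal1 :: (3, 'k::field) mpoly set))"
proof (rule basic_double_link[where a = cubic and b = quartic2 and c = varx and h = "varx ^ 5"])
  note id = is_ideal_ideal_gen
  have I: "cubic \<in> (the_ideal :: (3, 'k) mpoly set)" "varx * quadric \<in> (the_ideal :: (3, 'k) mpoly set)"
    "quartic1 \<in> (the_ideal :: (3, 'k) mpoly set)" "quartic2 \<in> (the_ideal :: (3, 'k) mpoly set)"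
    "varx ^ 6 \<in> (the_ideal :: (3, 'k) mpoly set)" "varz ^ 6 \<in> (the_ideal :: (3, 'k) mpoly set)"
    "varx * varz ^ 5 \<in> (the_ideal :: (3, 'k) mpoly set)"
    by (auto intro: ideal_gen_base)
  have K: "quadric \<in> ideal_gen (ideal1 :: (3, 'k) mpoly set)"
    "varz ^ 3 - varx ^ 2 * vary \<in> ideal_gen (ideal1 :: (3, 'k) mpoly set)"
    "varx ^ 2 * varz - vary * varz ^ 2 \<in> ideal_gen (ideal1 :: (3, 'k) mpoly set)"
    "varx ^ 5 \<in> ideal_gen (ideal1 :: (3, 'k) mpoly set)" "varz ^ 5 \<in> ideal_gen (ideal1 :: (3, 'k) mpoly set)"
    "varx * vary * varz ^ 3 \<in> ideal_gen (ideal1 :: (3, 'k) mpoly set)"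
    by (auto intro: ideal_gen_base)
  show "form_regular cubic quartic2 (varx * varx ^ 5 :: (3, 'k) mpoly)" "form_regular cubic quartic2 (varx ^ 5 :: (3, 'k) mpoly)"
    using form_regular_power[OF regular_cubic_quartic, of 5] form_regular_power[OF regular_cubic_quartic, of 4] by (simp_all add: numeral_eq_Suc)
  show "cubic \<in> (the_ideal :: (3, 'k) mpoly set)" "quartic2 \<in> (the_ideal :: (3, 'k) mpoly set)" by (rule I)+
  show "varx ^ 5 \<in> ideal_gen (ideal1 :: (3, 'k) mpoly set)" by (rule K)
  show c: "cubic \<in> ideal_gen (ideal1 :: (3, 'k) mpoly set)"
  proof -
    have "(cubic :: (3, 'k) mpoly) = vary * quadric - (varz ^ 3 - varx ^ 2 * vary)"
      by (simp add: algebra_simps numeral_eq_Suc)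
    then show ?thesis using is_ideal_diff[OF id is_ideal_mult[OF id K(1)] K(2)] by (simp only:)
  qed
  show "quartic2 \<in> ideal_gen (ideal1 :: (3, 'k) mpoly set)" using K(1) by (rule is_ideal_mult[OF id])
  show "varx * k \<in> the_ideal" if "k \<in> (ideal1 :: (3, 'k) mpoly set)" for k
  proof -
    have "varx * (varz ^ 3 - varx ^ 2 * vary) = vary * (varx * quadric) - varx * (cubic :: (3, 'k) mpoly)"
      "varx * (varx ^ 2 * varz - vary * varz ^ 2) = (quartic1 :: (3, 'k) mpoly)"
      "varx * varx ^ 5 = (varx ^ 6 :: (3, 'k) mpoly)"
      "varx * (varx * vary * varz ^ 3) = varz ^ 6 + (varz ^ 3 * cubic - vary * varz * (quartic2 :: (3, 'k) mpoly))"
      by (simp_all add: algebra_simps numeral_eq_Suc)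
    moreover have "vary * (varx * quadric) - varx * cubic \<in> (the_ideal :: (3, 'k) mpoly set)"
      by (rule is_ideal_diff[OF id is_ideal_mult[OF id I(2)] is_ideal_mult[OF id I(1)]])
    moreover have "varz ^ 6 + (varz ^ 3 * cubic - vary * varz * quartic2) \<in> (the_ideal :: (3, 'k) mpoly set)"
      by (rule is_ideal_add[OF id I(6) is_ideal_diff[OF id is_ideal_mult[OF id I(1)] is_ideal_mult[OF id I(4)]]])
    ultimately show ?thesis using that I by (elim insertE emptyE) (simp_all only:)
  qed
  show "\<exists>k\<in>ideal_gen ideal1. g - varx * k \<in> ideal_gen {cubic, quartic2}"
    if "g \<in> {cubic, varx * quadric, quartic1, quartic2, varx ^ 6, varz ^ 6, varx * varz ^ 5}" for g :: "(3, 'k) mpoly"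
  proof -
    have ex: "\<exists>k\<in>ideal_gen ideal1. g - varx * k \<in> ideal_gen {cubic, quartic2}"
      if "k \<in> ideal_gen ideal1" "g - varx * k = u * cubic + v * quartic2" for k u v and g :: "(3, 'k) mpoly"
      using that unfolding mem_ideal_gen_2 by blast
    show ?thesis using that
    proof (elim insertE emptyE)
      show ?thesis if "g = cubic" unfolding that by (rule ex[of 0 _ 1 0]) (simp_all add: is_ideal_0)
      show ?thesis if "g = quartic2" unfolding that by (rule ex[of 0 _ 0 1]) (simp_all add: is_ideal_0)
      show ?thesis if "g = varx * quadric" unfolding that by (rule ex[OF K(1), of _ 0 0]) simp
      show ?thesis if "g = quartic1" unfolding that
        by (rule ex[OF K(3), of _ 0 0]) (simp add: algebra_simps numeral_eq_Suc)
      show ?thesis if "g = varx ^ 6" unfolding that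
        by (rule ex[OF K(4), of _ 0 0]) (simp add: algebra_simps numeral_eq_Suc)
      \<comment> \<open>z^6 is not a multiple of x, but it equals x^2 y z^3 modulo
        \<open>cubic\<close> and \<open>quartic2\<close>.\<close>
      show ?thesis if "g = varz ^ 6" unfolding that
        by (rule ex[OF K(6), of _ "- (varz ^ 3)" "vary * varz"]) (simp add: algebra_simps numeral_eq_Suc)
      show ?thesis if "g = varx * varz ^ 5" unfolding that by (rule ex[OF K(5), of _ 0 0]) simp
    qed
  qed
  have "quadric \<notin> ideal_gen {cubic, quartic2, varx ^ 5 :: (3, 'k) mpoly}"
  proof
    assume "quadric \<in> ideal_gen {cubic, quartic2, varx ^ 5 :: (3, 'k) mpoly}"
    then have "quadric \<in> ideal_gen {cubic, quartic2 :: (3, 'k) mpoly}"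
      using low_degree_in_triple[OF _ homogeneous_forms(2) homogeneous_forms(1) homogeneous_forms(4)
          homogeneous_monomial[of 5 0 0, where ?'k = 'k]] by simp
    then have "(quadric :: (3, 'k) mpoly) = 0"
      using low_degree_in_pair_eq_0[OF _ homogeneous_forms(2) homogeneous_forms(1) homogeneous_forms(4)[where ?'k = 'k]] by simp
    then show False
      using regular_sequence_nonzero[OF form_regularD[OF regular_quadric(1)], of "quadric :: (3, 'k) mpoly"] by simp
  qed
  then show "ideal_gen ideal1 \<noteq> ideal_gen {cubic, quartic2, varx ^ 5 :: (3, 'k) mpoly}" using K(1) by blast
qed (rule homogeneous_generators, assumption, rule homogeneous_ideal1, assumption)

lemma link_ideal2: "directly_homogeneously_linked\<^sup>*\<^sup>* (ideal_gen ideal2) (ideal_gen (ideal3 :: (3, 'k::field) mpoly set))"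
proof (rule basic_double_link[where a = "vary ^ 2" and b = "varz ^ 2" and c = varx and h = "varx ^ 4"])
  show "form_regular (vary ^ 2) (varz ^ 2) (varx * varx ^ 4 :: (3, 'k) mpoly)" "form_regular (vary ^ 2) (varz ^ 2) (varx ^ 4 :: (3, 'k) mpoly)"
    using form_regular_power[OF regular_powers(2), of 4] form_regular_power[OF regular_powers(2), of 3] by (simp_all add: numeral_eq_Suc)
  show "vary ^ 2 \<in> ideal_gen (ideal2 :: (3, 'k) mpoly set)" "varz ^ 2 \<in> ideal_gen (ideal2 :: (3, 'k) mpoly set)"
    "vary ^ 2 \<in> ideal_gen (ideal3 :: (3, 'k) mpoly set)" "varx ^ 4 \<in> ideal_gen (ideal3 :: (3, 'k) mpoly set)"
    by (auto intro: ideal_gen_base)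
  show "varz ^ 2 \<in> ideal_gen (ideal3 :: (3, 'k) mpoly set)"
    by (rule mem_ideal_gen_1'[of _ varz varz]) (simp_all add: power2_eq_square)
  show "varx * k \<in> ideal_gen ideal2" if "k \<in> (ideal3 :: (3, 'k) mpoly set)" for k
    using that
  proof (elim insertE emptyE)
    show ?thesis if "k = varz" unfolding that by (rule mem_ideal_gen_1'[of _ 1 "varx * varz"]) simp_all
    show ?thesis if "k = vary ^ 2" unfolding that by (rule mem_ideal_gen_1'[of _ varx "vary ^ 2"]) simp_all
    show ?thesis if "k = varx * vary" unfolding that
      by (rule mem_ideal_gen_1'[of _ 1 "varx ^ 2 * vary"]) (simp_all add: power2_eq_square mult.assoc)
    show ?thesis if "k = varx ^ 4" unfolding that
      by (rule mem_ideal_gen_1'[of _ 1 "varx ^ 5"]) (simp_all add: numeral_eq_Suc)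
  qed
  show "\<exists>k\<in>ideal_gen ideal3. g - varx * k \<in> ideal_gen {vary ^ 2, varz ^ 2}"
    if "g \<in> ideal2" for g :: "(3, 'k) mpoly"
  proof -
    have ex: "\<exists>k\<in>ideal_gen ideal3. g - varx * k \<in> ideal_gen {vary ^ 2, varz ^ 2}"
      if "k = 0 \<or> k \<in> ideal3" "g - varx * k = u * vary ^ 2 + v * varz ^ 2" for k u v and g :: "(3, 'k) mpoly"
      using that ideal_gen_base[of k ideal3] is_ideal_0[OF is_ideal_ideal_gen, of "ideal3 :: (3, 'k) mpoly set"]
      unfolding mem_ideal_gen_2 by blast
    show ?thesis using that
    proof (elim insertE emptyE)
      show ?thesis if "g = vary ^ 2" unfolding that by (rule ex[of 0 _ 1 0]) simp_all
      show ?thesis if "g = varz ^ 2" unfolding that by (rule ex[of 0 _ 0 1]) simp_all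
      show ?thesis if "g = varx * varz" unfolding that by (rule ex[of varz _ 0 0]) simp_all
      show ?thesis if "g = varx ^ 2 * vary" unfolding that
        by (rule ex[of "varx * vary" _ 0 0]) (simp_all add: power2_eq_square mult.assoc)
      show ?thesis if "g = varx ^ 5" unfolding that
        by (rule ex[of "varx ^ 4" _ 0 0]) (simp_all add: numeral_eq_Suc)
    qed
  qed
  have "varz \<notin> ideal_gen {vary ^ 2, varz ^ 2, varx ^ 4 :: (3, 'k) mpoly}"
  proof
    note m = homogeneous_monomial'[where ?'k = 'k]
    have m: "homogeneous 2 (vary ^ 2 :: (3, 'k) mpoly)" "homogeneous 2 (varz ^ 2 :: (3, 'k) mpoly)" "homogeneous 4 (varx ^ 4 :: (3, 'k) mpoly)"
      using m[of 0 2 0 2] m[of 0 0 2 2] m[of 4 0 0 4] by simp_all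
    assume "varz \<in> ideal_gen {vary ^ 2, varz ^ 2, varx ^ 4 :: (3, 'k) mpoly}"
    then have "varz \<in> ideal_gen {vary ^ 2, varz ^ 2 :: (3, 'k) mpoly}"
      using low_degree_in_triple[OF _ homogeneous_Var m] by simp
    then have "(varz :: (3, 'k) mpoly) = 0"
      using low_degree_in_pair_eq_0[OF _ homogeneous_Var m(1,2)] by simp
    then show False
      using regular_sequence_nonzero[OF form_regularD[OF regular_powers(1)], of "varz :: (3, 'k) mpoly"] by simp
  qed
  moreover have "varz \<in> ideal_gen (ideal3 :: (3, 'k) mpoly set)" by (rule ideal_gen_base) simp
  ultimately show "ideal_gen ideal3 \<noteq> ideal_gen {vary ^ 2, varz ^ 2, varx ^ 4 :: (3, 'k) mpoly}" by blast
qed (rule homogeneous_monomial_ideals, assumption, rule homogeneous_monomial_ideals, assumption)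

lemma link_ideal3: "directly_homogeneously_linked\<^sup>*\<^sup>* (ideal_gen ideal3) (ideal_gen (ideal4 :: (3, 'k::field) mpoly set))"
proof (rule basic_double_link[where a = varz and b = "vary ^ 2" and c = varx and h = "varx ^ 3"])
  show "form_regular varz (vary ^ 2) (varx * varx ^ 3 :: (3, 'k) mpoly)" "form_regular varz (vary ^ 2) (varx ^ 3 :: (3, 'k) mpoly)"
    using form_regular_power[OF regular_powers(1), of 3] form_regular_power[OF regular_powers(1), of 2] by (simp_all add: numeral_eq_Suc)
  show "varz \<in> ideal_gen (ideal3 :: (3, 'k) mpoly set)" "vary ^ 2 \<in> ideal_gen (ideal3 :: (3, 'k) mpoly set)"
    "varz \<in> ideal_gen (ideal4 :: (3, 'k) mpoly set)" "varx ^ 3 \<in> ideal_gen (ideal4 :: (3, 'k) mpoly set)"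
    by (auto intro: ideal_gen_base)
  show "vary ^ 2 \<in> ideal_gen (ideal4 :: (3, 'k) mpoly set)"
    by (rule mem_ideal_gen_1'[of _ vary vary]) (simp_all add: power2_eq_square)
  show "varx * k \<in> ideal_gen ideal3" if "k \<in> (ideal4 :: (3, 'k) mpoly set)" for k
    using that
  proof (elim insertE emptyE)
    show ?thesis if "k = varz" unfolding that by (rule mem_ideal_gen_1'[of _ varx varz]) simp_all
    show ?thesis if "k = vary" unfolding that by (rule mem_ideal_gen_1'[of _ 1 "varx * vary"]) simp_all
    show ?thesis if "k = varx ^ 3" unfolding that
      by (rule mem_ideal_gen_1'[of _ 1 "varx ^ 4"]) (simp_all add: numeral_eq_Suc)
  qed
  show "\<exists>k\<in>ideal_gen ideal4. g - varx * k \<in> ideal_gen {varz, vary ^ 2}"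
    if "g \<in> ideal3" for g :: "(3, 'k) mpoly"
  proof -
    have ex: "\<exists>k\<in>ideal_gen ideal4. g - varx * k \<in> ideal_gen {varz, vary ^ 2}"
      if "k = 0 \<or> k \<in> ideal4" "g - varx * k = u * varz + v * vary ^ 2" for k u v and g :: "(3, 'k) mpoly"
      using that ideal_gen_base[of k ideal4] is_ideal_0[OF is_ideal_ideal_gen, of "ideal4 :: (3, 'k) mpoly set"]
      unfolding mem_ideal_gen_2 by blast
    show ?thesis using that
    proof (elim insertE emptyE)
      show ?thesis if "g = varz" unfolding that by (rule ex[of 0 _ 1 0]) simp_all
      show ?thesis if "g = vary ^ 2" unfolding that by (rule ex[of 0 _ 0 1]) simp_all
      show ?thesis if "g = varx * vary" unfolding that by (rule ex[of vary _ 0 0]) simp_all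
      show ?thesis if "g = varx ^ 4" unfolding that
        by (rule ex[of "varx ^ 3" _ 0 0]) (simp_all add: numeral_eq_Suc)
    qed
  qed
  have "vary \<notin> ideal_gen {varz, vary ^ 2, varx ^ 3 :: (3, 'k) mpoly}"
  proof
    note m = homogeneous_monomial'[where ?'k = 'k]
    have m: "homogeneous 2 (vary ^ 2 :: (3, 'k) mpoly)" "homogeneous 3 (varx ^ 3 :: (3, 'k) mpoly)"
      using m[of 0 2 0 2] m[of 3 0 0 3] by simp_all
    assume "vary \<in> ideal_gen {varz, vary ^ 2, varx ^ 3 :: (3, 'k) mpoly}"
    then have "vary \<in> ideal_gen {varz, vary ^ 2 :: (3, 'k) mpoly}"
      using low_degree_in_triple[OF _ homogeneous_Var homogeneous_Var m] by simp
    then obtain u v where "vary = u * varz + v * (vary ^ 2 :: (3, 'k) mpoly)" "v = hpart (int (Suc 0) - int 2) v"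
      using homogeneous_in_pair[OF _ homogeneous_Var homogeneous_Var m(1)] by metis
    then have "vary = u * (varz :: (3, 'k) mpoly)" by (simp add: hpart_neg)
    then have "vary \<in> (ideal_gen {varz} :: (3, 'k) mpoly set)" unfolding mem_ideal_gen_1 by blast
    then show False using Var_in_ideal_gen_Var[of 1 "{2::3}", where ?'k = 'k] by simp
  qed
  moreover have "vary \<in> ideal_gen (ideal4 :: (3, 'k) mpoly set)" by (rule ideal_gen_base) simp
  ultimately show "ideal_gen ideal4 \<noteq> ideal_gen {varz, vary ^ 2, varx ^ 3 :: (3, 'k) mpoly}" by blast
qed (rule homogeneous_monomial_ideals, assumption, rule homogeneous_monomial_ideals, assumption)

section \<open>The single link, through forms of degrees 2, 3, 5\<close>

abbreviation link1 :: "(3, 'k::field) mpoly set" where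
  "link1 \<equiv> ideal_gen {quadric, varz ^ 3 - varx ^ 2 * vary, varx ^ 5}"

text \<open>The coefficients record the rewriting of each product by y^2 to z^2, z^3 to x^2 y, and
  x^5 to 0.\<close>

lemma ideal2_mult_ideal1:
  assumes "g \<in> ideal2" "h \<in> ideal1"
  shows "g * h \<in> (link1 :: (3, 'k::field) mpoly set)"
proof -
  have ex: "p \<in> link1" if "p = u * quadric + v * (varz ^ 3 - varx ^ 2 * vary) + w * varx ^ 5" for p u v w :: "(3, 'k) mpoly"
    using that unfolding mem_ideal_gen_3 by blast
  have p1: "g * h \<in> link1" if "g \<in> ideal2" "h = varx ^ 2 * varz - vary * varz ^ 2" for g h :: "(3, 'k) mpoly"
    using that(1)
  proof (elim insertE emptyE)
    show ?thesis if "g = varx * varz" unfolding that \<open>h = _\<close>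
      by (rule ex[of _ "- (varx ^ 3)" "- (varx * vary)" "0"]) (simp add: algebra_simps numeral_eq_Suc)
    show ?thesis if "g = vary ^ 2" unfolding that \<open>h = _\<close>
      by (rule ex[of _ "varx ^ 2 * varz - vary * varz ^ 2 - varx ^ 2 * varz" "- (vary * varz)" "0"]) (simp add: algebra_simps numeral_eq_Suc)
    show ?thesis if "g = varz ^ 2" unfolding that \<open>h = _\<close>
      by (rule ex[of _ "- (varx ^ 2 * varz)" "- (vary * varz)" "0"]) (simp add: algebra_simps numeral_eq_Suc)
    show ?thesis if "g = varx ^ 2 * vary" unfolding that \<open>h = _\<close>
      by (rule ex[of _ "- (varx ^ 2 * varz ^ 2)" "- (varx ^ 2 * varz)" "0"]) (simp add: algebra_simps numeral_eq_Suc)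
    show ?thesis if "g = varx ^ 5" unfolding that by (rule mem_ideal_gen_1'[of _ h "varx ^ 5"]) simp_all
  qed
  have p2: "g * h \<in> link1" if "g \<in> ideal2" "h = varx * vary * varz ^ 3" for g h :: "(3, 'k) mpoly"
    using that(1)
  proof (elim insertE emptyE)
    show ?thesis if "g = varx * varz" unfolding that \<open>h = _\<close>
      by (rule ex[of _ "varx ^ 4 * varz" "varx ^ 2 * vary * varz + varx ^ 4" "varx * vary"]) (simp add: algebra_simps numeral_eq_Suc)
    show ?thesis if "g = vary ^ 2" unfolding that \<open>h = _\<close>
      by (rule ex[of _ "varx * vary * varz ^ 3 + varx ^ 3 * varz ^ 2" "varx * vary * varz ^ 2 + varx ^ 3 * varz" "vary * varz"]) (simp add: algebra_simps numeral_eq_Suc)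
    show ?thesis if "g = varz ^ 2" unfolding that \<open>h = _\<close>
      by (rule ex[of _ "varx ^ 3 * varz ^ 2" "varx * vary * varz ^ 2 + varx ^ 3 * varz" "vary * varz"]) (simp add: algebra_simps numeral_eq_Suc)
    show ?thesis if "g = varx ^ 2 * vary" unfolding that \<open>h = _\<close>
      by (rule ex[of _ "varx ^ 3 * varz ^ 3" "varx ^ 3 * varz ^ 2" "vary * varz ^ 2"]) (simp add: algebra_simps numeral_eq_Suc)
    show ?thesis if "g = varx ^ 5" unfolding that by (rule mem_ideal_gen_1'[of _ h "varx ^ 5"]) simp_all
  qed
  have p3: "g * h \<in> link1" if "g \<in> ideal2" "h = varz ^ 5" for g h :: "(3, 'k) mpoly"
    using that(1)
  proof (elim insertE emptyE)
    show ?thesis if "g = varx * varz" unfolding that \<open>h = _\<close>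
      by (rule ex[of _ "0" "varx * varz ^ 3 + varx ^ 3 * vary" "vary ^ 2"]) (simp add: algebra_simps numeral_eq_Suc)
    show ?thesis if "g = vary ^ 2" unfolding that \<open>h = _\<close>
      by (rule ex[of _ "varz ^ 5 + varx ^ 4 * varz" "varz ^ 4 + (varx ^ 2 * vary * varz + varx ^ 4)" "varx * vary"]) (simp add: algebra_simps numeral_eq_Suc)
    show ?thesis if "g = varz ^ 2" unfolding that \<open>h = _\<close>
      by (rule ex[of _ "varx ^ 4 * varz" "varz ^ 4 + (varx ^ 2 * vary * varz + varx ^ 4)" "varx * vary"]) (simp add: algebra_simps numeral_eq_Suc)
    show ?thesis if "g = varx ^ 2 * vary" unfolding that \<open>h = _\<close>
      by (rule ex[of _ "varx ^ 4 * varz ^ 2" "varx ^ 2 * vary * varz ^ 2 + varx ^ 4 * varz" "varx * vary * varz"]) (simp add: algebra_simps numeral_eq_Suc)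
    show ?thesis if "g = varx ^ 5" unfolding that by (rule mem_ideal_gen_1'[of _ h "varx ^ 5"]) simp_all
  qed
  have p4: "g * h \<in> link1" if "h \<in> {quadric, varz ^ 3 - varx ^ 2 * vary, varx ^ 5}" for g h :: "(3, 'k) mpoly"
    using that by (intro is_ideal_mult[OF is_ideal_ideal_gen] ideal_gen_base)
  consider "h \<in> {quadric, varz ^ 3 - varx ^ 2 * vary, varx ^ 5}" | "h = varx ^ 2 * varz - vary * varz ^ 2"
    | "h = varx * vary * varz ^ 3" | "h = varz ^ 5"
    using assms(2) by (elim insertE emptyE) simp_all
  then show ?thesis
  proof cases
    case 1 then show ?thesis by (rule p4)
  next
    case 2 then show ?thesis by (rule p1[OF assms(1)])
  next
    case 3 then show ?thesis by (rule p2[OF assms(1)])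
  next
    case 4 then show ?thesis by (rule p3[OF assms(1)])
  qed
qed

text \<open>The socle degree of \<open>link1\<close> is 7.\<close>

lemma socle_link1: "varx ^ 4 * vary * varz ^ 2 \<notin> (link1 :: (3, 'k::field) mpoly set)"
proof
  note id = is_ideal_ideal_gen
  have r: "form_regular quadric (varz ^ 3 - varx ^ 2 * vary) (varx ^ 4 :: (3, 'k) mpoly)"
    using form_regular_power[OF regular_quadric(2), of 3] by (simp only: numeral_eq_Suc) simp
  assume "varx ^ 4 * vary * varz ^ 2 \<in> (link1 :: (3, 'k) mpoly set)"
  then obtain u v w where "varx ^ 4 * vary * varz ^ 2 = u * quadric + v * (varz ^ 3 - varx ^ 2 * vary) + w * (varx ^ 5 :: (3, 'k) mpoly)"
    unfolding mem_ideal_gen_3 by blast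
  \<comment> \<open>The power x^4 is regular modulo the other two forms and is cancelled, which
    leaves one factor x; then z^2 is cancelled modulo x and \<open>quadric\<close>.\<close>
  then have "varx ^ 4 * (vary * varz ^ 2 - w * varx) = u * quadric + v * (varz ^ 3 - varx ^ 2 * vary :: (3, 'k) mpoly)"
    by (simp add: algebra_simps numeral_eq_Suc)
  then have "varx ^ 4 * (vary * varz ^ 2 - w * varx) \<in> ideal_gen {quadric, varz ^ 3 - varx ^ 2 * vary :: (3, 'k) mpoly}"
    unfolding mem_ideal_gen_2 by (intro exI)
  then have "vary * varz ^ 2 - w * varx \<in> ideal_gen {quadric, varz ^ 3 - varx ^ 2 * vary :: (3, 'k) mpoly}"
    by (rule form_regular_cancel[OF r])
  then obtain u v where "vary * varz ^ 2 - w * varx = u * quadric + v * (varz ^ 3 - varx ^ 2 * vary :: (3, 'k) mpoly)"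
    unfolding mem_ideal_gen_2 by blast
  then have "varz * (varz * (vary - v * varz)) = (w - v * varx * vary) * varx + u * quadric"
    by (simp add: algebra_simps numeral_eq_Suc)
  then have "varz * (varz * (vary - v * varz)) \<in> ideal_gen {varx, quadric}"
    unfolding mem_ideal_gen_2 by (intro exI)
  then have "varz * (vary - v * varz) \<in> ideal_gen {varx, quadric}" by (rule form_regular_cancel[OF regular_quadric(1)])
  then have "vary - v * varz \<in> ideal_gen {varx, quadric}" by (rule form_regular_cancel[OF regular_quadric(1)])
  then obtain p q where "vary - v * varz = p * varx + q * quadric" unfolding mem_ideal_gen_2 by blast
  then have "vary = p * varx + v * varz + q * (quadric :: (3, 'k) mpoly)" by (simp add: algebra_simps)
  then have "vary \<in> ideal_gen {varx, varz, quadric :: (3, 'k) mpoly}" unfolding mem_ideal_gen_3 by blast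
  then have "vary \<in> ideal_gen {varx, varz :: (3, 'k) mpoly}"
    using low_degree_in_triple[OF _ homogeneous_Var homogeneous_Var homogeneous_Var homogeneous_forms(2)] by simp
  then show False using Var_in_ideal_gen_Var[of 1 "{0::3, 2}", where ?'k = 'k] by simp
qed

text \<open>The monomials x^4, x y, y z span the socle modulo \<open>ideal2\<close>. Each has a
  generator of \<open>ideal1\<close> with which it pairs, up to sign, to the socle generator x^4 y
  z^2 modulo \<open>link1\<close>: in turn x^2 z - y z^2, x y z^3 and z^5.\<close>

lemma socle_colon_link1:
  assumes "Const a * varx ^ 4 + Const b * (varx * vary) + Const c * (vary * varz)
    \<in> ideal_colon link1 (ideal_gen (ideal1 :: (3, 'k::field) mpoly set))" (is "?s \<in> ?M")
  shows "a = 0" "b = 0" "c = 0"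
proof -
  note id = is_ideal_ideal_gen
  have ex: "p = 0" if "q \<in> ideal1" "?s * q = u * quadric + v * (varz ^ 3 - varx ^ 2 * vary) + w * varx ^ 5 + Const p * (varx ^ 4 * vary * varz ^ 2)"
    for p q u v w
  proof -
    have "?s * q \<in> link1" using assms that(1) unfolding mem_ideal_colon_gen[OF id] by blast
    moreover have "u * quadric + v * (varz ^ 3 - varx ^ 2 * vary) + w * varx ^ 5 \<in> link1"
      unfolding mem_ideal_gen_3 by blast
    ultimately have "Const p * (varx ^ 4 * vary * varz ^ 2) \<in> link1"
      unfolding that(2) using is_ideal_diff[OF id] by (metis add_diff_cancel_left')
    then show ?thesis using is_ideal_Const_cancel[OF id] socle_link1 by blast
  qed
  have b: "b = 0"
  proof (rule ex)
    show "?s * (varx * vary * varz ^ 3) = (Const b * varx ^ 2 * varz ^ 3 + Const c * (varx * varz ^ 4)) * quadric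
      + (Const b * varx ^ 2 * varz ^ 2 + Const c * (varx * varz ^ 3 + varx ^ 3 * vary)) * (varz ^ 3 - varx ^ 2 * vary)
      + (Const a * vary * varz ^ 3 + Const c * vary ^ 2) * varx ^ 5 + Const b * (varx ^ 4 * vary * varz ^ 2)"
      by (simp add: algebra_simps numeral_eq_Suc)
  qed simp
  then show "b = 0" .
  have c: "c = 0"
  proof (rule ex)
    show "?s * varz ^ 5 = (Const c * (varx ^ 2 * varz ^ 3)) * quadric
      + (Const c * (vary * varz ^ 3 + varx ^ 2 * varz ^ 2) + Const a * (varx ^ 4 * varz ^ 2)) * (varz ^ 3 - varx ^ 2 * vary)
      + (Const a * varx * vary * varz ^ 2) * varx ^ 5 + Const c * (varx ^ 4 * vary * varz ^ 2)"
      unfolding b by (simp add: algebra_simps numeral_eq_Suc)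
  qed simp
  then show "c = 0" .
  have "- a = 0"
  proof (rule ex)
    show "?s * (varx ^ 2 * varz - vary * varz ^ 2) = 0 * quadric + 0 * (varz ^ 3 - varx ^ 2 * vary)
      + (Const a * varx * varz) * varx ^ 5 + Const (- a) * (varx ^ 4 * vary * varz ^ 2)"
      unfolding b c by (simp add: algebra_simps numeral_eq_Suc Const_uminus)
  qed simp
  then show "a = 0" by simp
qed

text \<open>The quotient by \<open>ideal2\<close> is finite-dimensional and graded, so an element of
  the colon outside \<open>ideal2\<close> would have a multiple that is a nonzero socle element
  there; \<open>socle_colon_link1\<close> excludes these.\<close>

lemma colon_link1: "ideal_colon link1 (ideal_gen ideal1) = ideal_gen (ideal2 :: (3, 'k::field) mpoly set)"
proof (rule subset_antisym)
  note id = is_ideal_ideal_gen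
  let ?M = "ideal_colon link1 (ideal_gen ideal1) :: (3, 'k) mpoly set" and ?J = "ideal_gen ideal2 :: (3, 'k) mpoly set"
  have M: "is_ideal ?M" by (rule is_ideal_colon[OF id])
  show JM: "?J \<subseteq> ?M"
    by (intro ideal_gen_least M subsetI, unfold mem_ideal_colon_gen[OF id]) (rule ballI, rule ideal2_mult_ideal1)
  \<comment> \<open>The nine monomials outside \<open>ideal2\<close>.\<close>
  define B :: "nat \<Rightarrow> (3, 'k) mpoly" where
    "B = (\<lambda>i. [1, varx, varx ^ 2, varx ^ 3, varx ^ 4, vary, varx * vary, varz, vary * varz] ! i)"
  define N where "N = {p. \<exists>\<alpha>. p - (\<Sum>i<9. Const (\<alpha> i) * B i) \<in> ?J}"
  have N_add: "p + q \<in> N" if "p \<in> N" "q \<in> N" for p q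
  proof -
    obtain \<alpha> \<beta> where "p - (\<Sum>i<9. Const (\<alpha> i) * B i) \<in> ?J" "q - (\<Sum>i<9. Const (\<beta> i) * B i) \<in> ?J"
      using \<open>p \<in> N\<close> \<open>q \<in> N\<close> by (auto simp: N_def)
    from is_ideal_add[OF id this] have "p + q - (\<Sum>i<9. Const (\<alpha> i + \<beta> i) * B i) \<in> ?J"
      by (simp only: Const_add distrib_right sum.distrib add_diff_add)
    then show ?thesis unfolding N_def by (intro CollectI exI[of _ "\<lambda>i. \<alpha> i + \<beta> i"])
  qed
  have N_scale: "Const c * p \<in> N" if p: "p \<in> N" for c p
  proof -
    obtain \<alpha> where "p - (\<Sum>i<9. Const (\<alpha> i) * B i) \<in> ?J" using p by (auto simp: N_def)
    from is_ideal_mult[OF id this, of "Const c"] have "Const c * p - (\<Sum>i<9. Const (c * \<alpha> i) * B i) \<in> ?J"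
      by (simp only: Const_mult right_diff_distrib sum_distrib_left mult.assoc)
    then show ?thesis unfolding N_def by (intro CollectI exI[of _ "\<lambda>i. c * \<alpha> i"])
  qed
  have N_J: "p \<in> N" if "p \<in> ?J" for p
    unfolding N_def using that by (auto intro!: exI[of _ "\<lambda>_. 0"])
  have N_B: "B j \<in> N" if "j < 9" for j
  proof -
    have "(\<Sum>i<9. Const (if i = j then 1 else 0) * B i) = (\<Sum>i<9. if i = j then B i else 0)"
      by (intro sum.cong) simp_all
    also have "\<dots> = B j" using that by simp
    finally show ?thesis unfolding N_def using is_ideal_0[OF id]
      by (intro CollectI exI[of _ "\<lambda>i. if i = j then 1 else 0"]) (simp only: diff_self)
  qed
  have N_mon: "mon a b c \<in> N" for a b c
  proof -
    have J: "varx * varz \<in> ?J" "vary ^ 2 \<in> ?J" "varz ^ 2 \<in> ?J" "varx ^ 2 * vary \<in> ?J" "varx ^ 5 \<in> ?J"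
      by (auto intro: ideal_gen_base)
    have dvd: "mon a b c \<in> N" if "g \<in> ?J" "g = mon a' b' c'" "a' \<le> a" "b' \<le> b" "c' \<le> c" for g a' b' c'
    proof -
      have "mon a b c = mon (a - a') (b - b') (c - c') * g"
        unfolding that(2) mon_mult using that(3-5) by simp
      then show ?thesis using is_ideal_mult[OF id that(1)] N_J by (simp only:)
    qed
    consider "1 \<le> a \<and> 1 \<le> c" | "2 \<le> b" | "2 \<le> c" | "2 \<le> a \<and> 1 \<le> b" | "5 \<le> a"
      | "(a = 0 \<or> a = 1 \<or> a = 2 \<or> a = 3 \<or> a = 4) \<and> b = 0 \<and> c = 0" | "(a = 0 \<or> a = 1) \<and> b = 1 \<and> c = 0"
      | "a = 0 \<and> (b = 0 \<or> b = 1) \<and> c = 1"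
    proof -
      have "5 \<le> a \<or> a = 0 \<or> a = 1 \<or> a = 2 \<or> a = 3 \<or> a = 4" "2 \<le> b \<or> b = 0 \<or> b = 1" "2 \<le> c \<or> c = 0 \<or> c = 1"
        by linarith+
      then show ?thesis using that by (elim disjE) simp_all
    qed
    then show ?thesis
    proof cases
      case 1 then show ?thesis by (intro dvd[OF J(1), of 1 0 1]) (simp_all add: mon_def)
    next
      case 2 then show ?thesis by (intro dvd[OF J(2), of 0 2 0]) (simp_all add: mon_def)
    next
      case 3 then show ?thesis by (intro dvd[OF J(3), of 0 0 2]) (simp_all add: mon_def)
    next
      case 4 then show ?thesis by (intro dvd[OF J(4), of 2 1 0]) (simp_all add: mon_def)
    next
      case 5 then show ?thesis by (intro dvd[OF J(5), of 5 0 0]) (simp_all add: mon_def)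
    next
      case 6
      then show ?thesis
        using N_B[of 0] N_B[of 1] N_B[of 2] N_B[of 3] N_B[of 4] by (auto simp: B_def mon_def)
    next
      case 7
      then show ?thesis using N_B[of 5] N_B[of 6] by (auto simp: B_def mon_def)
    next
      case 8
      then show ?thesis using N_B[of 7] N_B[of 8] by (auto simp: B_def mon_def)
    qed
  qed
  have N_all: "p \<in> N" for p
  proof -
    have "(\<Sum>m\<in>A. Const (Poly_Mapping.lookup p m) *
      mon (Poly_Mapping.lookup m 0) (Poly_Mapping.lookup m 1) (Poly_Mapping.lookup m 2)) \<in> N" for A
      by (induction A rule: infinite_finite_induct) (simp_all add: N_add N_scale N_mon N_J is_ideal_0)
    then show ?thesis by (subst sum_mon)
  qed
  show "?M \<subseteq> ?J"
  proof
    fix h assume h: "h \<in> ?M"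
    obtain \<alpha> where \<alpha>: "h - (\<Sum>i<9. Const (\<alpha> i) * B i) \<in> ?J" using N_all[of h] by (auto simp: N_def)
    define a0 a1 a2 a3 a4 a5 a6 a7 a8 
      where a: "a0 = \<alpha> 0" and "a1 = \<alpha> 1" and "a2 = \<alpha> 2" and "a3 = \<alpha> 3" and "a4 = \<alpha> 4" and "a5 = \<alpha> 5" and "a6 = \<alpha> 6" and "a7 = \<alpha> 7" and "a8 = \<alpha> 8"
    define n where "n = Const a0 + Const a1 * varx + Const a2 * varx ^ 2 + Const a3 * varx ^ 3
      + Const a4 * varx ^ 4 + Const a5 * vary + Const a6 * (varx * vary) + Const a7 * varz
      + Const a8 * (vary * varz)"
    have "(\<Sum>i<9. Const (\<alpha> i) * B i) = n" by (simp add: B_def n_def a a1_def a2_def a3_def a4_def a5_def a6_def a7_def a8_def numeral_eq_Suc)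
    then have hn: "h - n \<in> ?J" using \<alpha> by simp
    then have n: "n \<in> ?M" using h is_ideal_diff_cancel[OF M subsetD[OF JM hn]] by blast
    have gen: "u1 * (varx * varz) + u2 * vary ^ 2 + u3 * varz ^ 2 + u4 * (varx ^ 2 * vary) + u5 * varx ^ 5 \<in> ?M"
      for u1 u2 u3 u4 u5
    proof -
      have "varx * varz \<in> ?M" "vary ^ 2 \<in> ?M" "varz ^ 2 \<in> ?M" "varx ^ 2 * vary \<in> ?M" "varx ^ 5 \<in> ?M"
        by (rule subsetD[OF JM], rule ideal_gen_base, simp)+
      then show ?thesis by (intro is_ideal_add[OF M]) (rule is_ideal_mult[OF M], assumption)+
    qed
    have test: "a = 0 \<and> b = 0 \<and> c = 0"
      if "m * n = u1 * (varx * varz) + u2 * vary ^ 2 + u3 * varz ^ 2 + u4 * (varx ^ 2 * vary) + u5 * varx ^ 5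
        + (Const a * varx ^ 4 + Const b * (varx * vary) + Const c * (vary * varz))" for m u1 u2 u3 u4 u5 a b c
    proof -
      have "Const a * varx ^ 4 + Const b * (varx * vary) + Const c * (vary * varz) \<in> ?M"
        using is_ideal_diff[OF M is_ideal_mult[OF M n, of m] gen[of u1 u2 u3 u4 u5]]
        unfolding that by (simp only: add_diff_cancel_left')
      from socle_colon_link1[OF this] show ?thesis by blast
    qed
    \<comment> \<open>Here and below, a monomial multiplier moves a coefficient not yet excluded to
      a socle monomial and the other terms into \<open>ideal2\<close> or onto further socle
      monomials.\<close>
    have 0: "a0 = 0"
      using test[of "varx ^ 4" "Const a7 * varx ^ 3 + Const a8 * (varx ^ 3 * vary)" 0 0
          "Const a5 * varx ^ 2 + Const a6 * varx ^ 3"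
          "Const a1 + Const a2 * varx + Const a3 * varx ^ 2 + Const a4 * varx ^ 3" a0 0 0]
      by (simp add: n_def algebra_simps numeral_eq_Suc)
    have 1: "a1 = 0"
      using test[of "varx ^ 3" "Const a7 * varx ^ 2 + Const a8 * (varx ^ 2 * vary)" 0 0
          "Const a5 * varx + Const a6 * varx ^ 2"
          "Const a2 + Const a3 * varx + Const a4 * varx ^ 2" a1 0 0]
      by (simp add: n_def 0 algebra_simps numeral_eq_Suc)
    have 2: "a2 = 0"
      using test[of "varx ^ 2" "Const a7 * varx + Const a8 * (varx * vary)" 0 0
          "Const a5 + Const a6 * varx"
          "Const a3 + Const a4 * varx" a2 0 0]
      by (simp add: n_def 0 1 algebra_simps numeral_eq_Suc)
    have 3: "a3 = 0 \<and> a5 = 0"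
      using test[of varx "Const a7 + Const a8 * vary" 0 0
          "Const a6" "Const a4" a3 a5 0]
      by (simp add: n_def 0 1 2 algebra_simps numeral_eq_Suc)
    have 7: "a7 = 0"
      using test[of vary 0 "Const a6 * varx + Const a8 * varz" 0
          "Const a4 * varx ^ 2" 0 0 0 a7]
      by (simp add: n_def 0 1 2 3 algebra_simps numeral_eq_Suc)
    have "a4 = 0 \<and> a6 = 0 \<and> a8 = 0"
      using test[of 1 0 0 0 0 0 a4 a6 a8] by (simp add: n_def 0 1 2 3 7 algebra_simps)
    then have "n = 0" by (simp add: n_def 0 1 2 3 7)
    then show "h \<in> ?J" using hn by simp
  qed
qed

lemma link_ideal1: "directly_homogeneously_linked (ideal_gen ideal1) (ideal_gen (ideal2 :: (3, 'k::field) mpoly set))"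
proof -
  have r: "form_regular quadric (varz ^ 3 - varx ^ 2 * vary) (varx ^ 5 :: (3, 'k) mpoly)"
    using form_regular_power[OF regular_quadric(2), of 4] by (simp only: numeral_eq_Suc) simp
  have "ideal_gen (ideal1 :: (3, 'k) mpoly set) \<noteq> link1"
  proof
    assume "ideal_gen (ideal1 :: (3, 'k) mpoly set) = link1"
    then have "1 \<in> ideal_colon link1 (ideal_gen (ideal1 :: (3, 'k) mpoly set))" by (simp add: mem_ideal_colon)
    then have "1 \<in> ideal_gen (ideal2 :: (3, 'k) mpoly set)" unfolding colon_link1 .
    then show False
      using ideal_gen_forms_proper[OF homogeneous_monomial_ideals(1)] is_ideal_eq_UNIV[OF is_ideal_ideal_gen] by blast
  qed
  moreover have "hclosed (ideal_gen (ideal1 :: (3, 'k) mpoly set))"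
    using homogeneous_ideal1 by (intro hclosed_ideal_gen) blast
  moreover have "ideal_gen (ideal1 :: (3, 'k) mpoly set) \<noteq> UNIV"
    by (rule ideal_gen_forms_proper[OF homogeneous_ideal1])
  moreover have "{quadric, varz ^ 3 - varx ^ 2 * vary, varx ^ 5} \<subseteq> ideal_gen (ideal1 :: (3, 'k) mpoly set)"
    by (auto intro: ideal_gen_base)
  ultimately show ?thesis using directly_linked_colon(1)[OF r is_ideal_ideal_gen, of ideal1] unfolding colon_link1 by blast
qed

lemma homogeneously_licci_the_ideal: "homogeneously_licci (the_ideal :: (3, 'k::field) mpoly set)"
proof -
  have "directly_homogeneously_linked\<^sup>*\<^sup>* (the_ideal :: (3, 'k) mpoly set) (ideal_gen ideal4)"
    by (rule rtranclp_trans[OF link_the_ideal converse_rtranclp_into_rtranclp[OF link_ideal1 rtranclp_trans[OF link_ideal2 link_ideal3]]])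
  moreover have "complete_intersection (ideal_gen (ideal4 :: (3, 'k) mpoly set))"
  proof -
    have "form_regular varz vary (varx ^ 3 :: (3, 'k) mpoly)"
      using form_regular_power[OF form_regular_reverse[OF form_regular_Var], of 2] by (simp add: numeral_eq_Suc)
    then show ?thesis unfolding complete_intersection_def using form_regularD
      by (intro exI[of _ "[varz, vary, varx ^ 3]"]) simp
  qed
  moreover have "homogeneous_ideal (the_ideal :: (3, 'k) mpoly set)"
    unfolding homogeneous_ideal_iff by (simp add: hclosed_the_ideal)
  ultimately show ?thesis unfolding homogeneously_licci_def by blast
qed

lemma not_minimally_licci_the_ideal:
  assumes "infinite (UNIV :: 'k::field set)"
  shows "\<not> minimally_homogeneously_licci (the_ideal :: (3, 'k) mpoly set)"
proof -
  \<comment> \<open>The values excluded are those of \<open>regular_cubic_sextic\<close>.\<close>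
  obtain t :: 'k where "t \<notin> {0, - 2, 2}" using assms ex_new_if_finite[of "{0, - 2, 2 :: 'k}"] by auto
  then have "t \<noteq> 0" "2 + t \<noteq> 0" "2 - t \<noteq> 0" by (auto simp: add_eq_0_iff)
  then show ?thesis by (rule even_kind_not_minimally_licci[OF even_kind_the_ideal])
qed

section \<open>Exactness by homotopies\<close>

lemma vec_choice:
  assumes "\<And>i. i < n \<Longrightarrow> \<exists>x. P i x"
  obtains u where "u \<in> carrier_vec n" "\<And>i. i < n \<Longrightarrow> P i (u $ i)"
  using assms by (intro that[of "vec n (\<lambda>i. SOME x. P i x)"]) (auto intro: someI_ex)

lemma mat_mult_smult_vec:
  fixes A :: "'a::comm_ring_1 mat"
  assumes "A \<in> carrier_mat m n" "v \<in> carrier_vec n"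
  shows "A *\<^sub>v (c \<cdot>\<^sub>v v) = c \<cdot>\<^sub>v (A *\<^sub>v v)"
  using assms by (intro eq_vecI) (auto simp: scalar_prod_def sum_distrib_left algebra_simps)

lemma smult_one_mult_vec:
  fixes c :: "'a::comm_ring_1"
  shows "v \<in> carrier_vec n \<Longrightarrow> (c \<cdot>\<^sub>m 1\<^sub>m n) *\<^sub>v v = c \<cdot>\<^sub>v v"
  by (intro eq_vecI) auto

lemma smult_vec_cancel:
  fixes c :: "'a::idom"
  assumes "c \<noteq> 0" "v \<in> carrier_vec n" "w \<in> carrier_vec n" "c \<cdot>\<^sub>v v = c \<cdot>\<^sub>v w"
  shows "v = w"
proof (rule eq_vecI)
  fix i assume "i < dim_vec w"
  then have "i < dim_vec v" "(c \<cdot>\<^sub>v v) $ i = (c \<cdot>\<^sub>v w) $ i" using assms by auto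
  with \<open>i < dim_vec w\<close> show "v $ i = w $ i" using assms(1) by simp
qed (use assms in simp)

lemma zero_mat_mult_vec: "v \<in> carrier_vec n \<Longrightarrow> 0\<^sub>m m n *\<^sub>v (v :: 'a::comm_ring_1 vec) = 0\<^sub>v m"
  by (intro eq_vecI) auto

lemma homotopy_mult_vec:
  fixes c :: "'a::comm_ring_1"
  assumes "A \<in> carrier_mat n m" "S \<in> carrier_mat m n" "B \<in> carrier_mat l n" "T \<in> carrier_mat n l"
    and "A * S + T * B = c \<cdot>\<^sub>m 1\<^sub>m n" "v \<in> carrier_vec n" "B *\<^sub>v v = 0\<^sub>v l"
  shows "c \<cdot>\<^sub>v v = A *\<^sub>v (S *\<^sub>v v)"
proof -
  have "c \<cdot>\<^sub>v v = (A * S + T * B) *\<^sub>v v" using assms(5,6) by (simp only: smult_one_mult_vec)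
  also have "\<dots> = A *\<^sub>v (S *\<^sub>v v) + T *\<^sub>v (B *\<^sub>v v)"
    using assms(1-4,6) by (simp add: add_mult_distrib_mat_vec[of _ n n])
  also have "T *\<^sub>v (B *\<^sub>v v) = 0\<^sub>v n" using assms(4,7) by auto
  finally show ?thesis using assms(1,2,6) by simp
qed

text \<open>The acyclicity lemma of Peskine and Szpiro for complexes of length three: the homology is
  annihilated by a regular sequence, and a syzygy relation that becomes trivial after multiplication
  by its members is already trivial by the exactness of the Koszul complex.\<close>

lemma exact_by_homotopies:
  fixes c :: "'i \<Rightarrow> 'a::idom"
  assumes reg: "regular_sequence [c i, c j, c k]"
    and D1: "D1 \<in> carrier_mat n0 n1" and D2: "D2 \<in> carrier_mat n1 n2" and D3: "D3 \<in> carrier_mat n2 n3"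
    and D12: "D1 * D2 = 0\<^sub>m n0 n2" and D23: "D2 * D3 = 0\<^sub>m n1 n3"
    and S0: "\<And>l. l \<in> {i, j, k} \<Longrightarrow> S0 l \<in> carrier_mat n1 n0"
    and S1: "\<And>l. l \<in> {i, j, k} \<Longrightarrow> S1 l \<in> carrier_mat n2 n1"
    and S2: "\<And>l. l \<in> {i, j} \<Longrightarrow> S2 l \<in> carrier_mat n3 n2"
    and H1: "\<And>l. l \<in> {i, j, k} \<Longrightarrow> D2 * S1 l + S0 l * D1 = c l \<cdot>\<^sub>m 1\<^sub>m n1"
    and H2: "\<And>l. l \<in> {i, j} \<Longrightarrow> D3 * S2 l + S1 l * D2 = c l \<cdot>\<^sub>m 1\<^sub>m n2"
    and H3: "S2 i * D3 = c i \<cdot>\<^sub>m 1\<^sub>m n3"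
  shows "mat_kernel D3 = {0\<^sub>v n3}" "mat_image D3 = mat_kernel D2" "mat_image D2 = mat_kernel D1"
proof -
  have ci: "c i \<noteq> 0" and cancel: "\<And>a b. c j * a = c i * b \<Longrightarrow> \<exists>e. a = c i * e"
  proof -
    note r = reg[unfolded regular_sequence_3]
    show "c i \<noteq> 0" using reg by (auto simp: regular_sequence_nonzero)
    show "\<exists>e. a = c i * e" if "c j * a = c i * b" for a b
    proof -
      have "c j * a \<in> ideal_gen {c i}" unfolding mem_ideal_gen_1 using that by (auto simp: mult.commute)
      then have "a \<in> ideal_gen {c i}" using r by blast
      then show ?thesis unfolding mem_ideal_gen_1 by (auto simp: mult.commute)
    qed
  qed
  have ker3: "v = 0\<^sub>v n3" if v: "v \<in> carrier_vec n3" and 0: "D3 *\<^sub>v v = 0\<^sub>v n2" for v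
  proof (rule smult_vec_cancel[OF ci v])
    have "c i \<cdot>\<^sub>v v = (S2 i * D3) *\<^sub>v v" unfolding H3 using v by (simp add: smult_one_mult_vec)
    also have "\<dots> = S2 i *\<^sub>v (D3 *\<^sub>v v)" using S2[of i] D3 v by simp
    finally show "c i \<cdot>\<^sub>v v = c i \<cdot>\<^sub>v 0\<^sub>v n3" unfolding 0 using S2[of i] by auto
  qed simp
  have inj3: "v = w" if "v \<in> carrier_vec n3" "w \<in> carrier_vec n3" "D3 *\<^sub>v v = D3 *\<^sub>v w" for v w
  proof -
    have "D3 *\<^sub>v (v - w) = 0\<^sub>v n2" using that D3 by (simp add: mult_minus_distrib_mat_vec[OF D3])
    then have "v - w = 0\<^sub>v n3" using ker3[of "v - w"] that by simp
    then have "(v - w) + w = 0\<^sub>v n3 + w" by simp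
    then show ?thesis using that by (simp add: minus_add_uminus_vec[of v n3 w])
  qed
  have ker2: "\<exists>w\<in>carrier_vec n3. v = D3 *\<^sub>v w" if v: "v \<in> carrier_vec n2" and 0: "D2 *\<^sub>v v = 0\<^sub>v n1" for v
  proof -
    define w where "w l = S2 l *\<^sub>v v" for l
    have w: "w i \<in> carrier_vec n3" "w j \<in> carrier_vec n3" using S2[of i] S2[of j] v by (simp_all add: w_def mult_mat_vec_carrier[of _ _ n2])
    have cv: "c l \<cdot>\<^sub>v v = D3 *\<^sub>v w l" if "l \<in> {i, j}" for l
      unfolding w_def using that by (intro homotopy_mult_vec[OF D3 S2 D2 S1 H2 v 0]) auto
    \<comment> \<open>Both vectors are mapped to the same multiple of \<open>v\<close>, and
      \<open>D3\<close> is injective; the regularity of \<open>c j\<close> modulo \<open>c i\<close>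
      then divides \<open>w i\<close> by \<open>c i\<close>.\<close>
    have "D3 *\<^sub>v (c j \<cdot>\<^sub>v w i) = c j \<cdot>\<^sub>v (c i \<cdot>\<^sub>v v)" using w cv by (simp add: mat_mult_smult_vec[OF D3])
    also have "\<dots> = c i \<cdot>\<^sub>v (c j \<cdot>\<^sub>v v)" by (simp add: smult_smult_assoc mult.commute)
    also have "\<dots> = D3 *\<^sub>v (c i \<cdot>\<^sub>v w j)" using w cv by (simp add: mat_mult_smult_vec[OF D3])
    finally have "c j \<cdot>\<^sub>v w i = c i \<cdot>\<^sub>v w j" by (rule inj3[rotated 2]) (use w in auto)
    then have "c j * w i $ m = c i * w j $ m" if "m < n3" for m
      using w that by (metis carrier_vecD index_smult_vec(1))
    then obtain u where u: "u \<in> carrier_vec n3" "\<And>m. m < n3 \<Longrightarrow> w i $ m = c i * u $ m"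
      using vec_choice[of n3 "\<lambda>m e. w i $ m = c i * e"] cancel by metis
    then have "w i = c i \<cdot>\<^sub>v u" using w by (intro eq_vecI) auto
    then have "c i \<cdot>\<^sub>v v = c i \<cdot>\<^sub>v (D3 *\<^sub>v u)" using cv[of i] u(1) by (simp add: mat_mult_smult_vec[OF D3])
    then have "v = D3 *\<^sub>v u" by (rule smult_vec_cancel[OF ci v mult_mat_vec_carrier[OF D3 u(1)]])
    then show ?thesis using u(1) by blast
  qed
  have ker1: "\<exists>w\<in>carrier_vec n2. v = D2 *\<^sub>v w" if v: "v \<in> carrier_vec n1" and 0: "D1 *\<^sub>v v = 0\<^sub>v n0" for v
  proof -
    define w where "w l = S1 l *\<^sub>v v" for l
    have w: "w l \<in> carrier_vec n2" if "l \<in> {i, j, k}" for l using S1[OF that] v by (simp add: w_def mult_mat_vec_carrier[of _ _ n1])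
    have cv: "c l \<cdot>\<^sub>v v = D2 *\<^sub>v w l" if "l \<in> {i, j, k}" for l
      unfolding w_def using that by (intro homotopy_mult_vec[OF D2 S1 D1 S0 H1 v 0]) auto
    \<comment> \<open>The vectors \<open>w\<close> are compared as in \<open>ker2\<close>, but they
      now agree only up to boundaries of vectors \<open>u\<close>; the injectivity of
      \<open>D3\<close> makes these satisfy a Koszul relation.\<close>
    have "\<exists>u\<in>carrier_vec n3. c b \<cdot>\<^sub>v w a - c a \<cdot>\<^sub>v w b = D3 *\<^sub>v u" if "a \<in> {i, j, k}" "b \<in> {i, j, k}" for a b
    proof (rule ker2)
      have "D2 *\<^sub>v (c b \<cdot>\<^sub>v w a - c a \<cdot>\<^sub>v w b) = c b \<cdot>\<^sub>v (c a \<cdot>\<^sub>v v) - c a \<cdot>\<^sub>v (c b \<cdot>\<^sub>v v)"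
        using w that cv by (simp add: mat_mult_smult_vec[OF D2] mult_minus_distrib_mat_vec[OF D2])
      also have "\<dots> = 0\<^sub>v n1" using v by (auto simp: smult_smult_assoc mult.commute)
      finally show "D2 *\<^sub>v (c b \<cdot>\<^sub>v w a - c a \<cdot>\<^sub>v w b) = 0\<^sub>v n1" .
    qed (use w that in simp)
    then obtain u12 u13 u23 where u: "u12 \<in> carrier_vec n3" "u13 \<in> carrier_vec n3" "u23 \<in> carrier_vec n3"
        and u12: "c j \<cdot>\<^sub>v w i - c i \<cdot>\<^sub>v w j = D3 *\<^sub>v u12"
        and u13: "c k \<cdot>\<^sub>v w i - c i \<cdot>\<^sub>v w k = D3 *\<^sub>v u13"
        and u23: "c k \<cdot>\<^sub>v w j - c j \<cdot>\<^sub>v w k = D3 *\<^sub>v u23"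
      by (meson insertI1 insertI2)
    have "D3 *\<^sub>v (c i \<cdot>\<^sub>v u23 - c j \<cdot>\<^sub>v u13 + c k \<cdot>\<^sub>v u12) = c i \<cdot>\<^sub>v (D3 *\<^sub>v u23) - c j \<cdot>\<^sub>v (D3 *\<^sub>v u13) + c k \<cdot>\<^sub>v (D3 *\<^sub>v u12)"
      using u by (simp add: mat_mult_smult_vec[OF D3] mult_add_distrib_mat_vec[OF D3] mult_minus_distrib_mat_vec[OF D3])
    also have "\<dots> = 0\<^sub>v n2" unfolding u12[symmetric] u13[symmetric] u23[symmetric]
      using w[of i] w[of j] w[of k] by (intro eq_vecI) (auto simp: algebra_simps)
    finally have "c i \<cdot>\<^sub>v u23 - c j \<cdot>\<^sub>v u13 + c k \<cdot>\<^sub>v u12 = 0\<^sub>v n3" by (rule ker3[rotated]) (use u in auto)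
    then have z: "(c i \<cdot>\<^sub>v u23 - c j \<cdot>\<^sub>v u13 + c k \<cdot>\<^sub>v u12) $ m = 0" if "m < n3" for m using that by simp
    have "\<exists>b. u12 $ m = c i * snd b - c j * fst b" if "m < n3" for m
    proof -
      have "u23 $ m * c i + (- u13 $ m) * c j + u12 $ m * c k = 0" using z[OF that] u that by (simp add: algebra_simps)
      from koszul_exact_1[OF reg this] show ?thesis by (metis fst_conv snd_conv)
    qed
    then obtain b where b: "b \<in> carrier_vec n3" "\<And>m. m < n3 \<Longrightarrow> u12 $ m = c i * snd (b $ m) - c j * fst (b $ m)"
      using vec_choice[of n3 "\<lambda>m b. u12 $ m = c i * snd b - c j * fst b"] by metis
    define b1 b2 where "b1 = map_vec fst b" and "b2 = map_vec snd b"
    have b12: "b1 \<in> carrier_vec n3" "b2 \<in> carrier_vec n3" using b(1) by (auto simp: b1_def b2_def)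
    have "u12 = c i \<cdot>\<^sub>v b2 - c j \<cdot>\<^sub>v b1" using b u(1) by (intro eq_vecI) (auto simp: b1_def b2_def)
    then have "c j \<cdot>\<^sub>v w i - c i \<cdot>\<^sub>v w j = c i \<cdot>\<^sub>v (D3 *\<^sub>v b2) - c j \<cdot>\<^sub>v (D3 *\<^sub>v b1)"
      unfolding u12 using b12 by (simp add: mat_mult_smult_vec[OF D3] mult_minus_distrib_mat_vec[OF D3])
    then have *: "(c j \<cdot>\<^sub>v w i - c i \<cdot>\<^sub>v w j) $ m = (c i \<cdot>\<^sub>v (D3 *\<^sub>v b2) - c j \<cdot>\<^sub>v (D3 *\<^sub>v b1)) $ m" for m by simp
    have Db: "D3 *\<^sub>v b1 \<in> carrier_vec n2" "D3 *\<^sub>v b2 \<in> carrier_vec n2" using D3 b12 by auto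
    \<comment> \<open>The two pieces of \<open>u12\<close> correct \<open>w i\<close> and
      \<open>w j\<close> by boundaries, which \<open>D2\<close> does not see, and \<open>c i\<close>
      divides the corrected \<open>w i\<close>.\<close>
    have "c j * (w i + D3 *\<^sub>v b1) $ m = c i * (w j + D3 *\<^sub>v b2) $ m" if "m < n2" for m
      using *[of m] that carrier_vecD[OF w[of i]] carrier_vecD[OF w[of j]] carrier_matD(1)[OF D3] by (simp add: algebra_simps)
    then obtain e where e: "e \<in> carrier_vec n2" "\<And>m. m < n2 \<Longrightarrow> (w i + D3 *\<^sub>v b1) $ m = c i * e $ m"
      using vec_choice[of n2 "\<lambda>m e. (w i + D3 *\<^sub>v b1) $ m = c i * e"] cancel by metis
    have "w i + D3 *\<^sub>v b1 = c i \<cdot>\<^sub>v e" using e w[of i] Db D3 by (intro eq_vecI) auto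
    then have "c i \<cdot>\<^sub>v (D2 *\<^sub>v e) = D2 *\<^sub>v (w i + D3 *\<^sub>v b1)" using e(1) by (simp add: mat_mult_smult_vec[OF D2])
    also have "\<dots> = D2 *\<^sub>v w i + (D2 * D3) *\<^sub>v b1"
      using w[of i] Db b12 D2 D3 by (simp add: mult_add_distrib_mat_vec[OF D2])
    also have "\<dots> = c i \<cdot>\<^sub>v v" unfolding D23 using b12 v cv[of i] D2 by auto
    finally have "v = D2 *\<^sub>v e" by (intro smult_vec_cancel[OF ci v mult_mat_vec_carrier[OF D2 e(1)]]) (rule sym)
    then show ?thesis using e(1) by blast
  qed
  have im2: "D2 *\<^sub>v (D3 *\<^sub>v w) = 0\<^sub>v n1" if "w \<in> carrier_vec n3" for w
    using assoc_mult_mat_vec[OF D2 D3 that] zero_mat_mult_vec[OF that] unfolding D23 by simp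
  have im1: "D1 *\<^sub>v (D2 *\<^sub>v w) = 0\<^sub>v n0" if "w \<in> carrier_vec n2" for w
    using assoc_mult_mat_vec[OF D1 D2 that] zero_mat_mult_vec[OF that] unfolding D12 by simp
  show "mat_kernel D3 = {0\<^sub>v n3}" using ker3 D3 by (auto simp: mat_kernel_def)
  show "mat_image D3 = mat_kernel D2" using ker2 im2 D2 D3 by (auto simp: mat_kernel_def mat_image_def)
  show "mat_image D2 = mat_kernel D1" using ker1 im1 D1 D2 by (auto simp: mat_kernel_def mat_image_def)
qed

section \<open>The minimal free resolution\<close>

text \<open>Matrices are multiplied as lists of rows, so that a product with symbolic entries is
  evaluated by rewriting. The argument \<open>n\<close> fixes the length of the empty sum.\<close>

fun row_times :: "nat \<Rightarrow> 'a::comm_ring_1 list \<Rightarrow> 'a list list \<Rightarrow> 'a list" where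
  "row_times n (a # r) (b # B) = map2 (+) (map ((*) a) b) (row_times n r B)"
| "row_times n _ _ = replicate n 0"

lemma length_row_times: "(\<And>b. b \<in> set B \<Longrightarrow> length b = n) \<Longrightarrow> length (row_times n r B) = n"
  by (induction n r B rule: row_times.induct) auto

lemma nth_row_times:
  assumes "\<And>b. b \<in> set B \<Longrightarrow> length b = n" "length r = length B" "j < n"
  shows "row_times n r B ! j = (\<Sum>k<length B. r ! k * B ! k ! j)"
  using assms
proof (induction n r B rule: row_times.induct)
  case (1 n a r b B)
  then show ?case by (simp add: length_row_times sum.lessThan_Suc_shift del: sum.lessThan_Suc)
qed auto

lemma mat_of_rows_list_mult:
  assumes "length B = m" "list_all (\<lambda>r. length r = m) A" "list_all (\<lambda>r. length r = n) B"
  shows "mat_of_rows_list m A * mat_of_rows_list n B = mat_of_rows_list n (map (\<lambda>r. row_times n r B) A)"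
  using assms
  by (intro eq_matI) (auto simp: mat_of_rows_list_def scalar_prod_def list_all_iff nth_row_times atLeast0LessThan)

lemma mat_of_rows_list_add:
  assumes "length A = length B" "list_all (\<lambda>r. length r = n) A" "list_all (\<lambda>r. length r = n) B"
  shows "mat_of_rows_list n A + mat_of_rows_list n B = mat_of_rows_list n (map2 (map2 (+)) A B)"
  using assms by (intro eq_matI) (auto simp: mat_of_rows_list_def list_all_iff)

lemma smult_one_mat_of_rows_list:
  "(c :: 'a::comm_ring_1) \<cdot>\<^sub>m 1\<^sub>m n = mat_of_rows_list n (map (\<lambda>i. map (\<lambda>j. if i = j then c else 0) [0..<n]) [0..<n])"
  by (intro eq_matI) (auto simp: mat_of_rows_list_def)

lemma zero_mat_of_rows_list: "0\<^sub>m m n = mat_of_rows_list n (replicate m (replicate n 0))"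
  by (intro eq_matI) (auto simp: mat_of_rows_list_def)

text \<open>The syzygies and the contractions of the multiplications by \<open>cubic\<close>, \<open>quartic2\<close> and \<open>x\<^sup>6\<close> on the
  resolution were found by linear algebra over the integers, degree by degree.\<close>

definition generators_mat :: "'a::comm_ring_1 \<Rightarrow> 'a \<Rightarrow> 'a \<Rightarrow> 'a mat" where
  "generators_mat x y z = mat_of_rows_list 7
   [[x ^ 2 * y + y ^ 3 - y * z ^ 2 - z ^ 3, x * y ^ 2 - x * z ^ 2, x ^ 3 * z - x * y * z ^ 2, y ^ 2 * z ^ 2 - z ^ 4, x ^ 6, z ^ 6, x * z ^ 5]]"

definition syzygies_mat :: "'a::comm_ring_1 \<Rightarrow> 'a \<Rightarrow> 'a \<Rightarrow> 'a mat" where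
  "syzygies_mat x y z = mat_of_rows_list 9
   [[0, - (x * z), - (x * y), 0, x ^ 2 * z ^ 2, y ^ 2 * z ^ 2 - z ^ 4, x ^ 2 * y ^ 2 + y * z ^ 3, x ^ 4 + x ^ 2 * y * z + z ^ 4, x ^ 5 + x ^ 3 * y * z + x * y ^ 2 * z ^ 2],
    [- (z ^ 2), y * z + z ^ 2, x ^ 2 + y ^ 2, 0, - (x * y * z ^ 2), - (x * y * z ^ 2), - (x ^ 3 * y) - x * y ^ 3, - (x ^ 3 * y) - x ^ 3 * z - x * y ^ 2 * z, - (x ^ 4 * y) - x ^ 4 * z - x ^ 2 * y ^ 2 * z - x ^ 2 * y * z ^ 2 - y ^ 3 * z ^ 2],
    [0, y, z, 0, x ^ 3, 0, x ^ 3, 0, 0],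
    [x, 0, 0, 0, 0, y * z ^ 2 + z ^ 3 - y ^ 3, - (y ^ 2 * z), - (y * z ^ 2), 0],
    [0, 0, 0, 0, - z, 0, - z, - y, - (x * y)],
    [0, 0, 0, - x, 0, 0, y, z, 0],
    [0, 0, 0, z, x, 0, 0, 0, y ^ 2]]"

definition second_syzygies_mat :: "'a::comm_ring_1 \<Rightarrow> 'a \<Rightarrow> 'a \<Rightarrow> 'a mat" where
  "second_syzygies_mat x y z = mat_of_rows_list 3
   [[y ^ 3 - y * z ^ 2 - z ^ 3, - (y ^ 3 * z), - (x * y * z ^ 2)],
    [- (z ^ 3), x ^ 4 + x ^ 2 * y * z, x ^ 3 * y],
    [y * z ^ 2, - (x ^ 2 * y ^ 2), 0],
    [0, - (y ^ 2), - (x * z)],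
    [0, 0, z ^ 2 - y ^ 2],
    [x, 0, 0],
    [0, - (x * y), - (z ^ 2)],
    [0, 0, y * z - x ^ 2],
    [0, z, x]]"

definition cubic_homotopy1 :: "'a::comm_ring_1 \<Rightarrow> 'a \<Rightarrow> 'a \<Rightarrow> 'a mat" where
  "cubic_homotopy1 x y z = mat_of_rows_list 7
   [[0, 0, 0, x * y, - (x * y * z ^ 2), 0, - (y ^ 4)],
    [0, - z, x ^ 2 + y ^ 2, 0, 0, - (x ^ 3 * y) - x ^ 3 * z - x * y ^ 2 * z, - (x ^ 4)],
    [0, y, - (y * z) - z ^ 2, 0, - (x ^ 3 * y) - x ^ 3 * z, x * y ^ 3, 0],
    [0, 0, 0, 0, - (x * z), - (x * y), - (y * z) - z ^ 2],
    [0, 0, 0, 0, z ^ 2, y * z, x * y],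
    [0, 0, 0, - 1, 0, - (y * z), - (x * y)],
    [0, 0, 0, 0, y * z, y ^ 2, 0],
    [0, 0, 0, 0, - (x ^ 2) - y ^ 2, - (y * z) - z ^ 2, - (x * y) - x * z],
    [0, 0, 0, 0, 0, 0, y]]"

definition cubic_homotopy2 :: "'a::comm_ring_1 \<Rightarrow> 'a \<Rightarrow> 'a \<Rightarrow> 'a mat" where
  "cubic_homotopy2 x y z = mat_of_rows_list 9
   [[1, 0, 0, 0, x * y, x * y, 0, 0, y ^ 3],
    [0, 0, 0, - y, 0, 0, - x, 0, - (y * z) - z ^ 2],
    [0, 0, 0, 0, - y, 0, z, 0, x * y]]"

definition quartic_homotopy1 :: "'a::comm_ring_1 \<Rightarrow> 'a \<Rightarrow> 'a \<Rightarrow> 'a mat" where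
  "quartic_homotopy1 x y z = mat_of_rows_list 7
   [[- (x * y), z ^ 2 - y ^ 2, y * z ^ 2 - x ^ 2 * z, 0, - (x ^ 5), 0, - (y ^ 3 * z ^ 2)],
    [0, 0, y * z ^ 2, 0, 0, - (x ^ 3 * z ^ 2) - x * y * z ^ 3, 0],
    [0, 0, - (z ^ 3), 0, - (x ^ 3 * z ^ 2), x * y ^ 2 * z ^ 2, 0],
    [0, 0, 0, 0, 0, 0, - (z ^ 3)],
    [0, 0, 0, 0, 0, 0, 0],
    [1, 0, 0, 0, 0, - (z ^ 3), - (x * z ^ 2)],
    [0, 0, 0, 0, z ^ 3, y * z ^ 2, 0],
    [0, 0, 0, 0, - (y * z ^ 2), - (z ^ 3), - (x * z ^ 2)],
    [0, 0, 0, 0, 0, 0, z ^ 2]]"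

definition quartic_homotopy2 :: "'a::comm_ring_1 \<Rightarrow> 'a \<Rightarrow> 'a \<Rightarrow> 'a mat" where
  "quartic_homotopy2 x y z = mat_of_rows_list 9
   [[0, z, y, 0, 0, 0, - (x * y ^ 2), - (x ^ 3) - x * y * z, - (x ^ 4) - x ^ 2 * y * z],
    [0, 0, 0, - (z ^ 2), 0, 0, 0, 0, - (z ^ 3)],
    [0, 0, 0, 0, - (z ^ 2), 0, 0, 0, 0]]"

definition power_homotopy1 :: "'a::comm_ring_1 \<Rightarrow> 'a \<Rightarrow> 'a \<Rightarrow> 'a mat" where
  "power_homotopy1 x y z = mat_of_rows_list 7
   [[x * y * z ^ 2, 0, x ^ 2 * y ^ 2 * z, x ^ 5, 0, - (x ^ 3 * y ^ 2 * z ^ 2) - x * y * z ^ 5, - (x ^ 4 * y ^ 2 * z) - x ^ 2 * y * z ^ 4],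
    [0, 0, 0, 0, 0, 0, 0],
    [x ^ 3 * y + x ^ 3 * z, x ^ 4, x ^ 4 * y, x ^ 3 * z ^ 2, 0, - (x ^ 5 * y * z) - x ^ 3 * z ^ 4, - (x ^ 6 * y) - x ^ 4 * z ^ 3],
    [x * z, 0, x ^ 2 * y, 0, 0, - (x ^ 5) - x ^ 3 * y * z - x * z ^ 4, - (x ^ 4 * y) - x ^ 2 * z ^ 3],
    [- (z ^ 2), 0, - (x * y * z), 0, 0, x ^ 4 * z + x ^ 2 * y * z ^ 2 + z ^ 5, x ^ 5 + x ^ 3 * y * z + x * z ^ 4],
    [0, 0, 0, 0, 0, 0, 0],
    [- (y * z), - (x * z), x ^ 3, - (z ^ 3), 0, - (x ^ 4 * z), - (x ^ 5)],
    [x ^ 2 + y ^ 2, x * y, 0, y * z ^ 2, 0, - (x ^ 2 * z ^ 3), - (x ^ 3 * z ^ 2)],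
    [0, 0, 0, 0, 0, 0, 0]]"


lemmas resolution_mats = generators_mat_def syzygies_mat_def second_syzygies_mat_def cubic_homotopy1_def cubic_homotopy2_def quartic_homotopy1_def quartic_homotopy2_def power_homotopy1_def

lemmas mat_of_rows_list_eval = mat_of_rows_list_mult mat_of_rows_list_add smult_one_mat_of_rows_list
  zero_mat_of_rows_list

lemma mat_of_rows_list_cong: "A = B \<Longrightarrow> mat_of_rows_list n A = mat_of_rows_list n B"
  by simp

text \<open>The matrix identities are stated for arbitrary elements of a commutative ring; they are
  polynomial identities with integer coefficients, verified entry by entry.\<close>

lemma generators_syzygies:
  "generators_mat x y z * syzygies_mat x y z = 0\<^sub>m 1 9"
  by (simp add: generators_mat_def syzygies_mat_def mat_of_rows_list_eval numeral_eq_Suc, rule mat_of_rows_list_cong)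
    (simp add: algebra_simps)

lemma syzygies_second_syzygies:
  "syzygies_mat x y z * second_syzygies_mat x y z = 0\<^sub>m 7 3"
  by (simp add: syzygies_mat_def second_syzygies_mat_def mat_of_rows_list_eval numeral_eq_Suc, rule mat_of_rows_list_cong)
    (simp add: algebra_simps)

lemma cubic_homotopy1_eq:
  "syzygies_mat x y z * cubic_homotopy1 x y z + mat_of_rows_list 1 [[1], [0], [0], [0], [0], [0], [0]] * generators_mat x y z =
    (x ^ 2 * y + y ^ 3 - y * z ^ 2 - z ^ 3) \<cdot>\<^sub>m 1\<^sub>m 7"
  by (simp add: generators_mat_def syzygies_mat_def cubic_homotopy1_def mat_of_rows_list_eval numeral_eq_Suc, rule mat_of_rows_list_cong)
    (simp add: algebra_simps)

lemma cubic_homotopy2_eq: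
  "second_syzygies_mat x y z * cubic_homotopy2 x y z + cubic_homotopy1 x y z * syzygies_mat x y z =
    (x ^ 2 * y + y ^ 3 - y * z ^ 2 - z ^ 3) \<cdot>\<^sub>m 1\<^sub>m 9"
  by (simp add: second_syzygies_mat_def syzygies_mat_def cubic_homotopy1_def cubic_homotopy2_def mat_of_rows_list_eval numeral_eq_Suc, rule mat_of_rows_list_cong)
    (simp add: algebra_simps)

lemma quartic_homotopy1_eq:
  "syzygies_mat x y z * quartic_homotopy1 x y z + mat_of_rows_list 1 [[0], [0], [0], [1], [0], [0], [0]] * generators_mat x y z =
    (y ^ 2 * z ^ 2 - z ^ 4) \<cdot>\<^sub>m 1\<^sub>m 7"
  by (simp add: generators_mat_def syzygies_mat_def quartic_homotopy1_def mat_of_rows_list_eval numeral_eq_Suc, rule mat_of_rows_list_cong)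
    (simp add: algebra_simps)

lemma quartic_homotopy2_eq:
  "second_syzygies_mat x y z * quartic_homotopy2 x y z + quartic_homotopy1 x y z * syzygies_mat x y z =
    (y ^ 2 * z ^ 2 - z ^ 4) \<cdot>\<^sub>m 1\<^sub>m 9"
  by (simp add: second_syzygies_mat_def syzygies_mat_def quartic_homotopy1_def quartic_homotopy2_def mat_of_rows_list_eval numeral_eq_Suc, rule mat_of_rows_list_cong)
    (simp add: algebra_simps)

lemma power_homotopy1_eq:
  "syzygies_mat x y z * power_homotopy1 x y z + mat_of_rows_list 1 [[0], [0], [0], [0], [1], [0], [0]] * generators_mat x y z =
    (x ^ 6) \<cdot>\<^sub>m 1\<^sub>m 7"
  by (simp add: generators_mat_def syzygies_mat_def power_homotopy1_def mat_of_rows_list_eval numeral_eq_Suc, rule mat_of_rows_list_cong)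
    (simp add: algebra_simps)

lemma cubic_homotopy2_second_syzygies:
  "cubic_homotopy2 x y z * second_syzygies_mat x y z = (x ^ 2 * y + y ^ 3 - y * z ^ 2 - z ^ 3) \<cdot>\<^sub>m 1\<^sub>m 3"
  by (simp add: second_syzygies_mat_def cubic_homotopy2_def mat_of_rows_list_eval numeral_eq_Suc, rule mat_of_rows_list_cong)
    (simp add: algebra_simps)


text \<open>Entries between equal degrees are required to vanish, so that one check of degrees shows
  the map to be both graded and minimal.\<close>

lemma minimal_graded_map:
  fixes R :: "('v::finite, 'k::field) mpoly list list"
  assumes "length bs = n"
    and "list_all2 (\<lambda>a. list_all2 (\<lambda>b p. if a < b then homogeneous (b - a) p else p = 0) bs) as R"
  shows "graded_map bs as (mat_of_rows_list n R) \<and> elements_mat (mat_of_rows_list n R) \<subseteq> irrelevant_ideal"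
proof
  have len: "length R = length as" using assms(2) by (simp add: list_all2_lengthD)
  have R: "if as ! i < bs ! j then homogeneous (bs ! j - as ! i) (R ! i ! j) else R ! i ! j = 0"
    if "i < length as" "j < length bs" for i j
    using list_all2_nthD[OF list_all2_nthD[OF assms(2) that(1)] that(2)] .
  have "if as ! i \<le> bs ! j then homogeneous (bs ! j - as ! i) (R ! i ! j) else R ! i ! j = 0"
    if "i < length as" "j < length bs" for i j
    using R[OF that] by (cases "as ! i < bs ! j") auto
  then show "graded_map bs as (mat_of_rows_list n R)"
    using len assms(1) by (simp add: graded_map_def mat_of_rows_list_def)
  have "R ! i ! j \<in> irrelevant_ideal" if "i < length as" "j < length bs" for i j
    using R[OF that] homogeneous_in_irrelevant[of "bs ! j - as ! i" "R ! i ! j"] is_ideal_0[of irrelevant_ideal]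
    by (cases "as ! i < bs ! j") (auto simp: irrelevant_ideal_def)
  then show "elements_mat (mat_of_rows_list n R) \<subseteq> irrelevant_ideal"
    using len assms(1) by (auto simp: mat_of_rows_list_def elements_mat_def)
qed

lemma image_row_matrix:
  fixes gs :: "'a::comm_ring_1 list"
  assumes n: "length gs = n"
  shows "(\<lambda>v. v $ 0) ` mat_image (mat_of_rows_list n [gs]) = ideal_gen (set gs)"
proof -
  let ?n = "length gs"
  let ?f = "\<lambda>v. \<Sum>k<?n. gs ! k * v $ k"
  have *: "(\<lambda>v. v $ 0) ` mat_image (mat_of_rows_list ?n [gs]) = ?f ` carrier_vec ?n"
    unfolding mat_image_def image_image
    by (intro image_cong) (auto simp: mat_of_rows_list_def scalar_prod_def atLeast0LessThan)
  have "is_ideal (?f ` carrier_vec ?n)"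
  proof (rule is_idealI)
    show "0 \<in> ?f ` carrier_vec ?n" by (rule image_eqI[of _ _ "0\<^sub>v ?n"]) auto
  next
    fix a b assume "a \<in> ?f ` carrier_vec ?n" "b \<in> ?f ` carrier_vec ?n"
    then obtain v w where a: "a = ?f v" "v \<in> carrier_vec ?n" and b: "b = ?f w" "w \<in> carrier_vec ?n"
      by (elim imageE)
    have "?f (v + w) = a + b"
      unfolding a(1) b(1) sum.distrib[symmetric] using a(2) b(2) by (intro sum.cong) (auto simp: distrib_left)
    then show "a + b \<in> ?f ` carrier_vec ?n"
      using a(2) b(2) by (intro image_eqI[where x = "v + w"]) auto
  next
    fix c a assume "a \<in> ?f ` carrier_vec ?n"
    then obtain v where a: "a = ?f v" "v \<in> carrier_vec ?n" by (rule imageE)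
    have "?f (c \<cdot>\<^sub>v v) = c * a"
      unfolding a(1) sum_distrib_left using a(2) by (intro sum.cong) (auto simp: mult.left_commute)
    then show "c * a \<in> ?f ` carrier_vec ?n"
      using a(2) by (intro image_eqI[where x = "c \<cdot>\<^sub>v v"]) auto
  qed
  moreover have "set gs \<subseteq> ?f ` carrier_vec ?n"
  proof
    fix g assume "g \<in> set gs"
    then obtain i where i: "i < ?n" "g = gs ! i" by (metis in_set_conv_nth)
    have "?f (unit_vec ?n i) = (\<Sum>k<?n. if k = i then gs ! k else 0)"
      using i by (intro sum.cong) auto
    then show "g \<in> ?f ` carrier_vec ?n" using i by (intro image_eqI[of _ _ "unit_vec ?n i"]) auto
  qed
  ultimately have "ideal_gen (set gs) \<subseteq> ?f ` carrier_vec ?n" by (rule ideal_gen_least)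
  moreover have "?f ` carrier_vec ?n \<subseteq> ideal_gen (set gs)"
  proof -
    have "?f v \<in> ideal_gen (set gs)" for v
      by (intro is_ideal_sum[OF is_ideal_ideal_gen] is_ideal_mult_right[OF is_ideal_ideal_gen] ideal_gen_base nth_mem) simp
    then show ?thesis by blast
  qed
  ultimately show ?thesis unfolding n[symmetric] * by blast
qed

lemma homogeneous_Var_mult:
  "1 \<le> n \<Longrightarrow> homogeneous (n - 1) p \<Longrightarrow> homogeneous n (Var v * (p :: ('v::finite, 'k::comm_ring_1) mpoly))"
  "k \<le> n \<Longrightarrow> homogeneous (n - k) p \<Longrightarrow> homogeneous n (Var v ^ k * p)"
  "n = 1 \<Longrightarrow> homogeneous n (Var v :: ('v, 'k) mpoly)"
  "n = k \<Longrightarrow> homogeneous n (Var v ^ k :: ('v, 'k) mpoly)"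
  using homogeneous_mult[OF homogeneous_Var[of v], of "n - 1" p]
    homogeneous_mult[OF homogeneous_power[OF homogeneous_Var[of v], of k], of "n - k" p]
    homogeneous_power[OF homogeneous_Var[of v], of k] homogeneous_Var[of v] by simp_all

lemma graded_resolution_mats:
  fixes D1 D2 D3 :: "(3, 'k::field) mpoly mat"
  defines "D1 \<equiv> generators_mat varx vary varz" and "D2 \<equiv> syzygies_mat varx vary varz"
    and "D3 \<equiv> second_syzygies_mat varx vary varz"
  shows "graded_map [3, 3, 4, 4, 6, 6, 6] [0] D1 \<and> elements_mat D1 \<subseteq> irrelevant_ideal"
    "graded_map [5, 5, 5, 7, 7, 7, 7, 7, 8] [3, 3, 4, 4, 6, 6, 6] D2 \<and> elements_mat D2 \<subseteq> irrelevant_ideal"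
    "graded_map [8, 9, 9] [5, 5, 5, 7, 7, 7, 7, 7, 8] D3 \<and> elements_mat D3 \<subseteq> irrelevant_ideal"
  unfolding D1_def D2_def D3_def resolution_mats
  by (rule minimal_graded_map; simp add: mult.assoc;
      intro conjI homogeneous_add homogeneous_diff homogeneous_uminus homogeneous_Var_mult; simp)+

lemma minimal_free_resolution_3:
  "minimal_free_resolution I [F0, F1, F2] [A, B, C] \<longleftrightarrow>
    graded_map F0 [0] A \<and> graded_map F1 F0 B \<and> graded_map F2 F1 C \<and>
    (\<lambda>v. v $ 0) ` mat_image A = I \<and> mat_image B = mat_kernel A \<and> mat_image C = mat_kernel B \<and>
    mat_kernel C = {0\<^sub>v (dim_col C)} \<and>
    elements_mat B \<subseteq> irrelevant_ideal \<and> elements_mat C \<subseteq> irrelevant_ideal"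
proof -
  have three: "(\<forall>i<length [a, b, c]. P i) \<longleftrightarrow> P 0 \<and> P 1 \<and> P 2" for a b c :: "nat list" and P :: "nat \<Rightarrow> bool"
    by (auto simp: less_Suc_eq numeral_2_eq_2)
  have two: "(\<forall>i. Suc i < length [a, b, c] \<longrightarrow> P i) \<longleftrightarrow> P 0 \<and> P 1" for a b c :: "nat list" and P :: "nat \<Rightarrow> bool"
    by (auto simp: less_Suc_eq)
  show ?thesis unfolding minimal_free_resolution_def three two by (simp add: numeral_2_eq_2 conj_ac)
qed

lemma minimal_free_resolution_the_ideal:
  "minimal_free_resolution (the_ideal :: (3, 'k::field) mpoly set)
     [[3, 3, 4, 4, 6, 6, 6], [5, 5, 5, 7, 7, 7, 7, 7, 8], [8, 9, 9]]
     [generators_mat varx vary varz, syzygies_mat varx vary varz, second_syzygies_mat varx vary varz]"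
proof -
  let ?D1 = "generators_mat varx vary varz :: (3, 'k) mpoly mat"
  let ?D2 = "syzygies_mat varx vary varz :: (3, 'k) mpoly mat"
  let ?D3 = "second_syzygies_mat varx vary varz :: (3, 'k) mpoly mat"
  note graded = graded_resolution_mats[where ?'k = 'k]
  have carrier: "?D1 \<in> carrier_mat 1 7" "?D2 \<in> carrier_mat 7 9" "?D3 \<in> carrier_mat 9 3"
    by (rule carrier_matI; simp add: resolution_mats mat_of_rows_list_def)+
  have quartic: "vary ^ 2 * varz ^ 2 - varz ^ 4 = (quartic2 :: (3, 'k) mpoly)"
    by (simp add: algebra_simps numeral_eq_Suc)
  define c :: "nat \<Rightarrow> (3, 'k) mpoly" where "c = (!) [cubic, quartic2, varx ^ 6]"
  \<comment> \<open>The positions of \<open>cubic\<close>, \<open>quartic2\<close> and x^6 among the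
    generators are 0, 3, 4: multiplication by a generator on S factors through its basis
    vector.\<close>
  define S0 :: "nat \<Rightarrow> (3, 'k) mpoly mat" where
    "S0 l = mat_of_rows_list 1 (map (\<lambda>m. [if m = [0, 3, 4 :: nat] ! l then 1 else 0]) [0..<7])" for l
  define S1 where "S1 = (!) [cubic_homotopy1 varx vary varz, quartic_homotopy1 varx vary varz,
    power_homotopy1 varx vary (varz :: (3, 'k) mpoly)]"
  define S2 where "S2 = (!) [cubic_homotopy2 varx vary varz, quartic_homotopy2 varx vary (varz :: (3, 'k) mpoly)]"
  have reg: "regular_sequence [c 0, c 1, c 2]"
    using form_regularD[OF form_regular_power[OF regular_cubic_quartic, of 5]] by (simp add: c_def)
  have S0: "S0 0 = mat_of_rows_list 1 [[1], [0], [0], [0], [0], [0], [0]]"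
    "S0 1 = mat_of_rows_list 1 [[0], [0], [0], [1], [0], [0], [0]]"
    "S0 2 = mat_of_rows_list 1 [[0], [0], [0], [0], [1], [0], [0]]"
    by (simp_all add: S0_def upt_rec)
  have C0: "S0 l \<in> carrier_mat 7 1" for l
    by (rule carrier_matI) (simp_all add: S0_def mat_of_rows_list_def)
  have C1: "S1 l \<in> carrier_mat 9 7" if "l \<in> {0, 1, 2}" for l
    by (rule carrier_matI) (use that in \<open>auto simp: S1_def resolution_mats mat_of_rows_list_def\<close>)
  have C2: "S2 l \<in> carrier_mat 3 9" if "l \<in> {0, 1}" for l
    by (rule carrier_matI) (use that in \<open>auto simp: S2_def resolution_mats mat_of_rows_list_def\<close>)
  have H1: "?D2 * S1 l + S0 l * ?D1 = c l \<cdot>\<^sub>m 1\<^sub>m 7" if "l \<in> {0, 1, 2}" for l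
    using that cubic_homotopy1_eq[of "varx :: (3, 'k) mpoly" vary varz]
      quartic_homotopy1_eq[of "varx :: (3, 'k) mpoly" vary varz]
      power_homotopy1_eq[of "varx :: (3, 'k) mpoly" vary varz]
    unfolding quartic S0[symmetric] by (auto simp: c_def S1_def)
  have H2: "?D3 * S2 l + S1 l * ?D2 = c l \<cdot>\<^sub>m 1\<^sub>m 9" if "l \<in> {0, 1}" for l
    using that cubic_homotopy2_eq[of "varx :: (3, 'k) mpoly" vary varz]
      quartic_homotopy2_eq[of "varx :: (3, 'k) mpoly" vary varz]
    unfolding quartic by (auto simp: c_def S1_def S2_def)
  have H3: "S2 0 * ?D3 = c 0 \<cdot>\<^sub>m 1\<^sub>m 3"
    by (simp add: S2_def c_def cubic_homotopy2_second_syzygies)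
  note exact = exact_by_homotopies[OF reg carrier generators_syzygies syzygies_second_syzygies C0 C1 C2 H1 H2 H3]
  have "(\<lambda>v. v $ 0) ` mat_image ?D1 = the_ideal"
    using image_row_matrix[of "[cubic, varx * vary ^ 2 - varx * varz ^ 2, quartic1, vary ^ 2 * varz ^ 2 - varz ^ 4,
      varx ^ 6, varz ^ 6, varx * varz ^ 5 :: (3, 'k) mpoly]" 7]
    by (simp add: generators_mat_def quartic right_diff_distrib)
  then show ?thesis
    unfolding minimal_free_resolution_3 using graded exact carrier_matD(2)[OF carrier(3)] by simp
qed

theorem theorem2p4:
  fixes x y z :: "(3, 'k::field) mpoly" and I :: "(3, 'k) mpoly set"
  assumes "infinite (UNIV :: 'k set)"
    and "x = Var 0" and "y = Var 1" and "z = Var 2"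
    and "I = ideal_gen {x^2 * y + y^3 - y * z^2 - z^3, x * y^2 - x * z^2,
                        x^3 * z - x * y * z^2, y^2 * z^2 - z^4, x^6, z^6, x * z^5}"
  shows "primary_to (ideal_gen {x, y, z}) I \<and>
    (\<exists>Ds. minimal_free_resolution I
       [[3, 3, 4, 4, 6, 6, 6], [5, 5, 5, 7, 7, 7, 7, 7, 8], [8, 9, 9]] Ds) \<and>
    quotient_hilbert_function I [1, 3, 6, 8, 7, 6, 2] \<and>
    homogeneously_licci I \<and>
    \<not> minimally_homogeneously_licci I"
proof -
  have "varx * vary ^ 2 - varx * varz ^ 2 = (varx * quadric :: (3, 'k) mpoly)"
    "vary ^ 2 * varz ^ 2 - varz ^ 4 = (quartic2 :: (3, 'k) mpoly)"
    by (simp_all add: algebra_simps numeral_eq_Suc)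
  then have I: "I = the_ideal" using assms(2-5) by (simp only:)
  show ?thesis
    unfolding I assms(2-4)
    using the_ideal_primary minimal_free_resolution_the_ideal hilbert_function
      homogeneously_licci_the_ideal not_minimally_licci_the_ideal[OF assms(1)] by blast
qed

end
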